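(* Let $d\ge 1$, $1\leq p<\infty$ and $0<\alpha<d/p$, and let $\mathrm{M}_\alpha$ denote either the centered fractional maximal operator $\mathrm{M}^{c}_\alpha$ or the uncentered fractional maximal operator $\mathrm{M}^{u}_\alpha$. Then there is a constant $C_{d,\alpha,p}$ depending only on $d,\alpha,p$ such that for all $f\in W^{1,p}(\mathbb{R}^d)$ the function $\mathrm{M}_\alpha f$ is weakly differentiable and \[ \|\nabla\mathrm{M}_\alpha f\|_{L^{(p^{-1}-\alpha/d)^{-1}}(\mathbb{R}^d)}\leq C_{d,\alpha,p}\|\nabla f\|_{L^p(\mathbb{R}^d)}. \] For $p=1$, the same holds for all $f\in \mathrm{BV}(\mathbb{R}^d)$, with $\|\nabla f\|_{1}$ replaced by the total variation $\operatorname{var} f$ of $f$. The endpoint case $\alpha=d/p$ also holds, i.e. for $f\in W^{1,p}(\mathbb{R}^d)$ with $p=d/\alpha$, $\mathrm{M}_\alpha f$ is weakly differentiable and $\|\nabla\mathrm{M}_\alpha f\|_{L^\infty}\le C_{d,\alpha}\|\nabla f\|_{L^{d/\alpha}}$.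
   Context: For $f\in L^1_{\mathrm{loc}}(\mathbb{R}^d)$ and a ball or cube $B$, write $f_B=\frac{1}{|B|}\int_B|f|$. For a ball $B$, $r(B)$ denotes its radius. The centered fractional maximal function is $\mathrm{M}^{c}_\alpha f(x)=\sup_{r>0}r^\alpha f_{B(x,r)}$, and the uncentered fractional maximal function is $\mathrm{M}^{u}_\alpha f(x)=\sup_{B\ni x}r(B)^\alpha f_B$, the supremum being over all balls containing $x$. $\mathrm{BV}(\mathbb{R}^d)$ denotes integrable functions whose distributional gradient is a finite vector measure; its total mass is the variation $\operatorname{var} f$. *)

theory Defs
  imports "HOL-Analysis.Analysis"
begin

definition partial_deriv :: "('a::euclidean_space \<Rightarrow> real) \<Rightarrow> 'a \<Rightarrow> 'a \<Rightarrow> real" where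
  "partial_deriv \<phi> i x = frechet_derivative \<phi> (at x) i"

fun Ck :: "nat \<Rightarrow> ('a::euclidean_space \<Rightarrow> real) \<Rightarrow> bool" where
  "Ck 0 \<phi> = continuous_on UNIV \<phi>"
| "Ck (Suc k) \<phi> = (continuous_on UNIV \<phi> \<and> (\<forall>x. \<phi> differentiable (at x)) \<and>
      (\<forall>i\<in>Basis. Ck k (partial_deriv \<phi> i)))"

definition smooth_fun :: "('a::euclidean_space \<Rightarrow> real) \<Rightarrow> bool" where
  "smooth_fun \<phi> \<longleftrightarrow> (\<forall>k. Ck k \<phi>)"

definition test_function :: "('a::euclidean_space \<Rightarrow> real) \<Rightarrow> bool" where
  "test_function \<phi> \<longleftrightarrow> smooth_fun \<phi> \<and> compact (closure {x. \<phi> x \<noteq> 0})"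

definition test_field :: "('a::euclidean_space \<Rightarrow> 'a) \<Rightarrow> bool" where
  "test_field \<psi> \<longleftrightarrow> (\<forall>i\<in>Basis. test_function (\<lambda>x. \<psi> x \<bullet> i))"

definition divergence :: "('a::euclidean_space \<Rightarrow> 'a) \<Rightarrow> 'a \<Rightarrow> real" where
  "divergence \<psi> x = (\<Sum>i\<in>Basis. partial_deriv (\<lambda>y. \<psi> y \<bullet> i) i x)"

definition locally_integrable :: "('a::euclidean_space \<Rightarrow> real) \<Rightarrow> bool" where
  "locally_integrable f \<longleftrightarrow> f \<in> borel_measurable lebesgue \<and>
     (\<forall>K. compact K \<longrightarrow> set_integrable lebesgue K f)"

definition has_weak_gradient :: "('a::euclidean_space \<Rightarrow> real) \<Rightarrow> ('a \<Rightarrow> 'a) \<Rightarrow> bool" where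
  "has_weak_gradient f G \<longleftrightarrow> locally_integrable f \<and>
     (\<forall>i\<in>Basis. locally_integrable (\<lambda>x. G x \<bullet> i)) \<and>
     (\<forall>\<phi>. test_function \<phi> \<longrightarrow> (\<forall>i\<in>Basis.
        (\<integral>x. f x * partial_deriv \<phi> i x \<partial>lebesgue) = - (\<integral>x. (G x \<bullet> i) * \<phi> x \<partial>lebesgue)))"

definition weakly_differentiable :: "('a::euclidean_space \<Rightarrow> real) \<Rightarrow> bool" where
  "weakly_differentiable f \<longleftrightarrow> (\<exists>G. has_weak_gradient f G)"

definition in_Lp :: "real \<Rightarrow> ('a::euclidean_space \<Rightarrow> 'b::euclidean_space) \<Rightarrow> bool" where
  "in_Lp p g \<longleftrightarrow> g \<in> borel_measurable lebesgue \<and> integrable lebesgue (\<lambda>x. norm (g x) powr p)"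

definition Lp_norm :: "real \<Rightarrow> ('a::euclidean_space \<Rightarrow> 'b::euclidean_space) \<Rightarrow> real" where
  "Lp_norm p g = (\<integral>x. norm (g x) powr p \<partial>lebesgue) powr (1 / p)"

definition sobolev_W1p :: "real \<Rightarrow> ('a::euclidean_space \<Rightarrow> real) \<Rightarrow> bool" where
  "sobolev_W1p p f \<longleftrightarrow> in_Lp p f \<and> (\<exists>G. has_weak_gradient f G \<and> in_Lp p G)"

definition variation :: "('a::euclidean_space \<Rightarrow> real) \<Rightarrow> ereal" where
  "variation f = (SUP \<psi>\<in>{\<psi>. test_field \<psi> \<and> (\<forall>x. norm (\<psi> x) \<le> 1)}.
       ereal (\<integral>x. f x * divergence \<psi> x \<partial>lebesgue))"

definition BV :: "('a::euclidean_space \<Rightarrow> real) \<Rightarrow> bool" where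
  "BV f \<longleftrightarrow> integrable lebesgue f \<and> variation f < \<infinity>"

definition avg :: "('a::euclidean_space \<Rightarrow> real) \<Rightarrow> 'a set \<Rightarrow> ennreal" where
  "avg f B = (\<integral>\<^sup>+ y\<in>B. ennreal \<bar>f y\<bar> \<partial>lebesgue) / emeasure lebesgue B"

definition frac_max_centered :: "real \<Rightarrow> ('a::euclidean_space \<Rightarrow> real) \<Rightarrow> 'a \<Rightarrow> ennreal" where
  "frac_max_centered \<alpha> f x = (SUP r\<in>{0<..}. ennreal (r powr \<alpha>) * avg f (ball x r))"

definition frac_max_uncentered :: "real \<Rightarrow> ('a::euclidean_space \<Rightarrow> real) \<Rightarrow> 'a \<Rightarrow> ennreal" where
  "frac_max_uncentered \<alpha> f x =
     (SUP (c, r)\<in>{(c, r). 0 < r \<and> x \<in> ball c r}. ennreal (r powr \<alpha>) * avg f (ball c r))"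

end

theory Submission
  imports Defs "HOL-Computational_Algebra.Polynomial"
begin

text \<open>
  Let \<open>f\<^sub>B\<close> be the mean of \<open>\<bar>f\<bar>\<close> over a ball \<open>B\<close> of radius \<open>r\<close>. If \<open>B\<close> is (almost) optimal for the maximal
  function at \<open>x\<close>, then moving \<open>B\<close> along with the point shows that the gradient of the maximal function
  at \<open>x\<close> is at most a constant times \<open>r powr (\<alpha> - 1) * f\<^sub>B\<close>. Optimality compares \<open>B\<close> with larger balls
  only: means over the ball enlarged by \<open>K\<close> are smaller by the factor \<open>K powr (- \<alpha>)\<close>. As \<open>\<alpha> > 0\<close>,
  for large \<open>K\<close> the function \<open>f\<close> is much smaller than \<open>f\<^sub>B\<close> on most of the enlarged ball, and a Poincare inequality,
  applied separately to the dyadic truncations of \<open>f\<close> above the level \<open>f\<^sub>B / 8\<close>, bounds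
  \<open>r powr (d - p) * f\<^sub>B powr p\<close> by the integral of \<open>\<bar>\<nabla>f\<bar> powr p\<close> over the enlarged ball, restricted to \<open>\<bar>f\<bar> \<ge> f\<^sub>B / 8\<close>,
  with a weight \<open>(f\<^sub>B / \<bar>f\<bar>) powr (1 / d)\<close>: high levels live on small sets and are seen at small scales.
  Optimal balls with comparable means that come close to each other have comparable radii, again because \<open>\<alpha> > 0\<close>.
  Hence a Vitali subfamily at each dyadic value of \<open>f\<^sub>B\<close> has bounded overlap, and the decaying weight
  makes the sum over all dyadic values converge. This treats every \<open>p \<ge> 1\<close> at once.
  In the endpoint case the maximal function is Lipschitz.
\<close>

section \<open>Oscillation estimates at separate levels\<close>

text \<open>Two obstacles shape the proof. First, for \<alpha> < d / p the maximal function need not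
  be Lipschitz. Restricting the radii to at least 1 / (n + 1) gives Lipschitz functions. Almost
  everywhere these equal the maximal function from some n on, because small balls contribute a
  summable series of dyadic pieces, and functions ordered pointwise that touch at a point have the
  same derivative there. A locally integrable majorant then permits dominated convergence. Second, f
  has no classical gradient, and in the BV case the gradient may be a measure. The ball estimates
  concern finite families, so they survive replacing f by one nearby C1 function, and only the bound
  \<open>W\<close> on the energies of the approximants is kept. The L^p norm of f makes masses
  finite and radii bounded; the final constants do not depend on it. The exponent q comes from
  scaling: as d / p - \<alpha> = d / q, the q-th power of the rate r^(\<alpha> - 1) a, with a the
  mean, times r^d is the power q / p of a^p r^(d - p). Since q \<ge> p, summability of the latter
  passes to these powers.\<close>

lemma ball_in_sets_borel [measurable]: "ball (c::'a::metric_space) r \<in> sets borel"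
  by (simp add: borel_open)

lemma nn_integral_lborel_translate:
  fixes h :: "'a::euclidean_space \<Rightarrow> ennreal"
  assumes [measurable]: "h \<in> borel_measurable borel"
  shows "(\<integral>\<^sup>+x. h (x + z) \<partial>lborel) = (\<integral>\<^sup>+x. h x \<partial>lborel)"
proof -
  have "(\<integral>\<^sup>+x. h x \<partial>lborel) = (\<integral>\<^sup>+x. h x \<partial>(distr lborel borel ((+) z)))"
    by (simp add: lborel_distr_plus)
  also have "\<dots> = (\<integral>\<^sup>+x. h (z + x) \<partial>lborel)"
    by (subst nn_integral_distr) auto
  finally show ?thesis by (simp add: add.commute)
qed

lemma emeasure_lborel_translate:
  fixes A :: "'a::euclidean_space set"
  assumes [measurable]: "A \<in> sets borel"
  shows "emeasure lborel {x. x + z \<in> A} = emeasure lborel A"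
proof -
  have [measurable]: "{x. x + z \<in> A} \<in> sets borel" by measurable
  have "emeasure lborel {x. x + z \<in> A} = (\<integral>\<^sup>+x. indicator A (x + z) \<partial>lborel)"
    by (subst nn_integral_indicator[symmetric]) (simp, intro nn_integral_cong, simp add: indicator_def)
  then show ?thesis
    by (simp add: nn_integral_lborel_translate)
qed

lemma abs_increment_le_nn_integral:
  fixes u u' N :: "real \<Rightarrow> real"
  assumes deriv: "\<And>t. (u has_real_derivative u' t) (at t)"
    and cont: "\<And>t. isCont u' t"
    and le: "\<And>t. \<bar>u' t\<bar> \<le> N t"
  shows "ennreal \<bar>u 1 - u 0\<bar> \<le> (\<integral>\<^sup>+t\<in>{0..1}. ennreal (N t) \<partial>lborel)"
proof -
  have hb: "has_bochner_integral lborel (\<lambda>x. u' x * indicator {0..1} x) (u 1 - u 0)"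
    by (rule has_bochner_integral_FTC_Icc_real) (use deriv cont in auto)
  have "ennreal \<bar>u 1 - u 0\<bar> \<le> (\<integral>\<^sup>+t. norm (u' t * indicator {0..1} t) \<partial>lborel)"
    using hb integral_norm_bound_ennreal[of lborel "\<lambda>x. u' x * indicator {0..1} x"]
    by (auto simp: has_bochner_integral_iff)
  also have "\<dots> \<le> (\<integral>\<^sup>+t\<in>{0..1}. ennreal (N t) \<partial>lborel)"
    by (intro nn_integral_mono) (use le in \<open>auto simp: indicator_def intro!: ennreal_leI\<close>)
  finally show ?thesis .
qed

text \<open>If the zero set of \<open>w\<close> fills half of every ball of radius \<open>s\<close>, comparing \<open>w x\<close> with
  \<open>w (x + z)\<close> and averaging over \<open>z\<close> in the ball of radius \<open>s\<close> gives the estimate.\<close>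

lemma small_support_poincare:
  fixes w N :: "'a::euclidean_space \<Rightarrow> real"
  assumes [measurable]: "w \<in> borel_measurable borel" "N \<in> borel_measurable borel"
    and w0: "\<And>x. 0 \<le> w x"
    and incr: "\<And>x z. ennreal \<bar>w (x + z) - w x\<bar> \<le>
                  ennreal (norm z) * (\<integral>\<^sup>+t\<in>{0..1::real}. ennreal (N (x + t *\<^sub>R z)) \<partial>lborel)"
    and s: "0 < s"
    and supp: "2 * emeasure lborel ({x. w x \<noteq> 0} \<inter> ball c (\<rho> + s)) \<le> emeasure lborel (ball (0::'a) s)"
  shows "(\<integral>\<^sup>+x\<in>ball c \<rho>. ennreal (w x) \<partial>lborel) \<le>
         ennreal (2 * s) * (\<integral>\<^sup>+x\<in>ball c (\<rho> + s). ennreal (N x) \<partial>lborel)"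
proof -
  define b where "b = emeasure lborel (ball (0::'a) s)"
  define J where "J = (\<integral>\<^sup>+x\<in>ball c (\<rho> + s). ennreal (N x) \<partial>lborel)"
  have b0: "b \<noteq> 0" and bfin: "b \<noteq> \<infinity>"
    using s unit_ball_vol_pos[of "real DIM('a)", THEN less_imp_neq] by (auto simp: b_def emeasure_ball)
  \<comment> \<open>On the set \<open>Z\<close> where w (x + z) vanishes the increment equals w x,
    and \<open>Z\<close> fills at least half of the ball of radius s; this is the source of the
    factor 2.\<close>
  have pt: "b * ennreal (w x) \<le> 2 * (\<integral>\<^sup>+z\<in>ball 0 s. ennreal \<bar>w (x + z) - w x\<bar> \<partial>lborel)"
    if x: "x \<in> ball c \<rho>" for x
  proof -
    define Z where "Z = {z \<in> ball 0 s. w (x + z) = 0}"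
    define Y where "Y = {z \<in> ball 0 s. w (x + z) \<noteq> 0}"
    have [measurable]: "Z \<in> sets borel" "Y \<in> sets borel"
      unfolding Z_def Y_def by measurable
    have [measurable]: "{x. w x \<noteq> 0} \<inter> ball c (\<rho> + s) \<in> sets borel"
      by measurable
    have "Y \<subseteq> {z. z + x \<in> {x. w x \<noteq> 0} \<inter> ball c (\<rho> + s)}"
    proof
      fix z assume "z \<in> Y"
      then have "norm z < s" "w (x + z) \<noteq> 0" by (auto simp: Y_def)
      moreover have "dist c (z + x) \<le> dist c x + norm z"
        by (metis add.commute dist_norm dist_triangle add_diff_cancel_left' norm_minus_commute)
      ultimately show "z \<in> {z. z + x \<in> {x. w x \<noteq> 0} \<inter> ball c (\<rho> + s)}"
        using x by (auto simp: add.commute)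
    qed
    then have "emeasure lborel Y \<le> emeasure lborel {z. z + x \<in> {x. w x \<noteq> 0} \<inter> ball c (\<rho> + s)}"
      by (intro emeasure_mono) auto
    also have "\<dots> = emeasure lborel ({x. w x \<noteq> 0} \<inter> ball c (\<rho> + s))"
      by (rule emeasure_lborel_translate) measurable
    finally have Y: "2 * emeasure lborel Y \<le> b"
      using supp unfolding b_def by (meson mult_left_mono order_trans zero_le)
    have "b = emeasure lborel (Z \<union> Y)"
      unfolding b_def by (rule arg_cong[where f="emeasure lborel"]) (auto simp: Z_def Y_def)
    also have "\<dots> \<le> emeasure lborel Z + emeasure lborel Y"
      by (rule emeasure_subadditive) auto
    finally have "2 * b \<le> 2 * emeasure lborel Z + 2 * emeasure lborel Y"
      by (metis distrib_left mult_left_mono zero_le)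
    also have "\<dots> \<le> 2 * emeasure lborel Z + b"
      using Y by (intro add_left_mono)
    finally have "b + b \<le> 2 * emeasure lborel Z + b"
      by (simp add: mult_2)
    then have bZ: "b \<le> 2 * emeasure lborel Z"
      using bfin by (metis ennreal_add_left_cancel_le add.commute infinity_ennreal_def)
    have "emeasure lborel Z * ennreal (w x) = (\<integral>\<^sup>+z\<in>Z. ennreal (w x) \<partial>lborel)"
      by (subst nn_integral_cmult_indicator) (auto simp: mult.commute)
    also have "\<dots> \<le> (\<integral>\<^sup>+z\<in>ball 0 s. ennreal \<bar>w (x + z) - w x\<bar> \<partial>lborel)"
      by (intro nn_integral_mono) (auto simp: Z_def indicator_def w0)
    finally have "2 * (emeasure lborel Z * ennreal (w x)) \<le>
        2 * (\<integral>\<^sup>+z\<in>ball 0 s. ennreal \<bar>w (x + z) - w x\<bar> \<partial>lborel)"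
      by (rule mult_left_mono) simp
    moreover have "b * ennreal (w x) \<le> 2 * emeasure lborel Z * ennreal (w x)"
      by (rule mult_right_mono[OF bZ]) simp
    ultimately show ?thesis by (simp add: mult.assoc)
  qed
  \<comment> \<open>Every point x + t z of the segment stays in the ball enlarged by s, so
    translation invariance gives a bound that is uniform in t and z.\<close>
  have inner: "(\<integral>\<^sup>+x\<in>ball c \<rho>. ennreal (N (x + t *\<^sub>R z)) \<partial>lborel) \<le> J"
    if z: "z \<in> ball 0 s" and t: "t \<in> {0..1::real}" for z t
  proof -
    have "(\<integral>\<^sup>+x\<in>ball c \<rho>. ennreal (N (x + t *\<^sub>R z)) \<partial>lborel) \<le>
        (\<integral>\<^sup>+x. ennreal (N (x + t *\<^sub>R z)) * indicator (ball c (\<rho> + s)) (x + t *\<^sub>R z) \<partial>lborel)"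
    proof (intro nn_integral_mono mult_left_mono)
      fix x
      have "norm (t *\<^sub>R z) \<le> norm z" using t by (simp add: mult_left_le_one_le)
      moreover have "dist c (x + t *\<^sub>R z) \<le> dist c x + norm (t *\<^sub>R z)"
        by (metis dist_norm dist_triangle add_diff_cancel_left' norm_minus_commute)
      ultimately show "indicator (ball c \<rho>) x \<le> (indicator (ball c (\<rho> + s)) (x + t *\<^sub>R z) :: ennreal)"
        using z by (auto simp: indicator_def)
    qed simp
    also have "\<dots> = J" unfolding J_def
      by (rule nn_integral_lborel_translate[where h="\<lambda>x. ennreal (N x) * indicator (ball c (\<rho> + s)) x"])
         (intro borel_measurable_times_ennreal borel_measurable_indicator, auto)
    finally show ?thesis .
  qed
  have inner2: "(\<integral>\<^sup>+x\<in>ball c \<rho>. (\<integral>\<^sup>+t\<in>{0..1::real}. ennreal (N (x + t *\<^sub>R z)) \<partial>lborel) \<partial>lborel) \<le> J"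
    if z: "z \<in> ball 0 s" for z
  proof -
    have "(\<integral>\<^sup>+x\<in>ball c \<rho>. (\<integral>\<^sup>+t\<in>{0..1::real}. ennreal (N (x + t *\<^sub>R z)) \<partial>lborel) \<partial>lborel) =
       (\<integral>\<^sup>+x. (\<integral>\<^sup>+t. ennreal (N (x + t *\<^sub>R z)) * indicator {0..1::real} t * indicator (ball c \<rho>) x \<partial>lborel) \<partial>lborel)"
      by (intro nn_integral_cong nn_integral_multc[symmetric]) measurable
    also have "\<dots> = (\<integral>\<^sup>+t. (\<integral>\<^sup>+x. ennreal (N (x + t *\<^sub>R z)) * indicator {0..1::real} t * indicator (ball c \<rho>) x \<partial>lborel) \<partial>lborel)"
      by (rule lborel_pair.Fubini') measurable
    also have "\<dots> = (\<integral>\<^sup>+t\<in>{0..1::real}. (\<integral>\<^sup>+x\<in>ball c \<rho>. ennreal (N (x + t *\<^sub>R z)) \<partial>lborel) \<partial>lborel)"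
      by (intro nn_integral_cong, subst nn_integral_multc[symmetric])
         (measurable, auto intro!: nn_integral_cong simp: ac_simps)
    also have "\<dots> \<le> (\<integral>\<^sup>+t\<in>{0..1::real}. J \<partial>lborel)"
      by (intro nn_integral_mono) (auto split: split_indicator intro!: inner z)
    also have "\<dots> = J" by (subst nn_integral_cmult_indicator) auto
    finally show ?thesis .
  qed
  have "b * (\<integral>\<^sup>+x\<in>ball c \<rho>. ennreal (w x) \<partial>lborel) = (\<integral>\<^sup>+x. b * ennreal (w x) * indicator (ball c \<rho>) x \<partial>lborel)"
    by (subst nn_integral_cmult[symmetric]) (auto simp: mult.assoc)
  also have "\<dots> \<le> (\<integral>\<^sup>+x. 2 * (\<integral>\<^sup>+z\<in>ball 0 s. ennreal \<bar>w (x + z) - w x\<bar> \<partial>lborel) * indicator (ball c \<rho>) x \<partial>lborel)"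
    by (intro nn_integral_mono) (auto split: split_indicator intro!: pt)
  also have "\<dots> \<le> (\<integral>\<^sup>+x. (\<integral>\<^sup>+z. 2 * ennreal s * (\<integral>\<^sup>+t\<in>{0..1::real}. ennreal (N (x + t *\<^sub>R z)) \<partial>lborel)
        * indicator (ball c \<rho>) x * indicator (ball 0 s) z \<partial>lborel) \<partial>lborel)"
  proof (rule nn_integral_mono)
    fix x
    have "2 * (\<integral>\<^sup>+z\<in>ball 0 s. ennreal \<bar>w (x + z) - w x\<bar> \<partial>lborel) * indicator (ball c \<rho>) x =
       (\<integral>\<^sup>+z. 2 * (ennreal \<bar>w (x + z) - w x\<bar> * indicator (ball 0 s) z) * indicator (ball c \<rho>) x \<partial>lborel)"
      by (subst nn_integral_cmult[symmetric], measurable, subst nn_integral_multc[symmetric], measurable)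
    also have "\<dots> \<le> (\<integral>\<^sup>+z. 2 * ennreal s * (\<integral>\<^sup>+t\<in>{0..1::real}. ennreal (N (x + t *\<^sub>R z)) \<partial>lborel)
        * indicator (ball c \<rho>) x * indicator (ball 0 s) z \<partial>lborel)"
    proof (rule nn_integral_mono)
      fix z
      show "2 * (ennreal \<bar>w (x + z) - w x\<bar> * indicator (ball 0 s) z) * indicator (ball c \<rho>) x \<le>
        2 * ennreal s * (\<integral>\<^sup>+t\<in>{0..1::real}. ennreal (N (x + t *\<^sub>R z)) \<partial>lborel)
        * indicator (ball c \<rho>) x * indicator (ball 0 s) z"
      proof (cases "z \<in> ball 0 s")
        case True
        have "ennreal \<bar>w (x + z) - w x\<bar> \<le> ennreal s * (\<integral>\<^sup>+t\<in>{0..1::real}. ennreal (N (x + t *\<^sub>R z)) \<partial>lborel)"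
          using True by (intro order_trans[OF incr] mult_right_mono ennreal_leI) auto
        with True show ?thesis
          by (auto simp: mult.assoc indicator_def intro!: mult_left_mono)
      qed (simp add: indicator_def)
    qed
    finally show "2 * (\<integral>\<^sup>+z\<in>ball 0 s. ennreal \<bar>w (x + z) - w x\<bar> \<partial>lborel) * indicator (ball c \<rho>) x \<le> \<dots>" .
  qed
  also have "\<dots> = (\<integral>\<^sup>+z. (\<integral>\<^sup>+x. 2 * ennreal s * (\<integral>\<^sup>+t\<in>{0..1::real}. ennreal (N (x + t *\<^sub>R z)) \<partial>lborel)
        * indicator (ball c \<rho>) x * indicator (ball 0 s) z \<partial>lborel) \<partial>lborel)"
    by (rule lborel_pair.Fubini') measurable
  also have "\<dots> \<le> (\<integral>\<^sup>+z. 2 * ennreal s * J * indicator (ball (0::'a) s) z \<partial>lborel)"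
  proof (rule nn_integral_mono)
    fix z :: 'a
    have "(\<integral>\<^sup>+x. 2 * ennreal s * (\<integral>\<^sup>+t\<in>{0..1::real}. ennreal (N (x + t *\<^sub>R z)) \<partial>lborel)
        * indicator (ball c \<rho>) x * indicator (ball 0 s) z \<partial>lborel) =
       2 * ennreal s * (\<integral>\<^sup>+x\<in>ball c \<rho>. (\<integral>\<^sup>+t\<in>{0..1::real}. ennreal (N (x + t *\<^sub>R z)) \<partial>lborel) \<partial>lborel) * indicator (ball 0 s) z"
    proof -
      define P where "P x = (\<integral>\<^sup>+t\<in>{0..1::real}. ennreal (N (x + t *\<^sub>R z)) \<partial>lborel)" for x
      have [measurable]: "P \<in> borel_measurable borel" unfolding P_def by measurable
      have "(\<integral>\<^sup>+x. 2 * ennreal s * P x * indicator (ball c \<rho>) x * indicator (ball 0 s) z \<partial>lborel) =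
          (\<integral>\<^sup>+x. (2 * ennreal s * indicator (ball 0 s) z) * (P x * indicator (ball c \<rho>) x) \<partial>lborel)"
        by (intro nn_integral_cong) (simp only: ac_simps)
      also have "\<dots> = (2 * ennreal s * indicator (ball 0 s) z) * (\<integral>\<^sup>+x\<in>ball c \<rho>. P x \<partial>lborel)"
        by (rule nn_integral_cmult) measurable
      finally show ?thesis by (simp only: P_def ac_simps)
    qed
    also have "\<dots> \<le> 2 * ennreal s * J * indicator (ball 0 s) z"
      by (cases "z \<in> ball 0 s") (auto simp: mult.assoc intro!: mult_left_mono inner2)
    finally show "(\<integral>\<^sup>+x. 2 * ennreal s * (\<integral>\<^sup>+t\<in>{0..1::real}. ennreal (N (x + t *\<^sub>R z)) \<partial>lborel)
        * indicator (ball c \<rho>) x * indicator (ball 0 s) z \<partial>lborel) \<le> 2 * ennreal s * J * indicator (ball 0 s) z" .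
  qed
  also have "\<dots> = b * (2 * ennreal s * J)"
    by (subst nn_integral_cmult_indicator) (auto simp: b_def mult.commute)
  finally have "b * (\<integral>\<^sup>+x\<in>ball c \<rho>. ennreal (w x) \<partial>lborel) \<le> b * (2 * ennreal s * J)" .
  then have "(\<integral>\<^sup>+x\<in>ball c \<rho>. ennreal (w x) \<partial>lborel) \<le> 2 * ennreal s * J"
    using b0 bfin by (metis ennreal_mult_le_mult_iff infinity_ennreal_def)
  then show ?thesis
    using s by (simp add: J_def ennreal_mult)
qed

text \<open>Continuity of the gradient is what the fundamental theorem along segments uses; the
  vector form keeps the estimates free of coordinates.\<close>

definition C1_gradient :: "('a::euclidean_space \<Rightarrow> real) \<Rightarrow> ('a \<Rightarrow> 'a) \<Rightarrow> bool" where
  "C1_gradient g D \<longleftrightarrow> continuous_on UNIV D \<and> (\<forall>x. (g has_derivative (\<lambda>h. D x \<bullet> h)) (at x))"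

lemma C1_gradient_along_line:
  assumes "C1_gradient g D"
  shows "((\<lambda>t. g (x + t *\<^sub>R z)) has_real_derivative (D (x + t *\<^sub>R z) \<bullet> z)) (at t)"
proof -
  have 1: "((\<lambda>t. x + t *\<^sub>R z) has_derivative (\<lambda>h. h *\<^sub>R z)) (at t)"
    by (auto intro!: derivative_eq_intros)
  have "(g has_derivative (\<lambda>h. D (x + t *\<^sub>R z) \<bullet> h)) (at (x + t *\<^sub>R z))"
    using assms by (auto simp: C1_gradient_def)
  from has_derivative_compose[OF 1 this] show ?thesis
    by (simp add: has_field_derivative_def mult_commute_abs)
qed

lemma C1_gradient_measurable:
  assumes "C1_gradient g D"
  shows "g \<in> borel_measurable borel" "D \<in> borel_measurable borel"
proof -
  have "continuous_on UNIV g"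
    using assms unfolding C1_gradient_def
    by (meson has_derivative_continuous continuous_at_imp_continuous_on)
  then show "g \<in> borel_measurable borel" by (rule borel_measurable_continuous_onI)
  show "D \<in> borel_measurable borel" using assms
    by (auto simp: C1_gradient_def intro: borel_measurable_continuous_onI)
qed

text \<open>Building block of the spline in \<open>trunc\<close>: the square of the positive part is
  C1 because at 0 its difference quotient is at most |h|.\<close>

lemma has_real_derivative_max_0_square:
  "((\<lambda>v. (max 0 v)\<^sup>2) has_real_derivative 2 * max 0 v) (at (v::real))"
proof -
  consider "v < 0" | "v > 0" | "v = 0" by linarith
  then show ?thesis
  proof cases
    case 1
    have "((\<lambda>v. (max 0 v)\<^sup>2) has_real_derivative 0) (at v)"
      by (rule has_field_derivative_transform_within_open[where S="{..<0}" and f="\<lambda>_. 0"])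
         (use 1 in auto)
    with 1 show ?thesis by simp
  next
    case 2
    have "((\<lambda>v. (max 0 v)\<^sup>2) has_real_derivative 2 * v) (at v)"
      by (rule has_field_derivative_transform_within_open[where S="{0<..}" and f="\<lambda>v. v\<^sup>2"])
         (use 2 in \<open>auto intro!: derivative_eq_intros\<close>)
    with 2 show ?thesis by simp
  next
    case 3
    have "((\<lambda>h. (max 0 h)\<^sup>2 / h) \<longlongrightarrow> 0) (at (0::real))"
    proof (rule Lim_null_comparison)
      show "\<forall>\<^sub>F h in at (0::real). norm ((max 0 h)\<^sup>2 / h) \<le> \<bar>h\<bar>"
        by (rule always_eventually) (auto simp: max_def power2_eq_square)
      show "(abs \<longlongrightarrow> 0) (at (0::real))" by (auto intro!: tendsto_eq_intros)
    qed
    with 3 show ?thesis by (simp add: DERIV_def)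
  qed
qed

text \<open>The quadratic spline in \<open>t\<^sup>2\<close> makes the truncation continuously differentiable, so that no chain
  rule for Lipschitz functions is needed.\<close>

definition trunc :: "real \<Rightarrow> real \<Rightarrow> real" where
  "trunc l t = (let v = 2 * ((t / l)\<^sup>2 - 1) / 3 in
     (l / 2) * ((max 0 v)\<^sup>2 - 2 * (max 0 (v - 1))\<^sup>2 + (max 0 (v - 2))\<^sup>2))"

text \<open>The variable v runs from 0 at |t| = l to 2 at |t| = 2 l. The first factor is the hat
  function on [0, 2] with peak 1 at v = 1, and 4 t / (3 l) collects l / 2, the 2 of the squares and
  dv/dt.\<close>

definition trunc' :: "real \<Rightarrow> real \<Rightarrow> real" where
  "trunc' l t = (let v = 2 * ((t / l)\<^sup>2 - 1) / 3 in
     (max 0 v - 2 * max 0 (v - 1) + max 0 (v - 2)) * (4 * t / (3 * l)))"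

lemma DERIV_trunc:
  assumes "0 < l"
  shows "(trunc l has_real_derivative trunc' l t) (at t)"
proof -
  have v: "((\<lambda>t. 2 * ((t / l)\<^sup>2 - 1) / 3 - k) has_real_derivative 4 * t / (3 * l\<^sup>2)) (at t)" for k
    using assms by (auto intro!: derivative_eq_intros simp: field_simps power2_eq_square)
  note q = DERIV_chain2[OF has_real_derivative_max_0_square v]
  show ?thesis
    unfolding trunc_def trunc'_def Let_def
    by (rule DERIV_cong[OF DERIV_cmult[OF DERIV_add[OF DERIV_diff[OF q[of 0, unfolded diff_zero]
            DERIV_cmult[OF q[of 1]]] q[of 2]]]])
       (use assms in \<open>simp add: divide_simps power2_eq_square, simp add: algebra_simps\<close>)
qed

lemma isCont_trunc': "isCont (trunc' l) t"
  unfolding trunc'_def Let_def divide_inverse by (intro continuous_intros)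

lemma trunc'_eq_0:
  assumes "0 < l" "\<not> (l \<le> \<bar>t\<bar> \<and> \<bar>t\<bar> < 2 * l)"
  shows "trunc' l t = 0"
proof -
  consider "\<bar>t\<bar> < l" | "2 * l \<le> \<bar>t\<bar>" using assms by linarith
  then show ?thesis
  proof cases
    case 1
    then have "(t / l)\<^sup>2 \<le> 1" using assms by (simp add: abs_square_le_1)
    then show ?thesis by (simp add: trunc'_def Let_def)
  next
    case 2
    then have "2 \<le> \<bar>t / l\<bar>" using assms by (simp add: field_simps)
    then have "4 \<le> (t / l)\<^sup>2" using power_mono[of 2 "\<bar>t / l\<bar>" 2] unfolding power2_abs by simp
    then show ?thesis by (simp add: trunc'_def Let_def max_def)
  qed
qed

lemma abs_trunc'_le:
  assumes "0 < l"
  shows "\<bar>trunc' l t\<bar> \<le> 3"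
proof (cases "l \<le> \<bar>t\<bar> \<and> \<bar>t\<bar> < 2 * l")
  case True
  have "\<bar>max 0 v - 2 * max 0 (v - 1) + max 0 (v - 2)\<bar> \<le> 1" for v :: real
    by (auto simp: max_def abs_if)
  \<comment> \<open>Here |t| < 2 l gives 8 / 3, rounded up.\<close>
  moreover have "\<bar>4 * t / (3 * l)\<bar> \<le> 3"
    using True assms by (simp add: abs_mult field_simps)
  ultimately have "\<bar>max 0 v - 2 * max 0 (v - 1) + max 0 (v - 2)\<bar> * \<bar>4 * t / (3 * l)\<bar> \<le> 1 * 3" for v :: real
    by (intro mult_mono) auto
  then show ?thesis
    unfolding trunc'_def Let_def abs_mult[of "_ + _"] by simp
next
  case False
  then show ?thesis using trunc'_eq_0[OF assms] by auto
qed

lemma trunc_eq_0: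
  assumes "0 < l" "\<bar>t\<bar> \<le> l"
  shows "trunc l t = 0"
proof -
  have "(t / l)\<^sup>2 \<le> 1" using assms by (simp add: abs_square_le_1)
  then show ?thesis by (simp add: trunc_def Let_def)
qed

lemma trunc_eq_level:
  assumes "0 < l" "2 * l \<le> \<bar>t\<bar>"
  shows "trunc l t = l"
proof -
  have "2 \<le> \<bar>t / l\<bar>" using assms by (simp add: field_simps)
  then have 4: "4 \<le> (t / l)\<^sup>2" using power_mono[of 2 "\<bar>t / l\<bar>" 2] unfolding power2_abs by simp
  define v where "v = 2 * ((t / l)\<^sup>2 - 1) / 3"
  have "2 \<le> v" using 4 by (simp add: v_def)
  then have eq: "(max 0 v)\<^sup>2 - 2 * (max 0 (v - 1))\<^sup>2 + (max 0 (v - 2))\<^sup>2 = 2"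
    by (simp add: power2_eq_square algebra_simps)
  show ?thesis unfolding trunc_def Let_def v_def[symmetric] eq by simp
qed

lemma trunc_nonneg:
  assumes "0 < l"
  shows "0 \<le> trunc l t"
proof -
  define v where "v = 2 * ((t / l)\<^sup>2 - 1) / 3"
  have "0 \<le> (max 0 v)\<^sup>2 - 2 * (max 0 (v - 1))\<^sup>2 + (max 0 (v - 2))\<^sup>2"
  proof -
    consider "v \<le> 1" | "1 \<le> v" "v \<le> 2" | "2 \<le> v" by linarith
    then show ?thesis
    proof cases
      case 2
      have "(v - 2)\<^sup>2 \<le> 1" using 2 by (simp add: abs_square_le_1)
      then have "0 \<le> 1 - (v - 2)\<^sup>2 + 1" by simp
      with 2 show ?thesis by (simp add: max_def power2_eq_square algebra_simps)
    next
      case 3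
      then show ?thesis by (simp add: power2_eq_square algebra_simps)
    qed (simp add: max_def)
  qed
  then show ?thesis using assms unfolding trunc_def Let_def v_def[symmetric] by simp
qed

lemma dyadic_level_exists:
  fixes y :: real
  assumes "1 \<le> y"
  shows "\<exists>n. 2 ^ n \<le> y \<and> y < 2 ^ Suc n"
proof -
  obtain k where "y < 2 ^ k" using real_arch_pow[of 2 y] by auto
  then show ?thesis
  proof (induction k)
    case 0
    with assms show ?case by simp
  next
    case (Suc k)
    then show ?case by (cases "y < 2 ^ k") (auto simp: not_less)
  qed
qed

text \<open>One term suffices: if 2^n a / 4 \<le> |t| < 2^(n+1) a / 4, the truncation at level 2^n a
  / 8 is saturated, and four times that level exceeds |t|.\<close>

lemma abs_le_sum_trunc:
  assumes "0 < a"
  shows "ennreal \<bar>t\<bar> \<le> ennreal (a / 4) + (\<Sum>n. ennreal (4 * trunc (2 ^ n * a / 8) t))"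
proof (cases "\<bar>t\<bar> \<le> a / 4")
  case True
  then show ?thesis by (meson ennreal_leI add_increasing2 zero_le)
next
  case False
  then have "1 \<le> \<bar>t\<bar> / (a / 4)" using assms by simp
  then obtain n where n: "2 ^ n \<le> \<bar>t\<bar> / (a / 4)" "\<bar>t\<bar> / (a / 4) < 2 ^ Suc n"
    using dyadic_level_exists by blast
  have "trunc (2 ^ n * a / 8) t = 2 ^ n * a / 8"
    by (rule trunc_eq_level) (use n assms in \<open>auto simp: field_simps\<close>)
  then have "\<bar>t\<bar> \<le> 4 * trunc (2 ^ n * a / 8) t"
    using n assms by (simp add: field_simps)
  then have "ennreal \<bar>t\<bar> \<le> ennreal (4 * trunc (2 ^ n * a / 8) t)" by (rule ennreal_leI)
  also have "\<dots> \<le> (\<Sum>n. ennreal (4 * trunc (2 ^ n * a / 8) t))"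
    using sum_le_suminf[of "\<lambda>n. ennreal (4 * trunc (2 ^ n * a / 8) t)" "{n}"] by (simp add: summableI)
  finally show ?thesis by (simp add: add_increasing)
qed

text \<open>Additive substitute for Hoelder and Jensen, valid down to p = 1: small y are absorbed by
  t, large y by the power. The parameter t is chosen at each use so that the first term can be
  absorbed or balances the second.\<close>

lemma le_young:
  fixes y t p :: real
  assumes "0 < t" "0 \<le> y" "1 \<le> p"
  shows "y \<le> t + t powr (1 - p) * y powr p"
proof (cases "y \<le> t")
  case True
  then show ?thesis by (simp add: add_increasing2)
next
  case False
  then have "y > 0" using assms by auto
  have "y powr (1 - p) \<le> t powr (1 - p)"
    using False assms by (intro powr_mono2') auto
  then have "y powr (1 - p) * y powr p \<le> t powr (1 - p) * y powr p"
    by (intro mult_right_mono) auto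
  moreover have "y powr (1 - p) * y powr p = y"
    using \<open>y > 0\<close> by (simp flip: powr_add)
  ultimately show ?thesis using assms by simp
qed

text \<open>The threshold a / 8 is the lowest truncation level, so the weight never exceeds 8 powr
  (1 / d); it decays as |t| grows.\<close>

definition level_weight :: "real \<Rightarrow> real \<Rightarrow> real \<Rightarrow> real" where
  "level_weight d a t = (if a / 8 \<le> \<bar>t\<bar> then (a / \<bar>t\<bar>) powr (1 / d) else 0)"

lemma level_weight_nonneg: "0 \<le> level_weight d a t"
  by (simp add: level_weight_def)

lemma level_weight_measurable [measurable]: "level_weight d a \<in> borel_measurable borel"
  unfolding level_weight_def by measurable

text \<open>The bands [l, 2 l) with l = 2^n a / 8 are disjoint, so at most one term is nonzero. For
  that n the factor 2 powr (- n / d) is bounded by 1 on the part u of \<open>le_young\<close> and by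
  the weight on the other part.\<close>

lemma sum_levels_le:
  fixes t y a u p d :: real
  assumes "0 < a" "0 < u" "0 \<le> y" "1 \<le> p" "0 < d"
  shows "(\<Sum>n. ennreal (2 powr (- real n / d) * (if 2 ^ n * a / 8 \<le> \<bar>t\<bar> \<and> \<bar>t\<bar> < 2 * (2 ^ n * a / 8) then y else 0)))
     \<le> ennreal (u + u powr (1 - p) * (level_weight d a t * y powr p))"
    (is "suminf ?f \<le> _")
proof (cases "a / 8 \<le> \<bar>t\<bar>")
  case False
  have "?f n = 0" for n
  proof -
    have "a / 8 \<le> 2 ^ n * a / 8" using assms by simp
    with False have "\<not> 2 ^ n * a / 8 \<le> \<bar>t\<bar>" by linarith
    then show ?thesis by simp
  qed
  then have "?f = (\<lambda>_. 0)" by auto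
  then show ?thesis by simp
next
  case True
  then have "1 \<le> \<bar>t\<bar> / (a / 8)" using assms by simp
  then obtain n where n: "2 ^ n \<le> \<bar>t\<bar> / (a / 8)" "\<bar>t\<bar> / (a / 8) < 2 ^ Suc n"
    using dyadic_level_exists by blast
  have n': "2 ^ n * a / 8 \<le> \<bar>t\<bar>" "\<bar>t\<bar> < 2 * (2 ^ n * a / 8)"
    using n assms by (simp_all add: field_simps)
  have other: "?f k = 0" if "k \<notin> {n}" for k
  proof -
    have "k < n \<or> n < k" using that by auto
    then have "2 * (2 ^ k * a / 8) \<le> 2 ^ n * a / 8 \<or> 2 * (2 ^ n * a / 8) \<le> 2 ^ k * a / 8"
    proof
      assume "k < n"
      then have "(2::real) ^ Suc k \<le> 2 ^ n" by (intro power_increasing) auto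
      then have "2 ^ Suc k * (a / 8) \<le> 2 ^ n * (a / 8)" using assms by (intro mult_right_mono) auto
      then show ?thesis by simp
    next
      assume "n < k"
      then have "(2::real) ^ Suc n \<le> 2 ^ k" by (intro power_increasing) auto
      then have "2 ^ Suc n * (a / 8) \<le> 2 ^ k * (a / 8)" using assms by (intro mult_right_mono) auto
      then show ?thesis by simp
    qed
    then have "\<not> (2 ^ k * a / 8 \<le> \<bar>t\<bar> \<and> \<bar>t\<bar> < 2 * (2 ^ k * a / 8))" using n' by linarith
    then show ?thesis by (simp only: if_False mult_zero_right ennreal_0)
  qed
  have tpos: "\<bar>t\<bar> > 0" using True assms by linarith
  have "suminf ?f = ?f n" using suminf_finite[of "{n}" ?f] other by simp
  also have "\<dots> = ennreal (2 powr (- real n / d) * y)" using n' by simp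
  also have "\<dots> \<le> ennreal (u + u powr (1 - p) * (level_weight d a t * y powr p))"
  proof (rule ennreal_leI)
    have w: "2 powr (- real n / d) \<le> level_weight d a t"
    proof -
      have "2 powr (- real n / d) = (2 powr (- real n)) powr (1 / d)" by (simp add: powr_powr)
      also have "\<dots> \<le> (a / \<bar>t\<bar>) powr (1 / d)"
      proof (rule powr_mono2)
        show "2 powr - real n \<le> a / \<bar>t\<bar>"
          using n' assms tpos by (simp add: powr_minus powr_realpow field_simps)
      qed (use assms in auto)
      finally show ?thesis using True by (simp add: level_weight_def)
    qed
    have 1: "2 powr (- real n / d) \<le> 1"
      using assms powr_mono[of "- real n / d" 0 2] by simp
    have "2 powr (- real n / d) * y \<le> 2 powr (- real n / d) * (u + u powr (1 - p) * y powr p)"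
      by (intro mult_left_mono le_young) (use assms in auto)
    also have "\<dots> \<le> 1 * u + u powr (1 - p) * (level_weight d a t * y powr p)"
    proof -
      have "2 powr (- real n / d) * u \<le> 1 * u" using 1 assms by (intro mult_right_mono) auto
      moreover have "2 powr (- real n / d) * (u powr (1 - p) * y powr p) \<le> level_weight d a t * (u powr (1 - p) * y powr p)"
        using w by (intro mult_right_mono) auto
      ultimately show ?thesis by (simp add: algebra_simps)
    qed
    finally show "2 powr (- real n / d) * y \<le> u + u powr (1 - p) * (level_weight d a t * y powr p)" by simp
  qed
  finally show ?thesis .
qed

text \<open>Only the band l \<le> |g| < 2 l contributes, because \<open>trunc'\<close> vanishes
  elsewhere; this localisation is what later lets the levels be added without overlap. The 3 is the
  bound on \<open>trunc'\<close>.\<close>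

lemma trunc_gradient_increment:
  fixes g :: "'a::euclidean_space \<Rightarrow> real"
  assumes g: "C1_gradient g D" and l: "0 < l"
  shows "ennreal \<bar>trunc l (g (x + z)) - trunc l (g x)\<bar> \<le> ennreal (norm z) *
    (\<integral>\<^sup>+t\<in>{0..1::real}. ennreal (3 * (if l \<le> \<bar>g (x + t *\<^sub>R z)\<bar> \<and> \<bar>g (x + t *\<^sub>R z)\<bar> < 2 * l then norm (D (x + t *\<^sub>R z)) else 0)) \<partial>lborel)"
proof -
  note [measurable] = C1_gradient_measurable[OF g]
  define N where "N y = 3 * (if l \<le> \<bar>g y\<bar> \<and> \<bar>g y\<bar> < 2 * l then norm (D y) else 0)" for y
  have [measurable]: "N \<in> borel_measurable borel" unfolding N_def by measurable
  have "ennreal \<bar>trunc l (g (x + 1 *\<^sub>R z)) - trunc l (g (x + 0 *\<^sub>R z))\<bar> \<le>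
      (\<integral>\<^sup>+t\<in>{0..1::real}. ennreal (norm z * N (x + t *\<^sub>R z)) \<partial>lborel)"
  proof (rule abs_increment_le_nn_integral[where u="\<lambda>t. trunc l (g (x + t *\<^sub>R z))"
        and u'="\<lambda>t. trunc' l (g (x + t *\<^sub>R z)) * (D (x + t *\<^sub>R z) \<bullet> z)"])
    fix t
    show "((\<lambda>t. trunc l (g (x + t *\<^sub>R z))) has_real_derivative
        trunc' l (g (x + t *\<^sub>R z)) * (D (x + t *\<^sub>R z) \<bullet> z)) (at t)"
      by (rule DERIV_chain2[OF DERIV_trunc[OF l] C1_gradient_along_line[OF g]])
    have D: "isCont (\<lambda>t. D (x + t *\<^sub>R z)) t"
    proof -
      have "isCont D (x + t *\<^sub>R z)"
        using g by (simp add: C1_gradient_def continuous_on_eq_continuous_at)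
      then show ?thesis by (rule isCont_o2[rotated]) (intro continuous_intros)
    qed
    have "isCont (\<lambda>t. trunc' l (g (x + t *\<^sub>R z))) t"
      by (rule isCont_o2[OF DERIV_isCont[OF C1_gradient_along_line[OF g]] isCont_trunc'])
    with D show "isCont (\<lambda>t. trunc' l (g (x + t *\<^sub>R z)) * (D (x + t *\<^sub>R z) \<bullet> z)) t"
      by (intro continuous_intros)
    have "\<bar>trunc' l (g y) * (D y \<bullet> z)\<bar> \<le> norm z * N y" for y
    proof (cases "l \<le> \<bar>g y\<bar> \<and> \<bar>g y\<bar> < 2 * l")
      case True
      have "\<bar>trunc' l (g y) * (D y \<bullet> z)\<bar> \<le> 3 * (norm (D y) * norm z)"
        unfolding abs_mult by (intro mult_mono abs_trunc'_le l Cauchy_Schwarz_ineq2) auto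
      with True show ?thesis by (simp add: N_def algebra_simps)
    next
      case False
      then show ?thesis using trunc'_eq_0[OF l] by (simp add: N_def)
    qed
    then show "\<bar>trunc' l (g (x + t *\<^sub>R z)) * (D (x + t *\<^sub>R z) \<bullet> z)\<bar> \<le> norm z * N (x + t *\<^sub>R z)" .
  qed
  also have "\<dots> = ennreal (norm z) * (\<integral>\<^sup>+t\<in>{0..1::real}. ennreal (N (x + t *\<^sub>R z)) \<partial>lborel)"
    by (subst nn_integral_cmult[symmetric]) (auto simp: ennreal_mult' mult.assoc)
  finally show ?thesis by (simp add: N_def)
qed

lemma markov_ball:
  fixes g :: "'a::euclidean_space \<Rightarrow> real"
  assumes [measurable]: "g \<in> borel_measurable borel" and l: "0 < l"
  shows "ennreal l * emeasure lborel ({x. l < \<bar>g x\<bar>} \<inter> ball c \<rho>) \<le> (\<integral>\<^sup>+x\<in>ball c \<rho>. ennreal \<bar>g x\<bar> \<partial>lborel)"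
proof -
  have "ennreal l * emeasure lborel ({x. l < \<bar>g x\<bar>} \<inter> ball c \<rho>) =
      (\<integral>\<^sup>+x. ennreal l * indicator ({x. l < \<bar>g x\<bar>} \<inter> ball c \<rho>) x \<partial>lborel)"
    by (subst nn_integral_cmult_indicator) auto
  also have "\<dots> \<le> (\<integral>\<^sup>+x\<in>ball c \<rho>. ennreal \<bar>g x\<bar> \<partial>lborel)"
    by (intro nn_integral_mono) (auto simp: indicator_def intro!: ennreal_leI)
  finally show ?thesis .
qed

text \<open>96 K is 8 times the 12 K in front of the level sum, the 8 coming from the a / 8 that
  survives absorption. The power undoes the parameter u = a / (96 K powr (d + 1) r) of
  \<open>le_young\<close>.\<close>

definition ball_const :: "real \<Rightarrow> real \<Rightarrow> real \<Rightarrow> real" where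
  "ball_const d p K = 96 * K / unit_ball_vol d * (96 * K powr (d + 1)) powr (p - 1)"

text \<open>The part of \<open>g\<close> above the level \<open>2\<^sup>n a / 8\<close> lives on a set of density of order \<open>2\<^sup>-\<^sup>n\<close>
  in the enlarged ball, so its oscillation is already seen at scale \<open>2 powr (-n/d)\<close> times the radius;
  this produces the decaying weight.\<close>

lemma ball_level_estimate:
  fixes g :: "'a::euclidean_space \<Rightarrow> real"
  assumes g: "C1_gradient g D" and a: "0 < a" and r: "0 < r" and K: "2 \<le> K" and p: "1 \<le> p"
    and hB: "ennreal (a / 2) * emeasure lborel (ball c r) \<le> (\<integral>\<^sup>+x\<in>ball c r. ennreal \<bar>g x\<bar> \<partial>lborel)"
    and hK: "(\<integral>\<^sup>+x\<in>ball c (K * r). ennreal \<bar>g x\<bar> \<partial>lborel) \<le>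
       ennreal (a / (16 * 2 ^ DIM('a))) * emeasure lborel (ball c (K * r))"
  shows "ennreal (a powr p * r powr (real DIM('a) - p)) \<le> ennreal (ball_const (real DIM('a)) p K) *
     (\<integral>\<^sup>+x\<in>ball c (K * r). ennreal (level_weight (real DIM('a)) a (g x) * norm (D x) powr p) \<partial>lborel)"
proof -
  note [measurable] = C1_gradient_measurable[OF g]
  define d where "d = real DIM('a)"
  define \<omega> where "\<omega> = unit_ball_vol d"
  have d1: "d \<ge> 1" using DIM_positive[where 'a='a] by (simp add: d_def Suc_leI)
  then have d: "d > 0" by simp
  have \<omega>: "\<omega> > 0" using d by (simp add: \<omega>_def)
  define l where "l n = 2 ^ n * a / 8" for n
  have l: "l n > 0" for n using a by (simp add: l_def)
  \<comment> \<open>With this scale the small ball has 2^(-n) 2^(-d) times the volume of the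
    enlarged one, exactly twice the Markov bound for the set where |g| > l n; the 16 * 2^d in
    \<open>hK\<close> is made for this.\<close>
  define s where "s n = K * r / 2 * 2 powr (- real n / d)" for n
  have s: "s n > 0" for n using K r by (simp add: s_def)
  \<comment> \<open>K \<ge> 2 leaves room for the widening by s n \<le> K r / 2.\<close>
  have sK: "r + s n \<le> K * r" for n
  proof -
    have "2 powr (- real n / d) \<le> 1" using d powr_mono[of "- real n / d" 0 2] by simp
    then have "s n \<le> K * r / 2" using K r by (simp add: s_def mult_left_le)
    moreover have "2 * r \<le> K * r" using K r by (intro mult_right_mono) auto
    ultimately show ?thesis by simp
  qed
  define L where "L n x = (if l n \<le> \<bar>g x\<bar> \<and> \<bar>g x\<bar> < 2 * l n then norm (D x) else 0)" for n x
  have [measurable]: "L n \<in> borel_measurable borel" for n unfolding L_def by measurable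
  have [measurable]: "(\<lambda>x. trunc (l n) (g x)) \<in> borel_measurable borel" for n
    unfolding trunc_def Let_def by measurable
  have volr: "emeasure lborel (ball c \<rho>) = ennreal (\<omega> * \<rho> ^ DIM('a))" if "\<rho> \<ge> 0" for \<rho> and c :: 'a
    using that by (simp add: emeasure_ball \<omega>_def d_def)
  have tr: "(\<integral>\<^sup>+x\<in>ball c r. ennreal (trunc (l n) (g x)) \<partial>lborel) \<le>
      ennreal (6 * s n) * (\<integral>\<^sup>+x\<in>ball c (K * r). ennreal (L n x) \<partial>lborel)" for n
  proof -
    have "(\<integral>\<^sup>+x\<in>ball c r. ennreal (trunc (l n) (g x)) \<partial>lborel) \<le>
        ennreal (2 * s n) * (\<integral>\<^sup>+x\<in>ball c (r + s n). ennreal (3 * L n x) \<partial>lborel)"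
    proof (rule small_support_poincare)
      show "ennreal \<bar>trunc (l n) (g (x + z)) - trunc (l n) (g x)\<bar> \<le> ennreal (norm z) *
          (\<integral>\<^sup>+t\<in>{0..1::real}. ennreal (3 * L n (x + t *\<^sub>R z)) \<partial>lborel)" for x z
        using trunc_gradient_increment[OF g l, of n x z] by (simp add: L_def)
      have [measurable]: "{x. trunc (l n) (g x) \<noteq> 0} \<inter> ball c (r + s n) \<in> sets borel" by measurable
      have "{x. trunc (l n) (g x) \<noteq> 0} \<inter> ball c (r + s n) \<subseteq> {x. l n < \<bar>g x\<bar>} \<inter> ball c (K * r)"
        using trunc_eq_0[OF l[of n]] sK[of n] by force
      then have "emeasure lborel ({x. trunc (l n) (g x) \<noteq> 0} \<inter> ball c (r + s n)) \<le>
          emeasure lborel ({x. l n < \<bar>g x\<bar>} \<inter> ball c (K * r))" (is "?e1 \<le> ?e2")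
        by (intro emeasure_mono) auto
      then have "ennreal (l n) * ?e1 \<le> ennreal (l n) * ?e2" by (intro mult_left_mono) auto
      also have "\<dots> \<le> ennreal (a / (16 * 2 ^ DIM('a))) * emeasure lborel (ball c (K * r))"
        by (rule order_trans[OF markov_ball hK]) (use l in auto)
      also have "\<dots> = ennreal (a / (16 * 2 ^ DIM('a)) * (\<omega> * (K * r) ^ DIM('a)))"
        using K r a \<omega> by (subst volr) (auto simp: ennreal_mult[symmetric])
      finally have e1: "ennreal (l n) * ?e1 \<le> ennreal (a / (16 * 2 ^ DIM('a)) * (\<omega> * (K * r) ^ DIM('a)))" .
      have sn: "s n ^ DIM('a) = (K * r) ^ DIM('a) / 2 ^ DIM('a) / 2 ^ n"
      proof -
        have "(2 powr (- real n / d)) ^ DIM('a) = 2 powr (- real n)"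
          using d by (simp add: powr_powr powr_realpow[symmetric] d_def)
        then show ?thesis
          by (simp add: s_def power_mult_distrib power_divide powr_minus powr_realpow field_simps)
      qed
      have "ennreal (l n) * (2 * ?e1) \<le> ennreal 2 * ennreal (a / (16 * 2 ^ DIM('a)) * (\<omega> * (K * r) ^ DIM('a)))"
        using mult_left_mono[OF e1, of 2] by (simp add: ac_simps)
      also have "\<dots> = ennreal (l n * (\<omega> * s n ^ DIM('a)))"
        unfolding sn using a K r \<omega> by (subst ennreal_mult[symmetric]) (auto simp: l_def field_simps)
      also have "\<dots> = ennreal (l n) * emeasure lborel (ball (0::'a) (s n))"
        using l[of n] s[of n] \<omega> by (subst volr) (auto simp: ennreal_mult)
      finally show "2 * ?e1 \<le> emeasure lborel (ball (0::'a) (s n))"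
        using l[of n] ennreal_mult_le_mult_iff[of "ennreal (l n)"] by auto
    qed (use s l trunc_nonneg in auto)
    also have "\<dots> \<le> ennreal (2 * s n) * (\<integral>\<^sup>+x\<in>ball c (K * r). ennreal (3 * L n x) \<partial>lborel)"
    proof (intro mult_left_mono nn_integral_mono)
      show "indicator (ball c (r + s n)) x \<le> (indicator (ball c (K * r)) x :: ennreal)" for x
        using sK[of n] by (auto simp: indicator_def)
    qed auto
    also have "(\<integral>\<^sup>+x\<in>ball c (K * r). ennreal (3 * L n x) \<partial>lborel) = 3 * (\<integral>\<^sup>+x\<in>ball c (K * r). ennreal (L n x) \<partial>lborel)"
      by (subst nn_integral_cmult[symmetric]) (auto simp: ennreal_mult' mult.assoc)
    also have "ennreal (2 * s n) * (3 * (\<integral>\<^sup>+x\<in>ball c (K * r). ennreal (L n x) \<partial>lborel)) =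
        ennreal (6 * s n) * (\<integral>\<^sup>+x\<in>ball c (K * r). ennreal (L n x) \<partial>lborel)"
    proof -
      have "ennreal (6 * s n) = ennreal (2 * s n) * 3"
        using s[of n] ennreal_mult[of "2 * s n" 3] by simp
      then show ?thesis by (simp add: mult.assoc)
    qed
    finally show ?thesis .
  qed
  \<comment> \<open>Chosen so that the u-term of the level sum is a / 8 times the volume of the
    ball: 12 K r u (K r)^d = (a / 8) r^d. Together with the a / 4 from low values it leaves a / 2 -
    a / 4 - a / 8 = a / 8 on the left.\<close>
  define u where "u = a / (96 * K powr (d + 1) * r)"
  have u: "u > 0" using a K r by (simp add: u_def)
  define w where "w x = level_weight d a (g x) * norm (D x) powr p" for x
  have [measurable]: "w \<in> borel_measurable borel" unfolding w_def by measurable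
  have w0: "w x \<ge> 0" for x by (simp add: w_def level_weight_nonneg)
  define X where "X = (\<integral>\<^sup>+x\<in>ball c (K * r). ennreal (w x) \<partial>lborel)"
  have vK: "emeasure lborel (ball c (K * r)) = ennreal (\<omega> * (K * r) ^ DIM('a))"
    using K r by (simp add: volr)
  have "ennreal (a / 2) * emeasure lborel (ball c r) \<le> (\<integral>\<^sup>+x\<in>ball c r. ennreal \<bar>g x\<bar> \<partial>lborel)" by (rule hB)
  also have "\<dots> \<le> (\<integral>\<^sup>+x. ennreal (a / 4) * indicator (ball c r) x + (\<Sum>n. ennreal (4 * trunc (l n) (g x)) * indicator (ball c r) x) \<partial>lborel)"
  proof (intro nn_integral_mono)
    fix x
    show "ennreal \<bar>g x\<bar> * indicator (ball c r) x \<le> ennreal (a / 4) * indicator (ball c r) x +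
        (\<Sum>n. ennreal (4 * trunc (l n) (g x)) * indicator (ball c r) x)"
      using abs_le_sum_trunc[OF a, of "g x"] by (auto simp: indicator_def l_def)
  qed
  also have "\<dots> = ennreal (a / 4) * emeasure lborel (ball c r) +
      (\<Sum>n. \<integral>\<^sup>+x\<in>ball c r. ennreal (4 * trunc (l n) (g x)) \<partial>lborel)"
    by (subst nn_integral_add, measurable, subst nn_integral_suminf, measurable,
        subst nn_integral_cmult_indicator) simp_all
  also have "(\<Sum>n. \<integral>\<^sup>+x\<in>ball c r. ennreal (4 * trunc (l n) (g x)) \<partial>lborel) \<le>
      (\<Sum>n. \<integral>\<^sup>+x. ennreal (12 * K * r) * (ennreal (2 powr (- real n / d) * L n x) * indicator (ball c (K * r)) x) \<partial>lborel)"
  proof (intro suminf_le summableI)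
    fix n
    have "(\<integral>\<^sup>+x\<in>ball c r. ennreal (4 * trunc (l n) (g x)) \<partial>lborel) = ennreal 4 * (\<integral>\<^sup>+x\<in>ball c r. ennreal (trunc (l n) (g x)) \<partial>lborel)"
      by (subst nn_integral_cmult[symmetric]) (auto simp: ennreal_mult' mult.assoc)
    also have "\<dots> \<le> ennreal 4 * (ennreal (6 * s n) * (\<integral>\<^sup>+x\<in>ball c (K * r). ennreal (L n x) \<partial>lborel))"
      by (intro mult_left_mono tr) auto
    also have "\<dots> = ennreal (24 * s n) * (\<integral>\<^sup>+x\<in>ball c (K * r). ennreal (L n x) \<partial>lborel)"
    proof -
      have "ennreal (24 * s n) = ennreal 4 * ennreal (6 * s n)"
        using s[of n] ennreal_mult[of 4 "6 * s n"] by simp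
      then show ?thesis by (simp only: mult.assoc)
    qed
    also have "\<dots> = (\<integral>\<^sup>+x. ennreal (24 * s n) * (ennreal (L n x) * indicator (ball c (K * r)) x) \<partial>lborel)"
      by (subst nn_integral_cmult) auto
    also have "\<dots> = (\<integral>\<^sup>+x. ennreal (12 * K * r) * (ennreal (2 powr (- real n / d) * L n x) * indicator (ball c (K * r)) x) \<partial>lborel)"
    proof (intro nn_integral_cong)
      fix x
      have "24 * s n * L n x = 12 * K * r * (2 powr (- real n / d) * L n x)" by (simp add: s_def)
      then have "ennreal (24 * s n) * ennreal (L n x) = ennreal (12 * K * r) * ennreal (2 powr (- real n / d) * L n x)"
        using s[of n] K r by (subst (1 2) ennreal_mult[symmetric]) (auto simp: L_def)
      then show "ennreal (24 * s n) * (ennreal (L n x) * indicator (ball c (K * r)) x) =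
        ennreal (12 * K * r) * (ennreal (2 powr (- real n / d) * L n x) * indicator (ball c (K * r)) x)"
        by (metis mult.assoc)
    qed
    finally show "(\<integral>\<^sup>+x\<in>ball c r. ennreal (4 * trunc (l n) (g x)) \<partial>lborel) \<le>
       (\<integral>\<^sup>+x. ennreal (12 * K * r) * (ennreal (2 powr (- real n / d) * L n x) * indicator (ball c (K * r)) x) \<partial>lborel)" .
  qed
  also have "\<dots> = ennreal (12 * K * r) * (\<integral>\<^sup>+x. (\<Sum>n. ennreal (2 powr (- real n / d) * L n x)) * indicator (ball c (K * r)) x \<partial>lborel)"
    by (subst nn_integral_suminf[symmetric]) (auto simp: nn_integral_cmult)
  also have "(\<integral>\<^sup>+x. (\<Sum>n. ennreal (2 powr (- real n / d) * L n x)) * indicator (ball c (K * r)) x \<partial>lborel) \<le>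
     (\<integral>\<^sup>+x. ennreal u * indicator (ball c (K * r)) x + ennreal (u powr (1 - p)) * (ennreal (w x) * indicator (ball c (K * r)) x) \<partial>lborel)"
  proof (intro nn_integral_mono)
    fix x
    have "(\<Sum>n. ennreal (2 powr (- real n / d) * L n x)) \<le> ennreal (u + u powr (1 - p) * w x)"
      using sum_levels_le[OF a u norm_ge_zero p d, of "g x" "D x"] by (simp add: L_def l_def w_def)
    also have "\<dots> = ennreal u + ennreal (u powr (1 - p)) * ennreal (w x)"
      using u w0 by (simp add: ennreal_mult)
    finally show "(\<Sum>n. ennreal (2 powr (- real n / d) * L n x)) * indicator (ball c (K * r)) x \<le>
      ennreal u * indicator (ball c (K * r)) x + ennreal (u powr (1 - p)) * (ennreal (w x) * indicator (ball c (K * r)) x)"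
      by (auto simp: indicator_def)
  qed
  also have "\<dots> = ennreal u * emeasure lborel (ball c (K * r)) + ennreal (u powr (1 - p)) * X"
    by (subst nn_integral_add) (auto simp: nn_integral_cmult nn_integral_cmult_indicator X_def)
  finally have main: "ennreal (a / 2) * emeasure lborel (ball c r) \<le> ennreal (a / 4) * emeasure lborel (ball c r) +
     ennreal (12 * K * r) * (ennreal u * emeasure lborel (ball c (K * r)) + ennreal (u powr (1 - p)) * X)"
    by (simp add: add_left_mono mult_left_mono)
  define cst where "cst = ball_const d p K"
  have cst: "cst > 0" using \<omega> K by (simp add: cst_def ball_const_def \<omega>_def)
  show ?thesis
  proof (cases "X = \<infinity>")
    case True
    then show ?thesis
      using cst by (simp add: X_def w_def d_def cst_def ennreal_mult_top)
  next
    case False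
    then obtain X' where X': "X = ennreal X'" "0 \<le> X'"
      by (metis ennreal_cases infinity_ennreal_def)
    define v1 where "v1 = \<omega> * r ^ DIM('a)"
    define v2 where "v2 = \<omega> * (K * r) ^ DIM('a)"
    define A where "A = 12 * K * r"
    define U where "U = u powr (1 - p)"
    have nn: "0 \<le> v1" "0 \<le> v2" "0 \<le> A" "0 \<le> U" using \<omega> r K by (auto simp: v1_def v2_def A_def U_def)
    have "ennreal (a / 2) * ennreal v1 \<le> ennreal (a / 4) * ennreal v1 +
        ennreal A * (ennreal u * ennreal v2 + ennreal U * ennreal X')"
      using main r unfolding vK X'(1) A_def[symmetric] U_def[symmetric] v2_def[symmetric]
      by (simp add: volr v1_def)
    then have "ennreal (a / 2 * v1) \<le> ennreal (a / 4 * v1 + A * (u * v2 + U * X'))"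
      using nn a u X'(2) by (simp add: ennreal_mult[symmetric] ennreal_plus[symmetric] del: ennreal_plus)
    then have "a / 2 * v1 \<le> a / 4 * v1 + A * (u * v2 + U * X')"
      using nn a u X'(2) by (subst (asm) ennreal_le_iff) auto
    moreover have "A * (u * v2) = a / 8 * v1"
    proof -
      have K1: "K powr (d + 1) = K * K ^ DIM('a)"
        using K by (simp add: powr_add powr_realpow d_def)
      define KD where "KD = K ^ DIM('a)"
      define rD where "rD = r ^ DIM('a)"
      have "KD > 0" using K by (simp add: KD_def)
      then show ?thesis using K r
        unfolding A_def u_def v2_def v1_def power_mult_distrib K1 KD_def[symmetric] rD_def[symmetric]
        by (simp add: divide_simps)
    qed
    ultimately have "a / 8 * v1 \<le> A * (U * X')"
      by (simp add: distrib_left)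
    then have "a / 8 * (\<omega> * r ^ DIM('a)) \<le> 12 * K * r * (u powr (1 - p) * X')"
      unfolding A_def U_def v1_def .
    \<comment> \<open>The factor u powr (p - 1) cancels the power of u in front of the
      energy.\<close>
    then have "u powr (p - 1) * (a / 8 * (\<omega> * r ^ DIM('a))) \<le> u powr (p - 1) * (12 * K * r * (u powr (1 - p) * X'))"
      by (intro mult_left_mono) auto
    also have "\<dots> = 12 * K * r * X'"
      using u by (simp add: powr_add[symmetric])
    finally have "u powr (p - 1) * (a / 8 * (\<omega> * r ^ DIM('a))) \<le> 12 * K * r * X'" .
    moreover have "u powr (p - 1) * (a / 8 * (\<omega> * r ^ DIM('a))) * (8 * (96 * K powr (d + 1)) powr (p - 1) / (\<omega> * r)) =
        a powr p * r powr (d - p)"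
    proof -
      have "u powr (p - 1) * (96 * K powr (d + 1)) powr (p - 1) = (a / r) powr (p - 1)"
        using a K r by (subst powr_mult[symmetric]) (auto simp: u_def)
      moreover have "(a / r) powr (p - 1) * (a * r ^ DIM('a) / r) = a powr p * r powr (d - p)"
      proof -
        have "(a / r) powr (p - 1) * (a * r ^ DIM('a) / r) = (a powr (p - 1) * a) * (r ^ DIM('a) / (r powr (p - 1) * r))"
          using a r by (simp add: powr_divide)
        also have "a powr (p - 1) * a = a powr p" using a by (simp add: powr_mult_base[symmetric] powr_diff)
        also have "r powr (p - 1) * r = r powr p" using r by (simp add: powr_diff)
        also have "r ^ DIM('a) / r powr p = r powr (d - p)" using r by (simp add: powr_diff powr_realpow d_def)
        finally show ?thesis .
      qed
      ultimately show ?thesis using \<omega> r by (simp add: field_simps)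
    qed
    ultimately have "a powr p * r powr (d - p) \<le> 12 * K * r * X' * (8 * (96 * K powr (d + 1)) powr (p - 1) / (\<omega> * r))"
      using \<omega> r K by (metis (no_types, lifting) mult_right_mono divide_nonneg_pos mult_nonneg_nonneg powr_ge_zero mult_pos_pos zero_le_numeral)
    also have "\<dots> = cst * X'" using r \<omega> by (simp add: cst_def ball_const_def \<omega>_def field_simps)
    finally have "ennreal (a powr p * r powr (d - p)) \<le> ennreal cst * X"
      using cst X' by (simp add: ennreal_mult[symmetric] ennreal_leI)
    then show ?thesis by (simp add: X_def w_def d_def cst_def)
  qed
qed

section \<open>Families of balls\<close>

text \<open>The largest possible weight 8 powr (1 / d) times the geometric series with ratio 2 powr
  (- 1 / d).\<close>

definition level_sum :: "real \<Rightarrow> real" where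
  "level_sum d = 8 powr (1 / d) / (1 - 2 powr (- 1 / d))"

lemma level_sum_nonneg: "0 < d \<Longrightarrow> 0 \<le> level_sum d"
  using powr_less_mono[of "- 1 / d" 0 2] by (simp add: level_sum_def)

text \<open>At a fixed t only levels with 2 powr k \<le> 8 |t| have a nonzero weight, and below the
  largest of them the weights fall geometrically. Hence a bound on the number of indices per level
  controls the sum over all levels.\<close>

lemma sum_level_weight_le:
  fixes m :: "'i \<Rightarrow> int" and d t :: real
  assumes fin: "finite I" and d: "0 < d"
    and card: "\<And>k. card {i \<in> I. m i = k} \<le> N"
  shows "(\<Sum>i\<in>I. level_weight d (2 powr m i) t) \<le> real N * level_sum d"
proof (cases "t = 0")
  case True
  then show ?thesis using d by (simp add: level_weight_def level_sum_nonneg)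
next
  case False
  define \<theta> where "\<theta> = 2 powr (- 1 / d)"
  have \<theta>: "0 < \<theta>" "\<theta> < 1" using d powr_less_mono[of "- 1 / d" 0 2] by (auto simp: \<theta>_def)
  define m0 where "m0 = \<lfloor>log 2 (8 * \<bar>t\<bar>)\<rfloor>"
  have le: "level_weight d (2 powr k) t \<le> (if k \<le> m0 then 8 powr (1 / d) * \<theta> ^ nat (m0 - k) else 0)" for k :: int
  proof (cases "2 powr k / 8 \<le> \<bar>t\<bar>")
    case True
    then have "2 powr k \<le> 8 * \<bar>t\<bar>" by simp
    then have "k \<le> log 2 (8 * \<bar>t\<bar>)" using False by (subst le_log_iff) auto
    then have k: "k \<le> m0" by (simp add: m0_def le_floor_iff)
    have "2 powr m0 \<le> 8 * \<bar>t\<bar>"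
    proof -
      have "real_of_int m0 \<le> log 2 (8 * \<bar>t\<bar>)" by (simp add: m0_def)
      then show ?thesis using False by (subst (asm) le_log_iff) auto
    qed
    then have "2 powr k \<le> 8 * \<bar>t\<bar> * 2 powr (- (real_of_int (m0 - k)))"
    proof -
      assume "2 powr m0 \<le> 8 * \<bar>t\<bar>"
      then have "2 powr m0 * 2 powr (- (real_of_int (m0 - k))) \<le> 8 * \<bar>t\<bar> * 2 powr (- (real_of_int (m0 - k)))"
        by (intro mult_right_mono) auto
      then show ?thesis by (simp flip: powr_add)
    qed
    then have "2 powr k / \<bar>t\<bar> \<le> 8 * 2 powr (- (real_of_int (m0 - k)))"
      using False by (simp add: field_simps)
    then have "(2 powr k / \<bar>t\<bar>) powr (1 / d) \<le> (8 * 2 powr (- (real_of_int (m0 - k)))) powr (1 / d)"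
      using d by (intro powr_mono2) auto
    also have "\<dots> = 8 powr (1 / d) * 2 powr (- (real_of_int (m0 - k)) / d)"
      by (simp add: powr_mult powr_powr)
    also have "2 powr (- (real_of_int (m0 - k)) / d) = \<theta> ^ nat (m0 - k)"
    proof -
      have "\<theta> ^ nat (m0 - k) = 2 powr (- 1 / d * real (nat (m0 - k)))"
        by (simp only: \<theta>_def powr_powr[symmetric] powr_realpow powr_gt_zero zero_less_numeral)
      moreover have "real (nat (m0 - k)) = real_of_int (m0 - k)" using k by simp
      ultimately show ?thesis by (simp add: diff_divide_distrib)
    qed
    finally show ?thesis using True k by (simp add: level_weight_def)
  qed (use \<theta> in \<open>auto simp: level_weight_def\<close>)
  have "(\<Sum>i\<in>I. level_weight d (2 powr m i) t) = (\<Sum>k\<in>m ` I. \<Sum>i\<in>{i \<in> I. m i = k}. level_weight d (2 powr m i) t)"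
    by (rule sum.image_gen[OF fin])
  also have "\<dots> = (\<Sum>k\<in>m ` I. real (card {i \<in> I. m i = k}) * level_weight d (2 powr k) t)"
    by (intro sum.cong) auto
  also have "\<dots> \<le> (\<Sum>k\<in>m ` I. real N * level_weight d (2 powr k) t)"
    by (intro sum_mono mult_right_mono) (use card in \<open>auto simp: level_weight_nonneg\<close>)
  also have "\<dots> = real N * (\<Sum>k\<in>m ` I. level_weight d (2 powr k) t)"
    by (simp add: sum_distrib_left)
  also have "(\<Sum>k\<in>m ` I. level_weight d (2 powr k) t) \<le> (\<Sum>k\<in>m ` I. if k \<le> m0 then 8 powr (1 / d) * \<theta> ^ nat (m0 - k) else 0)"
    by (intro sum_mono le)
  also have "\<dots> = (\<Sum>k\<in>{k \<in> m ` I. k \<le> m0}. 8 powr (1 / d) * \<theta> ^ nat (m0 - k))"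
    by (rule sum.inter_filter[symmetric]) (use fin in auto)
  also have "\<dots> = 8 powr (1 / d) * (\<Sum>j\<in>(\<lambda>k. nat (m0 - k)) ` {k \<in> m ` I. k \<le> m0}. \<theta> ^ j)"
    by (subst sum.reindex) (auto simp: inj_on_def sum_distrib_left)
  also have "(\<Sum>j\<in>(\<lambda>k. nat (m0 - k)) ` {k \<in> m ` I. k \<le> m0}. \<theta> ^ j) \<le> (\<Sum>j. \<theta> ^ j)"
    by (rule sum_le_suminf) (use \<theta> fin in \<open>auto intro!: summable_geometric\<close>)
  also have "(\<Sum>j. \<theta> ^ j) = 1 / (1 - \<theta>)" by (rule suminf_geometric) (use \<theta> in auto)
  finally show ?thesis by (simp add: level_sum_def \<theta>_def mult_left_mono)
qed

text \<open>Balls of different levels may pile up without bound; the decay of the weight pays for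
  that, and \<open>overlap\<close> limits the pile within each single level.\<close>

lemma family_estimate_C1:
  fixes g :: "'a::euclidean_space \<Rightarrow> real" and c :: "'i \<Rightarrow> 'a" and m :: "'i \<Rightarrow> int"
  assumes g: "C1_gradient g D" and K: "2 \<le> K" and p: "1 \<le> p" and fin: "finite I"
    and r: "\<And>i. i \<in> I \<Longrightarrow> 0 < r i"
    and hB: "\<And>i. i \<in> I \<Longrightarrow> ennreal (2 powr m i / 2) * emeasure lborel (ball (c i) (r i)) \<le>
              (\<integral>\<^sup>+x\<in>ball (c i) (r i). ennreal \<bar>g x\<bar> \<partial>lborel)"
    and hK: "\<And>i. i \<in> I \<Longrightarrow> (\<integral>\<^sup>+x\<in>ball (c i) (K * r i). ennreal \<bar>g x\<bar> \<partial>lborel) \<le>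
       ennreal (2 powr m i / (16 * 2 ^ DIM('a))) * emeasure lborel (ball (c i) (K * r i))"
    and overlap: "\<And>x k. card {i \<in> I. m i = k \<and> x \<in> ball (c i) (K * r i)} \<le> N"
  shows "(\<Sum>i\<in>I. ennreal ((2 powr m i) powr p * r i powr (real DIM('a) - p))) \<le>
    ennreal (ball_const (real DIM('a)) p K * (real N * level_sum (real DIM('a)))) * (\<integral>\<^sup>+x. ennreal (norm (D x) powr p) \<partial>lborel)"
proof -
  note [measurable] = C1_gradient_measurable[OF g]
  define d where "d = real DIM('a)"
  have d: "d > 0" by (simp add: d_def)
  define A where "A = ball_const d p K"
  have A: "0 \<le> A" using K d by (simp add: A_def ball_const_def)
  have "(\<Sum>i\<in>I. ennreal ((2 powr m i) powr p * r i powr (d - p))) \<le>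
     (\<Sum>i\<in>I. ennreal A * (\<integral>\<^sup>+x\<in>ball (c i) (K * r i). ennreal (level_weight d (2 powr m i) (g x) * norm (D x) powr p) \<partial>lborel))"
    unfolding A_def d_def by (intro sum_mono ball_level_estimate[OF g _ r K p hB hK]) auto
  also have "\<dots> = ennreal A * (\<Sum>i\<in>I. \<integral>\<^sup>+x\<in>ball (c i) (K * r i). ennreal (level_weight d (2 powr m i) (g x) * norm (D x) powr p) \<partial>lborel)"
    by (simp add: sum_distrib_left)
  also have "\<dots> = ennreal A * (\<integral>\<^sup>+x. (\<Sum>i\<in>I. ennreal (level_weight d (2 powr m i) (g x) * norm (D x) powr p) * indicator (ball (c i) (K * r i)) x) \<partial>lborel)"
    by (subst nn_integral_sum) auto
  also have "\<dots> \<le> ennreal A * (\<integral>\<^sup>+x. ennreal (real N * level_sum d) * ennreal (norm (D x) powr p) \<partial>lborel)"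
  proof (intro mult_left_mono nn_integral_mono)
    fix x
    define J where "J = {i \<in> I. x \<in> ball (c i) (K * r i)}"
    have "(\<Sum>i\<in>I. ennreal (level_weight d (2 powr m i) (g x) * norm (D x) powr p) * indicator (ball (c i) (K * r i)) x)
        = (\<Sum>i\<in>J. ennreal (level_weight d (2 powr m i) (g x) * norm (D x) powr p))"
      unfolding J_def sum.inter_filter[OF fin] by (rule sum.cong) (simp_all split: split_indicator)
    also have "\<dots> = ennreal (\<Sum>i\<in>J. level_weight d (2 powr m i) (g x) * norm (D x) powr p)"
      by (subst sum_ennreal) (auto simp: level_weight_nonneg)
    also have "\<dots> = ennreal ((\<Sum>i\<in>J. level_weight d (2 powr m i) (g x)) * norm (D x) powr p)"
      by (simp add: sum_distrib_right)
    also have "\<dots> \<le> ennreal ((real N * level_sum d) * norm (D x) powr p)"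
    proof (intro ennreal_leI mult_right_mono sum_level_weight_le d)
      show "finite J" using fin by (simp add: J_def)
      show "card {i \<in> J. m i = k} \<le> N" for k
        using overlap[of k x] by (simp add: J_def conj_ac)
    qed auto
    also have "\<dots> = ennreal (real N * level_sum d) * ennreal (norm (D x) powr p)"
      using d by (intro ennreal_mult) (auto simp: level_sum_nonneg)
    finally show "(\<Sum>i\<in>I. ennreal (level_weight d (2 powr m i) (g x) * norm (D x) powr p) * indicator (ball (c i) (K * r i)) x)
       \<le> ennreal (real N * level_sum d) * ennreal (norm (D x) powr p)" .
  qed auto
  also have "\<dots> = ennreal A * (ennreal (real N * level_sum d) * (\<integral>\<^sup>+x. ennreal (norm (D x) powr p) \<partial>lborel))"
    by (subst nn_integral_cmult) auto
  also have "\<dots> = ennreal (A * (real N * level_sum d)) * (\<integral>\<^sup>+x. ennreal (norm (D x) powr p) \<partial>lborel)"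
    using A d by (subst ennreal_mult) (auto simp: level_sum_nonneg mult.assoc)
  finally show ?thesis by (simp add: A_def d_def)
qed

text \<open>Common replacement for the Sobolev and the BV hypothesis: f enters only as a local L1
  limit of C1 functions with energies bounded by \<open>W\<close>. In the BV case the gradient of f
  may be a measure, hence none is mentioned.\<close>

definition gradient_approximable :: "real \<Rightarrow> real \<Rightarrow> ('a::euclidean_space \<Rightarrow> real) \<Rightarrow> bool" where
  "gradient_approximable p W f \<longleftrightarrow> (\<exists>g D. (\<forall>k::nat. C1_gradient (g k) (D k)) \<and>
     (\<forall>R. (\<lambda>k. \<integral>\<^sup>+x\<in>ball 0 R. ennreal \<bar>g k x - f x\<bar> \<partial>lborel) \<longlonglongrightarrow> 0) \<and>
     (\<forall>k. (\<integral>\<^sup>+x. ennreal (norm (D k x) powr p) \<partial>lborel) \<le> ennreal W))"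

lemma ennreal_add_right_cancel_imp_le:
  fixes a b :: ennreal
  assumes "a + ennreal x \<le> b + ennreal x"
  shows "a \<le> b"
  using assms ennreal_add_left_cancel_le[of "ennreal x" a b] by (simp add: add.commute)

lemma nn_integral_abs_le_diff:
  fixes g f :: "'a::euclidean_space \<Rightarrow> real"
  assumes [measurable]: "g \<in> borel_measurable borel" "f \<in> borel_measurable borel"
    and sub: "ball c \<rho> \<subseteq> S" and [measurable]: "S \<in> sets borel"
  shows "(\<integral>\<^sup>+x\<in>ball c \<rho>. ennreal \<bar>g x\<bar> \<partial>lborel) \<le>
     (\<integral>\<^sup>+x\<in>ball c \<rho>. ennreal \<bar>f x\<bar> \<partial>lborel) + (\<integral>\<^sup>+x\<in>S. ennreal \<bar>g x - f x\<bar> \<partial>lborel)"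
proof -
  have "(\<integral>\<^sup>+x\<in>ball c \<rho>. ennreal \<bar>g x\<bar> \<partial>lborel) \<le>
     (\<integral>\<^sup>+x. ennreal \<bar>f x\<bar> * indicator (ball c \<rho>) x + ennreal \<bar>g x - f x\<bar> * indicator S x \<partial>lborel)"
  proof (intro nn_integral_mono)
    fix x
    have "ennreal \<bar>g x\<bar> \<le> ennreal \<bar>f x\<bar> + ennreal \<bar>g x - f x\<bar>"
      by (simp flip: ennreal_plus) 
    then show "ennreal \<bar>g x\<bar> * indicator (ball c \<rho>) x \<le> ennreal \<bar>f x\<bar> * indicator (ball c \<rho>) x + ennreal \<bar>g x - f x\<bar> * indicator S x"
      using sub by (auto split: split_indicator)
  qed
  then show ?thesis by (subst (asm) nn_integral_add) auto
qed

text \<open>A finite family lies in one ball and tolerates a positive L1 error, so a single C1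
  approximant serves all its members. The error costs a factor 2 on each side: 2 powr m is halved,
  and 32 becomes 16.\<close>

lemma family_estimate:
  fixes f :: "'a::euclidean_space \<Rightarrow> real" and c :: "'i \<Rightarrow> 'a" and m :: "'i \<Rightarrow> int"
  assumes [measurable]: "f \<in> borel_measurable borel"
    and approx: "gradient_approximable p W f" and K: "2 \<le> K" and p: "1 \<le> p" and fin: "finite I"
    and r: "\<And>i. i \<in> I \<Longrightarrow> 0 < r i"
    and hB: "\<And>i. i \<in> I \<Longrightarrow> ennreal (2 powr m i) * emeasure lborel (ball (c i) (r i)) \<le>
              (\<integral>\<^sup>+x\<in>ball (c i) (r i). ennreal \<bar>f x\<bar> \<partial>lborel)"
    and hK: "\<And>i. i \<in> I \<Longrightarrow> (\<integral>\<^sup>+x\<in>ball (c i) (K * r i). ennreal \<bar>f x\<bar> \<partial>lborel) \<le>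
       ennreal (2 powr m i / (32 * 2 ^ DIM('a))) * emeasure lborel (ball (c i) (K * r i))"
    and overlap: "\<And>x k. card {i \<in> I. m i = k \<and> x \<in> ball (c i) (K * r i)} \<le> N"
  shows "(\<Sum>i\<in>I. ennreal ((2 powr m i) powr p * r i powr (real DIM('a) - p))) \<le>
    ennreal (ball_const (real DIM('a)) p K * (real N * level_sum (real DIM('a)))) * ennreal W"
proof (cases "I = {}")
  case True
  then show ?thesis by simp
next
  case False
  obtain g D where g: "\<And>k::nat. C1_gradient (g k) (D k)"
    and conv: "\<And>R. (\<lambda>k. \<integral>\<^sup>+x\<in>ball 0 R. ennreal \<bar>g k x - f x\<bar> \<partial>lborel) \<longlonglongrightarrow> 0"
    and W: "\<And>k. (\<integral>\<^sup>+x. ennreal (norm (D k x) powr p) \<partial>lborel) \<le> ennreal W"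
    using approx unfolding gradient_approximable_def by blast
  have "bounded (\<Union>i\<in>I. ball (c i) (K * r i))" using fin by auto
  then obtain R where R: "\<And>i. i \<in> I \<Longrightarrow> ball (c i) (K * r i) \<subseteq> ball 0 R"
    by (metis (no_types, lifting) UN_subset_iff bounded_subset_ballD)
  have rK: "r i \<le> K * r i" if "i \<in> I" for i
    using mult_right_mono[of 1 K "r i"] K r[OF that] by simp
  have sub: "ball (c i) (r i) \<subseteq> ball (c i) (K * r i)" if "i \<in> I" for i
    using rK[OF that] by (rule subset_ball)
  define b where "b i = unit_ball_vol (real DIM('a)) * r i ^ DIM('a)" for i
  have b: "emeasure lborel (ball (c i) (r i)) = ennreal (b i)" "b i > 0" if "i \<in> I" for i
    unfolding b_def using r[OF that] by (auto simp: emeasure_ball)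
  \<comment> \<open>The smallest error budget over the family, suitable both for the lower bounds on
    the balls and for the upper bounds on their enlargements.\<close>
  define e where "e = Min ((\<lambda>i. 2 powr m i / (32 * 2 ^ DIM('a)) * b i) ` I)"
  have e0: "e > 0" unfolding e_def using fin False b by (subst Min_gr_iff) auto
  have e: "e \<le> 2 powr m i / (32 * 2 ^ DIM('a)) * b i" if "i \<in> I" for i
    unfolding e_def using fin that by (intro Min_le) auto
  have "eventually (\<lambda>k. (\<integral>\<^sup>+x\<in>ball 0 R. ennreal \<bar>g k x - f x\<bar> \<partial>lborel) < ennreal e) sequentially"
    using e0 conv[of R] by (intro order_tendstoD) auto
  then obtain k where k: "(\<integral>\<^sup>+x\<in>ball 0 R. ennreal \<bar>g k x - f x\<bar> \<partial>lborel) < ennreal e"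
    by (auto simp: eventually_sequentially)
  have k': "(\<integral>\<^sup>+x\<in>ball 0 R. ennreal \<bar>f x - g k x\<bar> \<partial>lborel) < ennreal e"
    using k by (simp add: abs_minus_commute)
  note [measurable] = C1_gradient_measurable[OF g]
  have "(\<Sum>i\<in>I. ennreal ((2 powr m i) powr p * r i powr (real DIM('a) - p))) \<le>
    ennreal (ball_const (real DIM('a)) p K * (real N * level_sum (real DIM('a)))) * (\<integral>\<^sup>+x. ennreal (norm (D k x) powr p) \<partial>lborel)"
  proof (rule family_estimate_C1[OF g K p fin r _ _ overlap])
    fix i assume i: "i \<in> I"
    have "2 ^ DIM('a) \<ge> (1::real)" by simp
    then have "32 * 2 ^ DIM('a) \<ge> (2::real)" by linarith
    then have "2 powr m i / (32 * 2 ^ DIM('a)) \<le> 2 powr m i / 2"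
      by (rule divide_left_mono) auto
    then have "2 powr m i / (32 * 2 ^ DIM('a)) * b i \<le> 2 powr m i / 2 * b i"
      using b(2)[OF i] by (intro mult_right_mono) auto
    then have eb: "e \<le> 2 powr m i / 2 * b i" using e[OF i] by linarith
    have "ennreal (2 powr m i / 2 * b i) + ennreal (2 powr m i / 2 * b i) = ennreal (2 powr m i) * emeasure lborel (ball (c i) (r i))"
      using b[OF i] by (simp add: ennreal_mult[symmetric] ennreal_plus[symmetric] del: ennreal_plus)
    also have "\<dots> \<le> (\<integral>\<^sup>+x\<in>ball (c i) (r i). ennreal \<bar>f x\<bar> \<partial>lborel)" by (rule hB[OF i])
    also have "\<dots> \<le> (\<integral>\<^sup>+x\<in>ball (c i) (r i). ennreal \<bar>g k x\<bar> \<partial>lborel) + (\<integral>\<^sup>+x\<in>ball 0 R. ennreal \<bar>f x - g k x\<bar> \<partial>lborel)"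
      by (rule nn_integral_abs_le_diff) (use sub[OF i] R[OF i] in auto)
    also have "\<dots> \<le> (\<integral>\<^sup>+x\<in>ball (c i) (r i). ennreal \<bar>g k x\<bar> \<partial>lborel) + ennreal (2 powr m i / 2 * b i)"
      using k' ennreal_leI[OF eb] by (intro add_left_mono) auto
    finally have "ennreal (2 powr m i / 2 * b i) \<le> (\<integral>\<^sup>+x\<in>ball (c i) (r i). ennreal \<bar>g k x\<bar> \<partial>lborel)"
      by (rule ennreal_add_right_cancel_imp_le)
    then show "ennreal (2 powr m i / 2) * emeasure lborel (ball (c i) (r i)) \<le> (\<integral>\<^sup>+x\<in>ball (c i) (r i). ennreal \<bar>g k x\<bar> \<partial>lborel)"
      using b[OF i] by (simp add: ennreal_mult[symmetric])
  next
    fix i assume i: "i \<in> I"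
    define q where "q = ennreal (2 powr m i / (32 * 2 ^ DIM('a)))"
    have "(\<integral>\<^sup>+x\<in>ball (c i) (K * r i). ennreal \<bar>g k x\<bar> \<partial>lborel) \<le> (\<integral>\<^sup>+x\<in>ball (c i) (K * r i). ennreal \<bar>f x\<bar> \<partial>lborel) + (\<integral>\<^sup>+x\<in>ball 0 R. ennreal \<bar>g k x - f x\<bar> \<partial>lborel)"
      by (rule nn_integral_abs_le_diff) (use R[OF i] in auto)
    also have "\<dots> \<le> q * emeasure lborel (ball (c i) (K * r i)) + q * emeasure lborel (ball (c i) (r i))"
    proof (rule add_mono)
      show "(\<integral>\<^sup>+x\<in>ball (c i) (K * r i). ennreal \<bar>f x\<bar> \<partial>lborel) \<le> q * emeasure lborel (ball (c i) (K * r i))"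
        using hK[OF i] by (simp add: q_def)
      have "(\<integral>\<^sup>+x\<in>ball 0 R. ennreal \<bar>g k x - f x\<bar> \<partial>lborel) \<le> ennreal e" using k by simp
      also have "\<dots> \<le> ennreal (2 powr m i / (32 * 2 ^ DIM('a)) * b i)" by (rule ennreal_leI[OF e[OF i]])
      also have "\<dots> = q * emeasure lborel (ball (c i) (r i))" using b[OF i] by (simp add: q_def ennreal_mult[symmetric])
      finally show "(\<integral>\<^sup>+x\<in>ball 0 R. ennreal \<bar>g k x - f x\<bar> \<partial>lborel) \<le> q * emeasure lborel (ball (c i) (r i))" .
    qed
    also have "\<dots> \<le> q * emeasure lborel (ball (c i) (K * r i)) + q * emeasure lborel (ball (c i) (K * r i))"
      by (intro add_left_mono mult_left_mono emeasure_mono sub i) auto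
    also have "\<dots> = (q + q) * emeasure lborel (ball (c i) (K * r i))" by (simp add: distrib_right)
    also have "q + q = ennreal (2 powr m i / (16 * 2 ^ DIM('a)))"
      unfolding q_def by (subst ennreal_plus[symmetric]) auto
    finally show "(\<integral>\<^sup>+x\<in>ball (c i) (K * r i). ennreal \<bar>g k x\<bar> \<partial>lborel) \<le>
       ennreal (2 powr m i / (16 * 2 ^ DIM('a))) * emeasure lborel (ball (c i) (K * r i))" .
  qed
  also have "\<dots> \<le> ennreal (ball_const (real DIM('a)) p K * (real N * level_sum (real DIM('a)))) * ennreal W"
    by (intro mult_left_mono W) auto
  finally show ?thesis .
qed

section \<open>Good balls\<close>

text \<open>Real-valued for the sake of arithmetic; \<open>ennreal_mass\<close> shows that no
  infinite value is lost under an L^p bound.\<close>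

definition mass :: "('a::euclidean_space \<Rightarrow> real) \<Rightarrow> 'a \<Rightarrow> real \<Rightarrow> real" where
  "mass f c r = enn2real (\<integral>\<^sup>+x\<in>ball c r. ennreal \<bar>f x\<bar> \<partial>lborel)"

definition ball_mean :: "('a::euclidean_space \<Rightarrow> real) \<Rightarrow> 'a \<Rightarrow> real \<Rightarrow> real" where
  "ball_mean f c r = mass f c r / (unit_ball_vol (real DIM('a)) * r ^ DIM('a))"

text \<open>This is r powr \<alpha> times the mean, up to the volume of the unit ball; that factor
  is restored in \<open>frac_max_eq\<close>.\<close>

definition frac_val :: "real \<Rightarrow> ('a::euclidean_space \<Rightarrow> real) \<Rightarrow> 'a \<Rightarrow> real \<Rightarrow> real" where
  "frac_val \<alpha> f c r = r powr (\<alpha> - real DIM('a)) * mass f c r"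

lemma mass_nonneg: "0 \<le> mass f c r"
  by (simp add: mass_def)

lemma frac_val_nonneg: "0 \<le> frac_val \<alpha> f c r"
  by (simp add: frac_val_def mass_nonneg)

text \<open>The role of \<open>F\<close> is qualitative: it makes masses finite and bounds radii,
  while the final estimates are in terms of the gradient energy.\<close>

definition Lp_bounded :: "real \<Rightarrow> real \<Rightarrow> ('a::euclidean_space \<Rightarrow> real) \<Rightarrow> bool" where
  "Lp_bounded p F f \<longleftrightarrow> f \<in> borel_measurable borel \<and> 0 \<le> F \<and>
     (\<integral>\<^sup>+x. ennreal (\<bar>f x\<bar> powr p) \<partial>lborel) \<le> ennreal F"

lemma nn_integral_ball_le_Lp:
  fixes f :: "'a::euclidean_space \<Rightarrow> real"
  assumes f: "Lp_bounded p F f" and p: "1 \<le> p" and t: "0 < t" and r: "0 \<le> r"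
  shows "(\<integral>\<^sup>+x\<in>ball c r. ennreal \<bar>f x\<bar> \<partial>lborel) \<le>
     ennreal (t * (unit_ball_vol (real DIM('a)) * r ^ DIM('a)) + t powr (1 - p) * F)"
proof -
  have [measurable]: "f \<in> borel_measurable borel" and F: "0 \<le> F"
    and le: "(\<integral>\<^sup>+x. ennreal (\<bar>f x\<bar> powr p) \<partial>lborel) \<le> ennreal F"
    using f by (auto simp: Lp_bounded_def)
  have "(\<integral>\<^sup>+x\<in>ball c r. ennreal \<bar>f x\<bar> \<partial>lborel) \<le>
    (\<integral>\<^sup>+x. ennreal t * indicator (ball c r) x + ennreal (t powr (1 - p)) * ennreal (\<bar>f x\<bar> powr p) \<partial>lborel)"
  proof (intro nn_integral_mono)
    fix x
    have "ennreal \<bar>f x\<bar> \<le> ennreal (t + t powr (1 - p) * \<bar>f x\<bar> powr p)"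
      by (intro ennreal_leI le_young t p) auto
    also have "\<dots> = ennreal t + ennreal (t powr (1 - p)) * ennreal (\<bar>f x\<bar> powr p)"
      using t by (simp add: ennreal_mult)
    finally show "ennreal \<bar>f x\<bar> * indicator (ball c r) x \<le>
       ennreal t * indicator (ball c r) x + ennreal (t powr (1 - p)) * ennreal (\<bar>f x\<bar> powr p)"
      by (simp split: split_indicator)
  qed
  also have "\<dots> = ennreal t * emeasure lborel (ball c r) + ennreal (t powr (1 - p)) * (\<integral>\<^sup>+x. ennreal (\<bar>f x\<bar> powr p) \<partial>lborel)"
    by (subst nn_integral_add) (auto simp: nn_integral_cmult nn_integral_cmult_indicator)
  also have "\<dots> \<le> ennreal t * emeasure lborel (ball c r) + ennreal (t powr (1 - p)) * ennreal F"
    by (intro add_left_mono mult_left_mono le) auto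
  also have "\<dots> = ennreal (t * (unit_ball_vol (real DIM('a)) * r ^ DIM('a)) + t powr (1 - p) * F)"
    using t r F by (simp add: emeasure_ball ennreal_mult[symmetric] ennreal_plus[symmetric] del: ennreal_plus)
  finally show ?thesis .
qed

lemma ennreal_mass:
  fixes f :: "'a::euclidean_space \<Rightarrow> real"
  assumes f: "Lp_bounded p F f" and p: "1 \<le> p"
  shows "ennreal (mass f c r) = (\<integral>\<^sup>+x\<in>ball c r. ennreal \<bar>f x\<bar> \<partial>lborel)"
proof -
  have "(\<integral>\<^sup>+x\<in>ball c r. ennreal \<bar>f x\<bar> \<partial>lborel) < top"
  proof (cases "0 \<le> r")
    case True
    then show ?thesis
      using nn_integral_ball_le_Lp[OF f p zero_less_one True, of c] by (meson ennreal_less_top le_less_trans)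
  next
    case False
    then have e: "ball c r = {}" by auto
    show ?thesis unfolding e by simp
  qed
  then show ?thesis by (simp add: mass_def)
qed

lemma mass_mono:
  fixes f :: "'a::euclidean_space \<Rightarrow> real"
  assumes f: "Lp_bounded p F f" and p: "1 \<le> p" and sub: "ball c r \<subseteq> ball c' r'"
  shows "mass f c r \<le> mass f c' r'"
proof -
  have "ennreal (mass f c r) \<le> ennreal (mass f c' r')"
    unfolding ennreal_mass[OF f p]
    by (intro nn_integral_mono mult_left_mono) (use sub in \<open>auto split: split_indicator\<close>)
  then show ?thesis by (simp add: mass_nonneg)
qed

lemma mass_le:
  fixes f :: "'a::euclidean_space \<Rightarrow> real"
  assumes f: "Lp_bounded p F f" and p: "1 \<le> p" and r: "0 < r"
  shows "mass f c r \<le> (unit_ball_vol (real DIM('a)) + F) * r powr (real DIM('a) - real DIM('a) / p)"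
proof -
  define d where "d = real DIM('a)"
  \<comment> \<open>Balances the two terms: both become multiples of r powr (d - d / p).\<close>
  define t where "t = r powr (- d / p)"
  have t: "t > 0" using r by (simp add: t_def)
  have F: "0 \<le> F" using f by (simp add: Lp_bounded_def)
  have "ennreal (mass f c r) \<le> ennreal (t * (unit_ball_vol d * r ^ DIM('a)) + t powr (1 - p) * F)"
    unfolding ennreal_mass[OF f p] d_def using r by (intro nn_integral_ball_le_Lp[OF f p t]) auto
  then have "mass f c r \<le> t * (unit_ball_vol d * r ^ DIM('a)) + t powr (1 - p) * F"
    using t F r by (subst (asm) ennreal_le_iff) (auto simp: d_def)
  also have "t * (unit_ball_vol d * r ^ DIM('a)) = unit_ball_vol d * r powr (d - d / p)"
    using r by (simp add: t_def d_def powr_diff powr_minus powr_realpow field_simps)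
  also have "t powr (1 - p) = r powr (d - d / p)"
  proof -
    have "- d / p * (1 - p) = d - d / p" using p by (simp add: field_simps)
    then show ?thesis by (simp only: t_def powr_powr)
  qed
  finally show ?thesis by (simp add: d_def algebra_simps)
qed

lemma frac_val_le:
  fixes f :: "'a::euclidean_space \<Rightarrow> real"
  assumes f: "Lp_bounded p F f" and p: "1 \<le> p" and r: "0 < r"
  shows "frac_val \<alpha> f c r \<le> (unit_ball_vol (real DIM('a)) + F) * r powr (\<alpha> - real DIM('a) / p)"
proof -
  have "frac_val \<alpha> f c r \<le> r powr (\<alpha> - real DIM('a)) * ((unit_ball_vol (real DIM('a)) + F) * r powr (real DIM('a) - real DIM('a) / p))"
    unfolding frac_val_def by (intro mult_left_mono mass_le[OF f p r]) auto
  also have "\<dots> = (unit_ball_vol (real DIM('a)) + F) * r powr (\<alpha> - real DIM('a) / p)"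
    using r by (simp add: powr_add[symmetric])
  finally show ?thesis .
qed

text \<open>Inclusion of l^1 in l^e: every term is at most T, so s^e \<le> s T^(e - 1). It is
  applied with e = q / p.\<close>

lemma suminf_powr_le:
  fixes s :: "nat \<Rightarrow> real"
  assumes s: "\<And>n. 0 \<le> s n" and T: "\<And>n. (\<Sum>k<n. s k) \<le> T" and e: "1 \<le> e"
  shows "(\<Sum>n. ennreal (s n powr e)) \<le> ennreal (T powr e)"
proof (rule suminf_le_const)
  show "summable (\<lambda>n. ennreal (s n powr e))" by (rule summableI)
  fix n
  have sT: "s k \<le> T" for k
    using T[of "Suc k"] sum_nonneg[of "{..<k}" s] s by simp
  have T0: "0 \<le> T" using T[of 0] by simp
  have "(\<Sum>k<n. ennreal (s k powr e)) = ennreal (\<Sum>k<n. s k powr e)"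
    by (rule sum_ennreal) auto
  also have "(\<Sum>k<n. s k powr e) \<le> (\<Sum>k<n. s k * T powr (e - 1))"
  proof (rule sum_mono)
    fix k
    show "s k powr e \<le> s k * T powr (e - 1)"
    proof (cases "s k = 0")
      case False
      then have "s k > 0" using s[of k] by simp
      then have "s k powr e = s k * s k powr (e - 1)" by (simp add: powr_diff)
      also have "\<dots> \<le> s k * T powr (e - 1)"
        using s sT e by (intro mult_left_mono powr_mono2) auto
      finally show ?thesis .
    qed (use e in auto)
  qed
  also have "\<dots> = (\<Sum>k<n. s k) * T powr (e - 1)" by (simp add: sum_distrib_right)
  also have "\<dots> \<le> T * T powr (e - 1)" by (intro mult_right_mono T) auto
  also have "\<dots> = T powr e" using T0 e by (cases "T = 0") (auto simp: powr_diff)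
  finally show "(\<Sum>k<n. ennreal (s k powr e)) \<le> ennreal (T powr e)" by (simp add: ennreal_leI)
qed

text \<open>The centered operator has \<open>A x c r\<close> for \<open>c = x\<close>, the uncentered one for \<open>x \<in> ball c r\<close>.\<close>

locale admissible_balls =
  fixes A :: "'a::euclidean_space \<Rightarrow> 'a \<Rightarrow> real \<Rightarrow> bool"
  assumes A_mem: "A x c r \<Longrightarrow> 0 < r \<and> dist x c < r"
    and A_mono: "A x c r \<Longrightarrow> r \<le> R \<Longrightarrow> A x c R"
    and A_translate: "A x c r \<Longrightarrow> A (x + h) (c + h) r"
    and A_center: "0 < r \<Longrightarrow> A x x r"
begin

text \<open>The factor 2 is slack, as the supremum over admissible balls need not be attained.
  Positive mass makes the logarithm in \<open>level\<close> meaningful.\<close>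

definition good :: "real \<Rightarrow> ('a \<Rightarrow> real) \<Rightarrow> 'a \<Rightarrow> 'a \<Rightarrow> real \<Rightarrow> bool" where
  "good \<alpha> f x c r \<longleftrightarrow> A x c r \<and> 0 < mass f c r \<and>
     (\<forall>c' r'. A x c' r' \<and> r \<le> r' \<longrightarrow> frac_val \<alpha> f c' r' \<le> 2 * frac_val \<alpha> f c r)"

definition level :: "('a \<Rightarrow> real) \<Rightarrow> 'a \<Rightarrow> real \<Rightarrow> int" where
  "level f c r = \<lfloor>log 2 (ball_mean f c r)\<rfloor>"

lemma good_pos: "good \<alpha> f x c r \<Longrightarrow> 0 < r"
  using A_mem by (auto simp: good_def)

lemma good_ball_mean_pos: "good \<alpha> f x c r \<Longrightarrow> 0 < ball_mean f c r"
  using good_pos[of \<alpha> f x c r] by (simp add: ball_mean_def good_def)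

lemma good_mass: "good \<alpha> f x c r \<Longrightarrow> mass f c r = ball_mean f c r * (unit_ball_vol (real DIM('a)) * r ^ DIM('a))"
  using good_pos[of \<alpha> f x c r] unit_ball_vol_pos[of "real DIM('a)", THEN less_imp_neq] by (simp add: ball_mean_def)

lemma good_level:
  assumes "good \<alpha> f x c r"
  shows "2 powr level f c r \<le> ball_mean f c r" "ball_mean f c r < 2 * 2 powr level f c r"
proof -
  have b: "0 < ball_mean f c r" by (rule good_ball_mean_pos[OF assms])
  have "real_of_int (level f c r) \<le> log 2 (ball_mean f c r)" by (simp add: level_def)
  then show "2 powr level f c r \<le> ball_mean f c r" using b by (subst (asm) le_log_iff) auto
  have "log 2 (ball_mean f c r) < level f c r + 1" by (simp add: level_def)
  then have "ball_mean f c r < 2 powr (level f c r + 1)" using b by (subst (asm) log_less_iff) auto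
  then show "ball_mean f c r < 2 * 2 powr level f c r" by (simp add: powr_add)
qed

text \<open>The concentric ball of radius K r is admissible for x by \<open>A_mono\<close>, and
  comparison with it gives the decay K powr (- \<alpha>). Of the 4, one 2 is the slack in
  \<open>good\<close>, the other the rounding of the mean to a dyadic level.\<close>

lemma good_enlarged:
  assumes g: "good \<alpha> f x c r" and K: "1 \<le> K"
  shows "mass f c (K * r) \<le> 4 * K powr (- \<alpha>) * 2 powr level f c r * (unit_ball_vol (real DIM('a)) * (K * r) ^ DIM('a))"
proof -
  define d where "d = real DIM('a)"
  define \<omega> where "\<omega> = unit_ball_vol d"
  have \<omega>: "\<omega> > 0" by (simp add: \<omega>_def d_def)
  have r: "r > 0" by (rule good_pos[OF g])
  have Kr: "r \<le> K * r" using K r by simp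
  then have "A x c (K * r)" using g A_mono by (auto simp: good_def)
  then have "frac_val \<alpha> f c (K * r) \<le> 2 * frac_val \<alpha> f c r" using g Kr by (auto simp: good_def)
  then have "(K * r) powr (\<alpha> - d) * mass f c (K * r) \<le> 2 * (r powr (\<alpha> - d) * mass f c r)"
    by (simp add: frac_val_def d_def)
  then have "(K * r) powr (d - \<alpha>) * ((K * r) powr (\<alpha> - d) * mass f c (K * r)) \<le> (K * r) powr (d - \<alpha>) * (2 * (r powr (\<alpha> - d) * mass f c r))"
    by (intro mult_left_mono) auto
  also have "(K * r) powr (d - \<alpha>) * ((K * r) powr (\<alpha> - d) * mass f c (K * r)) = mass f c (K * r)"
    using K r by (simp add: mult.assoc[symmetric] powr_add[symmetric])
  also have "(K * r) powr (d - \<alpha>) * (2 * (r powr (\<alpha> - d) * mass f c r)) = 2 * K powr (d - \<alpha>) * mass f c r"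
  proof -
    have "r powr (d - \<alpha>) * r powr (\<alpha> - d) = 1" using r by (simp add: powr_add[symmetric])
    then have "K powr (d - \<alpha>) * 2 * mass f c r * (r powr (d - \<alpha>) * r powr (\<alpha> - d)) = 2 * K powr (d - \<alpha>) * mass f c r"
      by simp
    then show ?thesis using K r by (simp add: powr_mult ac_simps)
  qed
  also have "\<dots> \<le> 2 * K powr (d - \<alpha>) * (2 * 2 powr level f c r * (\<omega> * r ^ DIM('a)))"
    unfolding good_mass[OF g] \<omega>_def d_def
    by (intro mult_left_mono mult_right_mono less_imp_le[OF good_level(2)[OF g]]) (use r in auto)
  also have "K powr (d - \<alpha>) = K powr (- \<alpha>) * K ^ DIM('a)"
    using K by (simp add: d_def powr_diff powr_minus powr_realpow field_simps)
  finally show ?thesis by (simp add: \<omega>_def d_def power_mult_distrib ac_simps)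
qed

text \<open>Solves r' powr \<alpha> \<le> 4 (2 K + 1) powr (d - \<alpha>) * r powr \<alpha> for the
  ratio r' / r.\<close>

definition comparison_const :: "real \<Rightarrow> real \<Rightarrow> real" where
  "comparison_const \<alpha> K = (4 * (2 * K + 1) powr (real DIM('a) - \<alpha>)) powr (1 / \<alpha>)"

text \<open>Because \<open>\<alpha> > 0\<close>, a much smaller good ball near a good ball has a much larger mean, so good balls
  of the same level that come close to each other have comparable radii.\<close>

lemma good_comparable:
  assumes f: "Lp_bounded p F f" and p: "1 \<le> p" and \<alpha>: "0 < \<alpha>" "\<alpha> \<le> real DIM('a)" and K: "1 \<le> K"
    and g: "good \<alpha> f x c r" and g': "good \<alpha> f x' c' r'" and lev: "level f c r = level f c' r'"
    and meet: "ball c (K * r) \<inter> ball c' (K * r') \<noteq> {}"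
  shows "r' \<le> comparison_const \<alpha> K * r"
proof -
  define d where "d = real DIM('a)"
  define \<omega> where "\<omega> = unit_ball_vol d"
  have \<omega>: "\<omega> > 0" by (simp add: \<omega>_def d_def)
  have r: "r > 0" "r' > 0" using good_pos g g' by auto
  define M where "M = 4 * (2 * K + 1) powr (d - \<alpha>)"
  have "(2 * K + 1) powr 0 \<le> (2 * K + 1) powr (d - \<alpha>)" using K \<alpha> by (intro powr_mono) (auto simp: d_def)
  then have M1: "M \<ge> 1" using K by (simp add: M_def)
  have C1: "1 \<le> M powr (1 / \<alpha>)" using M1 \<alpha> by (intro ge_one_powr_ge_zero) auto
  show ?thesis
  proof (cases "r \<le> r'")
    case False
    have "1 * r \<le> M powr (1 / \<alpha>) * r" using C1 r by (intro mult_right_mono) auto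
    then show ?thesis using False by (simp add: comparison_const_def M_def d_def)
  next
    case True
    \<comment> \<open>The competitor is centered at c rather than c', so that it is admissible for
      x; its radius is large enough to contain the other ball and still at most (2 K + 1)
      r'.\<close>
    define R where "R = r' + dist c c'"
    obtain z where "dist c z < K * r" "dist c' z < K * r'" using meet by auto
    then have "dist c c' \<le> K * r + K * r'" by (smt (verit) dist_commute dist_triangle)
    also have "\<dots> \<le> K * r' + K * r'" using True K by auto
    finally have R: "R \<le> (2 * K + 1) * r'" by (simp add: R_def algebra_simps)
    have Rr: "r' \<le> R" by (simp add: R_def)
    have "A x c R" using A_mono[of x c r R] g True Rr by (auto simp: good_def)
    then have "frac_val \<alpha> f c R \<le> 2 * frac_val \<alpha> f c r" using g True Rr by (auto simp: good_def)
    then have 1: "R powr (\<alpha> - d) * mass f c R \<le> 2 * (r powr (\<alpha> - d) * mass f c r)"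
      by (simp add: frac_val_def d_def)
    have "ball c' r' \<subseteq> ball c R"
      by (rule ball_subset_ball_iff[THEN iffD2]) (simp add: R_def dist_commute)
    then have 2: "mass f c' r' \<le> mass f c R" by (rule mass_mono[OF f p])
    define a where "a = 2 powr level f c r"
    have a: "a > 0" by (simp add: a_def)
    have 3: "a * (\<omega> * r' ^ DIM('a)) \<le> mass f c' r'"
      unfolding good_mass[OF g'] a_def \<omega>_def d_def lev by (intro mult_right_mono good_level(1)[OF g']) (use r in auto)
    have 4: "mass f c r \<le> 2 * a * (\<omega> * r ^ DIM('a))"
      unfolding good_mass[OF g] a_def \<omega>_def d_def by (intro mult_right_mono less_imp_le[OF good_level(2)[OF g]]) (use r in auto)
    have "((2 * K + 1) * r') powr (\<alpha> - d) * (a * (\<omega> * r' ^ DIM('a))) \<le> R powr (\<alpha> - d) * mass f c R"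
    proof (intro mult_mono)
      show "((2 * K + 1) * r') powr (\<alpha> - d) \<le> R powr (\<alpha> - d)"
        using \<alpha> r Rr R by (intro powr_mono2') (auto simp: d_def)
    qed (use 2 3 a \<omega> r in \<open>auto simp: mass_nonneg\<close>)
    also note 1
    also have "2 * (r powr (\<alpha> - d) * mass f c r) \<le> 2 * (r powr (\<alpha> - d) * (2 * a * (\<omega> * r ^ DIM('a))))"
      by (intro mult_left_mono 4) auto
    finally have "(2 * K + 1) powr (\<alpha> - d) * (r' powr (\<alpha> - d) * r' ^ DIM('a)) * (a * \<omega>) \<le> 4 * (r powr (\<alpha> - d) * r ^ DIM('a)) * (a * \<omega>)"
      using K r by (simp add: powr_mult ac_simps)
    then have "(2 * K + 1) powr (\<alpha> - d) * (r' powr (\<alpha> - d) * r' ^ DIM('a)) \<le> 4 * (r powr (\<alpha> - d) * r ^ DIM('a))"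
      by (rule mult_right_le_imp_le) (use a \<omega> in auto)
    moreover have "r powr (\<alpha> - d) * r ^ DIM('a) = r powr \<alpha>" "r' powr (\<alpha> - d) * r' ^ DIM('a) = r' powr \<alpha>"
      using r by (auto simp: d_def powr_diff powr_realpow)
    ultimately have "(2 * K + 1) powr (\<alpha> - d) * r' powr \<alpha> \<le> 4 * r powr \<alpha>" by simp
    then have "(2 * K + 1) powr (d - \<alpha>) * ((2 * K + 1) powr (\<alpha> - d) * r' powr \<alpha>) \<le> (2 * K + 1) powr (d - \<alpha>) * (4 * r powr \<alpha>)"
      by (intro mult_left_mono) auto
    moreover have "(2 * K + 1) powr (d - \<alpha>) * (2 * K + 1) powr (\<alpha> - d) = 1"
      using K by (simp flip: powr_add)
    then have "(2 * K + 1) powr (d - \<alpha>) * ((2 * K + 1) powr (\<alpha> - d) * r' powr \<alpha>) = r' powr \<alpha>"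
      by (metis mult.assoc mult_1)
    ultimately have "r' powr \<alpha> \<le> M * r powr \<alpha>"
      unfolding M_def by linarith
    then have "(r' powr \<alpha>) powr (1 / \<alpha>) \<le> (M * r powr \<alpha>) powr (1 / \<alpha>)"
      using \<alpha> by (intro powr_mono2) auto
    then have "r' \<le> M powr (1 / \<alpha>) * r" using M1 r \<alpha> by (simp add: powr_mult powr_powr)
    then show ?thesis by (simp add: comparison_const_def M_def d_def)
  qed
qed

lemma comparison_const_ge_1:
  assumes \<alpha>: "0 < \<alpha>" "\<alpha> \<le> real DIM('a)" and K: "1 \<le> K"
  shows "1 \<le> comparison_const \<alpha> K"
proof -
  have "(2 * K + 1) powr 0 \<le> (2 * K + 1) powr (real DIM('a) - \<alpha>)" using K \<alpha> by (intro powr_mono) auto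
  then show ?thesis unfolding comparison_const_def using K \<alpha> by (intro ge_one_powr_ge_zero) auto
qed

text \<open>Volume packing: all radii lie within a factor \<Lambda> of one reference radius \<rho>,
  so these disjoint balls have at least the volume of a ball of radius \<rho> / \<Lambda> and lie
  within distance (K + 1) \<Lambda> \<rho> of y.\<close>

lemma good_overlap:
  fixes I :: "('a \<times> 'a \<times> real) set"
  assumes f: "Lp_bounded p F f" and p: "1 \<le> p" and \<alpha>: "0 < \<alpha>" "\<alpha> \<le> real DIM('a)" and K: "1 \<le> K"
    and fin: "finite I"
    and g: "\<And>x c r. (x, c, r) \<in> I \<Longrightarrow> good \<alpha> f x c r \<and> level f c r = k \<and> y \<in> ball c (K * r)"
    and disj: "pairwise (\<lambda>i j. disjnt (ball (fst (snd i)) (snd (snd i))) (ball (fst (snd j)) (snd (snd j)))) I"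
  shows "real (card I) \<le> ((K + 1) * (comparison_const \<alpha> K)\<^sup>2) ^ DIM('a)"
proof (cases "I = {}")
  case True
  then show ?thesis using K by simp
next
  case False
  define \<Lambda> where "\<Lambda> = comparison_const \<alpha> K"
  have \<Lambda>: "\<Lambda> \<ge> 1" unfolding \<Lambda>_def by (rule comparison_const_ge_1[OF \<alpha> K])
  define \<omega> where "\<omega> = unit_ball_vol (real DIM('a))"
  have \<omega>: "\<omega> > 0" by (simp add: \<omega>_def)
  obtain x0 c0 \<rho> where 0: "(x0, c0, \<rho>) \<in> I" using False by auto
  have \<rho>: "\<rho> > 0" using g[OF 0] good_pos by blast
  have cmp: "r \<le> \<Lambda> * \<rho>" "\<rho> \<le> \<Lambda> * r" if "(x, c, r) \<in> I" for x c r
  proof -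
    have gs: "good \<alpha> f x c r" "good \<alpha> f x0 c0 \<rho>" "level f c r = level f c0 \<rho>" "level f c0 \<rho> = level f c r"
      "ball c (K * r) \<inter> ball c0 (K * \<rho>) \<noteq> {}" "ball c0 (K * \<rho>) \<inter> ball c (K * r) \<noteq> {}"
      using g[OF that] g[OF 0] by auto
    show "r \<le> \<Lambda> * \<rho>" unfolding \<Lambda>_def by (rule good_comparable[OF f p \<alpha> K gs(2,1,4,6)])
    show "\<rho> \<le> \<Lambda> * r" unfolding \<Lambda>_def by (rule good_comparable[OF f p \<alpha> K gs(1,2,3,5)])
  qed
  define B where "B i = ball (fst (snd i)) (snd (snd i))" for i :: "'a \<times> 'a \<times> real"
  have "(\<Sum>i\<in>I. ennreal (\<omega> * (\<rho> / \<Lambda>) ^ DIM('a))) \<le> (\<Sum>i\<in>I. emeasure lborel (B i))"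
  proof (rule sum_mono)
    fix i assume "i \<in> I"
    then obtain x c r where i: "i = (x, c, r)" "(x, c, r) \<in> I" by (metis prod_cases3)
    have r: "r > 0" using g[OF i(2)] good_pos by blast
    have "(\<rho> / \<Lambda>) ^ DIM('a) \<le> r ^ DIM('a)"
      using cmp(2)[OF i(2)] \<Lambda> \<rho> by (intro power_mono) (auto simp: field_simps)
    then show "ennreal (\<omega> * (\<rho> / \<Lambda>) ^ DIM('a)) \<le> emeasure lborel (B i)"
      using r \<omega> by (auto simp: B_def i emeasure_ball \<omega>_def intro!: ennreal_leI)
  qed
  also have "\<dots> = emeasure lborel (\<Union>i\<in>I. B i)"
  proof (rule sum_emeasure)
    show "disjoint_family_on B I"
      using disj by (auto simp: disjoint_family_on_def pairwise_def disjnt_def B_def)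
  qed (use fin in \<open>auto simp: B_def\<close>)
  also have "\<dots> \<le> emeasure lborel (ball y ((K + 1) * (\<Lambda> * \<rho>)))"
  proof (rule emeasure_mono)
    show "(\<Union>i\<in>I. B i) \<subseteq> ball y ((K + 1) * (\<Lambda> * \<rho>))"
    proof
      fix z assume "z \<in> (\<Union>i\<in>I. B i)"
      then obtain x c r where i: "(x, c, r) \<in> I" "dist c z < r" by (auto simp: B_def)
      have "dist y z \<le> dist c y + dist c z" by (metis dist_commute dist_triangle)
      also have "\<dots> < K * r + r" using g[OF i(1)] i(2) by auto
      also have "\<dots> = (K + 1) * r" by (simp add: algebra_simps)
      also have "\<dots> \<le> (K + 1) * (\<Lambda> * \<rho>)" using cmp(1)[OF i(1)] K by (intro mult_left_mono) auto
      finally show "z \<in> ball y ((K + 1) * (\<Lambda> * \<rho>))" by simp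
    qed
  qed auto
  also have "\<dots> = ennreal (\<omega> * ((K + 1) * (\<Lambda> * \<rho>)) ^ DIM('a))"
    using K \<Lambda> \<rho> by (simp add: emeasure_ball \<omega>_def)
  finally have "ennreal (real (card I) * (\<omega> * (\<rho> / \<Lambda>) ^ DIM('a))) \<le> ennreal (\<omega> * ((K + 1) * (\<Lambda> * \<rho>)) ^ DIM('a))"
    using \<omega> \<rho> \<Lambda> by (simp add: ennreal_mult ennreal_of_nat_eq_real_of_nat)
  then have "real (card I) * (\<omega> * (\<rho> / \<Lambda>) ^ DIM('a)) \<le> \<omega> * ((K + 1) * (\<Lambda> * \<rho>)) ^ DIM('a)"
    using K \<Lambda> \<rho> \<omega> by (subst (asm) ennreal_le_iff) auto
  also have "\<dots> = ((K + 1) * \<Lambda>\<^sup>2) ^ DIM('a) * (\<omega> * (\<rho> / \<Lambda>) ^ DIM('a))"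
  proof -
    have e: "(K + 1) * (\<Lambda> * \<rho>) = ((K + 1) * \<Lambda>\<^sup>2) * (\<rho> / \<Lambda>)" using \<Lambda> by (simp add: power2_eq_square)
    show ?thesis unfolding e power_mult_distrib[of "(K + 1) * \<Lambda>\<^sup>2" "\<rho> / \<Lambda>"] by simp
  qed
  finally show ?thesis
    unfolding \<Lambda>_def[symmetric] by (rule mult_right_le_imp_le) (use \<omega> \<rho> \<Lambda> in auto)
qed

end

section \<open>Covering by good balls and a dominating function for their rates\<close>

context admissible_balls
begin

text \<open>A mean of given level forces a mass of order r^d, while the L^p bound allows only r powr
  (d - d / p). The resulting bound on the radii is the hypothesis of the Vitali covering
  lemma.\<close>

lemma good_radius_le:
  assumes f: "Lp_bounded p F f" and p: "1 \<le> p" and g: "good \<alpha> f x c r"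
  shows "r \<le> ((unit_ball_vol (real DIM('a)) + F) / (2 powr level f c r * unit_ball_vol (real DIM('a)))) powr (p / real DIM('a))"
proof -
  define d where "d = real DIM('a)"
  have d: "d > 0" by (simp add: d_def)
  define \<omega> where "\<omega> = unit_ball_vol d"
  have \<omega>: "\<omega> > 0" by (simp add: \<omega>_def d_def)
  have r: "r > 0" by (rule good_pos[OF g])
  define a where "a = 2 powr level f c r"
  have a: "a > 0" by (simp add: a_def)
  have "a * (\<omega> * r ^ DIM('a)) \<le> mass f c r"
    unfolding good_mass[OF g] a_def \<omega>_def d_def by (intro mult_right_mono good_level(1)[OF g]) (use r in auto)
  also have "\<dots> \<le> (\<omega> + F) * r powr (d - d / p)"
    unfolding \<omega>_def d_def by (rule mass_le[OF f p r])
  finally have "a * (\<omega> * r powr d) \<le> (\<omega> + F) * (r powr d / r powr (d / p))"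
    using r by (simp add: d_def powr_realpow powr_diff)
  then have "r powr (d / p) * (a * \<omega>) * r powr d \<le> (\<omega> + F) * r powr d"
    using r by (simp add: field_simps)
  then have "r powr (d / p) * (a * \<omega>) \<le> \<omega> + F"
    by (rule mult_right_le_imp_le) (use r in auto)
  then have "r powr (d / p) \<le> (\<omega> + F) / (a * \<omega>)"
    using a \<omega> by (simp add: pos_le_divide_eq)
  then have "(r powr (d / p)) powr (p / d) \<le> ((\<omega> + F) / (a * \<omega>)) powr (p / d)"
    using p d by (intro powr_mono2) auto
  then show ?thesis using r p d by (simp add: powr_powr a_def \<omega>_def d_def)
qed

text \<open>The covering is made separately at each level, because radii are comparable only within
  a level. The triples keep the point x since goodness refers to it, and the last clause supplies
  the meeting hypothesis of \<open>good_comparable\<close>.\<close>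

lemma good_vitali:
  assumes f: "Lp_bounded p F f" and p: "1 \<le> p"
  shows "\<exists>C. \<forall>m. countable (C m) \<and> (\<forall>x c r. (x, c, r) \<in> C m \<longrightarrow> good \<alpha> f x c r \<and> level f c r = m) \<and>
     pairwise (\<lambda>i j. disjnt (ball (fst (snd i)) (snd (snd i))) (ball (fst (snd j)) (snd (snd j)))) (C m) \<and>
     (\<forall>x c r. good \<alpha> f x c r \<and> level f c r = m \<longrightarrow> (\<exists>x' c' r'. (x', c', r') \<in> C m \<and> x \<in> ball c' (5 * r')
        \<and> ball c r \<inter> ball c' (5 * r') \<noteq> {}))"
proof -
  have "\<exists>C. countable C \<and> (\<forall>x c r. (x, c, r) \<in> C \<longrightarrow> good \<alpha> f x c r \<and> level f c r = m) \<and>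
     pairwise (\<lambda>i j. disjnt (ball (fst (snd i)) (snd (snd i))) (ball (fst (snd j)) (snd (snd j)))) C \<and>
     (\<forall>x c r. good \<alpha> f x c r \<and> level f c r = m \<longrightarrow> (\<exists>x' c' r'. (x', c', r') \<in> C \<and> x \<in> ball c' (5 * r')
        \<and> ball c r \<inter> ball c' (5 * r') \<noteq> {}))" for m
  proof -
    define S where "S = {(x, c, r). good \<alpha> f x c r \<and> level f c r = m}"
    define B where "B = ((unit_ball_vol (real DIM('a)) + F) / (2 powr m * unit_ball_vol (real DIM('a)))) powr (p / real DIM('a))"
    have "0 < snd (snd i) \<and> snd (snd i) \<le> B" if "i \<in> S" for i
      using that good_radius_le[OF f p] good_pos by (fastforce simp: S_def B_def)
    \<comment> \<open>The covering lemma selects disjoint closed balls whose open fivefold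
      enlargements swallow the whole family; disjointness passes to the open balls.\<close>
    from Vitali_covering_lemma_cballs_balls[of S "\<lambda>i. snd (snd i)" B "\<lambda>i. fst (snd i)", OF this]
    obtain C where C: "countable C" "C \<subseteq> S"
      "pairwise (\<lambda>i j. disjnt (cball (fst (snd i)) (snd (snd i))) (cball (fst (snd j)) (snd (snd j)))) C"
      and cov: "\<And>i. i \<in> S \<Longrightarrow> \<exists>j. j \<in> C \<and> \<not> disjnt (cball (fst (snd i)) (snd (snd i))) (cball (fst (snd j)) (snd (snd j))) \<and>
                        cball (fst (snd i)) (snd (snd i)) \<subseteq> ball (fst (snd j)) (5 * snd (snd j))"
      by blast
    have cover: "\<exists>x' c' r'. (x', c', r') \<in> C \<and> x \<in> ball c' (5 * r') \<and> ball c r \<inter> ball c' (5 * r') \<noteq> {}"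
      if g: "good \<alpha> f x c r" "level f c r = m" for x c r
    proof -
      have "(x, c, r) \<in> S" using g by (simp add: S_def)
      from cov[OF this] obtain j where j: "j \<in> C" "cball c r \<subseteq> ball (fst (snd j)) (5 * snd (snd j))" by auto
      obtain x' c' r' where [simp]: "j = (x', c', r')" by (metis prod_cases3)
      have "dist x c < r" "0 < r" using g(1) A_mem by (auto simp: good_def)
      then have mem: "x \<in> cball c r" "c \<in> cball c r" "c \<in> ball c r" by (auto simp: dist_commute)
      have "(x', c', r') \<in> C \<and> x \<in> ball c' (5 * r') \<and> ball c r \<inter> ball c' (5 * r') \<noteq> {}"
        using j mem unfolding \<open>j = (x', c', r')\<close> fst_conv snd_conv by blast
      then show ?thesis by blast
    qed
    have pw: "pairwise (\<lambda>i j. disjnt (ball (fst (snd i)) (snd (snd i))) (ball (fst (snd j)) (snd (snd j)))) C"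
    proof (rule pairwiseI)
      fix i j assume "i \<in> C" "j \<in> C" "i \<noteq> j"
      from pairwiseD[OF C(3) this] show "disjnt (ball (fst (snd i)) (snd (snd i))) (ball (fst (snd j)) (snd (snd j)))"
        using ball_subset_cball[of "fst (snd i)" "snd (snd i)"] ball_subset_cball[of "fst (snd j)" "snd (snd j)"]
        unfolding disjnt_def by blast
    qed
    have "good \<alpha> f x c r \<and> level f c r = m" if "(x, c, r) \<in> C" for x c r
      using that C(2) by (auto simp: S_def)
    then show ?thesis
      by (intro exI[of _ C] conjI C(1) pw allI impI) (use cover in auto)
  qed
  then show ?thesis by (intro choice allI)
qed

text \<open>Within a level the means differ by a factor of at most 2 and the radii by at most
  \<open>comparison_const\<close>. The absolute value in the exponent covers \<alpha> on either side
  of 1, where r powr (\<alpha> - 1) changes its monotonicity.\<close>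

lemma rate_comparable:
  assumes f: "Lp_bounded p F f" and p: "1 \<le> p" and \<alpha>: "0 < \<alpha>" "\<alpha> \<le> real DIM('a)" and K: "1 \<le> K"
    and g: "good \<alpha> f x c r" and g': "good \<alpha> f x' c' r'" and lev: "level f c' r' = level f c r"
    and meet: "ball c (K * r) \<inter> ball c' (K * r') \<noteq> {}"
  shows "r powr (\<alpha> - 1) * ball_mean f c r \<le> 2 * comparison_const \<alpha> K powr \<bar>\<alpha> - 1\<bar> * (r' powr (\<alpha> - 1) * ball_mean f c' r')"
proof -
  define \<Lambda> where "\<Lambda> = comparison_const \<alpha> K"
  have \<Lambda>: "\<Lambda> \<ge> 1" unfolding \<Lambda>_def by (rule comparison_const_ge_1[OF \<alpha> K])
  have r: "r > 0" "r' > 0" using good_pos g g' by auto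
  have c1: "r' \<le> \<Lambda> * r" unfolding \<Lambda>_def by (rule good_comparable[OF f p \<alpha> K g g' lev[symmetric] meet])
  have c2: "r \<le> \<Lambda> * r'" unfolding \<Lambda>_def
    by (rule good_comparable[OF f p \<alpha> K g' g lev]) (use meet in auto)
  have "r powr (\<alpha> - 1) \<le> \<Lambda> powr \<bar>\<alpha> - 1\<bar> * r' powr (\<alpha> - 1)"
  proof (cases "\<alpha> \<ge> 1")
    case True
    have "r powr (\<alpha> - 1) \<le> (\<Lambda> * r') powr (\<alpha> - 1)" using c2 r True by (intro powr_mono2) auto
    then show ?thesis using True \<Lambda> r by (simp add: powr_mult)
  next
    case False
    have "r powr (\<alpha> - 1) \<le> (r' / \<Lambda>) powr (\<alpha> - 1)" using c1 r False \<Lambda> by (intro powr_mono2') (auto simp: field_simps)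
    also have "\<dots> = \<Lambda> powr (1 - \<alpha>) * r' powr (\<alpha> - 1)"
      using \<Lambda> r by (simp add: powr_divide powr_diff)
    finally show ?thesis using False by simp
  qed
  moreover have "ball_mean f c r \<le> 2 * ball_mean f c' r'"
    using good_level(2)[OF g] good_level(1)[OF g'] lev by simp
  ultimately have "r powr (\<alpha> - 1) * ball_mean f c r \<le> (\<Lambda> powr \<bar>\<alpha> - 1\<bar> * r' powr (\<alpha> - 1)) * (2 * ball_mean f c' r')"
    using good_ball_mean_pos[OF g] by (intro mult_mono) auto
  then show ?thesis by (simp add: \<Lambda>_def ac_simps)
qed

text \<open>A scaling identity: q (d / p - \<alpha>) = d, hence q (\<alpha> - 1) + d = (d - p) q /
  p. Up to the rounding of the mean, which costs 2 powr q, the left side is the power q / p of the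
  quantity summed in \<open>family_estimate\<close>.\<close>

lemma rate_powr_volume_le:
  assumes p: "1 \<le> p" and \<alpha>: "0 < \<alpha>" "\<alpha> < real DIM('a) / p"
    and q: "q = 1 / (1 / p - \<alpha> / real DIM('a))" and g: "good \<alpha> f x c r"
  shows "(r powr (\<alpha> - 1) * ball_mean f c r) powr q * r ^ DIM('a) \<le>
     2 powr q * ((2 powr level f c r) powr p * r powr (real DIM('a) - p)) powr (q / p)"
proof -
  define d where "d = real DIM('a)"
  have d: "d > 0" by (simp add: d_def)
  have pos: "1 / p - \<alpha> / d > 0" using \<alpha> p d by (simp add: d_def field_simps)
  then have q0: "q > 0" by (simp add: q d_def)
  have qd: "q * (d / p - \<alpha>) = d" using pos d p by (simp add: q d_def[symmetric] field_simps)
  have r: "r > 0" by (rule good_pos[OF g])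
  define a where "a = 2 powr level f c r"
  have a: "a > 0" by (simp add: a_def)
  have b: "0 < ball_mean f c r" "ball_mean f c r \<le> 2 * a"
    using good_ball_mean_pos[OF g] good_level(2)[OF g] by (auto simp: a_def)
  have "(r powr (\<alpha> - 1) * ball_mean f c r) powr q * r ^ DIM('a) \<le> (r powr (\<alpha> - 1) * (2 * a)) powr q * r ^ DIM('a)"
    using b r q0 by (intro mult_right_mono powr_mono2 mult_left_mono) auto
  also have "\<dots> = 2 powr q * (a powr q * (r powr (q * (\<alpha> - 1)) * r powr d))"
    using a r by (simp add: powr_mult powr_powr d_def powr_realpow ac_simps)
  also have "r powr (q * (\<alpha> - 1)) * r powr d = r powr (q * (\<alpha> - 1) + q * (d / p - \<alpha>))"
    using r by (simp add: powr_add qd)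
  also have "q * (\<alpha> - 1) + q * (d / p - \<alpha>) = (d - p) * (q / p)" using p by (simp add: field_simps)
  also have "a powr q * r powr ((d - p) * (q / p)) = (a powr p * r powr (d - p)) powr (q / p)"
    using a r p by (simp add: powr_mult powr_powr)
  finally show ?thesis by (simp add: a_def d_def)
qed

text \<open>One function majorises the rates of all good balls at once. It is built from the
  selected balls only, each spreading its rate over its fivefold enlargement; comparability
  transfers the bound to every other good ball of the same level. C is fixed before f.\<close>

lemma good_dominated:
  assumes p: "1 \<le> p" and \<alpha>: "0 < \<alpha>" "\<alpha> < real DIM('a) / p" and q: "q = 1 / (1 / p - \<alpha> / real DIM('a))"
  shows "\<exists>C\<ge>0. \<forall>f F W. Lp_bounded p F f \<and> 0 \<le> W \<and> gradient_approximable p W f \<longrightarrow>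
     (\<exists>G\<in>borel_measurable borel. (\<integral>\<^sup>+x. G x \<partial>lborel) \<le> ennreal (C * W powr (q / p)) \<and>
        (\<forall>x c r. good \<alpha> f x c r \<longrightarrow> ennreal ((r powr (\<alpha> - 1) * ball_mean f c r) powr q) \<le> G x))"
proof -
  define d where "d = real DIM('a)"
  have d: "d \<ge> 1" using DIM_positive[where 'a='a] by (simp add: d_def Suc_leI)
  have "d / p \<le> d" using p d by (simp add: divide_le_eq)
  then have \<alpha>d: "\<alpha> \<le> real DIM('a)" using \<alpha> by (simp add: d_def)
  have pos: "1 / p - \<alpha> / d > 0" using \<alpha> p d by (simp add: d_def field_simps)
  have qp: "q / p \<ge> 1" "q > 0"
  proof -
    have "1 / p - \<alpha> / d \<le> 1 / p" using \<alpha> d by simp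
    then have "1 / (1 / p) \<le> q" unfolding q d_def[symmetric] using pos p by (intro divide_left_mono) auto
    then show "q / p \<ge> 1" "q > 0" using p by auto
  qed
  define \<omega> where "\<omega> = unit_ball_vol d"
  have \<omega>: "\<omega> > 0" using d by (simp add: \<omega>_def)
  \<comment> \<open>The power makes 4 * K powr (- \<alpha>) \<le> 1 / (32 * 2^d), the smallness that
    \<open>family_estimate\<close> asks for; the 5 makes the enlarged balls contain the fivefold
    Vitali balls.\<close>
  define K where "K = 5 + (128 * 2 ^ DIM('a)) powr (1 / \<alpha>)"
  have K: "K \<ge> 5" by (simp add: K_def)
  have K4: "4 * K powr (- \<alpha>) \<le> 1 / (32 * 2 ^ DIM('a))"
  proof -
    have "((128 * 2 ^ DIM('a)) powr (1 / \<alpha>)) powr \<alpha> \<le> K powr \<alpha>"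
      using \<alpha> by (intro powr_mono2) (auto simp: K_def)
    then have "128 * 2 ^ DIM('a) \<le> K powr \<alpha>" using \<alpha> by (simp add: powr_powr)
    then show ?thesis using K by (simp add: powr_minus field_simps)
  qed
  define \<Lambda> where "\<Lambda> = comparison_const \<alpha> K"
  define N where "N = nat \<lceil>((K + 1) * \<Lambda>\<^sup>2) ^ DIM('a)\<rceil>"
  define B0 where "B0 = ball_const d p K * (real N * level_sum d)"
  have B0: "B0 \<ge> 0" using K d by (simp add: B0_def ball_const_def level_sum_nonneg)
  define C1 where "C1 = (2 * \<Lambda> powr \<bar>\<alpha> - 1\<bar>) powr q"
  define C2 where "C2 = C1 * (\<omega> * 5 ^ DIM('a)) * 2 powr q"
  have C12: "C1 \<ge> 0" "C2 \<ge> 0" using \<omega> by (auto simp: C1_def C2_def)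
  show ?thesis
  proof (intro exI[of _ "C2 * B0 powr (q / p)"] conjI allI impI)
    show "0 \<le> C2 * B0 powr (q / p)" using C12 by simp
  next
    fix f :: "'a \<Rightarrow> real" and F W :: real
    assume asm: "Lp_bounded p F f \<and> 0 \<le> W \<and> gradient_approximable p W f"
    then have f: "Lp_bounded p F f" and W: "0 \<le> W" and approx: "gradient_approximable p W f" by auto
    have fm: "f \<in> borel_measurable borel" using f by (simp add: Lp_bounded_def)
    obtain C where C: "\<forall>m. countable (C m) \<and> (\<forall>x c r. (x, c, r) \<in> C m \<longrightarrow> good \<alpha> f x c r \<and> level f c r = m) \<and>
     pairwise (\<lambda>i j. disjnt (ball (fst (snd i)) (snd (snd i))) (ball (fst (snd j)) (snd (snd j)))) (C m) \<and>
     (\<forall>x c r. good \<alpha> f x c r \<and> level f c r = m \<longrightarrow> (\<exists>x' c' r'. (x', c', r') \<in> C m \<and> x \<in> ball c' (5 * r')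
        \<and> ball c r \<inter> ball c' (5 * r') \<noteq> {}))"
      using good_vitali[OF f p, of \<alpha>] by (rule exE)
    have cnt: "countable (C m)" for m using C by blast
    have Cg: "good \<alpha> f x c r \<and> level f c r = m" if "(x, c, r) \<in> C m" for m x c r using C that by blast
    have disj: "pairwise (\<lambda>i j. disjnt (ball (fst (snd i)) (snd (snd i))) (ball (fst (snd j)) (snd (snd j)))) (C m)" for m
      using C by blast
    have cov: "\<exists>x' c' r'. (x', c', r') \<in> C (level f c r) \<and> x \<in> ball c' (5 * r') \<and> ball c r \<inter> ball c' (5 * r') \<noteq> {}"
      if "good \<alpha> f x c r" for x c r using C that by blast
    define U where "U = (\<Union>m. C m)"
    have U: "countable U" using cnt by (auto simp: U_def)
    define cc rr lev where "cc i = fst (snd i)" and "rr i = snd (snd i)" and "lev i = level f (cc i) (rr i)" for i :: "'a \<times> 'a \<times> real"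
    have Ug: "good \<alpha> f (fst i) (cc i) (rr i)" "i \<in> C (lev i)" if "i \<in> U" for i
      using that Cg by (cases i; force simp: U_def cc_def rr_def lev_def)+
    define s where "s i = (2 powr lev i) powr p * rr i powr (d - p)" for i
    define \<rho> where "\<rho> i = rr i powr (\<alpha> - 1) * ball_mean f (cc i) (rr i)" for i
    \<comment> \<open>A bound for finite subfamilies, with one constant for all of them, is enough:
      the terms are nonnegative and the partial sums of the enumeration below are of this
      kind.\<close>
    have fam: "(\<Sum>i\<in>I. s i) \<le> B0 * W" if I: "I \<subseteq> U" "finite I" for I
    proof -
      have "(\<Sum>i\<in>I. ennreal ((2 powr lev i) powr p * rr i powr (real DIM('a) - p))) \<le>
        ennreal (ball_const (real DIM('a)) p K * (real N * level_sum (real DIM('a)))) * ennreal W"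
      proof (rule family_estimate[OF fm approx _ p I(2), where c=cc])
        show "2 \<le> K" using K by simp
        fix i assume "i \<in> I"
        then have i: "i \<in> U" using I by auto
        note g = Ug(1)[OF i]
        show ri: "0 < rr i" by (rule good_pos[OF g])
        have "2 powr lev i * (\<omega> * rr i ^ DIM('a)) \<le> mass f (cc i) (rr i)"
          unfolding good_mass[OF g] lev_def \<omega>_def d_def by (intro mult_right_mono good_level(1)[OF g]) (use ri in auto)
        then have "ennreal (2 powr lev i * (\<omega> * rr i ^ DIM('a))) \<le> ennreal (mass f (cc i) (rr i))" by (rule ennreal_leI)
        then show "ennreal (2 powr lev i) * emeasure lborel (ball (cc i) (rr i)) \<le> (\<integral>\<^sup>+x\<in>ball (cc i) (rr i). ennreal \<bar>f x\<bar> \<partial>lborel)"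
          unfolding ennreal_mass[OF f p] using ri \<omega> by (simp add: emeasure_ball ennreal_mult[symmetric] \<omega>_def d_def)
        have "mass f (cc i) (K * rr i) \<le> 4 * K powr (- \<alpha>) * 2 powr lev i * (\<omega> * (K * rr i) ^ DIM('a))"
          unfolding lev_def \<omega>_def d_def using K by (intro good_enlarged[OF g]) auto
        also have "\<dots> \<le> 1 / (32 * 2 ^ DIM('a)) * 2 powr lev i * (\<omega> * (K * rr i) ^ DIM('a))"
          using K4 \<omega> K ri by (intro mult_right_mono) auto
        finally have "ennreal (mass f (cc i) (K * rr i)) \<le> ennreal (2 powr lev i / (32 * 2 ^ DIM('a)) * (\<omega> * (K * rr i) ^ DIM('a)))"
          by (intro ennreal_leI) simp
        then show "(\<integral>\<^sup>+x\<in>ball (cc i) (K * rr i). ennreal \<bar>f x\<bar> \<partial>lborel) \<le>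
            ennreal (2 powr lev i / (32 * 2 ^ DIM('a))) * emeasure lborel (ball (cc i) (K * rr i))"
          unfolding ennreal_mass[OF f p] using K ri \<omega> by (simp add: emeasure_ball ennreal_mult[symmetric] \<omega>_def d_def)
      next
        fix x k
        define J where "J = {i \<in> I. lev i = k \<and> x \<in> ball (cc i) (K * rr i)}"
        \<comment> \<open>Equal level puts all these triples into one Vitali family, so their balls
          are disjoint.\<close>
        have JC: "J \<subseteq> C k" using I Ug(2) by (auto simp: J_def)
        have "real (card J) \<le> ((K + 1) * (comparison_const \<alpha> K)\<^sup>2) ^ DIM('a)"
        proof (rule good_overlap[OF f p \<alpha>(1) \<alpha>d])
          show "pairwise (\<lambda>i j. disjnt (ball (fst (snd i)) (snd (snd i))) (ball (fst (snd j)) (snd (snd j)))) J"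
            by (rule pairwise_subset[OF disj JC])
          show "finite J" using I by (simp add: J_def)
          show "1 \<le> K" using K by simp
          show "good \<alpha> f x' c r \<and> level f c r = k \<and> x \<in> ball c (K * r)" if "(x', c, r) \<in> J" for x' c r
            using that JC Cg by (auto simp: J_def cc_def rr_def)
        qed
        then have "card J \<le> N" unfolding N_def \<Lambda>_def by linarith
        then show "card {i \<in> I. lev i = k \<and> x \<in> ball (cc i) (K * rr i)} \<le> N" by (simp add: J_def)
      qed
      also have "(\<Sum>i\<in>I. ennreal ((2 powr lev i) powr p * rr i powr (real DIM('a) - p))) = ennreal (\<Sum>i\<in>I. s i)"
        by (subst sum_ennreal) (auto simp: s_def d_def)
      also have "ennreal (ball_const (real DIM('a)) p K * (real N * level_sum (real DIM('a)))) * ennreal W = ennreal (B0 * W)"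
        using B0 W by (simp add: B0_def d_def ennreal_mult)
      finally show ?thesis using B0 W by (subst (asm) ennreal_le_iff) auto
    qed
    \<comment> \<open>Enumeration of the countable set \<open>U\<close>, with zero terms at the
      indices outside \<open>NN\<close>, so that finite and infinite families are treated
      alike.\<close>
    define NN where "NN = to_nat_on U ` U"
    define ix where "ix = from_nat_into U"
    have ixU: "ix n \<in> U" if "n \<in> NN" for n
      using that U by (auto simp: NN_def ix_def)
    have ix_inj: "inj_on ix NN"
      using U by (auto simp: inj_on_def NN_def ix_def)
    define G where "G x = (\<Sum>n. if n \<in> NN then ennreal (C1 * \<rho> (ix n) powr q) * indicator (ball (cc (ix n)) (5 * rr (ix n))) x else 0)" for x
    define s' where "s' n = (if n \<in> NN then s (ix n) else 0)" for n
    have s0: "s i \<ge> 0" for i by (simp add: s_def)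
    have Gm: "G \<in> borel_measurable borel" unfolding G_def by measurable
    have "(\<integral>\<^sup>+x. G x \<partial>lborel) = (\<Sum>n. \<integral>\<^sup>+x. (if n \<in> NN then ennreal (C1 * \<rho> (ix n) powr q) * indicator (ball (cc (ix n)) (5 * rr (ix n))) x else 0) \<partial>lborel)"
      unfolding G_def by (rule nn_integral_suminf) measurable
    also have "\<dots> \<le> (\<Sum>n. ennreal C2 * ennreal (s' n powr (q / p)))"
    proof (intro suminf_le summableI)
      fix n
      show "(\<integral>\<^sup>+x. (if n \<in> NN then ennreal (C1 * \<rho> (ix n) powr q) * indicator (ball (cc (ix n)) (5 * rr (ix n))) x else 0) \<partial>lborel)
          \<le> ennreal C2 * ennreal (s' n powr (q / p))"
      proof (cases "n \<in> NN")
        case True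
        define i where "i = ix n"
        have i: "i \<in> U" using ixU[OF True] by (simp add: i_def)
        note g = Ug(1)[OF i]
        have ri: "0 < rr i" by (rule good_pos[OF g])
        have "(\<integral>\<^sup>+x. (if n \<in> NN then ennreal (C1 * \<rho> (ix n) powr q) * indicator (ball (cc (ix n)) (5 * rr (ix n))) x else 0) \<partial>lborel)
           = ennreal (C1 * \<rho> i powr q) * ennreal (\<omega> * (5 * rr i) ^ DIM('a))"
          using True ri by (simp add: i_def[symmetric] nn_integral_cmult_indicator emeasure_ball \<omega>_def d_def)
        also have "\<dots> = ennreal (C1 * (\<omega> * 5 ^ DIM('a)) * (\<rho> i powr q * rr i ^ DIM('a)))"
          using C12 \<omega> ri by (subst ennreal_mult[symmetric]) (auto simp: power_mult_distrib ac_simps)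
        also have "\<dots> \<le> ennreal (C1 * (\<omega> * 5 ^ DIM('a)) * (2 powr q * s i powr (q / p)))"
          using rate_powr_volume_le[OF p \<alpha> q g] C12 \<omega>
          by (intro ennreal_leI mult_left_mono) (auto simp: \<rho>_def s_def lev_def d_def)
        also have "\<dots> = ennreal C2 * ennreal (s' n powr (q / p))"
          using C12 True by (simp add: C2_def s'_def i_def ennreal_mult[symmetric] mult.assoc)
        finally show ?thesis .
      qed simp
    qed
    also have "\<dots> = ennreal C2 * (\<Sum>n. ennreal (s' n powr (q / p)))" by simp
    also have "\<dots> \<le> ennreal C2 * ennreal ((B0 * W) powr (q / p))"
    proof (intro mult_left_mono suminf_powr_le qp(1))
      show "0 \<le> s' n" for n by (simp add: s'_def s0)
      fix n
      have "(\<Sum>k<n. s' k) = (\<Sum>k\<in>{k \<in> {..<n}. k \<in> NN}. s (ix k))"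
        unfolding s'_def by (rule sum.inter_filter[symmetric]) simp
      also have "\<dots> = (\<Sum>i\<in>ix ` {k \<in> {..<n}. k \<in> NN}. s i)"
        by (subst sum.reindex) (auto intro: inj_on_subset[OF ix_inj])
      also have "\<dots> \<le> B0 * W" by (rule fam) (use ixU in auto)
      finally show "(\<Sum>k<n. s' k) \<le> B0 * W" .
    qed simp
    also have "\<dots> = ennreal (C2 * B0 powr (q / p) * W powr (q / p))"
      using C12 B0 W by (simp add: ennreal_mult[symmetric] powr_mult mult.assoc)
    finally have GI: "(\<integral>\<^sup>+x. G x \<partial>lborel) \<le> ennreal (C2 * B0 powr (q / p) * W powr (q / p))" .
    have GP: "ennreal ((r powr (\<alpha> - 1) * ball_mean f c r) powr q) \<le> G x" if g: "good \<alpha> f x c r" for x c r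
    proof -
      obtain x' c' r' where i: "(x', c', r') \<in> C (level f c r)" "x \<in> ball c' (5 * r')" "ball c r \<inter> ball c' (5 * r') \<noteq> {}"
        using cov[OF g] by blast
      define i where "i = (x', c', r')"
      have iU: "i \<in> U" using i by (auto simp: U_def i_def)
      have g': "good \<alpha> f x' c' r'" and lev: "level f c' r' = level f c r" using Cg[OF i(1)] by auto
      have r: "r > 0" "r' > 0" using good_pos g g' by auto
      have "ball c r \<subseteq> ball c (K * r)" "ball c' (5 * r') \<subseteq> ball c' (K * r')"
        using K r by (auto intro!: subset_ball)
      then have meet: "ball c (K * r) \<inter> ball c' (K * r') \<noteq> {}" using i(3) by blast
      have "r powr (\<alpha> - 1) * ball_mean f c r \<le> 2 * \<Lambda> powr \<bar>\<alpha> - 1\<bar> * (r' powr (\<alpha> - 1) * ball_mean f c' r')"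
        unfolding \<Lambda>_def using K by (intro rate_comparable[OF f p \<alpha>(1) \<alpha>d _ g g' lev meet]) auto
      then have "(r powr (\<alpha> - 1) * ball_mean f c r) powr q \<le> (2 * \<Lambda> powr \<bar>\<alpha> - 1\<bar> * (r' powr (\<alpha> - 1) * ball_mean f c' r')) powr q"
        using qp good_ball_mean_pos[OF g] by (intro powr_mono2) auto
      also have "\<dots> = C1 * \<rho> i powr q"
        using good_ball_mean_pos[OF g'] by (simp add: C1_def \<rho>_def i_def rr_def cc_def powr_mult mult.assoc)
      finally have le: "(r powr (\<alpha> - 1) * ball_mean f c r) powr q \<le> C1 * \<rho> i powr q" .
      define n where "n = to_nat_on U i"
      have n: "n \<in> NN" "ix n = i" using iU U by (auto simp: n_def NN_def ix_def)
      let ?h = "\<lambda>n. if n \<in> NN then ennreal (C1 * \<rho> (ix n) powr q) * indicator (ball (cc (ix n)) (5 * rr (ix n))) x else 0"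
      have "ennreal ((r powr (\<alpha> - 1) * ball_mean f c r) powr q) \<le> ?h n"
        using le i(2) n by (auto simp: i_def cc_def rr_def intro!: ennreal_leI)
      also have "\<dots> \<le> suminf ?h" using sum_le_suminf[of ?h "{n}"] by (simp add: summableI)
      finally show ?thesis by (simp add: G_def)
    qed
    show "\<exists>G\<in>borel_measurable borel. (\<integral>\<^sup>+x. G x \<partial>lborel) \<le> ennreal (C2 * B0 powr (q / p) * W powr (q / p)) \<and>
        (\<forall>x c r. good \<alpha> f x c r \<longrightarrow> ennreal ((r powr (\<alpha> - 1) * ball_mean f c r) powr q) \<le> G x)"
      using Gm GI GP by blast
  qed
qed

end

section \<open>Weak derivatives of Lipschitz functions\<close>

text \<open>\<open>F = w + 2 M x\<close> is bi-Lipschitz; the density of the image of Lebesgue measure under its inverse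
  is the derivative of \<open>F\<close> almost everywhere, from both sides.\<close>

lemma lipschitz_real_differentiable_AE:
  fixes w :: "real \<Rightarrow> real"
  assumes lip: "\<And>x y. \<bar>w x - w y\<bar> \<le> L * \<bar>x - y\<bar>"
  shows "\<exists>N. negligible N \<and> (\<forall>x. x \<notin> N \<longrightarrow> (\<exists>D. (w has_real_derivative D) (at x)))"
proof -
  have "0 \<le> L" using lip[of 1 0] by simp
  \<comment> \<open>Adding 1 makes M positive even for L = 0, so that the slopes of w + 2 M x lie
    between M and 3 M.\<close>
  define M where "M = L + 1"
  have M: "M > 0" "L \<le> M" using \<open>0 \<le> L\<close> by (auto simp: M_def)
  have lipM: "\<bar>w x - w y\<bar> \<le> M * \<bar>x - y\<bar>" for x y
    using lip[of x y] M mult_right_mono[of L M "\<bar>x - y\<bar>"] by linarith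
  define F where "F x = w x + 2 * M * x" for x
  have Flow: "M * (y - x) \<le> F y - F x" if "x \<le> y" for x y
    using lipM[of y x] that by (simp add: F_def algebra_simps)
  have Fup: "\<bar>F y - F x\<bar> \<le> 3 * M * \<bar>y - x\<bar>" for x y
  proof -
    have "\<bar>F y - F x\<bar> \<le> \<bar>w y - w x\<bar> + \<bar>2 * M * (y - x)\<bar>" by (simp add: F_def algebra_simps)
    also have "\<bar>2 * M * (y - x)\<bar> = 2 * M * \<bar>y - x\<bar>" using M by (simp add: abs_mult)
    finally show ?thesis using lipM[of y x] by simp
  qed
  have Fmono: "F x \<le> F y \<longleftrightarrow> x \<le> y" for x y
    using Flow[of x y] Flow[of y x] M
    by (smt (verit, best) mult_le_cancel_left_pos mult_pos_pos)
  have Fcont: "continuous_on UNIV F"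
  proof -
    have "(3 * M)-lipschitz_on UNIV F"
      using Fup M by (intro lipschitz_onI) (auto simp: dist_real_def)
    then show ?thesis by (rule lipschitz_on_continuous_on)
  qed
  have Fsurj: "\<exists>x. F x = z" for z
  proof -
    define a where "a = - (\<bar>z\<bar> + \<bar>F 0\<bar>) / M"
    define b where "b = (\<bar>z\<bar> + \<bar>F 0\<bar>) / M"
    have ab: "a \<le> 0" "0 \<le> b" using M by (auto simp: a_def b_def divide_nonpos_pos)
    have "F a \<le> z" using Flow[OF ab(1)] M by (simp add: a_def)
    moreover have "z \<le> F b" using Flow[OF ab(2)] M by (simp add: b_def)
    ultimately show ?thesis
      using IVT'[of F a z b] ab Fcont continuous_on_subset by fastforce
  qed
  define P where "P = inv F"
  have FP: "F (P z) = z" for z unfolding P_def using Fsurj by (metis surj_def surj_f_inv_f)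
  have PF: "P (F x) = x" for x using FP[of "F x"] Fmono by (metis order_antisym order_refl)
  have Plip: "\<bar>P z - P y\<bar> \<le> 1 / M * \<bar>z - y\<bar>" for z y
  proof -
    have "M * \<bar>P z - P y\<bar> \<le> \<bar>z - y\<bar>"
      using Flow[of "P z" "P y"] Flow[of "P y" "P z"] FP[of z] FP[of y]
      by (cases "P z \<le> P y") (auto simp: abs_if)
    then show ?thesis using M by (simp add: field_simps)
  qed
  have Pcont: "continuous_on UNIV P"
  proof -
    have "(1 / M)-lipschitz_on UNIV P"
      using Plip M by (intro lipschitz_onI) (auto simp: dist_real_def)
    then show ?thesis by (rule lipschitz_on_continuous_on)
  qed
  have [measurable]: "P \<in> borel_measurable borel" by (rule borel_measurable_continuous_onI[OF Pcont])
  define \<mu> where "\<mu> = distr lborel lborel P"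
  \<comment> \<open>F is Lipschitz, so it maps null sets to null sets, and preimages under P are
    images under F.\<close>
  have ac: "absolutely_continuous lborel \<mu>"
    unfolding absolutely_continuous_def
  proof
    fix A :: "real set" assume A: "A \<in> null_sets lborel"
    then have [measurable]: "A \<in> sets borel" by auto
    have "negligible A" using A by (simp add: negligible_iff_null_sets null_sets_completionI)
    then have "negligible (F ` A)"
    proof (rule negligible_locally_Lipschitz_image[rotated])
      fix x assume "x \<in> A"
      show "\<exists>T B. open T \<and> x \<in> T \<and> (\<forall>y\<in>A \<inter> T. norm (F y - F x) \<le> B * norm (y - x))"
        using Fup by (intro exI[of _ UNIV] exI[of _ "3 * M"]) auto
    qed simp
    moreover have "F ` A = P -` A" using FP PF by (auto simp: image_iff) metis
    ultimately have "emeasure lebesgue (P -` A) = 0" by (metis negligible_iff_null_sets null_setsD1)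
    moreover have "P -` A \<in> sets borel" using measurable_sets[of P borel borel A] by simp
    ultimately have "emeasure lborel (P -` A) = 0" by (simp add: main_part_sets)
    then show "A \<in> null_sets \<mu>" by (simp add: null_sets_def \<mu>_def emeasure_distr)
  qed
  obtain h where h[measurable]: "h \<in> borel_measurable lborel" and dh: "density lborel h = \<mu>"
    using sigma_finite_measure.Radon_Nikodym[OF sigma_finite_lborel ac] by (auto simp: \<mu>_def)
  have hI: "(\<integral>\<^sup>+x. h x * indicator {a..b} x \<partial>lborel) = ennreal (F b - F a)" if "a \<le> b" for a b
  proof -
    have "(\<integral>\<^sup>+x. h x * indicator {a..b} x \<partial>lborel) = emeasure \<mu> {a..b}"
      unfolding dh[symmetric] by (subst emeasure_density) auto
    also have "\<dots> = emeasure lborel (P -` {a..b})" by (simp add: \<mu>_def emeasure_distr)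
    also have "P -` {a..b} = {F a..F b}"
    proof -
      have "a \<le> P z \<longleftrightarrow> F a \<le> z" "P z \<le> b \<longleftrightarrow> z \<le> F b" for z
        using Fmono[of a "P z"] Fmono[of "P z" b] FP[of z] by auto
      then show ?thesis by auto
    qed
    finally show ?thesis using that Fmono by simp
  qed
  define k where "k x = enn2real (h x)" for x
  have [measurable]: "k \<in> borel_measurable borel" unfolding k_def using h by simp
  have kI: "(k has_integral (F b - F a)) {a..b}" if "a \<le> b" for a b
  proof -
    have "AE x in lborel. h x * indicator {a..b} x \<noteq> \<infinity>"
      by (rule nn_integral_PInf_AE) (use hI[OF that] in auto)
    then have "(\<integral>\<^sup>+x. ennreal (k x * indicator {a..b} x) \<partial>lborel) = (\<integral>\<^sup>+x. h x * indicator {a..b} x \<partial>lborel)"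
      by (intro nn_integral_cong_AE) (auto simp: k_def less_top split: split_indicator)
    then have "((\<lambda>x. k x * indicator {a..b} x) has_integral (F b - F a)) UNIV"
      using hI[OF that] Fmono that by (intro nn_integral_has_integral) (auto simp: k_def)
    moreover have "(\<lambda>x. k x * indicator {a..b} x) = (\<lambda>x. if x \<in> {a..b} then k x else 0)" by (auto simp: indicator_def)
    ultimately show ?thesis by (simp only: has_integral_restrict_UNIV)
  qed
  have int1: "k integrable_on cbox a b" for a b
    using kI[of a b] by (cases "a \<le> b") (auto simp: integrable_on_def)
  \<comment> \<open>The differentiation theorem for intervals [x, x + h] gives right derivatives;
    applied to the reflected density it gives the left ones.\<close>
  have int2: "(\<lambda>x. k (- x)) integrable_on cbox a b" for a b
    using int1[of "- b" "- a"] Henstock_Kurzweil_Integration.integrable_reflect_real[where f=k and a="- b" and b="- a"] by simp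
  obtain N1 where N1: "negligible N1" "\<And>x e. x \<notin> N1 \<Longrightarrow> 0 < e \<Longrightarrow>
      \<exists>d>0. \<forall>h. 0 < h \<and> h < d \<longrightarrow> norm (integral (cbox x (x + h *\<^sub>R One)) k /\<^sub>R h ^ DIM(real) - k x) < e"
    by (rule integrable_ccontinuous_explicit[of k, OF int1]) (rule that)
  obtain N2 where N2: "negligible N2" "\<And>x e. x \<notin> N2 \<Longrightarrow> 0 < e \<Longrightarrow>
      \<exists>d>0. \<forall>h. 0 < h \<and> h < d \<longrightarrow> norm (integral (cbox x (x + h *\<^sub>R One)) (\<lambda>x. k (- x)) /\<^sub>R h ^ DIM(real) - k (- x)) < e"
    by (rule integrable_ccontinuous_explicit[of "\<lambda>x. k (- x)", OF int2]) (rule that)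
  have "negligible (N1 \<union> uminus ` N2)"
  proof (rule negligible_Un[OF N1(1)])
    show "negligible (uminus ` N2)"
      by (rule negligible_differentiable_image_negligible[OF _ N2(1)]) (auto intro!: derivative_intros simp: differentiable_on_def)
  qed
  moreover have "\<exists>D. (w has_real_derivative D) (at x)" if x: "x \<notin> N1 \<union> uminus ` N2" for x
  proof -
    have x1: "x \<notin> N1" and x2: "- x \<notin> N2" using x by (auto simp: image_iff)
    have "(F has_real_derivative k x) (at x)"
      unfolding DERIV_def LIM_eq
    proof (intro allI impI)
      fix e :: real assume e: "0 < e"
      obtain d1 where d1: "d1 > 0" "\<And>h. 0 < h \<Longrightarrow> h < d1 \<Longrightarrow> \<bar>integral {x..x + h} k / h - k x\<bar> < e"
        using N1(2)[OF x1 e] by (auto simp: divide_inverse mult.commute)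
      obtain d2 where d2: "d2 > 0" "\<And>h. 0 < h \<Longrightarrow> h < d2 \<Longrightarrow> \<bar>integral {- x..- x + h} (\<lambda>x. k (- x)) / h - k x\<bar> < e"
        using N2(2)[OF x2 e] by (auto simp: divide_inverse mult.commute)
      show "\<exists>s>0. \<forall>h. h \<noteq> 0 \<and> norm (h - 0) < s \<longrightarrow> norm ((F (x + h) - F x) / h - k x) < e"
      proof (intro exI[of _ "min d1 d2"] conjI allI impI)
        show "0 < min d1 d2" using d1 d2 by simp
        fix h :: real assume h: "h \<noteq> 0 \<and> norm (h - 0) < min d1 d2"
        show "norm ((F (x + h) - F x) / h - k x) < e"
        proof (cases "h > 0")
          case True
          then have "integral {x..x + h} k = F (x + h) - F x" using kI[of x "x + h"] by (auto simp: integral_unique)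
          then show ?thesis using d1(2)[of h] h True by auto
        next
          case False
          then have hn: "h < 0" using h by simp
          have "integral {- x..- (x + h)} (\<lambda>x. k (- x)) = integral {x + h..x} k"
            by (rule Henstock_Kurzweil_Integration.integral_reflect_real)
          also have "\<dots> = F x - F (x + h)" using kI[of "x + h" x] hn by (auto simp: integral_unique)
          finally have "integral {- x..- (x + h)} (\<lambda>x. k (- x)) / (- h) = (F (x + h) - F x) / h"
            by (metis minus_diff_eq minus_divide_divide)
          then show ?thesis using d2(2)[of "- h"] h hn by simp
        qed
      qed
    qed
    then have "((\<lambda>x. F x - 2 * M * x) has_real_derivative (k x - 2 * M)) (at x)"
      by (auto intro!: derivative_eq_intros)
    moreover have "(\<lambda>x. F x - 2 * M * x) = w" by (auto simp: F_def)
    ultimately show ?thesis by auto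
  qed
  ultimately show ?thesis by blast
qed

text \<open>Differentiability as a Cauchy condition on difference quotients with countable outer
  quantifiers; in this form the set of differentiability points becomes a countable combination of
  closed sets, hence Borel.\<close>

lemma real_derivative_Cauchy_criterion:
  fixes v :: "real \<Rightarrow> real"
  shows "(\<exists>D. (v has_real_derivative D) (at 0)) \<longleftrightarrow>
    (\<forall>k::nat. \<exists>n::nat. \<forall>s t. s \<noteq> 0 \<and> \<bar>s\<bar> < 1 / Suc n \<and> t \<noteq> 0 \<and> \<bar>t\<bar> < 1 / Suc n \<longrightarrow>
       \<bar>(v s - v 0) / s - (v t - v 0) / t\<bar> \<le> 1 / Suc k)" (is "?L \<longleftrightarrow> ?R")
proof
  assume ?L
  then obtain D where D: "(v has_real_derivative D) (at 0)" by blast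
  show ?R
  proof
    fix k :: nat
    have "0 < 1 / (2 * Suc k)" by simp
    then obtain e where e: "e > 0" "\<And>s. s \<noteq> 0 \<Longrightarrow> \<bar>s\<bar> < e \<Longrightarrow> \<bar>(v s - v 0) / s - D\<bar> < 1 / (2 * Suc k)"
      using D unfolding DERIV_def LIM_eq by (metis add_0 diff_zero real_norm_def)
    obtain n where n: "1 / Suc n < e" using e(1) nat_approx_posE by blast
    have "\<bar>(v s - v 0) / s - (v t - v 0) / t\<bar> \<le> 1 / Suc k"
      if "s \<noteq> 0 \<and> \<bar>s\<bar> < 1 / Suc n \<and> t \<noteq> 0 \<and> \<bar>t\<bar> < 1 / Suc n" for s t
    proof -
      have "\<bar>(v s - v 0) / s - D\<bar> < 1 / (2 * Suc k)" "\<bar>(v t - v 0) / t - D\<bar> < 1 / (2 * Suc k)"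
        using e(2)[of s] e(2)[of t] that n by linarith+
      moreover have "1 / (2 * Suc k) + 1 / (2 * Suc k) = 1 / real (Suc k)" by (simp add: field_simps)
      moreover have "\<bar>A - B\<bar> \<le> E" if "\<bar>A - D\<bar> < e" "\<bar>B - D\<bar> < e" "e + e = E" for A B e E :: real
        using that by linarith
      ultimately show ?thesis by blast
    qed
    then show "\<exists>n. \<forall>s t. s \<noteq> 0 \<and> \<bar>s\<bar> < 1 / Suc n \<and> t \<noteq> 0 \<and> \<bar>t\<bar> < 1 / Suc n \<longrightarrow>
       \<bar>(v s - v 0) / s - (v t - v 0) / t\<bar> \<le> 1 / Suc k" by blast
  qed
next
  assume R: ?R
  define Q where "Q s = (v s - v 0) / s" for s
  define y where "y n = Q (1 / Suc (Suc n))" for n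
  have small: "\<exists>n. \<forall>s t. s \<noteq> 0 \<and> \<bar>s\<bar> < 1 / Suc n \<and> t \<noteq> 0 \<and> \<bar>t\<bar> < 1 / Suc n \<longrightarrow> \<bar>Q s - Q t\<bar> < e" if e0: "e > 0" for e
  proof -
    obtain k where "1 / Suc k < e" using reals_Archimedean[OF e0] by (auto simp: inverse_eq_divide)
    moreover obtain n where "\<forall>s t. s \<noteq> 0 \<and> \<bar>s\<bar> < 1 / Suc n \<and> t \<noteq> 0 \<and> \<bar>t\<bar> < 1 / Suc n \<longrightarrow> \<bar>Q s - Q t\<bar> \<le> 1 / Suc k"
      using R[THEN spec, of k] unfolding Q_def by (rule exE)
    ultimately show ?thesis by (intro exI[of _ n]) (auto intro: le_less_trans)
  qed
  have yn: "1 / real (Suc (Suc j)) < 1 / Suc n" if "n \<le> j" for n j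
    using that by (simp add: field_simps)
  have "Cauchy y"
  proof (rule metric_CauchyI)
    fix e :: real assume "e > 0"
    from small[OF this] obtain n where
      n: "\<forall>s t. s \<noteq> 0 \<and> \<bar>s\<bar> < 1 / Suc n \<and> t \<noteq> 0 \<and> \<bar>t\<bar> < 1 / Suc n \<longrightarrow> \<bar>Q s - Q t\<bar> < e" by (rule exE)
    show "\<exists>M. \<forall>m\<ge>M. \<forall>n\<ge>M. dist (y m) (y n) < e"
    proof (intro exI[of _ n] allI impI)
      fix i j assume "n \<le> i" "n \<le> j"
      then show "dist (y i) (y j) < e"
        unfolding y_def dist_real_def using yn[of n i] yn[of n j] by (intro n[rule_format]) simp
    qed
  qed
  then obtain D where D: "y \<longlonglongrightarrow> D" using real_Cauchy_convergent convergent_def by blast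
  have "(v has_real_derivative D) (at 0)"
    unfolding DERIV_def LIM_eq
  proof (intro allI impI)
    fix e :: real assume e: "e > 0"
    then have "e / 2 > 0" by simp
    from small[OF this] obtain n where
      n: "\<forall>s t. s \<noteq> 0 \<and> \<bar>s\<bar> < 1 / Suc n \<and> t \<noteq> 0 \<and> \<bar>t\<bar> < 1 / Suc n \<longrightarrow> \<bar>Q s - Q t\<bar> < e / 2" by (rule exE)
    have "\<forall>\<^sub>F j in sequentially. \<bar>y j - D\<bar> < e / 2 \<and> n \<le> j"
      using eventually_conj[OF tendstoD[OF D, of "e / 2"] eventually_ge_at_top[of n]] e by (simp add: dist_real_def)
    then obtain j where j: "\<bar>y j - D\<bar> < e / 2" "n \<le> j" by (auto simp: eventually_sequentially)
    show "\<exists>s>0. \<forall>h. h \<noteq> 0 \<and> norm (h - 0) < s \<longrightarrow> norm ((v (0 + h) - v 0) / h - D) < e"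
    proof (intro exI[of _ "1 / Suc n"] conjI allI impI)
      fix h :: real assume h: "h \<noteq> 0 \<and> norm (h - 0) < 1 / Suc n"
      have "\<bar>Q h - y j\<bar> < e / 2" unfolding y_def using h j(2) yn[of n j] by (intro n[rule_format]) simp
      then show "norm ((v (0 + h) - v 0) / h - D) < e" using j(1) unfolding Q_def real_norm_def add_0 by linarith
    qed simp
  qed
  then show ?L by blast
qed

text \<open>Every line in direction v meets the exceptional set in a null set of parameters.
  Averaging the measure of its translates by t v over t in [0, 1] and exchanging the integrals shows
  that the set itself is null.\<close>

lemma lipschitz_partially_differentiable_AE:
  fixes u :: "'a::euclidean_space \<Rightarrow> real"
  assumes lip: "\<And>x y. \<bar>u x - u y\<bar> \<le> L * norm (x - y)"
  shows "AE x in lborel. \<exists>D. ((\<lambda>t. u (x + t *\<^sub>R v)) has_real_derivative D) (at 0)"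
proof -
  have L: "L \<ge> 0"
  proof -
    obtain b :: 'a where "norm b = 1" using norm_Basis nonempty_Basis by blast
    then show ?thesis using lip[of b 0] by simp
  qed
  have cont: "continuous_on UNIV u"
  proof -
    have "L-lipschitz_on UNIV u" using lip L by (intro lipschitz_onI) (auto simp: dist_real_def dist_norm)
    then show ?thesis by (rule lipschitz_on_continuous_on)
  qed
  have cont': "continuous_on UNIV (\<lambda>x. u (x + a))" for a
    by (intro continuous_on_compose2[OF cont] continuous_intros) auto
  define Df where "Df = {x. \<exists>D. ((\<lambda>t. u (x + t *\<^sub>R v)) has_real_derivative D) (at 0)}"
  define E where "E k n = (\<Inter>(s, t)\<in>{(s, t). s \<noteq> 0 \<and> \<bar>s\<bar> < 1 / Suc n \<and> t \<noteq> 0 \<and> \<bar>t\<bar> < 1 / Suc n}.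
      {x. \<bar>(u (x + s *\<^sub>R v) - u x) / s - (u (x + t *\<^sub>R v) - u x) / t\<bar> \<le> 1 / Suc k})" for k n :: nat
  \<comment> \<open>By continuity of u each condition is closed in x, so the intersection over
    uncountably many s and t remains measurable.\<close>
  have "closed (E k n)" for k n
    unfolding E_def divide_inverse
    by (intro closed_INT ballI, clarsimp, intro closed_Collect_le continuous_intros cont' cont)
  then have [measurable]: "E k n \<in> sets borel" for k n by (simp add: borel_closed)
  have "Df = (\<Inter>k. \<Union>n. E k n)"
    unfolding Df_def real_derivative_Cauchy_criterion E_def by auto
  then have [measurable]: "Df \<in> sets borel" by simp
  define N where "N = - Df"
  have N[measurable]: "N \<in> sets borel" by (simp add: N_def)
  have line: "(\<integral>\<^sup>+t. indicator N (x + t *\<^sub>R v) * indicator {0..1::real} t \<partial>lborel) = 0" for x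
  proof -
    define w where "w t = u (x + t *\<^sub>R v)" for t
    have "\<bar>w s - w t\<bar> \<le> (L * norm v) * \<bar>s - t\<bar>" for s t
      using lip[of "x + s *\<^sub>R v" "x + t *\<^sub>R v"] by (simp add: w_def ac_simps flip: scaleR_diff_left)
    then obtain Z where Z: "negligible Z" "\<And>t. t \<notin> Z \<Longrightarrow> \<exists>D. (w has_real_derivative D) (at t)"
      using lipschitz_real_differentiable_AE[of w "L * norm v"] by blast
    have "t \<in> Z" if "x + t *\<^sub>R v \<in> N" for t
    proof (rule ccontr)
      assume "t \<notin> Z"
      then obtain D where "(w has_real_derivative D) (at (t + 0))" using Z(2) by auto
      then have "((\<lambda>s. w (t + s)) has_real_derivative D) (at 0)"
        using DERIV_at_within_shift[of w D t 0 UNIV] by simp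
      moreover have "(\<lambda>s. w (t + s)) = (\<lambda>s. u (x + t *\<^sub>R v + s *\<^sub>R v))"
        by (auto simp: w_def algebra_simps)
      ultimately show False using that by (auto simp: N_def Df_def)
    qed
    then have "{t. x + t *\<^sub>R v \<in> N} \<subseteq> Z" by auto
    then have "negligible {t. x + t *\<^sub>R v \<in> N}" using Z(1) negligible_subset by blast
    moreover have B: "{t. x + t *\<^sub>R v \<in> N} \<in> sets borel" by measurable
    ultimately have "emeasure lebesgue {t. x + t *\<^sub>R v \<in> N} = 0"
      by (metis negligible_iff_null_sets null_setsD1)
    with B have 0: "emeasure lborel {t. x + t *\<^sub>R v \<in> N} = 0" by (simp add: main_part_sets)
    have "(\<integral>\<^sup>+t. indicator N (x + t *\<^sub>R v) * indicator {0..1::real} t \<partial>lborel) \<le> (\<integral>\<^sup>+t. indicator {t. x + t *\<^sub>R v \<in> N} t \<partial>lborel)"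
      by (intro nn_integral_mono) (auto split: split_indicator)
    also have "\<dots> = 0" using B 0 by simp
    finally show ?thesis by simp
  qed
  \<comment> \<open>For each t the constant integrand is rewritten, by translation invariance, as
    the measure of the shifted set.\<close>
  have "emeasure lborel N = (\<integral>\<^sup>+t. emeasure lborel N * indicator {0..1::real} t \<partial>lborel)"
    by (subst nn_integral_cmult_indicator) auto
  also have "\<dots> = (\<integral>\<^sup>+t. (\<integral>\<^sup>+x. indicator N (x + t *\<^sub>R v) * indicator {0..1::real} t \<partial>lborel) \<partial>lborel)"
  proof (intro nn_integral_cong)
    fix t :: real
    have "(\<integral>\<^sup>+x. indicator N (x + t *\<^sub>R v) * indicator {0..1::real} t \<partial>lborel) = (\<integral>\<^sup>+x. indicator N (x + t *\<^sub>R v) \<partial>lborel) * indicator {0..1::real} t"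
      by (rule nn_integral_multc) measurable
    also have "(\<integral>\<^sup>+x. indicator N (x + t *\<^sub>R v) \<partial>lborel) = emeasure lborel N"
      by (subst nn_integral_lborel_translate) auto
    finally show "emeasure lborel N * indicator {0..1::real} t = (\<integral>\<^sup>+x. indicator N (x + t *\<^sub>R v) * indicator {0..1::real} t \<partial>lborel)" by simp
  qed
  also have "\<dots> = (\<integral>\<^sup>+x. (\<integral>\<^sup>+t. indicator N (x + t *\<^sub>R v) * indicator {0..1::real} t \<partial>lborel) \<partial>lborel)"
    by (rule lborel_pair.Fubini'[symmetric]) measurable
  also have "\<dots> = 0" by (simp add: line)
  finally have "N \<in> null_sets lborel" by (auto simp: null_sets_def)
  then show ?thesis by (rule AE_I') (auto simp: N_def Df_def)
qed

section \<open>Test functions and integration by parts for Lipschitz functions\<close>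

lemma test_function_Ck: "test_function \<phi> \<Longrightarrow> Ck k \<phi>"
  by (simp add: test_function_def smooth_fun_def)

lemma test_function_continuous: "test_function \<phi> \<Longrightarrow> continuous_on UNIV \<phi>"
  using test_function_Ck[of \<phi> 0] by simp

lemma test_function_differentiable: "test_function \<phi> \<Longrightarrow> \<phi> differentiable (at x)"
  using test_function_Ck[of \<phi> "Suc 0"] by simp

lemma test_function_partial_continuous:
  "test_function \<phi> \<Longrightarrow> i \<in> Basis \<Longrightarrow> continuous_on UNIV (partial_deriv \<phi> i)"
  using test_function_Ck[of \<phi> "Suc 0"] by simp

lemma has_real_derivative_along_line:
  fixes \<phi> :: "'a::euclidean_space \<Rightarrow> real"
  assumes "\<phi> differentiable (at (x + t *\<^sub>R v))"
  shows "((\<lambda>t. \<phi> (x + t *\<^sub>R v)) has_real_derivative partial_deriv \<phi> v (x + t *\<^sub>R v)) (at t)"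
proof -
  have 1: "((\<lambda>t. x + t *\<^sub>R v) has_derivative (\<lambda>h. h *\<^sub>R v)) (at t)"
    by (auto intro!: derivative_eq_intros)
  have 2: "(\<phi> has_derivative frechet_derivative \<phi> (at (x + t *\<^sub>R v))) (at (x + t *\<^sub>R v))"
    using assms frechet_derivative_works by blast
  have "linear (frechet_derivative \<phi> (at (x + t *\<^sub>R v)))" using 2 has_derivative_linear by blast
  then have "frechet_derivative \<phi> (at (x + t *\<^sub>R v)) (h *\<^sub>R v) = partial_deriv \<phi> v (x + t *\<^sub>R v) * h" for h
    by (simp add: linear_cmul partial_deriv_def)
  with has_derivative_compose[OF 1 2] show ?thesis by (simp add: has_field_derivative_def)
qed

lemma partial_deriv_eq_0:
  fixes \<phi> :: "'a::euclidean_space \<Rightarrow> real"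
  assumes "open S" "x \<in> S" "\<And>y. y \<in> S \<Longrightarrow> \<phi> y = 0"
  shows "partial_deriv \<phi> v x = 0"
proof -
  have "(\<phi> has_derivative (\<lambda>_. 0)) (at x)"
    by (rule has_derivative_transform_within_open[OF has_derivative_const[of 0] assms(1,2)]) (use assms in auto)
  then have "frechet_derivative \<phi> (at x) = (\<lambda>_. 0)" by (rule frechet_derivative_at[symmetric])
  then show ?thesis by (simp add: partial_deriv_def)
qed

lemma test_function_bounded_support:
  fixes \<phi> :: "'a::euclidean_space \<Rightarrow> real"
  assumes "test_function \<phi>"
  obtains R where "0 < R" "\<And>x. R \<le> norm x \<Longrightarrow> \<phi> x = 0" "\<And>x v. R \<le> norm x \<Longrightarrow> partial_deriv \<phi> v x = 0"
proof -
  have "bounded (closure {x. \<phi> x \<noteq> 0})"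
    using assms compact_imp_bounded by (auto simp: test_function_def)
  then obtain R where R: "0 < R" "closure {x. \<phi> x \<noteq> 0} \<subseteq> ball 0 R"
    using bounded_subset_ballD by blast
  have out: "x \<in> - closure {x. \<phi> x \<noteq> 0}" if "R \<le> norm x" for x using R(2) that by auto
  have zero: "\<phi> y = 0" if "y \<in> - closure {x. \<phi> x \<noteq> 0}" for y
    using that by (metis (mono_tags, lifting) ComplD closure_subset mem_Collect_eq subsetD)
  show ?thesis
  proof (rule that[OF R(1)])
    show "\<phi> x = 0" if "R \<le> norm x" for x using zero[OF out[OF that]] .
    show "partial_deriv \<phi> v x = 0" if "R \<le> norm x" for x v
      by (rule partial_deriv_eq_0[OF open_Compl[OF closed_closure] out[OF that] zero])
  qed
qed

lemma bounded_of_continuous_support: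
  fixes h :: "'a::euclidean_space \<Rightarrow> real"
  assumes "continuous_on UNIV h" "\<And>x. R \<le> norm x \<Longrightarrow> h x = 0"
  obtains B where "0 \<le> B" "\<And>x. \<bar>h x\<bar> \<le> B"
proof -
  have "compact (h ` cball 0 R)"
    by (intro compact_continuous_image) (auto intro: continuous_on_subset[OF assms(1)])
  then obtain B where B: "\<And>y. y \<in> h ` cball 0 R \<Longrightarrow> \<bar>y\<bar> \<le> B"
    using compact_imp_bounded[THEN bounded_iff[THEN iffD1]] by (metis real_norm_def)
  have "\<bar>h x\<bar> \<le> max 0 B" for x
    using B[of "h x"] assms(2)[of x] by (cases "norm x \<le> R") auto
  then show ?thesis using that[of "max 0 B"] by auto
qed

lemma lborel_integral_translate:
  fixes h :: "'a::euclidean_space \<Rightarrow> real"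
  assumes [measurable]: "h \<in> borel_measurable borel"
  shows "(\<integral>x. h (x + z) \<partial>lborel) = (\<integral>x. h x \<partial>lborel)"
proof -
  have "(\<integral>x. h x \<partial>lborel) = (\<integral>x. h x \<partial>(distr lborel borel ((+) z)))"
    by (simp add: lborel_distr_plus)
  also have "\<dots> = (\<integral>x. h (z + x) \<partial>lborel)"
    by (subst integral_distr) auto
  finally show ?thesis by (simp add: add.commute)
qed

lemma integrable_continuous_bounded_support:
  fixes h :: "'a::euclidean_space \<Rightarrow> real"
  assumes "continuous_on UNIV h" "\<And>x. R \<le> norm x \<Longrightarrow> h x = 0"
  shows "integrable lborel h"
proof -
  have "integrable lborel (\<lambda>x. indicator (cball 0 R) x *\<^sub>R h x)"
    by (rule borel_integrable_compact) (auto intro: continuous_on_subset[OF assms(1)])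
  moreover have "(\<lambda>x. indicator (cball 0 R) x *\<^sub>R h x) = h"
    using assms(2) by (auto simp: indicator_def fun_eq_iff)
  ultimately show ?thesis by simp
qed

text \<open>A fixed sequence of steps and the total operator \<open>lim\<close> give a function that
  is measurable and defined everywhere; it is the directional derivative wherever that
  exists.\<close>

definition quotient_limit :: "('a::euclidean_space \<Rightarrow> real) \<Rightarrow> 'a \<Rightarrow> 'a \<Rightarrow> real" where
  "quotient_limit u v x = lim (\<lambda>n. (u (x + (1 / Suc n) *\<^sub>R v) - u x) / (1 / Suc n))"

lemma LIMSEQ_difference_quotient:
  assumes "(v has_real_derivative D) (at 0)"
  shows "(\<lambda>n. (v (1 / real (Suc n)) - v 0) / (1 / Suc n)) \<longlonglongrightarrow> D"
proof -
  have "((\<lambda>h. (v h - v 0) / h) \<longlongrightarrow> D) (at 0)" using assms by (simp add: DERIV_def)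
  moreover have "filterlim (\<lambda>n. 1 / real (Suc n)) (at 0) sequentially"
    using LIMSEQ_inverse_real_of_nat by (simp add: filterlim_at inverse_eq_divide)
  ultimately show ?thesis by (rule filterlim_compose)
qed

lemma quotient_limit_eq:
  assumes "((\<lambda>t. u (x + t *\<^sub>R v)) has_real_derivative D) (at 0)"
  shows "quotient_limit u v x = D"
  using LIMSEQ_difference_quotient[OF assms] unfolding quotient_limit_def by (intro limI) simp

text \<open>Integration by parts is exact for difference quotients, by translation. The quotients of
  u are bounded by L and those of \<phi> by a bound on its partial derivative, so both sides pass to
  the limit by dominated convergence.\<close>

lemma lipschitz_weak_derivative:
  fixes u :: "'a::euclidean_space \<Rightarrow> real"
  assumes lip: "\<And>x y. \<bar>u x - u y\<bar> \<le> L * norm (x - y)" and i: "i \<in> Basis" and \<phi>: "test_function \<phi>"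
  shows "(\<integral>x. u x * partial_deriv \<phi> i x \<partial>lborel) = - (\<integral>x. quotient_limit u i x * \<phi> x \<partial>lborel)"
proof -
  have ni: "norm i = 1" using i by simp
  have L: "L \<ge> 0" using lip[of i 0] ni by simp
  have cont: "continuous_on UNIV u"
  proof -
    have "L-lipschitz_on UNIV u" using lip L by (intro lipschitz_onI) (auto simp: dist_real_def dist_norm)
    then show ?thesis by (rule lipschitz_on_continuous_on)
  qed
  have um[measurable]: "u \<in> borel_measurable borel" by (rule borel_measurable_continuous_onI[OF cont])
  have [measurable]: "\<phi> \<in> borel_measurable borel" "partial_deriv \<phi> i \<in> borel_measurable borel"
    using test_function_continuous[OF \<phi>] test_function_partial_continuous[OF \<phi> i] borel_measurable_continuous_onI by auto
  have Dm[measurable]: "quotient_limit u i \<in> borel_measurable borel"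
    unfolding quotient_limit_def by measurable
  obtain R where R: "0 < R" "\<And>x. R \<le> norm x \<Longrightarrow> \<phi> x = 0" "\<And>x v. R \<le> norm x \<Longrightarrow> partial_deriv \<phi> v x = 0"
    using test_function_bounded_support[OF \<phi>] by metis
  obtain B where B: "0 \<le> B" "\<And>x. \<bar>partial_deriv \<phi> i x\<bar> \<le> B"
    by (rule bounded_of_continuous_support[OF test_function_partial_continuous[OF \<phi> i] R(3)]) (auto intro: that)
  define h where "h n = 1 / real (Suc n)" for n
  have h: "0 < h n" "h n \<le> 1" for n by (auto simp: h_def)
  have deriv: "((\<lambda>t. \<phi> (x + t *\<^sub>R i)) has_real_derivative partial_deriv \<phi> i (x + t *\<^sub>R i)) (at t)" for x t
    by (rule has_real_derivative_along_line[OF test_function_differentiable[OF \<phi>]])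
  have \<phi>lip: "\<bar>\<phi> (x - t *\<^sub>R i) - \<phi> x\<bar> \<le> B * t" if "0 \<le> t" for x t
  proof -
    have "norm (\<phi> (x + (- t) *\<^sub>R i) - \<phi> (x + 0 *\<^sub>R i)) \<le> B * norm (- t - 0)"
      by (rule field_differentiable_bound[of UNIV "\<lambda>t. \<phi> (x + t *\<^sub>R i)" "\<lambda>t. partial_deriv \<phi> i (x + t *\<^sub>R i)"])
         (use deriv B in auto)
    then show ?thesis using that by simp
  qed
  have cont_sh: "continuous_on UNIV (\<lambda>x. \<phi> (x - a))" "continuous_on UNIV (\<lambda>x. u (x + a))" for a
    by (rule continuous_on_compose2[OF test_function_continuous[OF \<phi>]], auto intro!: continuous_intros)
       (rule continuous_on_compose2[OF cont], auto intro!: continuous_intros)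
  have int1: "integrable lborel (\<lambda>x. u x * \<phi> x)"
    by (rule integrable_continuous_bounded_support[of _ R]) (auto intro!: continuous_intros cont test_function_continuous[OF \<phi>] R)
  have int2: "integrable lborel (\<lambda>x. u (x + h n *\<^sub>R i) * \<phi> x)" for n
    by (rule integrable_continuous_bounded_support[of _ R]) (auto intro!: continuous_intros cont_sh test_function_continuous[OF \<phi>] R)
  have int3: "integrable lborel (\<lambda>x. u x * \<phi> (x - h n *\<^sub>R i))" for n
  proof (rule integrable_continuous_bounded_support[of _ "R + 1"])
    fix x :: 'a assume "R + 1 \<le> norm x"
    moreover have "norm x \<le> norm (x - h n *\<^sub>R i) + norm (h n *\<^sub>R i)" by (metis diff_add_cancel norm_triangle_ineq)
    moreover have "norm (h n *\<^sub>R i) \<le> 1" using h[of n] ni by simp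
    ultimately have "R \<le> norm (x - h n *\<^sub>R i)" by linarith
    then show "u x * \<phi> (x - h n *\<^sub>R i) = 0" using R by simp
  qed (auto intro!: continuous_intros cont_sh cont)
  have eq: "(\<integral>x. u x * ((\<phi> x - \<phi> (x - h n *\<^sub>R i)) / h n) \<partial>lborel) = - (\<integral>x. (u (x + h n *\<^sub>R i) - u x) / h n * \<phi> x \<partial>lborel)" for n
  proof -
    have "(\<integral>x. u x * ((\<phi> x - \<phi> (x - h n *\<^sub>R i)) / h n) \<partial>lborel) = (\<integral>x. (u x * \<phi> x - u x * \<phi> (x - h n *\<^sub>R i)) / h n \<partial>lborel)"
      by (intro Bochner_Integration.integral_cong) (auto simp: algebra_simps diff_divide_distrib)
    also have "\<dots> = ((\<integral>x. u x * \<phi> x \<partial>lborel) - (\<integral>x. u x * \<phi> (x - h n *\<^sub>R i) \<partial>lborel)) / h n"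
      using int1 int3 by simp
    also have "(\<integral>x. u x * \<phi> (x - h n *\<^sub>R i) \<partial>lborel) = (\<integral>x. u (x + h n *\<^sub>R i) * \<phi> x \<partial>lborel)"
      using lborel_integral_translate[of "\<lambda>x. u x * \<phi> (x - h n *\<^sub>R i)" "h n *\<^sub>R i"] by simp
    also have "((\<integral>x. u x * \<phi> x \<partial>lborel) - (\<integral>x. u (x + h n *\<^sub>R i) * \<phi> x \<partial>lborel)) / h n =
        - (\<integral>x. (u (x + h n *\<^sub>R i) * \<phi> x - u x * \<phi> x) / h n \<partial>lborel)"
      using int1 int2[of n] by (simp add: diff_divide_distrib)
    also have "(\<integral>x. (u (x + h n *\<^sub>R i) * \<phi> x - u x * \<phi> x) / h n \<partial>lborel) = (\<integral>x. (u (x + h n *\<^sub>R i) - u x) / h n * \<phi> x \<partial>lborel)"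
      by (intro Bochner_Integration.integral_cong) (auto simp: algebra_simps diff_divide_distrib)
    finally show ?thesis .
  qed
  \<comment> \<open>Shifts have length at most 1, hence the majorant lives on the ball of radius R +
    1.\<close>
  have lim1: "(\<lambda>n. \<integral>x. u x * ((\<phi> x - \<phi> (x - h n *\<^sub>R i)) / h n) \<partial>lborel) \<longlonglongrightarrow> (\<integral>x. u x * partial_deriv \<phi> i x \<partial>lborel)"
  proof (rule integral_dominated_convergence[where w="\<lambda>x. indicator (cball 0 (R + 1)) x *\<^sub>R (\<bar>u x\<bar> * B)"])
    show "integrable lborel (\<lambda>x. indicator (cball 0 (R + 1)) x *\<^sub>R (\<bar>u x\<bar> * B))"
      by (rule borel_integrable_compact) (auto intro!: continuous_intros continuous_on_subset[OF cont])
    show "AE x in lborel. (\<lambda>n. u x * ((\<phi> x - \<phi> (x - h n *\<^sub>R i)) / h n)) \<longlonglongrightarrow> u x * partial_deriv \<phi> i x"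
    proof (intro AE_I2 tendsto_mult_left)
      fix x
      \<comment> \<open>The quotient of \<phi> is taken backwards, so its limit is read off after
        reflecting t.\<close>
      have "((\<lambda>t. \<phi> (x + t *\<^sub>R i)) has_real_derivative partial_deriv \<phi> i x) (at (- 0))" using deriv[of x 0] by simp
      then have "((\<lambda>t. \<phi> (x + (- t) *\<^sub>R i)) has_real_derivative - partial_deriv \<phi> i x) (at 0)"
        by (subst (asm) DERIV_mirror) simp
      from LIMSEQ_difference_quotient[OF this]
      have "(\<lambda>n. - ((\<phi> (x - h n *\<^sub>R i) - \<phi> x) / h n)) \<longlonglongrightarrow> - (- partial_deriv \<phi> i x)"
        unfolding h_def by (intro tendsto_minus) simp
      then show "(\<lambda>n. (\<phi> x - \<phi> (x - h n *\<^sub>R i)) / h n) \<longlonglongrightarrow> partial_deriv \<phi> i x"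
        by (simp add: minus_divide_left)
    qed
    show "AE x in lborel. norm (u x * ((\<phi> x - \<phi> (x - h n *\<^sub>R i)) / h n)) \<le> indicator (cball 0 (R + 1)) x *\<^sub>R (\<bar>u x\<bar> * B)" for n
    proof (rule AE_I2)
      fix x
      show "norm (u x * ((\<phi> x - \<phi> (x - h n *\<^sub>R i)) / h n)) \<le> indicator (cball 0 (R + 1)) x *\<^sub>R (\<bar>u x\<bar> * B)"
      proof (cases "norm x \<le> R + 1")
        case True
        have "\<bar>(\<phi> x - \<phi> (x - h n *\<^sub>R i)) / h n\<bar> \<le> B"
          using \<phi>lip[of "h n" x] h[of n] by (simp add: abs_minus_commute field_simps)
        from mult_left_mono[OF this, of "\<bar>u x\<bar>"] show ?thesis using True by (simp add: abs_mult)
      next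
        case False
        have "norm x \<le> norm (x - h n *\<^sub>R i) + norm (h n *\<^sub>R i)" by (metis diff_add_cancel norm_triangle_ineq)
        moreover have "norm (h n *\<^sub>R i) \<le> 1" using h[of n] ni by simp
        ultimately have "R \<le> norm (x - h n *\<^sub>R i)" "R \<le> norm x" using False by linarith+
        then show ?thesis using False R by simp
      qed
    qed
  qed simp_all
  have lim2: "(\<lambda>n. \<integral>x. (u (x + h n *\<^sub>R i) - u x) / h n * \<phi> x \<partial>lborel) \<longlonglongrightarrow> (\<integral>x. quotient_limit u i x * \<phi> x \<partial>lborel)"
  proof (rule integral_dominated_convergence[where w="\<lambda>x. L * \<bar>\<phi> x\<bar>"])
    show "integrable lborel (\<lambda>x. L * \<bar>\<phi> x\<bar>)"
      by (rule integrable_continuous_bounded_support[of _ R]) (auto intro!: continuous_intros test_function_continuous[OF \<phi>] R)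
    show "AE x in lborel. (\<lambda>n. (u (x + h n *\<^sub>R i) - u x) / h n * \<phi> x) \<longlonglongrightarrow> quotient_limit u i x * \<phi> x"
    proof (rule AE_mp[OF lipschitz_partially_differentiable_AE[OF lip, of i] AE_I2], intro impI tendsto_mult_right)
      fix x assume "\<exists>D. ((\<lambda>t. u (x + t *\<^sub>R i)) has_real_derivative D) (at 0)"
      then obtain D where D: "((\<lambda>t. u (x + t *\<^sub>R i)) has_real_derivative D) (at 0)" by blast
      show "(\<lambda>n. (u (x + h n *\<^sub>R i) - u x) / h n) \<longlonglongrightarrow> quotient_limit u i x"
        unfolding quotient_limit_eq[OF D] h_def using LIMSEQ_difference_quotient[OF D] by simp
    qed
    show "AE x in lborel. norm ((u (x + h n *\<^sub>R i) - u x) / h n * \<phi> x) \<le> L * \<bar>\<phi> x\<bar>" for n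
    proof (rule AE_I2)
      fix x
      have "\<bar>u (x + h n *\<^sub>R i) - u x\<bar> \<le> L * h n" using lip[of "x + h n *\<^sub>R i" x] h[of n] ni by simp
      then have "\<bar>(u (x + h n *\<^sub>R i) - u x) / h n\<bar> \<le> L" using h[of n] by (simp add: field_simps)
      from mult_right_mono[OF this, of "\<bar>\<phi> x\<bar>"]
      show "norm ((u (x + h n *\<^sub>R i) - u x) / h n * \<phi> x) \<le> L * \<bar>\<phi> x\<bar>" by (simp add: abs_mult)
    qed
  qed simp_all
  show ?thesis
    using LIMSEQ_unique[OF lim1] tendsto_minus[OF lim2] unfolding eq by blast
qed

section \<open>Truncated maximal functions\<close>

context admissible_balls
begin

definition max_val :: "real \<Rightarrow> ('a \<Rightarrow> real) \<Rightarrow> 'a \<Rightarrow> ennreal" where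
  "max_val \<alpha> f x = (SUP (c, r)\<in>{(c, r). A x c r}. ennreal (frac_val \<alpha> f c r))"

text \<open>Radii of at least \<epsilon> keep the values below \<open>val_bound\<close>, so the real
  supremum is meaningful and the function is Lipschitz. Enlarging a ball respects the constraint,
  which suits the argument by moving and enlarging.\<close>

definition trunc_max :: "real \<Rightarrow> ('a \<Rightarrow> real) \<Rightarrow> real \<Rightarrow> 'a \<Rightarrow> real" where
  "trunc_max \<alpha> f \<epsilon> x = (SUP (c, r)\<in>{(c, r). A x c r \<and> \<epsilon> \<le> r}. frac_val \<alpha> f c r)"

definition val_bound :: "real \<Rightarrow> real \<Rightarrow> real \<Rightarrow> real \<Rightarrow> real" where
  "val_bound p F \<alpha> \<epsilon> = (unit_ball_vol (real DIM('a)) + F) * \<epsilon> powr (\<alpha> - real DIM('a) / p)"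

lemma frac_val_le_val_bound:
  fixes f :: "'a \<Rightarrow> real"
  assumes f: "Lp_bounded p F f" and p: "1 \<le> p" and \<alpha>: "\<alpha> \<le> real DIM('a) / p" and \<epsilon>: "0 < \<epsilon>" "\<epsilon> \<le> r"
  shows "frac_val \<alpha> f c r \<le> val_bound p F \<alpha> \<epsilon>"
proof -
  have F: "0 \<le> F" using f by (simp add: Lp_bounded_def)
  have "frac_val \<alpha> f c r \<le> (unit_ball_vol (real DIM('a)) + F) * r powr (\<alpha> - real DIM('a) / p)"
    by (rule frac_val_le[OF f p]) (use \<epsilon> in simp)
  also have "\<dots> \<le> val_bound p F \<alpha> \<epsilon>"
    unfolding val_bound_def using \<epsilon> \<alpha> F by (intro mult_left_mono powr_mono2') auto
  finally show ?thesis .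
qed

context
  fixes p F \<alpha> \<epsilon> :: real and f :: "'a \<Rightarrow> real"
  assumes f: "Lp_bounded p F f" and p: "1 \<le> p" and \<alpha>: "0 < \<alpha>" "\<alpha> \<le> real DIM('a) / p" and \<epsilon>: "0 < \<epsilon>"
begin

lemma trunc_max_upper:
  assumes "A x c r" "\<epsilon> \<le> r"
  shows "frac_val \<alpha> f c r \<le> trunc_max \<alpha> f \<epsilon> x"
proof -
  have "bdd_above ((\<lambda>(c, r). frac_val \<alpha> f c r) ` {(c, r). A x c r \<and> \<epsilon> \<le> r})"
    using frac_val_le_val_bound[OF f p \<alpha>(2) \<epsilon>] by (intro bdd_aboveI[of _ "val_bound p F \<alpha> \<epsilon>"]) auto
  moreover have "(c, r) \<in> {(c, r). A x c r \<and> \<epsilon> \<le> r}" using assms by auto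
  ultimately have "(case (c, r) of (c, r) \<Rightarrow> frac_val \<alpha> f c r) \<le> trunc_max \<alpha> f \<epsilon> x"
    unfolding trunc_max_def by (rule cSUP_upper[rotated])
  then show ?thesis by simp
qed

lemma trunc_max_least:
  assumes "\<And>c r. A x c r \<Longrightarrow> \<epsilon> \<le> r \<Longrightarrow> frac_val \<alpha> f c r \<le> b"
  shows "trunc_max \<alpha> f \<epsilon> x \<le> b"
  unfolding trunc_max_def
proof (rule cSUP_least)
  show "{(c, r). A x c r \<and> \<epsilon> \<le> r} \<noteq> {}" using A_center[OF \<epsilon>, of x] by auto
qed (use assms in auto)

lemma trunc_max_approx:
  assumes "b < trunc_max \<alpha> f \<epsilon> x"
  obtains c r where "A x c r" "\<epsilon> \<le> r" "b < frac_val \<alpha> f c r"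
  using trunc_max_least[of x b] assms by (meson not_le)

lemma trunc_max_nonneg: "0 \<le> trunc_max \<alpha> f \<epsilon> x"
  using trunc_max_upper[OF A_center[OF \<epsilon>] order_refl] frac_val_nonneg order_trans by blast

lemma trunc_max_le_val_bound: "trunc_max \<alpha> f \<epsilon> x \<le> val_bound p F \<alpha> \<epsilon>"
  by (rule trunc_max_least) (use frac_val_le_val_bound[OF f p \<alpha>(2) \<epsilon>] in auto)

lemma alpha_le_dim: "\<alpha> \<le> real DIM('a)"
proof -
  have "real DIM('a) / p \<le> real DIM('a)" using p by (simp add: divide_le_eq)
  then show ?thesis using \<alpha> by simp
qed

text \<open>The translated ball enlarged by |h| contains the old one, so only the factor (1 + s)
  powr (\<alpha> - d) with s = |h| / r is lost, and Bernoulli's inequality makes that loss linear in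
  s.\<close>

lemma frac_val_shift:
  assumes "0 < r"
  shows "frac_val \<alpha> f c r * (1 - real DIM('a) * (norm h / r)) \<le> frac_val \<alpha> f (c + h) (r + norm h)"
proof -
  define D where "D = DIM('a)"
  define s where "s = norm h / r"
  have s: "s \<ge> 0" using assms by (simp add: s_def)
  have rs: "r + norm h = r * (1 + s)" using assms by (simp add: s_def field_simps)
  have "1 - real D * s \<le> 1 + real D * (- (s / (1 + s)))"
    using s by (simp add: divide_le_eq distrib_left)
  also have "\<dots> \<le> (1 + (- (s / (1 + s)))) ^ D"
    using s by (intro Bernoulli_inequality) (simp add: divide_le_eq)
  also have "1 + (- (s / (1 + s))) = 1 / (1 + s)" using s by (simp add: field_simps)
  also have "(1 / (1 + s)) ^ D = (1 + s) powr (- real D)"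
    using s by (simp add: powr_minus powr_realpow power_one_over inverse_eq_divide)
  also have "\<dots> \<le> (1 + s) powr (\<alpha> - real D)"
    using s \<alpha> by (intro powr_mono) auto
  finally have 1: "1 - real D * s \<le> (1 + s) powr (\<alpha> - real D)" .
  have "ball c r \<subseteq> ball (c + h) (r + norm h)"
    by (rule ball_subset_ball_iff[THEN iffD2]) (simp add: dist_norm)
  then have "mass f c r \<le> mass f (c + h) (r + norm h)" by (rule mass_mono[OF f p])
  then have "(r powr (\<alpha> - real D) * (1 + s) powr (\<alpha> - real D)) * mass f c r \<le> frac_val \<alpha> f (c + h) (r + norm h)"
    unfolding frac_val_def rs using assms s by (simp add: powr_mult D_def mult_left_mono)
  moreover have "frac_val \<alpha> f c r * (1 - real D * s) \<le> frac_val \<alpha> f c r * (1 + s) powr (\<alpha> - real D)"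
    by (intro mult_left_mono 1 frac_val_nonneg)
  ultimately show ?thesis by (simp add: frac_val_def D_def s_def ac_simps)
qed

lemma trunc_max_shift:
  assumes A: "A x c r" and r: "\<epsilon> \<le> r"
  shows "frac_val \<alpha> f c r * (1 - real DIM('a) * (norm h / r)) \<le> trunc_max \<alpha> f \<epsilon> (x + h)"
proof -
  have "A (x + h) (c + h) (r + norm h)" by (rule A_mono[OF A_translate[OF A]]) simp
  then have "frac_val \<alpha> f (c + h) (r + norm h) \<le> trunc_max \<alpha> f \<epsilon> (x + h)"
    by (rule trunc_max_upper) (use r in \<open>simp add: add_increasing2\<close>)
  moreover have "0 < r" using A A_mem by blast
  ultimately show ?thesis using frac_val_shift[of r c h] by linarith
qed

lemma trunc_max_lipschitz:
  "\<bar>trunc_max \<alpha> f \<epsilon> x - trunc_max \<alpha> f \<epsilon> y\<bar> \<le> (val_bound p F \<alpha> \<epsilon> * real DIM('a) / \<epsilon>) * norm (x - y)"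
proof -
  define U where "U = val_bound p F \<alpha> \<epsilon>"
  have U: "0 \<le> U" using trunc_max_le_val_bound[of x] trunc_max_nonneg[of x] by (simp add: U_def)
  have "trunc_max \<alpha> f \<epsilon> x \<le> trunc_max \<alpha> f \<epsilon> y + (U * real DIM('a) / \<epsilon>) * norm (x - y)" for x y
  proof (rule trunc_max_least)
    fix c r assume A: "A x c r" and r: "\<epsilon> \<le> r"
    have r0: "r > 0" using r \<epsilon> by simp
    have "frac_val \<alpha> f c r * (real DIM('a) * (norm (y - x) / r)) \<le> U * (real DIM('a) * (norm (y - x) / \<epsilon>))"
      using frac_val_le_val_bound[OF f p \<alpha>(2) \<epsilon> r] U r \<epsilon>
      by (intro mult_mono mult_left_mono divide_left_mono) (auto simp: U_def)
    moreover have "frac_val \<alpha> f c r * (1 - real DIM('a) * (norm (y - x) / r)) \<le> trunc_max \<alpha> f \<epsilon> y"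
      using trunc_max_shift[OF A r, of "y - x"] by simp
    ultimately show "frac_val \<alpha> f c r \<le> trunc_max \<alpha> f \<epsilon> y + (U * real DIM('a) / \<epsilon>) * norm (x - y)"
      by (simp add: right_diff_distrib norm_minus_commute ac_simps)
  qed
  from this[of x y] this[of y x] show ?thesis by (simp add: U_def norm_minus_commute abs_le_iff)
qed

text \<open>A zero is a minimum, since the function is nonnegative. This covers the points that
  \<open>trunc_max_derivative_le\<close> excludes.\<close>

lemma trunc_max_derivative_0:
  assumes "((\<lambda>t. trunc_max \<alpha> f \<epsilon> (x + t *\<^sub>R v)) has_real_derivative L) (at 0)" "trunc_max \<alpha> f \<epsilon> x = 0"
  shows "L = 0"
  by (rule DERIV_local_min[OF assms(1), of 1]) (use assms(2) trunc_max_nonneg in auto)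

text \<open>Moving a nearly optimal ball along with the point, while enlarging it, costs little; this bounds the
  derivative from below in both directions, hence from above and below.\<close>

lemma trunc_max_derivative_le:
  assumes \<alpha>p: "\<alpha> < real DIM('a) / p" and v: "norm v = 1"
    and L: "((\<lambda>t. trunc_max \<alpha> f \<epsilon> (x + t *\<^sub>R v)) has_real_derivative L) (at 0)"
    and pos: "0 < trunc_max \<alpha> f \<epsilon> x"
  shows "\<exists>c r. good \<alpha> f x c r \<and> \<bar>L\<bar> \<le> 4 * real DIM('a) * (frac_val \<alpha> f c r / r)"
proof -
  define u where "u = trunc_max \<alpha> f \<epsilon>"
  define D where "D = real DIM('a)"
  have D: "D \<ge> 1" using DIM_positive[where 'a='a] by (simp add: D_def Suc_leI)
  define \<omega> where "\<omega> = unit_ball_vol D"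
  have F: "0 \<le> F" using f by (simp add: Lp_bounded_def)
  have \<omega>F: "\<omega> + F > 0" using F unit_ball_vol_pos[of D] D by (simp add: \<omega>_def add_pos_nonneg)
  have u0: "u x > 0" using pos by (simp add: u_def)
  define \<gamma> where "\<gamma> = D / p - \<alpha>"
  have \<gamma>: "\<gamma> > 0" using \<alpha>p by (simp add: \<gamma>_def D_def)
  \<comment> \<open>As \<alpha> < d / p, the values decay like r powr (- \<gamma>), so every ball
    with at least half the value u x has radius at most Rm.\<close>
  define Rm where "Rm = (2 * (\<omega> + F) / u x) powr (1 / \<gamma>)"
  have Rm: "Rm > 0" using \<omega>F u0 by (simp add: Rm_def)
  have rad: "r \<le> Rm" if "A x c r" "u x / 2 \<le> frac_val \<alpha> f c r" for c r
  proof -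
    have r: "r > 0" using A_mem that by blast
    have "u x / 2 \<le> (\<omega> + F) * r powr (- \<gamma>)"
      using frac_val_le[OF f p r, of \<alpha> c] that by (simp add: \<omega>_def D_def \<gamma>_def)
    then have "r powr \<gamma> \<le> 2 * (\<omega> + F) / u x"
      using r u0 by (simp add: powr_minus field_simps)
    then have "(r powr \<gamma>) powr (1 / \<gamma>) \<le> Rm"
      unfolding Rm_def using \<gamma> by (intro powr_mono2) auto
    then show ?thesis using r \<gamma> by (simp add: powr_powr)
  qed
  define \<kappa> where "\<kappa> = D * u x / Rm"
  have \<kappa>: "\<kappa> > 0" using D u0 Rm by (simp add: \<kappa>_def)
  obtain \<delta> where \<delta>: "\<delta> > 0" "\<And>h. h \<noteq> 0 \<Longrightarrow> \<bar>h\<bar> < \<delta> \<Longrightarrow> \<bar>(u (x + h *\<^sub>R v) - u x) / h - L\<bar> < \<kappa> / 2"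
  proof -
    have "((\<lambda>h. (u (x + h *\<^sub>R v) - u x) / h) \<longlongrightarrow> L) (at 0)"
      using L by (simp add: DERIV_def u_def)
    then show ?thesis
      using \<kappa> that unfolding LIM_eq by (metis diff_zero half_gt_zero real_norm_def)
  qed
  define t where "t = min (\<delta> / 2) (min (\<kappa> / (2 * u x)) (1 / 2))"
  have t: "0 < t" "t < \<delta>" "t * u x \<le> \<kappa> / 2" "t \<le> 1 / 2"
  proof -
    show "0 < t" "t < \<delta>" "t \<le> 1 / 2" using \<delta>(1) \<kappa> u0 by (auto simp: t_def)
    have "t * u x \<le> \<kappa> / (2 * u x) * u x" using u0 by (intro mult_right_mono) (auto simp: t_def)
    then show "t * u x \<le> \<kappa> / 2" using u0 by simp
  qed
  \<comment> \<open>The tolerance is quadratic in t so that it stays small after division by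
    t.\<close>
  have "(1 - t\<^sup>2) * u x < u x" using t u0 by simp
  then obtain c r where cr: "A x c r" "\<epsilon> \<le> r" "(1 - t\<^sup>2) * u x < frac_val \<alpha> f c r"
    unfolding u_def by (rule trunc_max_approx)
  define V where "V = frac_val \<alpha> f c r"
  have "t\<^sup>2 \<le> (1 / 2)\<^sup>2" using t by (intro power_mono) auto
  then have "1 / 2 * u x \<le> (1 - t\<^sup>2) * u x" using u0 by (intro mult_right_mono) (auto simp: power2_eq_square)
  then have V: "u x / 2 \<le> V" using cr(3) by (simp add: V_def)
  have Vu: "V \<le> u x" unfolding V_def u_def by (rule trunc_max_upper[OF cr(1,2)])
  have r: "0 < r" "r \<le> Rm" using A_mem[OF cr(1)] rad[OF cr(1)] V by (auto simp: V_def)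
  have low: "(u x - u (x + h *\<^sub>R v)) / t \<le> t * u x + D * u x / r" if h: "\<bar>h\<bar> = t" for h
  proof -
    have "V * (1 - D * (t / r)) \<le> u (x + h *\<^sub>R v)"
      using trunc_max_shift[OF cr(1,2), of "h *\<^sub>R v"] v h by (simp add: V_def D_def u_def)
    moreover have "V * (D * (t / r)) \<le> u x * (D * (t / r))"
      using Vu D t r by (intro mult_right_mono) auto
    moreover have "(1 - t\<^sup>2) * u x \<le> V" using cr(3) by (simp add: V_def)
    ultimately have "u x - u (x + h *\<^sub>R v) \<le> t\<^sup>2 * u x + u x * (D * (t / r))"
      by (simp add: algebra_simps)
    then have "(u x - u (x + h *\<^sub>R v)) / t \<le> (t\<^sup>2 * u x + u x * (D * (t / r))) / t"
      using t by (intro divide_right_mono) auto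
    also have "\<dots> = t * u x + D * u x / r" using t by (simp add: power2_eq_square field_simps)
    finally show ?thesis .
  qed
  have q1: "\<bar>(u (x + t *\<^sub>R v) - u x) / t - L\<bar> < \<kappa> / 2" using \<delta>(2)[of t] t by simp
  have q2: "\<bar>(u (x + (- t) *\<^sub>R v) - u x) / (- t) - L\<bar> < \<kappa> / 2" using \<delta>(2)[of "- t"] t by simp
  have e1: "(u (x + t *\<^sub>R v) - u x) / t = - ((u x - u (x + t *\<^sub>R v)) / t)"
    by (metis minus_diff_eq minus_divide_left)
  have e2: "(u (x + (- t) *\<^sub>R v) - u x) / (- t) = (u x - u (x + (- t) *\<^sub>R v)) / t"
    by (metis minus_diff_eq minus_divide_divide)
  have "\<bar>L\<bar> \<le> t * u x + D * u x / r + \<kappa> / 2"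
  proof -
    have "\<bar>L\<bar> \<le> E + k" if "\<bar>- a - L\<bar> < k" "\<bar>b - L\<bar> < k" "a \<le> E" "b \<le> E" for a b E k :: real
      using that by linarith
    then show ?thesis using q1 q2 low[of t] low[of "- t"] t(1) unfolding e1 e2 by simp
  qed
  also have "\<dots> \<le> \<kappa> + D * u x / r" using t by simp
  also have "\<kappa> \<le> D * u x / r" unfolding \<kappa>_def using r D u0 by (intro divide_left_mono) auto
  finally have "\<bar>L\<bar> \<le> 2 * (D * u x / r)" by simp
  also have "\<dots> \<le> 2 * (D * (2 * V) / r)"
    using V D r by (intro mult_left_mono divide_right_mono) auto
  finally have "\<bar>L\<bar> \<le> 4 * D * (V / r)" by simp
  moreover have "good \<alpha> f x c r"
    unfolding good_def
  proof (intro conjI allI impI)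
    show "A x c r" by (rule cr)
    have "V > 0" using V u0 by simp
    then show "0 < mass f c r" using mass_nonneg[of f c r] unfolding V_def frac_val_def
      by (metis less_eq_real_def mult_zero_right less_irrefl)
    fix c' r' assume "A x c' r' \<and> r \<le> r'"
    then have "frac_val \<alpha> f c' r' \<le> u x" unfolding u_def using cr(2) by (intro trunc_max_upper) auto
    then show "frac_val \<alpha> f c' r' \<le> 2 * frac_val \<alpha> f c r" using V by (simp add: V_def)
  qed
  ultimately show ?thesis unfolding V_def D_def by blast
qed

end

end

section \<open>Finiteness and local integrability of the maximal function through dyadic
  radii\<close>

lemma dyadic_radius_exists:
  fixes r :: real
  assumes "0 < r" "r \<le> 1"
  shows "\<exists>k. (1 / 2) ^ Suc k < r \<and> r \<le> (1 / 2) ^ k"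
proof -
  have "1 \<le> 1 / r" using assms by simp
  then obtain k where "2 ^ k \<le> 1 / r" "1 / r < 2 ^ Suc k" using dyadic_level_exists by blast
  then have "(1 / 2) ^ Suc k < r" "r \<le> (1 / 2) ^ k"
    using assms by (auto simp: field_simps power_divide)
  then show ?thesis by blast
qed

text \<open>Majorant of all values with radius in (2^(-k-1), 2^(-k)]: the power is taken at the
  smaller end, where it is largest for \<alpha> \<le> d, and a ball containing x lies in the ball
  about x of twice the radius.\<close>

definition shell :: "real \<Rightarrow> ('a::euclidean_space \<Rightarrow> real) \<Rightarrow> nat \<Rightarrow> 'a \<Rightarrow> ennreal" where
  "shell \<alpha> f k x = ennreal (((1 / 2) ^ Suc k) powr (\<alpha> - real DIM('a))) *
     (\<integral>\<^sup>+y. (if dist x y < 2 * (1 / 2) ^ k then ennreal \<bar>f y\<bar> else 0) \<partial>lborel)"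

lemma shell_measurable:
  assumes [measurable]: "f \<in> borel_measurable borel"
  shows "shell \<alpha> f k \<in> borel_measurable borel"
  unfolding shell_def by measurable

text \<open>After exchanging the integrals each y is counted on a ball of volume of order 2^(-k d);
  times the factor of order 2^(k (d - \<alpha>)) this leaves 2^(-k \<alpha>).\<close>

lemma nn_integral_shell_le:
  fixes f :: "'a::euclidean_space \<Rightarrow> real"
  assumes f: "Lp_bounded p F f" and p: "1 \<le> p"
  shows "(\<integral>\<^sup>+x\<in>ball 0 R. shell \<alpha> f k x \<partial>lborel) \<le>
     ennreal (unit_ball_vol (real DIM('a)) * 2 powr (2 * real DIM('a) - \<alpha>) * mass f 0 (R + 2) * (2 powr (- \<alpha>)) ^ k)"
proof -
  have [measurable]: "f \<in> borel_measurable borel" using f by (simp add: Lp_bounded_def)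
  define \<rho> :: real where "\<rho> = 2 * (1 / 2) ^ k"
  have \<rho>: "0 < \<rho>" "\<rho> \<le> 2" by (auto simp: \<rho>_def power_le_one)
  define w where "w = ((1 / 2) ^ Suc k) powr (\<alpha> - real DIM('a))"
  define b where "b = unit_ball_vol (real DIM('a)) * \<rho> ^ DIM('a)"
  have b: "0 \<le> b" using \<rho> by (simp add: b_def)
  have "(\<integral>\<^sup>+x\<in>ball 0 R. shell \<alpha> f k x \<partial>lborel) =
     (\<integral>\<^sup>+x. ennreal w * (\<integral>\<^sup>+y. (if dist x y < \<rho> then ennreal \<bar>f y\<bar> else 0) * indicator (ball 0 R) x \<partial>lborel) \<partial>lborel)"
    unfolding shell_def w_def[symmetric] \<rho>_def[symmetric]
    by (intro nn_integral_cong) (simp add: nn_integral_multc mult.assoc)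
  also have "\<dots> = ennreal w * (\<integral>\<^sup>+x. (\<integral>\<^sup>+y. (if dist x y < \<rho> then ennreal \<bar>f y\<bar> else 0) * indicator (ball 0 R) x \<partial>lborel) \<partial>lborel)"
    by (rule nn_integral_cmult) measurable
  also have "(\<integral>\<^sup>+x. (\<integral>\<^sup>+y. (if dist x y < \<rho> then ennreal \<bar>f y\<bar> else 0) * indicator (ball 0 R) x \<partial>lborel) \<partial>lborel) =
      (\<integral>\<^sup>+y. (\<integral>\<^sup>+x. (if dist x y < \<rho> then ennreal \<bar>f y\<bar> else 0) * indicator (ball 0 R) x \<partial>lborel) \<partial>lborel)"
    by (rule lborel_pair.Fubini') measurable
  also have "\<dots> \<le> (\<integral>\<^sup>+y. ennreal b * (ennreal \<bar>f y\<bar> * indicator (ball 0 (R + 2)) y) \<partial>lborel)"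
  proof (rule nn_integral_mono)
    fix y
    have "(\<integral>\<^sup>+x. (if dist x y < \<rho> then ennreal \<bar>f y\<bar> else 0) * indicator (ball 0 R) x \<partial>lborel) \<le>
       (\<integral>\<^sup>+x. (ennreal \<bar>f y\<bar> * indicator (ball 0 (R + 2)) y) * indicator (ball y \<rho>) x \<partial>lborel)"
    proof (rule nn_integral_mono)
      fix x
      have "norm y < R + 2" if "dist x y < \<rho>" "norm x < R"
        using that \<rho> norm_triangle_sub[of y x] by (simp add: dist_norm norm_minus_commute)
      then show "(if dist x y < \<rho> then ennreal \<bar>f y\<bar> else 0) * indicator (ball 0 R) x \<le>
          (ennreal \<bar>f y\<bar> * indicator (ball 0 (R + 2)) y) * indicator (ball y \<rho>) x"
        by (auto split: split_indicator simp: dist_commute)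
    qed
    also have "\<dots> = (ennreal \<bar>f y\<bar> * indicator (ball 0 (R + 2)) y) * ennreal b"
      using \<rho> by (subst nn_integral_cmult_indicator) (auto simp: emeasure_ball b_def)
    finally show "(\<integral>\<^sup>+x. (if dist x y < \<rho> then ennreal \<bar>f y\<bar> else 0) * indicator (ball 0 R) x \<partial>lborel) \<le>
        ennreal b * (ennreal \<bar>f y\<bar> * indicator (ball 0 (R + 2)) y)"
      by (simp only: mult.commute)
  qed
  also have "\<dots> = ennreal b * ennreal (mass f 0 (R + 2))"
    unfolding ennreal_mass[OF f p] by (rule nn_integral_cmult) measurable
  finally have "(\<integral>\<^sup>+x\<in>ball 0 R. shell \<alpha> f k x \<partial>lborel) \<le> ennreal w * (ennreal b * ennreal (mass f 0 (R + 2)))"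
    by (simp add: mult_left_mono)
  also have "\<dots> = ennreal (w * (b * mass f 0 (R + 2)))"
    using b by (simp add: ennreal_mult mass_nonneg w_def)
  also have "w * (b * mass f 0 (R + 2)) = unit_ball_vol (real DIM('a)) * 2 powr (2 * real DIM('a) - \<alpha>) * mass f 0 (R + 2) * (2 powr (- \<alpha>)) ^ k"
  proof -
    define d where "d = real DIM('a)"
    have half: "(1 / 2) ^ j = 2 powr (- real j)" for j :: nat
      by (simp add: powr_minus powr_realpow power_one_over inverse_eq_divide)
    have "w = 2 powr (- real (Suc k) * (\<alpha> - d))"
      unfolding w_def half powr_powr d_def by simp
    moreover have "\<rho> ^ DIM('a) = 2 powr ((1 - real k) * d)"
    proof -
      have "\<rho> = 2 powr (1 - real k)" unfolding \<rho>_def half by (simp add: powr_diff powr_minus field_simps)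
      then show ?thesis by (simp add: d_def powr_realpow[symmetric] powr_powr)
    qed
    moreover have "(2 powr (- \<alpha>)) ^ k = 2 powr (- \<alpha> * real k)"
      by (simp add: powr_realpow[symmetric] powr_powr)
    moreover have "2 powr (- real (Suc k) * (\<alpha> - d)) * 2 powr ((1 - real k) * d) = 2 powr (2 * d - \<alpha>) * 2 powr (- \<alpha> * real k)"
      by (simp add: powr_add[symmetric] algebra_simps)
    ultimately show ?thesis
      by (simp only: b_def d_def[symmetric] ac_simps)
  qed
  finally show ?thesis .
qed

text \<open>A geometric series with ratio 2 powr (- \<alpha>) < 1: positivity of \<alpha> makes
  small balls negligible on average.\<close>

lemma nn_integral_sum_shell_finite:
  fixes f :: "'a::euclidean_space \<Rightarrow> real"
  assumes f: "Lp_bounded p F f" and p: "1 \<le> p" and \<alpha>: "0 < \<alpha>"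
  shows "(\<integral>\<^sup>+x\<in>ball 0 R. (\<Sum>k. shell \<alpha> f k x) \<partial>lborel) < \<infinity>"
proof -
  have fm: "f \<in> borel_measurable borel" using f by (simp add: Lp_bounded_def)
  note [measurable] = shell_measurable[OF fm]
  define B where "B = unit_ball_vol (real DIM('a)) * 2 powr (2 * real DIM('a) - \<alpha>) * mass f 0 (R + 2)"
  have B: "B \<ge> 0" by (simp add: B_def mass_nonneg)
  define \<theta> where "\<theta> = 2 powr (- \<alpha>)"
  have \<theta>: "0 < \<theta>" "\<theta> < 1" using \<alpha> powr_less_mono[of "- \<alpha>" 0 2] by (auto simp: \<theta>_def)
  have "(\<integral>\<^sup>+x\<in>ball 0 R. (\<Sum>k. shell \<alpha> f k x) \<partial>lborel) = (\<Sum>k. \<integral>\<^sup>+x\<in>ball 0 R. shell \<alpha> f k x \<partial>lborel)"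
    by (subst nn_integral_suminf[symmetric]) auto
  also have "\<dots> \<le> (\<Sum>k. ennreal (B * \<theta> ^ k))"
    by (intro suminf_le summableI) (use nn_integral_shell_le[OF f p] in \<open>auto simp: B_def \<theta>_def\<close>)
  also have "\<dots> = ennreal (\<Sum>k. B * \<theta> ^ k)"
    by (rule suminf_ennreal2) (use B \<theta> in \<open>auto intro!: summable_mult summable_geometric\<close>)
  also have "\<dots> < \<infinity>" by simp
  finally show ?thesis .
qed

context admissible_balls
begin

context
  fixes p F \<alpha> :: real and f :: "'a \<Rightarrow> real"
  assumes f: "Lp_bounded p F f" and p: "1 \<le> p" and \<alpha>: "0 < \<alpha>" "\<alpha> \<le> real DIM('a) / p"
begin

lemma frac_val_le_shell:
  assumes A: "A x c r" and r: "(1 / 2) ^ Suc k < r" "r \<le> (1 / 2) ^ k"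
  shows "ennreal (frac_val \<alpha> f c r) \<le> shell \<alpha> f k x"
proof -
  have \<alpha>d: "\<alpha> \<le> real DIM('a)" by (rule alpha_le_dim[OF f p \<alpha> zero_less_one])
  have "ennreal (frac_val \<alpha> f c r) = ennreal (r powr (\<alpha> - real DIM('a))) * ennreal (mass f c r)"
    by (simp add: frac_val_def ennreal_mult mass_nonneg)
  also have "\<dots> \<le> shell \<alpha> f k x"
    unfolding shell_def
  proof (intro mult_mono)
    show "ennreal (r powr (\<alpha> - real DIM('a))) \<le> ennreal (((1 / 2) ^ Suc k) powr (\<alpha> - real DIM('a)))"
      using r \<alpha>d by (intro ennreal_leI powr_mono2') auto
    show "ennreal (mass f c r) \<le> (\<integral>\<^sup>+y. (if dist x y < 2 * (1 / 2) ^ k then ennreal \<bar>f y\<bar> else 0) \<partial>lborel)"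
      unfolding ennreal_mass[OF f p]
    proof (rule nn_integral_mono)
      fix y
      have "dist x y < 2 * (1 / 2) ^ k" if "dist c y < r"
        using that A_mem[OF A] r(2) dist_triangle[of x y c] by linarith
      then show "ennreal \<bar>f y\<bar> * indicator (ball c r) y \<le> (if dist x y < 2 * (1 / 2) ^ k then ennreal \<bar>f y\<bar> else 0)"
        by (auto split: split_indicator)
    qed
  qed auto
  finally show ?thesis .
qed

lemma max_val_upper: "A x c r \<Longrightarrow> ennreal (frac_val \<alpha> f c r) \<le> max_val \<alpha> f x"
  unfolding max_val_def by (rule SUP_upper2[of "(c, r)"]) auto

lemma max_val_least: "(\<And>c r. A x c r \<Longrightarrow> ennreal (frac_val \<alpha> f c r) \<le> b) \<Longrightarrow> max_val \<alpha> f x \<le> b"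
  unfolding max_val_def by (rule SUP_least) auto

text \<open>Radii of at least 1 are controlled by the L^p bound; a smaller radius falls into one
  dyadic shell, and a single term is at most the sum.\<close>

lemma max_val_le_shells:
  "max_val \<alpha> f x \<le> ennreal (val_bound p F \<alpha> 1) + (\<Sum>k. shell \<alpha> f k x)"
proof (rule max_val_least)
  fix c r assume A: "A x c r"
  then have r: "0 < r" using A_mem by blast
  show "ennreal (frac_val \<alpha> f c r) \<le> ennreal (val_bound p F \<alpha> 1) + (\<Sum>k. shell \<alpha> f k x)"
  proof (cases "1 \<le> r")
    case True
    have "ennreal (frac_val \<alpha> f c r) \<le> ennreal (val_bound p F \<alpha> 1)"
      by (intro ennreal_leI frac_val_le_val_bound[OF f p \<alpha>(2)]) (use True in auto)
    then show ?thesis by (rule add_increasing2[OF zero_le])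
  next
    case False
    then obtain k where "(1 / 2) ^ Suc k < r" "r \<le> (1 / 2) ^ k" using dyadic_radius_exists[of r] r by auto
    from frac_val_le_shell[OF A this] have "ennreal (frac_val \<alpha> f c r) \<le> shell \<alpha> f k x" .
    also have "\<dots> \<le> (\<Sum>k. shell \<alpha> f k x)"
      using sum_le_suminf[of "\<lambda>k. shell \<alpha> f k x" "{k}"] by (simp add: summableI)
    finally show ?thesis by (rule add_increasing[OF zero_le])
  qed
qed

abbreviation (input) tm :: "nat \<Rightarrow> 'a \<Rightarrow> real" where
  "tm n \<equiv> trunc_max \<alpha> f (1 / Suc n)"

lemma tm_le_max_val: "ennreal (tm n x) \<le> max_val \<alpha> f x"
proof -
  have e: "0 < 1 / real (Suc n)" by simp
  show ?thesis
  proof (cases "max_val \<alpha> f x = \<infinity>")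
    case False
    then obtain m where m: "max_val \<alpha> f x = ennreal m" "0 \<le> m"
      by (metis ennreal_cases infinity_ennreal_def)
    have "tm n x \<le> m"
    proof (rule trunc_max_least[OF f p \<alpha> e])
      fix c r assume "A x c r"
      from max_val_upper[OF this] show "frac_val \<alpha> f c r \<le> m" using m by simp
    qed
    then show ?thesis using m by (simp add: ennreal_leI)
  qed simp
qed

lemma tm_mono:
  assumes "n \<le> m"
  shows "tm n x \<le> tm m x"
proof (rule trunc_max_least[OF f p \<alpha>])
  fix c r assume "A x c r" "1 / real (Suc n) \<le> r"
  moreover have "1 / real (Suc m) \<le> 1 / real (Suc n)" using assms by (simp add: field_simps)
  ultimately show "frac_val \<alpha> f c r \<le> tm m x" by (intro trunc_max_upper[OF f p \<alpha>]) auto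
qed simp

lemma tm_continuous: "continuous_on UNIV (tm n)"
proof -
  have e: "0 < 1 / real (Suc n)" by simp
  note lip = trunc_max_lipschitz[OF f p \<alpha> e]
  define L where "L = val_bound p F \<alpha> (1 / real (Suc n)) * real DIM('a) / (1 / real (Suc n))"
  have "0 \<le> L"
    using trunc_max_le_val_bound[OF f p \<alpha> e, of 0] trunc_max_nonneg[OF f p \<alpha> e, of 0] by (simp add: L_def)
  then have "L-lipschitz_on UNIV (tm n)"
    using lip by (intro lipschitz_onI) (auto simp: dist_real_def dist_norm L_def)
  then show ?thesis by (rule lipschitz_on_continuous_on)
qed

lemma tm_measurable: "tm n \<in> borel_measurable borel"
  by (rule borel_measurable_continuous_onI[OF tm_continuous])

lemma max_val_eq_SUP: "max_val \<alpha> f x = (SUP n. ennreal (tm n x))"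
proof (rule antisym)
  show "max_val \<alpha> f x \<le> (SUP n. ennreal (tm n x))"
  proof (rule max_val_least)
    fix c r assume A: "A x c r"
    then have "0 < r" using A_mem by blast
    then obtain n where "inverse (real (Suc n)) < r" using reals_Archimedean by blast
    then have "frac_val \<alpha> f c r \<le> tm n x"
      by (intro trunc_max_upper[OF f p \<alpha> _ A]) (auto simp: inverse_eq_divide)
    then show "ennreal (frac_val \<alpha> f c r) \<le> (SUP n. ennreal (tm n x))"
      by (intro SUP_upper2[of n]) (auto intro: ennreal_leI)
  qed
  show "(SUP n. ennreal (tm n x)) \<le> max_val \<alpha> f x" by (intro SUP_least tm_le_max_val)
qed

lemma max_val_measurable: "max_val \<alpha> f \<in> borel_measurable borel"
proof -
  note [measurable] = tm_measurable
  have eq: "max_val \<alpha> f = (\<lambda>x. SUP n. ennreal (tm n x))" using max_val_eq_SUP by auto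
  show ?thesis unfolding eq by measurable
qed

lemma AE_shells_finite: "AE x in lborel. (\<Sum>k. shell \<alpha> f k x) < \<infinity>"
proof -
  have fm: "f \<in> borel_measurable borel" using f by (simp add: Lp_bounded_def)
  note [measurable] = shell_measurable[OF fm]
  have "AE x in lborel. (\<Sum>k. shell \<alpha> f k x) * indicator (ball 0 (real n)) x \<noteq> \<infinity>" for n :: nat
    by (rule nn_integral_PInf_AE) (use nn_integral_sum_shell_finite[OF f p \<alpha>(1), of "real n"] in auto)
  then have "AE x in lborel. \<forall>n. (\<Sum>k. shell \<alpha> f k x) * indicator (ball 0 (real n)) x \<noteq> \<infinity>"
    by (simp add: AE_all_countable)
  then show ?thesis
  proof (rule AE_mp[OF _ AE_I2], intro impI)
    fix x assume *: "\<forall>n. (\<Sum>k. shell \<alpha> f k x) * indicator (ball 0 (real n)) x \<noteq> \<infinity>"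
    obtain n where "norm x < real n" using reals_Archimedean2 by blast
    then have "indicator (ball 0 (real n)) x = (1 :: ennreal)" by simp
    with *[rule_format, of n] show "(\<Sum>k. shell \<alpha> f k x) < \<infinity>" by (simp add: less_top)
  qed
qed

lemma max_val_finite:
  assumes "(\<Sum>k. shell \<alpha> f k x) < \<infinity>"
  shows "max_val \<alpha> f x < \<infinity>"
  using max_val_le_shells[of x] assms by (metis ennreal_add_less_top ennreal_less_top infinity_ennreal_def le_less_trans)

text \<open>The terms of a convergent series tend to 0, so balls of small radius stay below half of
  a positive supremum and cannot influence it. From some n on the restriction on the radii is
  therefore invisible at x.\<close>

lemma max_val_eventually_attained:
  assumes S: "(\<Sum>k. shell \<alpha> f k x) < \<infinity>"
  shows "\<exists>n0. \<forall>n\<ge>n0. ennreal (tm n x) = max_val \<alpha> f x"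
proof -
  have e: "0 < 1 / real (Suc n)" for n by simp
  obtain m where m: "max_val \<alpha> f x = ennreal m" "0 \<le> m"
    using max_val_finite[OF S] by (metis ennreal_cases infinity_ennreal_def less_irrefl)
  have tmm: "tm n x \<le> m" for n using tm_le_max_val[of n x] m by simp
  show ?thesis
  proof (cases "m = 0")
    case True
    then have "tm n x = 0" for n using tmm[of n] trunc_max_nonneg[OF f p \<alpha> e, of n x] by simp
    then show ?thesis using m True by auto
  next
    case False
    have "(\<lambda>k. shell \<alpha> f k x) \<longlonglongrightarrow> 0"
    proof -
      have "\<exists>s. shell \<alpha> f k x = ennreal s \<and> 0 \<le> s" for k
      proof -
        have "shell \<alpha> f k x \<le> (\<Sum>k. shell \<alpha> f k x)"
          using sum_le_suminf[of "\<lambda>k. shell \<alpha> f k x" "{k}"] by (simp add: summableI)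
        then have "shell \<alpha> f k x < \<infinity>" using S by (rule le_less_trans)
        then show ?thesis by (metis ennreal_cases infinity_ennreal_def less_irrefl)
      qed
      then obtain s where s: "\<And>k. shell \<alpha> f k x = ennreal (s k)" "\<And>k. 0 \<le> s k" by metis
      have "summable s"
        by (rule summable_suminf_not_top) (use s S in auto)
      then have "s \<longlonglongrightarrow> 0" by (rule summable_LIMSEQ_zero)
      then have "(\<lambda>k. ennreal (s k)) \<longlonglongrightarrow> ennreal 0" by (rule tendsto_ennrealI)
      then show ?thesis by (simp add: s(1))
    qed
    then have "eventually (\<lambda>k. shell \<alpha> f k x < ennreal (m / 2)) sequentially"
      using False m by (intro order_tendstoD) auto
    then obtain k0 where k0: "\<And>k. k0 \<le> k \<Longrightarrow> shell \<alpha> f k x < ennreal (m / 2)"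
      by (auto simp: eventually_sequentially)
    \<comment> \<open>Radii below 1 / (n0 + 1) belong to shells of index at least k0, where the
      values are below m / 2.\<close>
    obtain n0 where n0: "inverse (real (Suc n0)) < (1 / 2) ^ k0" using reals_Archimedean[of "(1 / 2) ^ k0"] by auto
    have "m \<le> tm n x" if n: "n0 \<le> n" for n
    proof -
      have le: "frac_val \<alpha> f c r \<le> max (tm n x) (m / 2)" if A: "A x c r" for c r
      proof (cases "1 / Suc n \<le> r")
        case True
        then show ?thesis using trunc_max_upper[OF f p \<alpha> e A True] by simp
      next
        case False
        have r0: "0 < r" using A A_mem by blast
        have "1 / real (Suc n) \<le> 1 / real (Suc n0)" using n by (simp add: field_simps)
        then have rk: "r < (1 / 2) ^ k0" using False n0 by (simp add: inverse_eq_divide)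
        moreover have "(1 / 2 :: real) ^ k0 \<le> 1" by (simp add: power_le_one)
        ultimately have "r \<le> 1" by linarith
        then obtain k where k: "(1 / 2) ^ Suc k < r" "r \<le> (1 / 2) ^ k" using dyadic_radius_exists[OF r0] by blast
        have "(1 / 2 :: real) ^ Suc k < (1 / 2) ^ k0" using k rk by linarith
        then have "k0 < Suc k" by (subst (asm) power_strict_decreasing_iff) auto
        then have "ennreal (frac_val \<alpha> f c r) < ennreal (m / 2)"
          using frac_val_le_shell[OF A k] k0[of k] by auto
        then show ?thesis by (simp add: ennreal_less_iff frac_val_nonneg)
      qed
      have "max_val \<alpha> f x \<le> ennreal (max (tm n x) (m / 2))"
        by (rule max_val_least) (use le in \<open>auto intro: ennreal_leI\<close>)
      then have "m \<le> max (tm n x) (m / 2)" using m(2) unfolding m(1) by (subst (asm) ennreal_le_iff) auto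
      then show ?thesis using False m by auto
    qed
    then have "tm n x = m" if "n0 \<le> n" for n using tmm[of n] that by (simp add: antisym)
    then show ?thesis using m by auto
  qed
qed

end

end

section \<open>Weak gradient of the maximal function\<close>

text \<open>Borel form of local integrability, tested on balls; the analysis is done with
  \<open>lborel\<close> and carried over to \<open>lebesgue\<close> afterwards.\<close>

definition locally_finite_integral :: "('a::euclidean_space \<Rightarrow> real) \<Rightarrow> bool" where
  "locally_finite_integral k \<longleftrightarrow> k \<in> borel_measurable borel \<and> (\<forall>R. (\<integral>\<^sup>+x\<in>ball 0 R. ennreal \<bar>k x\<bar> \<partial>lborel) < \<infinity>)"

lemma locally_finite_integralI_AE:
  fixes k :: "'a::euclidean_space \<Rightarrow> real"
  assumes "k \<in> borel_measurable borel" and k': "locally_finite_integral k'" and le: "AE x in lborel. \<bar>k x\<bar> \<le> k' x"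
  shows "locally_finite_integral k"
proof -
  have le': "(\<integral>\<^sup>+x\<in>ball 0 R. ennreal \<bar>k x\<bar> \<partial>lborel) \<le> (\<integral>\<^sup>+x\<in>ball 0 R. ennreal \<bar>k' x\<bar> \<partial>lborel)" for R
    by (rule nn_integral_mono_AE) (use le in \<open>auto intro!: ennreal_leI split: split_indicator\<close>)
  show ?thesis unfolding locally_finite_integral_def
  proof (intro conjI allI assms(1))
    fix R
    have "(\<integral>\<^sup>+x\<in>ball 0 R. ennreal \<bar>k' x\<bar> \<partial>lborel) < \<infinity>"
      using k' by (simp add: locally_finite_integral_def)
    with le'[of R] show "(\<integral>\<^sup>+x\<in>ball 0 R. ennreal \<bar>k x\<bar> \<partial>lborel) < \<infinity>" by (rule le_less_trans)
  qed
qed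

lemma locally_finite_integral_times_integrable:
  fixes k \<phi> :: "'a::euclidean_space \<Rightarrow> real"
  assumes k: "locally_finite_integral k" and \<phi>: "continuous_on UNIV \<phi>" "\<And>x. R \<le> norm x \<Longrightarrow> \<phi> x = 0"
  shows "integrable lborel (\<lambda>x. k x * \<phi> x)"
proof -
  have [measurable]: "k \<in> borel_measurable borel" "\<phi> \<in> borel_measurable borel"
    using k \<phi> borel_measurable_continuous_onI by (auto simp: locally_finite_integral_def)
  obtain B where B: "0 \<le> B" "\<And>x. \<bar>\<phi> x\<bar> \<le> B"
    by (rule bounded_of_continuous_support[OF \<phi>]) (auto intro: that)
  have "(\<integral>\<^sup>+x. ennreal (norm (k x * \<phi> x)) \<partial>lborel) \<le> (\<integral>\<^sup>+x. ennreal B * (ennreal \<bar>k x\<bar> * indicator (ball 0 R) x) \<partial>lborel)"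
  proof (rule nn_integral_mono)
    fix x
    show "ennreal (norm (k x * \<phi> x)) \<le> ennreal B * (ennreal \<bar>k x\<bar> * indicator (ball 0 R) x)"
    proof (cases "norm x < R")
      case True
      have "ennreal (norm (k x * \<phi> x)) \<le> ennreal (B * \<bar>k x\<bar>)"
        using mult_left_mono[OF B(2)[of x], of "\<bar>k x\<bar>"] by (intro ennreal_leI) (simp add: abs_mult mult.commute)
      then show ?thesis using True B(1) by (simp add: ennreal_mult)
    next
      case False
      then show ?thesis using \<phi>(2)[of x] by simp
    qed
  qed
  also have "\<dots> = ennreal B * (\<integral>\<^sup>+x\<in>ball 0 R. ennreal \<bar>k x\<bar> \<partial>lborel)"
    by (rule nn_integral_cmult) measurable
  also have "\<dots> < \<infinity>" using k by (simp add: locally_finite_integral_def ennreal_mult_less_top)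
  finally show ?thesis by (intro integrableI_bounded) auto
qed

lemma locally_finite_integral_imp_locally_integrable:
  fixes k :: "'a::euclidean_space \<Rightarrow> real"
  assumes k: "locally_finite_integral k"
  shows "locally_integrable k"
  unfolding locally_integrable_def
proof (intro conjI allI impI)
  have km[measurable]: "k \<in> borel_measurable borel" using k by (simp add: locally_finite_integral_def)
  show "k \<in> borel_measurable lebesgue" using km by (intro measurable_completion) simp
  fix K :: "'a set" assume K: "compact K"
  then have [measurable]: "K \<in> sets borel" by (simp add: borel_compact)
  obtain R where R: "K \<subseteq> ball 0 R" using K compact_imp_bounded bounded_subset_ballD by blast
  have "(\<integral>\<^sup>+x. ennreal (norm (indicator K x *\<^sub>R k x)) \<partial>lborel) \<le> (\<integral>\<^sup>+x\<in>ball 0 R. ennreal \<bar>k x\<bar> \<partial>lborel)"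
    by (intro nn_integral_mono) (use R in \<open>auto split: split_indicator\<close>)
  also have "\<dots> < \<infinity>" using k by (simp add: locally_finite_integral_def)
  finally have "integrable lborel (\<lambda>x. indicator K x *\<^sub>R k x)" by (intro integrableI_bounded) auto
  then show "set_integrable lebesgue K k" unfolding set_integrable_def by (subst integrable_completion) auto
qed

text \<open>All integrands are Borel, so completing the measure leaves the integrals
  unchanged.\<close>

lemma has_weak_gradient_lborelI:
  fixes u :: "'a::euclidean_space \<Rightarrow> real"
  assumes u: "locally_finite_integral u" and H: "\<And>i. i \<in> Basis \<Longrightarrow> locally_finite_integral (\<lambda>x. H x \<bullet> i)"
    and eq: "\<And>\<phi> i. test_function \<phi> \<Longrightarrow> i \<in> Basis \<Longrightarrow>
        (\<integral>x. u x * partial_deriv \<phi> i x \<partial>lborel) = - (\<integral>x. (H x \<bullet> i) * \<phi> x \<partial>lborel)"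
  shows "has_weak_gradient u H"
  unfolding has_weak_gradient_def
proof (intro conjI ballI allI impI)
  show "locally_integrable u" using u by (rule locally_finite_integral_imp_locally_integrable)
  show "locally_integrable (\<lambda>x. H x \<bullet> i)" if "i \<in> Basis" for i
    using H[OF that] by (rule locally_finite_integral_imp_locally_integrable)
  fix \<phi> :: "'a \<Rightarrow> real" and i :: 'a assume \<phi>: "test_function \<phi>" and i: "i \<in> Basis"
  have [measurable]: "u \<in> borel_measurable borel" "(\<lambda>x. H x \<bullet> i) \<in> borel_measurable borel"
    using u H[OF i] by (auto simp: locally_finite_integral_def)
  have [measurable]: "\<phi> \<in> borel_measurable borel" "partial_deriv \<phi> i \<in> borel_measurable borel"
    using test_function_continuous[OF \<phi>] test_function_partial_continuous[OF \<phi> i] borel_measurable_continuous_onI by auto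
  show "(\<integral>x. u x * partial_deriv \<phi> i x \<partial>lebesgue) = - (\<integral>x. (H x \<bullet> i) * \<phi> x \<partial>lebesgue)"
    using eq[OF \<phi> i] by (subst (1 2) integral_completion) auto
qed

lemma le_one_plus_powr:
  fixes y q :: real
  assumes "0 \<le> y" "1 \<le> q"
  shows "y \<le> 1 + y powr q"
  using le_young[of 1 y q] assms by simp

context admissible_balls
begin

lemma locally_finite_max_val:
  assumes f: "Lp_bounded p F f" and p: "1 \<le> p" and \<alpha>: "0 < \<alpha>" "\<alpha> \<le> real DIM('a) / p"
  shows "locally_finite_integral (\<lambda>x. enn2real (max_val \<alpha> f x))"
  unfolding locally_finite_integral_def
proof (intro conjI allI)
  note [measurable] = max_val_measurable[OF f p \<alpha>]
  show "(\<lambda>x. enn2real (max_val \<alpha> f x)) \<in> borel_measurable borel" by measurable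
  have fm: "f \<in> borel_measurable borel" using f by (simp add: Lp_bounded_def)
  note [measurable] = shell_measurable[OF fm]
  fix R
  have "(\<integral>\<^sup>+x\<in>ball 0 R. ennreal \<bar>enn2real (max_val \<alpha> f x)\<bar> \<partial>lborel) \<le>
     (\<integral>\<^sup>+x. ennreal (val_bound p F \<alpha> 1) * indicator (ball 0 R) x + (\<Sum>k. shell \<alpha> f k x) * indicator (ball 0 R) x \<partial>lborel)"
  proof (rule nn_integral_mono)
    fix x
    have "ennreal \<bar>enn2real (max_val \<alpha> f x)\<bar> \<le> max_val \<alpha> f x"
      by (cases "max_val \<alpha> f x") auto
    also note max_val_le_shells[OF f p \<alpha>]
    finally show "ennreal \<bar>enn2real (max_val \<alpha> f x)\<bar> * indicator (ball 0 R) x \<le>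
        ennreal (val_bound p F \<alpha> 1) * indicator (ball 0 R) x + (\<Sum>k. shell \<alpha> f k x) * indicator (ball 0 R) x"
      by (simp split: split_indicator)
  qed
  also have "\<dots> = ennreal (val_bound p F \<alpha> 1) * emeasure lborel (ball (0::'a) R) + (\<integral>\<^sup>+x\<in>ball 0 R. (\<Sum>k. shell \<alpha> f k x) \<partial>lborel)"
    by (subst nn_integral_add, measurable, subst nn_integral_cmult_indicator) simp_all
  also have "\<dots> < \<infinity>"
    using nn_integral_sum_shell_finite[OF f p \<alpha>(1), of R] emeasure_lborel_ball_finite[of "0::'a" R]
    by (simp add: ennreal_mult_less_top)
  finally show "(\<integral>\<^sup>+x\<in>ball 0 R. ennreal \<bar>enn2real (max_val \<alpha> f x)\<bar> \<partial>lborel) < \<infinity>" .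
qed

text \<open>The weak gradient is the limit of the derivatives of the radius-restricted functions. At
  almost every point these derivatives are eventually constant in n, and
  \<open>good_dominated\<close> gives a majorant independent of n.\<close>

lemma max_val_weak_gradient:
  assumes p: "1 \<le> p" and \<alpha>: "0 < \<alpha>" "\<alpha> < real DIM('a) / p" and q: "q = 1 / (1 / p - \<alpha> / real DIM('a))"
  shows "\<exists>C\<ge>0. \<forall>f F W. Lp_bounded p F f \<and> 0 \<le> W \<and> gradient_approximable p W f \<longrightarrow>
     (AE x in lborel. max_val \<alpha> f x < \<infinity>) \<and>
     (\<exists>H\<in>borel_measurable borel. has_weak_gradient (\<lambda>x. enn2real (max_val \<alpha> f x)) H \<and>
        (\<integral>\<^sup>+x. ennreal (norm (H x) powr q) \<partial>lborel) \<le> ennreal (C * W powr (q / p)))"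
proof -
  obtain C where C: "C \<ge> 0" and dom: "\<forall>f F W. Lp_bounded p F f \<and> 0 \<le> W \<and> gradient_approximable p W f \<longrightarrow>
     (\<exists>G\<in>borel_measurable borel. (\<integral>\<^sup>+x. G x \<partial>lborel) \<le> ennreal (C * W powr (q / p)) \<and>
        (\<forall>x c r. good \<alpha> f x c r \<longrightarrow> ennreal ((r powr (\<alpha> - 1) * ball_mean f c r) powr q) \<le> G x))"
    using good_dominated[OF p \<alpha> q] by blast
  define d where "d = real DIM('a)"
  have d: "d \<ge> 1" using DIM_positive[where 'a='a] by (simp add: d_def Suc_leI)
  define \<omega> where "\<omega> = unit_ball_vol d"
  have \<omega>: "\<omega> > 0" using d by (simp add: \<omega>_def)
  \<comment> \<open>The 4 d comes from \<open>trunc_max_derivative_le\<close>, and the volume of the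
    unit ball converts \<open>frac_val\<close> into \<open>ball_mean\<close>.\<close>
  define c0 where "c0 = 4 * d * \<omega>"
  have c0: "c0 > 0" using d \<omega> by (simp add: c0_def)
  have pos: "1 / p - \<alpha> / d > 0" using \<alpha> p d by (simp add: d_def field_simps)
  have q1: "q \<ge> 1"
  proof -
    have "1 / p \<le> 1" using p by simp
    then have "1 / p - \<alpha> / d \<le> 1" using \<alpha> d by (smt (verit) divide_pos_pos)
    then show ?thesis using pos by (simp add: q d_def)
  qed
  have \<alpha>': "0 < \<alpha>" "\<alpha> \<le> real DIM('a) / p" using \<alpha> by auto
  define C' where "C' = (d * c0) powr q * C"
  show ?thesis
  proof (intro exI[of _ C'] conjI allI impI)
    show "0 \<le> C'" using C by (simp add: C'_def)
  next
    fix f :: "'a \<Rightarrow> real" and F W :: real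
    assume asm: "Lp_bounded p F f \<and> 0 \<le> W \<and> gradient_approximable p W f"
    then have f: "Lp_bounded p F f" by auto
    note sh = AE_shells_finite[OF f p \<alpha>']
    show "AE x in lborel. max_val \<alpha> f x < \<infinity>"
      by (rule AE_mp[OF sh AE_I2]) (use max_val_finite[OF f p \<alpha>'] in auto)
  next
    fix f :: "'a \<Rightarrow> real" and F W :: real
    assume asm: "Lp_bounded p F f \<and> 0 \<le> W \<and> gradient_approximable p W f"
    then have f: "Lp_bounded p F f" by auto
    obtain G where Gm[measurable]: "G \<in> borel_measurable borel" and GI: "(\<integral>\<^sup>+x. G x \<partial>lborel) \<le> ennreal (C * W powr (q / p))"
      and GP: "\<And>x c r. good \<alpha> f x c r \<Longrightarrow> ennreal ((r powr (\<alpha> - 1) * ball_mean f c r) powr q) \<le> G x"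
      using dom asm by blast
    define M where "M x = enn2real (max_val \<alpha> f x)" for x
    define tm where "tm n = trunc_max \<alpha> f (1 / real (Suc n))" for n
    define h where "h n i x = quotient_limit (tm n) i x" for n i x
    have e: "0 < 1 / real (Suc n)" for n by simp
    note lip = trunc_max_lipschitz[OF f p \<alpha>' e, folded tm_def]
    have tmm[measurable]: "tm n \<in> borel_measurable borel" for n
      unfolding tm_def by (rule tm_measurable[OF f p \<alpha>'])
    have Mm[measurable]: "M \<in> borel_measurable borel"
      unfolding M_def using max_val_measurable[OF f p \<alpha>'] by measurable
    have hm[measurable]: "h n i \<in> borel_measurable borel" for n i
      unfolding h_def quotient_limit_def by measurable
    have "AE x in lborel. \<forall>i\<in>Basis. \<forall>n. \<exists>D. ((\<lambda>t. tm n (x + t *\<^sub>R i)) has_real_derivative D) (at 0)"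
      by (subst AE_finite_all) (auto simp: AE_all_countable intro!: lipschitz_partially_differentiable_AE[OF lip])
    then have diff: "AE x in lborel. \<forall>i\<in>Basis. \<forall>n. ((\<lambda>t. tm n (x + t *\<^sub>R i)) has_real_derivative h n i x) (at 0)"
    proof (rule AE_mp[OF _ AE_I2], intro impI ballI allI)
      fix x i n
      assume *: "\<forall>i\<in>Basis. \<forall>n. \<exists>D. ((\<lambda>t. tm n (x + t *\<^sub>R i)) has_real_derivative D) (at 0)" and "(i::'a) \<in> Basis"
      then obtain D where "((\<lambda>t. tm n (x + t *\<^sub>R i)) has_real_derivative D) (at 0)" by blast
      then show "((\<lambda>t. tm n (x + t *\<^sub>R i)) has_real_derivative h n i x) (at 0)"
        using quotient_limit_eq[of "tm n" x i D] by (simp add: h_def)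
    qed
    have hb: "ennreal (\<bar>h n i x\<bar> powr q) \<le> ennreal (c0 powr q) * G x"
      if D: "((\<lambda>t. tm n (x + t *\<^sub>R i)) has_real_derivative h n i x) (at 0)" and i: "i \<in> Basis" for n i x
    proof (cases "tm n x = 0")
      case True
      have "h n i x = 0"
        using trunc_max_derivative_0[OF f p \<alpha>' e, of n x i "h n i x"] D True by (simp add: tm_def)
      then show ?thesis by simp
    next
      case False
      then have "0 < tm n x" using trunc_max_nonneg[OF f p \<alpha>' e, of n x] by (simp add: tm_def less_le)
      then obtain c r where g: "good \<alpha> f x c r" and le: "\<bar>h n i x\<bar> \<le> 4 * d * (frac_val \<alpha> f c r / r)"
        using trunc_max_derivative_le[OF f p \<alpha>' e \<alpha>(2), of i n x "h n i x"] D i by (auto simp: tm_def d_def)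
      have r: "r > 0" by (rule good_pos[OF g])
      have bm: "ball_mean f c r = mass f c r / (\<omega> * r ^ DIM('a))" by (simp add: ball_mean_def \<omega>_def d_def)
      have "frac_val \<alpha> f c r / r = \<omega> * (r powr (\<alpha> - 1) * ball_mean f c r)"
        unfolding bm frac_val_def using r \<omega> by (simp add: powr_diff powr_realpow field_simps)
      then have "\<bar>h n i x\<bar> \<le> c0 * (r powr (\<alpha> - 1) * ball_mean f c r)"
        using le by (simp add: c0_def ac_simps)
      then have "\<bar>h n i x\<bar> powr q \<le> (c0 * (r powr (\<alpha> - 1) * ball_mean f c r)) powr q"
        using q1 by (intro powr_mono2) auto
      also have "\<dots> = c0 powr q * (r powr (\<alpha> - 1) * ball_mean f c r) powr q"
        using c0 good_ball_mean_pos[OF g] by (simp add: powr_mult)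
      finally have "ennreal (\<bar>h n i x\<bar> powr q) \<le> ennreal (c0 powr q) * ennreal ((r powr (\<alpha> - 1) * ball_mean f c r) powr q)"
        by (simp add: ennreal_leI ennreal_mult[symmetric])
      also have "\<dots> \<le> ennreal (c0 powr q) * G x" by (intro mult_left_mono GP[OF g]) auto
      finally show ?thesis .
    qed
    have GAE: "AE x in lborel. G x \<noteq> \<infinity>"
      by (rule nn_integral_PInf_AE) (use GI in \<open>auto simp: top_unique\<close>)
    \<comment> \<open>G controls q-th powers; y \<le> 1 + y powr q turns this into a locally
      integrable majorant of the derivatives themselves.\<close>
    define k where "k x = 1 + c0 powr q * enn2real (G x)" for x
    have [measurable]: "k \<in> borel_measurable borel" unfolding k_def by measurable
    have kloc: "locally_finite_integral k"
      unfolding locally_finite_integral_def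
    proof (intro conjI allI)
      fix R
      have "(\<integral>\<^sup>+x\<in>ball 0 R. ennreal \<bar>k x\<bar> \<partial>lborel) \<le> (\<integral>\<^sup>+x. 1 * indicator (ball 0 R) x + ennreal (c0 powr q) * G x \<partial>lborel)"
      proof (rule nn_integral_mono)
        fix x
        have "ennreal \<bar>k x\<bar> = 1 + ennreal (c0 powr q) * ennreal (enn2real (G x))"
          by (simp add: k_def ennreal_mult)
        also have "ennreal (enn2real (G x)) \<le> G x" by (cases "G x") auto
        finally have "ennreal \<bar>k x\<bar> \<le> 1 + ennreal (c0 powr q) * G x" by (simp add: add_left_mono mult_left_mono)
        then show "ennreal \<bar>k x\<bar> * indicator (ball 0 R) x \<le> 1 * indicator (ball 0 R) x + ennreal (c0 powr q) * G x"
          by (simp split: split_indicator)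
      qed
      also have "\<dots> = emeasure lborel (ball (0::'a) R) + ennreal (c0 powr q) * (\<integral>\<^sup>+x. G x \<partial>lborel)"
        by (subst nn_integral_add) (auto simp: nn_integral_cmult)
      also have "\<dots> < \<infinity>"
        using GI emeasure_lborel_ball_finite[of "0::'a" R] by (auto simp: ennreal_mult_less_top intro: le_less_trans)
      finally show "(\<integral>\<^sup>+x\<in>ball 0 R. ennreal \<bar>k x\<bar> \<partial>lborel) < \<infinity>" .
    qed measurable
    have kb: "y \<le> k x" if "ennreal (y powr q) \<le> ennreal (c0 powr q) * G x" "G x \<noteq> \<infinity>" "0 \<le> y" for x y
    proof -
      have "ennreal (y powr q) \<le> ennreal (c0 powr q * enn2real (G x))"
        using that by (cases "G x") (auto simp: ennreal_mult)
      then have "y powr q \<le> c0 powr q * enn2real (G x)" by (subst (asm) ennreal_le_iff) auto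
      then show ?thesis using le_one_plus_powr[OF that(3) q1] by (simp add: k_def)
    qed
    define hl where "hl i x = lim (\<lambda>n. h n i x)" for i x
    have hlm[measurable]: "hl i \<in> borel_measurable borel" for i unfolding hl_def by measurable
    have main: "AE x in lborel. max_val \<alpha> f x < \<infinity> \<and> (\<lambda>n. tm n x) \<longlonglongrightarrow> M x \<and> (\<forall>n. \<bar>tm n x\<bar> \<le> M x) \<and>
        (\<forall>i\<in>Basis. (\<lambda>n. h n i x) \<longlonglongrightarrow> hl i x \<and> (\<forall>n. \<bar>h n i x\<bar> \<le> k x) \<and> \<bar>hl i x\<bar> \<le> k x \<and>
           ennreal (\<bar>hl i x\<bar> powr q) \<le> ennreal (c0 powr q) * G x)"
      using AE_shells_finite[OF f p \<alpha>'] diff GAE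
    proof eventually_elim
      case (elim x)
      note S = elim(1) and D = elim(2) and Gx = elim(3)
      have mf: "max_val \<alpha> f x < \<infinity>" by (rule max_val_finite[OF f p \<alpha>' S])
      then have mM: "max_val \<alpha> f x = ennreal (M x)" by (simp add: M_def less_top)
      have M0: "M x \<ge> 0" by (simp add: M_def)
      have tm0: "tm n x \<ge> 0" for n unfolding tm_def by (rule trunc_max_nonneg[OF f p \<alpha>' e])
      have tmM: "tm n x \<le> M x" for n
        using tm_le_max_val[OF f p \<alpha>', of n x] M0 unfolding mM by (simp add: tm_def)
      obtain n0 where n0: "\<And>n. n0 \<le> n \<Longrightarrow> ennreal (tm n x) = ennreal (M x)"
        using max_val_eventually_attained[OF f p \<alpha>' S] unfolding mM tm_def by blast
      then have n0': "tm n x = M x" if "n0 \<le> n" for n using that tm0 M0 by (simp add: ennreal_inj)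
      \<comment> \<open>From n0 on, tm n - tm n0 is nonnegative and vanishes at x, so it has a
        minimum there and its derivative is zero.\<close>
      have stab: "h n i x = h n0 i x" if i: "i \<in> Basis" and n: "n0 \<le> n" for n i
      proof -
        have "((\<lambda>t. tm n (x + t *\<^sub>R i) - tm n0 (x + t *\<^sub>R i)) has_real_derivative h n i x - h n0 i x) (at 0)"
          using D i by (intro DERIV_diff) auto
        then have "h n i x - h n0 i x = 0"
        proof (rule DERIV_local_min[of _ _ _ 1])
          show "\<forall>y. \<bar>0 - y\<bar> < 1 \<longrightarrow> tm n (x + 0 *\<^sub>R i) - tm n0 (x + 0 *\<^sub>R i) \<le> tm n (x + y *\<^sub>R i) - tm n0 (x + y *\<^sub>R i)"
            using n0' n tm_mono[OF f p \<alpha>' n] by (auto simp: tm_def)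
        qed simp
        then show ?thesis by simp
      qed
      have lim: "(\<lambda>n. h n i x) \<longlonglongrightarrow> h n0 i x" if "i \<in> Basis" for i
        by (rule tendsto_eventually, rule eventually_mono[OF eventually_ge_at_top[of n0]]) (rule stab[OF that])
      have hl: "hl i x = h n0 i x" if "i \<in> Basis" for i unfolding hl_def by (rule limI[OF lim[OF that]])
      show ?case
      proof (intro conjI ballI allI mf)
        show "(\<lambda>n. tm n x) \<longlonglongrightarrow> M x"
          by (rule tendsto_eventually, rule eventually_mono[OF eventually_ge_at_top[of n0]]) (rule n0')
        show "\<bar>tm n x\<bar> \<le> M x" for n using tm0[of n] tmM[of n] by simp
        fix i :: 'a assume i: "i \<in> Basis"
        have b: "ennreal (\<bar>h n i x\<bar> powr q) \<le> ennreal (c0 powr q) * G x" for n using hb[of n x i] D i by blast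
        show "(\<lambda>n. h n i x) \<longlonglongrightarrow> hl i x" using lim[OF i] hl[OF i] by simp
        show "\<bar>h n i x\<bar> \<le> k x" for n by (rule kb[OF b Gx]) simp
        show "\<bar>hl i x\<bar> \<le> k x" unfolding hl[OF i] by (rule kb[OF b Gx]) simp
        show "ennreal (\<bar>hl i x\<bar> powr q) \<le> ennreal (c0 powr q) * G x" unfolding hl[OF i] by (rule b)
      qed
    qed
    define H where "H x = (\<Sum>i\<in>Basis. hl i x *\<^sub>R i)" for x
    have Hi: "H x \<bullet> i = hl i x" if "i \<in> Basis" for x i
      unfolding H_def using that by (simp add: inner_sum_left inner_Basis if_distrib cong: if_cong)
    have Hm[measurable]: "H \<in> borel_measurable borel" unfolding H_def by measurable
    have Mloc: "locally_finite_integral M" unfolding M_def by (rule locally_finite_max_val[OF f p \<alpha>'])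
    have weak: "has_weak_gradient M H"
    proof (rule has_weak_gradient_lborelI[OF Mloc])
      show "locally_finite_integral (\<lambda>x. H x \<bullet> i)" if i: "i \<in> Basis" for i
        unfolding Hi[OF i] by (rule locally_finite_integralI_AE[OF hlm kloc]) (use main i in auto)
      fix \<phi> :: "'a \<Rightarrow> real" and i :: 'a assume \<phi>: "test_function \<phi>" and i: "i \<in> Basis"
      obtain R where R: "0 < R" "\<And>x. R \<le> norm x \<Longrightarrow> \<phi> x = 0" "\<And>x v. R \<le> norm x \<Longrightarrow> partial_deriv \<phi> v x = 0"
        using test_function_bounded_support[OF \<phi>] by metis
      note c\<phi> = test_function_continuous[OF \<phi>] test_function_partial_continuous[OF \<phi> i]
      have [measurable]: "\<phi> \<in> borel_measurable borel" "partial_deriv \<phi> i \<in> borel_measurable borel"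
        using c\<phi> borel_measurable_continuous_onI by auto
      have l1: "(\<lambda>n. \<integral>x. tm n x * partial_deriv \<phi> i x \<partial>lborel) \<longlonglongrightarrow> (\<integral>x. M x * partial_deriv \<phi> i x \<partial>lborel)"
      proof (rule integral_dominated_convergence[where w="\<lambda>x. M x * \<bar>partial_deriv \<phi> i x\<bar>"])
        show "integrable lborel (\<lambda>x. M x * \<bar>partial_deriv \<phi> i x\<bar>)"
          by (rule locally_finite_integral_times_integrable[OF Mloc, of _ R]) (use R in \<open>auto intro!: continuous_intros c\<phi>\<close>)
        show "AE x in lborel. (\<lambda>n. tm n x * partial_deriv \<phi> i x) \<longlonglongrightarrow> M x * partial_deriv \<phi> i x"
          using main by eventually_elim (auto intro!: tendsto_mult_right)
        show "AE x in lborel. norm (tm n x * partial_deriv \<phi> i x) \<le> M x * \<bar>partial_deriv \<phi> i x\<bar>" for n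
          using main by eventually_elim (auto simp: abs_mult intro!: mult_right_mono)
      qed simp_all
      have l2: "(\<lambda>n. \<integral>x. h n i x * \<phi> x \<partial>lborel) \<longlonglongrightarrow> (\<integral>x. hl i x * \<phi> x \<partial>lborel)"
      proof (rule integral_dominated_convergence[where w="\<lambda>x. k x * \<bar>\<phi> x\<bar>"])
        show "integrable lborel (\<lambda>x. k x * \<bar>\<phi> x\<bar>)"
          by (rule locally_finite_integral_times_integrable[OF kloc, of _ R]) (use R in \<open>auto intro!: continuous_intros c\<phi>\<close>)
        show "AE x in lborel. (\<lambda>n. h n i x * \<phi> x) \<longlonglongrightarrow> hl i x * \<phi> x"
          using main by eventually_elim (use i in \<open>auto intro!: tendsto_mult_right\<close>)
        show "AE x in lborel. norm (h n i x * \<phi> x) \<le> k x * \<bar>\<phi> x\<bar>" for n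
          using main by eventually_elim (use i in \<open>auto simp: abs_mult intro!: mult_right_mono\<close>)
      qed simp_all
      have eq: "(\<integral>x. tm n x * partial_deriv \<phi> i x \<partial>lborel) = - (\<integral>x. h n i x * \<phi> x \<partial>lborel)" for n
        unfolding h_def by (rule lipschitz_weak_derivative[OF lip i \<phi>])
      show "(\<integral>x. M x * partial_deriv \<phi> i x \<partial>lborel) = - (\<integral>x. (H x \<bullet> i) * \<phi> x \<partial>lborel)"
        unfolding Hi[OF i] using LIMSEQ_unique[OF l1] tendsto_minus[OF l2] unfolding eq by blast
    qed
    have "(\<integral>\<^sup>+x. ennreal (norm (H x) powr q) \<partial>lborel) \<le> (\<integral>\<^sup>+x. ennreal ((d * c0) powr q) * G x \<partial>lborel)"
    proof (rule nn_integral_mono_AE)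
      show "AE x in lborel. ennreal (norm (H x) powr q) \<le> ennreal ((d * c0) powr q) * G x"
        using main
      proof eventually_elim
        case (elim x)
        \<comment> \<open>The norm is compared with d times the largest component, so that the bound
          by \<open>G\<close> is used once and the constant becomes (d c0) powr q.\<close>
        define m where "m = Max ((\<lambda>i. \<bar>hl i x\<bar>) ` Basis)"
        have "m \<in> (\<lambda>i. \<bar>hl i x\<bar>) ` Basis" unfolding m_def by (rule Max_in) auto
        then obtain i0 where i0: "i0 \<in> Basis" "m = \<bar>hl i0 x\<bar>" by auto
        have "norm (H x) \<le> (\<Sum>i\<in>Basis. \<bar>H x \<bullet> i\<bar>)" by (rule norm_le_l1)
        also have "\<dots> \<le> (\<Sum>i\<in>(Basis::'a set). m)"
          by (intro sum_mono) (auto simp: Hi m_def intro!: Max_ge)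
        also have "\<dots> = d * \<bar>hl i0 x\<bar>" by (simp add: d_def i0)
        finally have "norm (H x) powr q \<le> (d * \<bar>hl i0 x\<bar>) powr q" using q1 by (intro powr_mono2) auto
        also have "\<dots> = d powr q * \<bar>hl i0 x\<bar> powr q" using d by (simp add: powr_mult)
        finally have "ennreal (norm (H x) powr q) \<le> ennreal (d powr q) * ennreal (\<bar>hl i0 x\<bar> powr q)"
          by (simp add: ennreal_leI ennreal_mult[symmetric])
        also have "\<dots> \<le> ennreal (d powr q) * (ennreal (c0 powr q) * G x)"
          using elim i0 by (intro mult_left_mono) auto
        also have "\<dots> = ennreal ((d * c0) powr q) * G x"
          using d c0 by (simp add: powr_mult ennreal_mult mult.assoc)
        finally show ?case .
      qed
    qed
    also have "\<dots> = ennreal ((d * c0) powr q) * (\<integral>\<^sup>+x. G x \<partial>lborel)" by (rule nn_integral_cmult) measurable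
    also have "\<dots> \<le> ennreal ((d * c0) powr q) * ennreal (C * W powr (q / p))" by (intro mult_left_mono GI) auto
    also have "\<dots> = ennreal (C' * W powr (q / p))" using C by (simp add: C'_def ennreal_mult[symmetric] mult.assoc)
    finally show "\<exists>H\<in>borel_measurable borel. has_weak_gradient (\<lambda>x. enn2real (max_val \<alpha> f x)) H \<and>
        (\<integral>\<^sup>+x. ennreal (norm (H x) powr q) \<partial>lborel) \<le> ennreal (C' * W powr (q / p))"
      using weak Hm unfolding M_def[abs_def] by blast
  qed
qed

end

section \<open>Endpoint case: Lipschitz bounds from translation estimates\<close>

lemma C1_gradient_translate_le:
  fixes g :: "'a::euclidean_space \<Rightarrow> real"
  assumes g: "C1_gradient g D" and p: "1 \<le> p" and s: "0 < s" and r: "0 \<le> r" and W0: "0 \<le> W"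
    and W: "(\<integral>\<^sup>+x. ennreal (norm (D x) powr p) \<partial>lborel) \<le> ennreal W"
  shows "(\<integral>\<^sup>+x\<in>ball c r. ennreal \<bar>g (x + h) - g x\<bar> \<partial>lborel) \<le>
     ennreal (norm h * (s * (unit_ball_vol (real DIM('a)) * r ^ DIM('a)) + s powr (1 - p) * W))"
proof -
  note [measurable] = C1_gradient_measurable[OF g]
  define E where "E = s * (unit_ball_vol (real DIM('a)) * r ^ DIM('a)) + s powr (1 - p) * W"
  have E: "E \<ge> 0" using s r W0 by (simp add: E_def)
  have incr: "ennreal \<bar>g (x + h) - g x\<bar> \<le> (\<integral>\<^sup>+t\<in>{0..1::real}. ennreal (norm h * norm (D (x + t *\<^sub>R h))) \<partial>lborel)" for x
  proof -
    have "ennreal \<bar>g (x + 1 *\<^sub>R h) - g (x + 0 *\<^sub>R h)\<bar> \<le> (\<integral>\<^sup>+t\<in>{0..1::real}. ennreal (norm h * norm (D (x + t *\<^sub>R h))) \<partial>lborel)"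
    proof (rule abs_increment_le_nn_integral[where u="\<lambda>t. g (x + t *\<^sub>R h)" and u'="\<lambda>t. D (x + t *\<^sub>R h) \<bullet> h"])
      fix t
      show "((\<lambda>t. g (x + t *\<^sub>R h)) has_real_derivative D (x + t *\<^sub>R h) \<bullet> h) (at t)"
        by (rule C1_gradient_along_line[OF g])
      have "isCont D (x + t *\<^sub>R h)" using g by (simp add: C1_gradient_def continuous_on_eq_continuous_at)
      then have "isCont (\<lambda>t. D (x + t *\<^sub>R h)) t" by (rule isCont_o2[rotated]) (intro continuous_intros)
      then show "isCont (\<lambda>t. D (x + t *\<^sub>R h) \<bullet> h) t" by (intro continuous_intros)
      show "\<bar>D (x + t *\<^sub>R h) \<bullet> h\<bar> \<le> norm h * norm (D (x + t *\<^sub>R h))"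
        by (metis Cauchy_Schwarz_ineq2 mult.commute)
    qed
    then show ?thesis by simp
  qed
  \<comment> \<open>The parameter s of \<open>le_young\<close> stays free here; the endpoint
    argument adapts it to the radius.\<close>
  have slice: "(\<integral>\<^sup>+x. ennreal (norm (D (x + z))) * indicator (ball c r) x \<partial>lborel) \<le> ennreal E" for z
  proof -
    have "(\<integral>\<^sup>+x. ennreal (norm (D (x + z))) * indicator (ball c r) x \<partial>lborel) \<le>
       (\<integral>\<^sup>+x. ennreal s * indicator (ball c r) x + ennreal (s powr (1 - p)) * ennreal (norm (D (x + z)) powr p) \<partial>lborel)"
    proof (rule nn_integral_mono)
      fix x
      have "ennreal (norm (D (x + z))) \<le> ennreal (s + s powr (1 - p) * norm (D (x + z)) powr p)"
        by (intro ennreal_leI le_young s p) auto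
      also have "\<dots> = ennreal s + ennreal (s powr (1 - p)) * ennreal (norm (D (x + z)) powr p)"
        using s by (simp add: ennreal_mult)
      finally show "ennreal (norm (D (x + z))) * indicator (ball c r) x \<le>
         ennreal s * indicator (ball c r) x + ennreal (s powr (1 - p)) * ennreal (norm (D (x + z)) powr p)"
        by (simp split: split_indicator)
    qed
    also have "\<dots> = ennreal s * emeasure lborel (ball c r) + ennreal (s powr (1 - p)) * (\<integral>\<^sup>+x. ennreal (norm (D (x + z)) powr p) \<partial>lborel)"
      by (subst nn_integral_add, measurable, subst nn_integral_cmult_indicator, simp, subst nn_integral_cmult) simp_all
    also have "(\<integral>\<^sup>+x. ennreal (norm (D (x + z)) powr p) \<partial>lborel) = (\<integral>\<^sup>+x. ennreal (norm (D x) powr p) \<partial>lborel)"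
      by (rule nn_integral_lborel_translate[where h="\<lambda>x. ennreal (norm (D x) powr p)"]) measurable
    also have "ennreal s * emeasure lborel (ball c r) + ennreal (s powr (1 - p)) * \<dots> \<le>
        ennreal s * emeasure lborel (ball c r) + ennreal (s powr (1 - p)) * ennreal W"
      by (intro add_left_mono mult_left_mono W) auto
    also have "\<dots> = ennreal E"
      using s r W0 by (simp add: E_def emeasure_ball ennreal_mult[symmetric] ennreal_plus[symmetric] del: ennreal_plus)
    finally show ?thesis .
  qed
  have "(\<integral>\<^sup>+x\<in>ball c r. ennreal \<bar>g (x + h) - g x\<bar> \<partial>lborel) \<le>
     (\<integral>\<^sup>+x. (\<integral>\<^sup>+t. ennreal (norm h * norm (D (x + t *\<^sub>R h))) * indicator {0..1::real} t * indicator (ball c r) x \<partial>lborel) \<partial>lborel)"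
  proof (rule nn_integral_mono)
    fix x
    have "(\<integral>\<^sup>+t. ennreal (norm h * norm (D (x + t *\<^sub>R h))) * indicator {0..1::real} t * indicator (ball c r) x \<partial>lborel) =
      (\<integral>\<^sup>+t\<in>{0..1::real}. ennreal (norm h * norm (D (x + t *\<^sub>R h))) \<partial>lborel) * indicator (ball c r) x"
      by (rule nn_integral_multc) measurable
    then show "ennreal \<bar>g (x + h) - g x\<bar> * indicator (ball c r) x \<le>
      (\<integral>\<^sup>+t. ennreal (norm h * norm (D (x + t *\<^sub>R h))) * indicator {0..1::real} t * indicator (ball c r) x \<partial>lborel)"
      by (simp only:) (intro mult_right_mono incr, simp)
  qed
  also have "\<dots> = (\<integral>\<^sup>+t. (\<integral>\<^sup>+x. ennreal (norm h * norm (D (x + t *\<^sub>R h))) * indicator {0..1::real} t * indicator (ball c r) x \<partial>lborel) \<partial>lborel)"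
    by (rule lborel_pair.Fubini') measurable
  also have "\<dots> \<le> (\<integral>\<^sup>+t. ennreal (norm h * E) * indicator {0..1::real} t \<partial>lborel)"
  proof (rule nn_integral_mono)
    fix t :: real
    have "(\<integral>\<^sup>+x. ennreal (norm h * norm (D (x + t *\<^sub>R h))) * indicator {0..1::real} t * indicator (ball c r) x \<partial>lborel) =
       (\<integral>\<^sup>+x. (ennreal (norm h) * indicator {0..1::real} t) * (ennreal (norm (D (x + t *\<^sub>R h))) * indicator (ball c r) x) \<partial>lborel)"
      by (intro nn_integral_cong) (simp only: ennreal_mult[OF norm_ge_zero norm_ge_zero] ac_simps)
    also have "\<dots> = (ennreal (norm h) * indicator {0..1::real} t) * (\<integral>\<^sup>+x. ennreal (norm (D (x + t *\<^sub>R h))) * indicator (ball c r) x \<partial>lborel)"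
      by (rule nn_integral_cmult) measurable
    also have "\<dots> \<le> (ennreal (norm h) * indicator {0..1::real} t) * ennreal E"
      by (intro mult_left_mono slice) simp
    also have "\<dots> = ennreal (norm h * E) * indicator {0..1::real} t"
      using E by (simp add: ennreal_mult ac_simps)
    finally show "(\<integral>\<^sup>+x. ennreal (norm h * norm (D (x + t *\<^sub>R h))) * indicator {0..1::real} t * indicator (ball c r) x \<partial>lborel) \<le>
       ennreal (norm h * E) * indicator {0..1::real} t" .
  qed
  also have "\<dots> = ennreal (norm h * E)" by (subst nn_integral_cmult_indicator) auto
  finally show ?thesis by (simp add: E_def)
qed

text \<open>The increment of f splits into the increment of a C1 approximant and two errors; after a
  translation both errors are the same integral, which tends to 0.\<close>

lemma approximable_translate_le:
  fixes f :: "'a::euclidean_space \<Rightarrow> real"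
  assumes fm[measurable]: "f \<in> borel_measurable borel" and approx: "gradient_approximable p W f"
    and p: "1 \<le> p" and s: "0 < s" and r: "0 \<le> r" and W0: "0 \<le> W"
  shows "(\<integral>\<^sup>+x\<in>ball c r. ennreal \<bar>f (x + h) - f x\<bar> \<partial>lborel) \<le>
     ennreal (norm h * (s * (unit_ball_vol (real DIM('a)) * r ^ DIM('a)) + s powr (1 - p) * W))" (is "_ \<le> ?E")
proof -
  obtain g D where g: "\<And>k::nat. C1_gradient (g k) (D k)"
    and conv: "\<And>R. (\<lambda>k. \<integral>\<^sup>+x\<in>ball 0 R. ennreal \<bar>g k x - f x\<bar> \<partial>lborel) \<longlonglongrightarrow> 0"
    and W: "\<And>k. (\<integral>\<^sup>+x. ennreal (norm (D k x) powr p) \<partial>lborel) \<le> ennreal W"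
    using approx unfolding gradient_approximable_def by blast
  define R where "R = norm c + r + norm h"
  define e where "e k = (\<integral>\<^sup>+x\<in>ball 0 R. ennreal \<bar>g k x - f x\<bar> \<partial>lborel)" for k
  have e0: "e \<longlonglongrightarrow> 0" unfolding e_def by (rule conv)
  have step: "(\<integral>\<^sup>+x\<in>ball c r. ennreal \<bar>f (x + h) - f x\<bar> \<partial>lborel) \<le> e k + ?E + e k" for k
  proof -
    note [measurable] = C1_gradient_measurable[OF g]
    have inR: "x + h \<in> ball 0 R" "x \<in> ball 0 R" if "x \<in> ball c r" for x
    proof -
      have "norm x < norm c + r" using that norm_triangle_sub[of x c] by (simp add: dist_norm norm_minus_commute)
      then show "x + h \<in> ball 0 R" "x \<in> ball 0 R" using norm_triangle_ineq[of x h] norm_ge_zero[of h] unfolding R_def mem_ball_0 by linarith+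
    qed
    have "(\<integral>\<^sup>+x\<in>ball c r. ennreal \<bar>f (x + h) - f x\<bar> \<partial>lborel) \<le>
      (\<integral>\<^sup>+x. (ennreal \<bar>g k (x + h) - f (x + h)\<bar> * indicator (ball 0 R) (x + h) + ennreal \<bar>g k (x + h) - g k x\<bar> * indicator (ball c r) x)
         + ennreal \<bar>g k x - f x\<bar> * indicator (ball 0 R) x \<partial>lborel)"
    proof (rule nn_integral_mono)
      fix x
      show "ennreal \<bar>f (x + h) - f x\<bar> * indicator (ball c r) x \<le>
        (ennreal \<bar>g k (x + h) - f (x + h)\<bar> * indicator (ball 0 R) (x + h) + ennreal \<bar>g k (x + h) - g k x\<bar> * indicator (ball c r) x)
         + ennreal \<bar>g k x - f x\<bar> * indicator (ball 0 R) x"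
      proof (cases "x \<in> ball c r")
        case True
        have "ennreal \<bar>f (x + h) - f x\<bar> \<le> ennreal (\<bar>g k (x + h) - f (x + h)\<bar> + \<bar>g k (x + h) - g k x\<bar> + \<bar>g k x - f x\<bar>)"
          by (rule ennreal_leI) linarith
        then show ?thesis using True inR[OF True] by (simp add: ennreal_plus[symmetric] del: ennreal_plus mem_ball)
      qed simp
    qed
    also have "\<dots> = (\<integral>\<^sup>+x. ennreal \<bar>g k (x + h) - f (x + h)\<bar> * indicator (ball 0 R) (x + h) \<partial>lborel) +
        (\<integral>\<^sup>+x\<in>ball c r. ennreal \<bar>g k (x + h) - g k x\<bar> \<partial>lborel) + e k"
      unfolding e_def by (subst nn_integral_add, measurable, subst nn_integral_add, measurable)
    also have "(\<integral>\<^sup>+x. ennreal \<bar>g k (x + h) - f (x + h)\<bar> * indicator (ball 0 R) (x + h) \<partial>lborel) = e k"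
      unfolding e_def by (rule nn_integral_lborel_translate[where h="\<lambda>x. ennreal \<bar>g k x - f x\<bar> * indicator (ball 0 R) x"]) measurable
    also have "e k + (\<integral>\<^sup>+x\<in>ball c r. ennreal \<bar>g k (x + h) - g k x\<bar> \<partial>lborel) + e k \<le> e k + ?E + e k"
      by (intro add_mono order_refl C1_gradient_translate_le[OF g p s r W0 W])
    finally show ?thesis .
  qed
  have "(\<lambda>k. e k + ?E + e k) \<longlonglongrightarrow> 0 + ?E + 0" by (intro tendsto_add e0 tendsto_const)
  then show ?thesis using step by (intro LIMSEQ_le_const[of "\<lambda>k. e k + ?E + e k"]) auto
qed

context admissible_balls
begin

text \<open>At \<alpha> = d / p the estimate is scale invariant: moving a ball by h at fixed radius
  changes its value by at most a multiple of W powr (1 / p) |h|, whatever the radius. So the maximal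
  function itself is Lipschitz.\<close>

lemma max_val_endpoint:
  assumes p: "1 \<le> p" and \<alpha>: "\<alpha> = real DIM('a) / p"
  shows "\<exists>C\<ge>0. \<forall>f F W. Lp_bounded p F f \<and> 0 \<le> W \<and> gradient_approximable p W f \<longrightarrow>
     (\<forall>x. max_val \<alpha> f x < \<infinity>) \<and>
     (\<exists>H\<in>borel_measurable borel. has_weak_gradient (\<lambda>x. enn2real (max_val \<alpha> f x)) H \<and>
        (AE x in lborel. norm (H x) \<le> C * W powr (1 / p)))"
proof -
  define d where "d = real DIM('a)"
  have d: "d \<ge> 1" using DIM_positive[where 'a='a] by (simp add: d_def Suc_leI)
  define \<omega> where "\<omega> = unit_ball_vol d"
  have \<omega>: "\<omega> > 0" using d by (simp add: \<omega>_def)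
  have \<alpha>': "0 < \<alpha>" "\<alpha> \<le> real DIM('a) / p" using \<alpha> p by auto
  have \<alpha>p: "\<alpha> * p = d" using \<alpha> p by (simp add: d_def)
  have "\<exists>H\<in>borel_measurable borel. has_weak_gradient (\<lambda>x. enn2real (max_val \<alpha> f x)) H \<and>
        (AE x in lborel. norm (H x) \<le> (d * (\<omega> + 1)) * W powr (1 / p))" and "max_val \<alpha> f x < \<infinity>"
    if asm: "Lp_bounded p F f" "0 \<le> W" "gradient_approximable p W f" for f F W and x :: 'a
  proof -
    note f = asm(1) and W = asm(2) and approx = asm(3)
    have fm[measurable]: "f \<in> borel_measurable borel" and F: "0 \<le> F" using f by (auto simp: Lp_bounded_def)
    have valb: "frac_val \<alpha> f c r \<le> \<omega> + F" if "A x c r" for x c r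
    proof -
      have r: "r > 0" using A_mem that by blast
      show ?thesis using frac_val_le[OF f p r, of \<alpha> c] r by (simp add: \<alpha> \<omega>_def d_def)
    qed
    have fin: "max_val \<alpha> f x < \<infinity>" for x
    proof -
      have "max_val \<alpha> f x \<le> ennreal (\<omega> + F)"
        by (rule max_val_least[OF f p \<alpha>']) (use valb in \<open>auto intro: ennreal_leI\<close>)
      then show ?thesis by (simp add: le_less_trans)
    qed
    then show "max_val \<alpha> f x < \<infinity>" .
    define M where "M x = enn2real (max_val \<alpha> f x)" for x
    have mM: "max_val \<alpha> f x = ennreal (M x)" for x using fin[of x] by (simp add: M_def)
    have M0: "M x \<ge> 0" for x by (simp add: M_def)
    have Mu: "frac_val \<alpha> f c r \<le> M x" if "A x c r" for x c r
      using max_val_upper[OF f p \<alpha>' that] M0[of x] unfolding mM by simp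
    have Ml: "M x \<le> b" if "\<And>c r. A x c r \<Longrightarrow> frac_val \<alpha> f c r \<le> b" "0 \<le> b" for x b
    proof -
      have "max_val \<alpha> f x \<le> ennreal b" by (rule max_val_least[OF f p \<alpha>']) (use that in \<open>auto intro: ennreal_leI\<close>)
      then show ?thesis using that(2) unfolding mM by simp
    qed
    \<comment> \<open>A positive V with W \<le> V powr p stands in for W powr (1 / p), so that W = 0
      can be reached by letting V tend to 0.\<close>
    have lipV: "M x \<le> M y + (\<omega> + 1) * V * norm (x - y)" if V: "0 < V" "W \<le> V powr p" for V x y
    proof (rule Ml)
      show "0 \<le> M y + (\<omega> + 1) * V * norm (x - y)" using M0[of y] \<omega> V by simp
      fix c r assume A: "A x c r"
      then have r: "r > 0" using A_mem by blast
      define h where "h = y - x"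
      \<comment> \<open>With this parameter both terms of the translation estimate, after
        multiplication by r powr (\<alpha> - d), are bounded by multiples of V independent of
        r.\<close>
      define s where "s = V * r powr (- \<alpha>)"
      have s: "s > 0" using V r by (simp add: s_def)
      define E where "E = norm h * (s * (\<omega> * r ^ DIM('a)) + s powr (1 - p) * W)"
      have E: "E \<ge> 0" using s \<omega> r W by (simp add: E_def)
      have "ennreal (mass f c r) \<le> (\<integral>\<^sup>+x. ennreal \<bar>f (x + h)\<bar> * indicator (ball (c + h) r) (x + h) + ennreal \<bar>f (x + h) - f x\<bar> * indicator (ball c r) x \<partial>lborel)"
        unfolding ennreal_mass[OF f p]
      proof (rule nn_integral_mono)
        fix x
        have "ennreal \<bar>f x\<bar> \<le> ennreal (\<bar>f (x + h)\<bar> + \<bar>f (x + h) - f x\<bar>)" by (rule ennreal_leI) linarith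
        then show "ennreal \<bar>f x\<bar> * indicator (ball c r) x \<le> ennreal \<bar>f (x + h)\<bar> * indicator (ball (c + h) r) (x + h) + ennreal \<bar>f (x + h) - f x\<bar> * indicator (ball c r) x"
          by (simp add: dist_norm split: split_indicator)
      qed
      also have "\<dots> = (\<integral>\<^sup>+x. ennreal \<bar>f (x + h)\<bar> * indicator (ball (c + h) r) (x + h) \<partial>lborel) + (\<integral>\<^sup>+x\<in>ball c r. ennreal \<bar>f (x + h) - f x\<bar> \<partial>lborel)"
        by (rule nn_integral_add) measurable
      also have "(\<integral>\<^sup>+x. ennreal \<bar>f (x + h)\<bar> * indicator (ball (c + h) r) (x + h) \<partial>lborel) = ennreal (mass f (c + h) r)"
        unfolding ennreal_mass[OF f p]
        by (rule nn_integral_lborel_translate[where h="\<lambda>x. ennreal \<bar>f x\<bar> * indicator (ball (c + h) r) x"]) measurable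
      also have "ennreal (mass f (c + h) r) + (\<integral>\<^sup>+x\<in>ball c r. ennreal \<bar>f (x + h) - f x\<bar> \<partial>lborel) \<le> ennreal (mass f (c + h) r) + ennreal E"
        unfolding E_def \<omega>_def d_def using r by (intro add_left_mono approximable_translate_le[OF fm approx p s _ W]) simp
      finally have mass: "mass f c r \<le> mass f (c + h) r + E"
        using E by (simp add: ennreal_plus[symmetric] mass_nonneg del: ennreal_plus)
      have "r powr (\<alpha> - d) * E \<le> (\<omega> + 1) * V * norm h"
      proof -
        have 1: "r powr (\<alpha> - d) * (s * (\<omega> * r ^ DIM('a))) = V * \<omega>"
        proof -
          have "r powr (\<alpha> - d) * r powr (- \<alpha>) * r powr d = 1" using r by (simp add: powr_add[symmetric])
          moreover have "r ^ DIM('a) = r powr d" using r by (simp add: d_def powr_realpow)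
          ultimately show ?thesis by (simp add: s_def)
        qed
        have sV: "s powr (1 - p) * V powr p = V * r powr (d - \<alpha>)"
        proof -
          have "V powr (1 - p) * V powr p = V" using V by (simp add: powr_add[symmetric])
          moreover have "- \<alpha> * (1 - p) = d - \<alpha>" using \<alpha>p by (simp add: algebra_simps)
          moreover have "s powr (1 - p) = V powr (1 - p) * r powr (- \<alpha> * (1 - p))"
            using V r by (simp add: s_def powr_mult powr_powr)
          ultimately show ?thesis by (metis mult.assoc mult.commute)
        qed
        have "s powr (1 - p) * W \<le> s powr (1 - p) * V powr p" using V by (intro mult_left_mono) auto
        then have "r powr (\<alpha> - d) * (s powr (1 - p) * W) \<le> r powr (\<alpha> - d) * (V * r powr (d - \<alpha>))"
          unfolding sV by (intro mult_left_mono) auto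
        also have "\<dots> = V"
        proof -
          have "r powr (\<alpha> - d) * r powr (d - \<alpha>) = 1" using r by (simp add: powr_add[symmetric])
          then show ?thesis by (metis mult.left_commute mult.right_neutral)
        qed
        finally have 2: "r powr (\<alpha> - d) * (s powr (1 - p) * W) \<le> V" .
        have "r powr (\<alpha> - d) * E = norm h * (r powr (\<alpha> - d) * (s * (\<omega> * r ^ DIM('a))) + r powr (\<alpha> - d) * (s powr (1 - p) * W))"
          by (simp add: E_def algebra_simps)
        also have "\<dots> \<le> norm h * (V * \<omega> + V)" using 1 2 by (intro mult_left_mono add_mono) auto
        finally show ?thesis by (simp add: algebra_simps)
      qed
      moreover have "frac_val \<alpha> f c r \<le> frac_val \<alpha> f (c + h) r + r powr (\<alpha> - d) * E"
        unfolding frac_val_def d_def[symmetric] using mult_left_mono[OF mass, of "r powr (\<alpha> - d)"] by (simp add: distrib_left)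
      moreover have "frac_val \<alpha> f (c + h) r \<le> M y"
        using Mu[OF A_translate[OF A, of h]] by (simp add: h_def)
      ultimately show "frac_val \<alpha> f c r \<le> M y + (\<omega> + 1) * V * norm (x - y)"
        by (simp add: h_def norm_minus_commute)
    qed
    define L where "L = (\<omega> + 1) * W powr (1 / p)"
    have L0: "L \<ge> 0" using \<omega> by (simp add: L_def)
    have lip1: "M x \<le> M y + L * norm (x - y)" for x y
    proof (cases "W = 0")
      case False
      then have "0 < W powr (1 / p)" "W \<le> (W powr (1 / p)) powr p" using W p by (auto simp: powr_powr)
      from lipV[OF this] show ?thesis by (simp add: L_def)
    next
      case True
      show ?thesis
      proof (rule field_le_epsilon)
        fix e :: real assume e: "0 < e"
        define V where "V = e / ((\<omega> + 1) * (norm (x - y) + 1))"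
        have n1: "norm (x - y) + 1 > 0" by (simp add: add_nonneg_pos)
        then have V: "0 < V" using e \<omega> by (simp add: V_def)
        have "M x \<le> M y + (\<omega> + 1) * V * norm (x - y)" by (rule lipV[OF V]) (simp add: True)
        also have "(\<omega> + 1) * V * norm (x - y) \<le> (\<omega> + 1) * V * (norm (x - y) + 1)" using \<omega> V by (intro mult_left_mono) auto
        also have "\<dots> = e" using \<omega> n1 by (simp add: V_def)
        finally show "M x \<le> M y + L * norm (x - y) + e" using L0 by (smt (verit) mult_nonneg_nonneg norm_ge_zero)
      qed
    qed
    have lip: "\<bar>M x - M y\<bar> \<le> L * norm (x - y)" for x y
      using lip1[of x y] lip1[of y x] by (simp add: norm_minus_commute abs_le_iff)
    define H where "H x = (\<Sum>i\<in>Basis. quotient_limit M i x *\<^sub>R i)" for x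
    have Hi: "H x \<bullet> i = quotient_limit M i x" if "i \<in> Basis" for x i
      unfolding H_def using that by (simp add: inner_sum_left inner_Basis if_distrib cong: if_cong)
    have Mm[measurable]: "M \<in> borel_measurable borel"
      unfolding M_def using max_val_measurable[OF f p \<alpha>'] by measurable
    have qm[measurable]: "quotient_limit M i \<in> borel_measurable borel" for i
      unfolding quotient_limit_def by measurable
    have Hm[measurable]: "H \<in> borel_measurable borel" unfolding H_def by measurable
    have qb: "AE x in lborel. \<bar>quotient_limit M i x\<bar> \<le> L" if i: "i \<in> Basis" for i
      using lipschitz_partially_differentiable_AE[OF lip, of i]
    proof eventually_elim
      case (elim x)
      then obtain D where D: "((\<lambda>t. M (x + t *\<^sub>R i)) has_real_derivative D) (at 0)" by blast
      have "(\<lambda>n. \<bar>(M (x + (1 / real (Suc n)) *\<^sub>R i) - M (x + 0 *\<^sub>R i)) / (1 / Suc n)\<bar>) \<longlonglongrightarrow> \<bar>D\<bar>"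
        by (intro tendsto_rabs LIMSEQ_difference_quotient[OF D])
      moreover have "\<bar>(M (x + (1 / real (Suc n)) *\<^sub>R i) - M (x + 0 *\<^sub>R i)) / (1 / Suc n)\<bar> \<le> L" for n
      proof -
        define e where "e = 1 / real (Suc n)"
        have e: "e > 0" by (simp add: e_def)
        have "\<bar>M (x + e *\<^sub>R i) - M x\<bar> \<le> L * e"
          using lip[of "x + e *\<^sub>R i" x] i e by simp
        then have "\<bar>(M (x + e *\<^sub>R i) - M (x + 0 *\<^sub>R i)) / e\<bar> \<le> L"
          using e by (simp add: pos_divide_le_eq abs_divide)
        then show ?thesis unfolding e_def .
      qed
      ultimately have "\<bar>D\<bar> \<le> L" by (intro LIMSEQ_le_const2) auto
      then show ?case using quotient_limit_eq[OF D] by simp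
    qed
    have "has_weak_gradient M H"
    proof (rule has_weak_gradient_lborelI)
      show "locally_finite_integral M" unfolding M_def by (rule locally_finite_max_val[OF f p \<alpha>'])
      show "locally_finite_integral (\<lambda>x. H x \<bullet> i)" if i: "i \<in> Basis" for i
        unfolding Hi[OF i]
      proof (rule locally_finite_integralI_AE[where k'="\<lambda>_. L"])
        show "locally_finite_integral (\<lambda>_::'a. L)"
          unfolding locally_finite_integral_def using emeasure_lborel_ball_finite[of "0::'a"]
          by (auto simp: nn_integral_cmult_indicator ennreal_mult_less_top)
      qed (use qb[OF i] in auto)
      show "(\<integral>x. M x * partial_deriv \<phi> i x \<partial>lborel) = - (\<integral>x. (H x \<bullet> i) * \<phi> x \<partial>lborel)" if "test_function \<phi>" "i \<in> Basis" for \<phi> i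
        unfolding Hi[OF that(2)] by (rule lipschitz_weak_derivative[OF lip that(2,1)])
    qed
    moreover have "AE x in lborel. norm (H x) \<le> (d * (\<omega> + 1)) * W powr (1 / p)"
    proof -
      have "AE x in lborel. \<forall>i\<in>Basis. \<bar>quotient_limit M i x\<bar> \<le> L"
        by (subst AE_finite_all) (use qb in auto)
      then show ?thesis
      proof eventually_elim
        case (elim x)
        have "norm (H x) \<le> (\<Sum>i\<in>Basis. \<bar>H x \<bullet> i\<bar>)" by (rule norm_le_l1)
        also have "\<dots> \<le> (\<Sum>i\<in>(Basis::'a set). L)" by (intro sum_mono) (use elim in \<open>auto simp: Hi\<close>)
        also have "\<dots> = d * L" by (simp add: d_def)
        finally show ?case by (simp add: L_def)
      qed
    qed
    ultimately show "\<exists>H\<in>borel_measurable borel. has_weak_gradient (\<lambda>x. enn2real (max_val \<alpha> f x)) H \<and>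
        (AE x in lborel. norm (H x) \<le> (d * (\<omega> + 1)) * W powr (1 / p))"
      using Hm unfolding M_def[abs_def] by blast
  qed
  then show ?thesis using d \<omega> by (intro exI[of _ "d * (\<omega> + 1)"]) auto
qed

end

section \<open>Mollification\<close>

text \<open>The classical flat function with a polynomial in 1 / t in front: a family closed under
  differentiation, where the polynomial keeps track of the derivatives.\<close>

definition flat_exp :: "real poly \<Rightarrow> real \<Rightarrow> real" where
  "flat_exp P t = (if 0 < t then poly P (1 / t) * exp (- (1 / t)) else 0)"

lemma poly_times_exp_minus_tendsto_0:
  fixes P :: "real poly"
  shows "((\<lambda>s. poly P s * exp (- s)) \<longlongrightarrow> 0) at_top"
proof -
  have "((\<lambda>s. \<Sum>i\<le>degree P. coeff P i * (s ^ i / exp s)) \<longlongrightarrow> (\<Sum>i\<le>degree P. coeff P i * 0)) at_top"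
    by (intro tendsto_sum tendsto_mult_left tendsto_power_div_exp_0)
  moreover have "(\<lambda>s. \<Sum>i\<le>degree P. coeff P i * (s ^ i / exp s)) = (\<lambda>s. poly P s * exp (- s))"
    by (simp add: poly_altdef sum_distrib_right exp_minus divide_inverse mult.assoc)
  ultimately show ?thesis by simp
qed

text \<open>The new polynomial X^2 (P - P') comes from the chain rule in 1 / t. At 0 the right
  difference quotient is X P evaluated at 1 / t, times the exponential, and tends to 0.\<close>

lemma DERIV_flat_exp:
  "(flat_exp P has_real_derivative flat_exp ([:0, 0, 1:] * (P - pderiv P)) t) (at t)"
proof -
  consider "t < 0" | "t > 0" | "t = 0" by linarith
  then show ?thesis
  proof cases
    case 1
    have "(flat_exp P has_real_derivative 0) (at t)"
      by (rule has_field_derivative_transform_within_open[where S="{..<0}" and f="\<lambda>_. 0"])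
         (use 1 in \<open>auto simp: flat_exp_def\<close>)
    with 1 show ?thesis by (simp add: flat_exp_def)
  next
    case 2
    have "((\<lambda>t. poly P (1 / t) * exp (- (1 / t))) has_real_derivative flat_exp ([:0, 0, 1:] * (P - pderiv P)) t) (at t)"
      using 2 by (auto intro!: derivative_eq_intros DERIV_chain2[OF poly_DERIV] simp: flat_exp_def field_simps power2_eq_square)
    then show ?thesis
      by (rule has_field_derivative_transform_within_open[where S="{0<..}"])
         (use 2 in \<open>auto simp: flat_exp_def\<close>)
  next
    case 3
    have l: "((\<lambda>h. flat_exp P h / h) \<longlongrightarrow> 0) (at_left 0)"
    proof (rule tendsto_eventually)
      show "\<forall>\<^sub>F h in at_left 0. flat_exp P h / h = 0"
        by (auto simp: eventually_at_filter flat_exp_def)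
    qed
    have "((\<lambda>s. poly ([:0, 1:] * P) s * exp (- s)) \<longlongrightarrow> 0) at_top" by (rule poly_times_exp_minus_tendsto_0)
    then have "((\<lambda>h. poly ([:0, 1:] * P) (inverse h) * exp (- inverse h)) \<longlongrightarrow> 0) (at_right 0)"
      by (rule filterlim_compose) (rule filterlim_inverse_at_top_right)
    then have r: "((\<lambda>h. flat_exp P h / h) \<longlongrightarrow> 0) (at_right 0)"
    proof (rule Lim_transform_eventually)
      show "\<forall>\<^sub>F h in at_right 0. poly ([:0, 1:] * P) (inverse h) * exp (- inverse h) = flat_exp P h / h"
        by (auto simp: eventually_at_filter flat_exp_def inverse_eq_divide)
    qed
    from l r have "((\<lambda>h. flat_exp P h / h) \<longlongrightarrow> 0) (at 0)"
      using filterlim_split_at by blast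
    with 3 show ?thesis by (simp add: DERIV_def flat_exp_def)
  qed
qed

text \<open>A syntactic class closed under partial derivatives, so that smoothness of the mollifiers
  is an induction on the order in \<open>Ck\<close>. Composition occurs only with affine arguments c
  + x \<bullet> v.\<close>

inductive smooth_class :: "('a::euclidean_space \<Rightarrow> real) \<Rightarrow> bool" where
  const: "smooth_class (\<lambda>_. c)"
| flat: "smooth_class (\<lambda>x. flat_exp P (c + x \<bullet> v))"
| add: "smooth_class f \<Longrightarrow> smooth_class g \<Longrightarrow> smooth_class (\<lambda>x. f x + g x)"
| mult: "smooth_class f \<Longrightarrow> smooth_class g \<Longrightarrow> smooth_class (\<lambda>x. f x * g x)"

lemma partial_deriv_eqI: "(\<phi> has_derivative \<phi>') (at x) \<Longrightarrow> partial_deriv \<phi> v x = \<phi>' v"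
  using frechet_derivative_at[of \<phi> \<phi>' x] by (simp add: partial_deriv_def)

lemma smooth_class_has_derivative:
  assumes "smooth_class f"
  shows "(\<forall>x. f differentiable (at x)) \<and> (\<forall>i. smooth_class (partial_deriv f i))"
  using assms
proof induction
  case (const c)
  have "partial_deriv (\<lambda>_::'a. c) i = (\<lambda>_. 0)" for i :: 'a
    using partial_deriv_eqI[OF has_derivative_const[of c]] by auto
  then show ?case by (auto intro: smooth_class.const)
next
  case (flat P c v)
  have D: "((\<lambda>x. flat_exp P (c + x \<bullet> v)) has_derivative (\<lambda>h. flat_exp ([:0, 0, 1:] * (P - pderiv P)) (c + x \<bullet> v) * (h \<bullet> v))) (at x)" for x
  proof -
    have "((\<lambda>x. c + x \<bullet> v) has_derivative (\<lambda>h. h \<bullet> v)) (at x)" by (auto intro!: derivative_eq_intros)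
    from has_derivative_compose[OF this DERIV_flat_exp[THEN has_field_derivative_imp_has_derivative]]
    show ?thesis .
  qed
  then have "partial_deriv (\<lambda>x. flat_exp P (c + x \<bullet> v)) i = (\<lambda>x. flat_exp ([:0, 0, 1:] * (P - pderiv P)) (c + x \<bullet> v) * (i \<bullet> v))" for i
    using partial_deriv_eqI by blast
  then show ?case using D by (auto simp: differentiable_def intro!: smooth_class.intros)
next
  case (add f g)
  have df: "(f has_derivative frechet_derivative f (at x)) (at x)" "(g has_derivative frechet_derivative g (at x)) (at x)" for x
    using add.IH by (simp_all add: frechet_derivative_works[symmetric])
  note D = has_derivative_add[OF df]
  have "partial_deriv (\<lambda>x. f x + g x) i x = partial_deriv f i x + partial_deriv g i x" for i x
    using partial_deriv_eqI[OF D] unfolding partial_deriv_def[of f] partial_deriv_def[of g] .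
  then have "partial_deriv (\<lambda>x. f x + g x) i = (\<lambda>x. partial_deriv f i x + partial_deriv g i x)" for i by (rule ext)
  then show ?case using D add.IH by (auto simp: differentiable_def intro: smooth_class.add)
next
  case (mult f g)
  have df: "(f has_derivative frechet_derivative f (at x)) (at x)" "(g has_derivative frechet_derivative g (at x)) (at x)" for x
    using mult.IH by (simp_all add: frechet_derivative_works[symmetric])
  note D = has_derivative_mult[OF df]
  have "partial_deriv (\<lambda>x. f x * g x) i x = f x * partial_deriv g i x + partial_deriv f i x * g x" for i x
    using partial_deriv_eqI[OF D] unfolding partial_deriv_def[of f] partial_deriv_def[of g] .
  then have "partial_deriv (\<lambda>x. f x * g x) i = (\<lambda>x. f x * partial_deriv g i x + partial_deriv f i x * g x)" for i by (rule ext)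
  moreover have "smooth_class (\<lambda>x. f x * partial_deriv g i x + partial_deriv f i x * g x)" for i
    by (intro smooth_class.add smooth_class.mult) (use mult in auto)
  ultimately show ?case using differentiableI[OF D] by simp
qed

lemma smooth_class_differentiable: "smooth_class f \<Longrightarrow> f differentiable (at x)"
  using smooth_class_has_derivative by blast

lemma smooth_class_partial: "smooth_class f \<Longrightarrow> smooth_class (partial_deriv f i)"
  using smooth_class_has_derivative by blast

lemma smooth_class_continuous: "smooth_class f \<Longrightarrow> continuous_on UNIV f"
  by (simp add: smooth_class_differentiable differentiable_imp_continuous_within continuous_at_imp_continuous_on)

lemma smooth_class_Ck: "smooth_class f \<Longrightarrow> Ck k f"
  by (induction k arbitrary: f) (auto simp: smooth_class_continuous smooth_class_differentiable smooth_class_partial)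

lemma smooth_class_smooth: "smooth_class f \<Longrightarrow> smooth_fun f"
  by (simp add: smooth_fun_def smooth_class_Ck)

lemma smooth_class_prod:
  assumes "\<And>i. i \<in> I \<Longrightarrow> smooth_class (f i)"
  shows "smooth_class (\<lambda>x. \<Prod>i\<in>I. f i x)"
  using assms by (induction I rule: infinite_finite_induct) (auto intro: smooth_class.intros)

lemma test_functionI:
  assumes "smooth_fun \<phi>" "\<And>x. R \<le> norm x \<Longrightarrow> \<phi> x = 0"
  shows "test_function \<phi>"
proof -
  have "{x. \<phi> x \<noteq> 0} \<subseteq> cball 0 R"
  proof
    fix x assume "x \<in> {x. \<phi> x \<noteq> 0}"
    then have "\<not> R \<le> norm x" using assms(2)[of x] by blast
    then show "x \<in> cball 0 R" by simp
  qed
  then have "compact (closure {x. \<phi> x \<noteq> 0})" using bounded_subset[OF bounded_cball] by (simp add: compact_closure)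
  then show ?thesis using assms by (simp add: test_function_def)
qed

text \<open>A product over coordinates rather than a function of the norm: every factor has an
  affine argument and so fits \<open>smooth_class\<close>. For \<epsilon> > 0 it is positive exactly
  on the open cube with half side \<epsilon>.\<close>

definition bump :: "real \<Rightarrow> 'a::euclidean_space \<Rightarrow> real" where
  "bump \<epsilon> z = (\<Prod>i\<in>Basis. flat_exp 1 (1 - (z \<bullet> i) / \<epsilon>) * flat_exp 1 (1 + (z \<bullet> i) / \<epsilon>))"

lemma flat_exp_1_pos_iff: "flat_exp 1 t > 0 \<longleftrightarrow> t > 0" and flat_exp_1_nonneg: "flat_exp 1 t \<ge> 0"
  by (auto simp: flat_exp_def)

lemma bump_smooth_class: "smooth_class (bump \<epsilon>)"
  unfolding bump_def
proof (rule smooth_class_prod)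
  fix i :: 'a
  have "smooth_class (\<lambda>z. flat_exp 1 (1 + z \<bullet> ((- 1 / \<epsilon>) *\<^sub>R i)) * flat_exp 1 (1 + z \<bullet> ((1 / \<epsilon>) *\<^sub>R i)))"
    by (intro smooth_class.intros)
  then show "smooth_class (\<lambda>z. flat_exp 1 (1 - z \<bullet> i / \<epsilon>) * flat_exp 1 (1 + z \<bullet> i / \<epsilon>))" by simp
qed

text \<open>\<open>smooth_class\<close> has no general rule for composition, so the reflected
  translate, which serves as a test function in y, is checked from the product formula.\<close>

lemma bump_reflect_smooth_class: "smooth_class (\<lambda>y. bump \<epsilon> (x - y))"
  unfolding bump_def
proof (rule smooth_class_prod)
  fix i :: 'a
  have "smooth_class (\<lambda>y. flat_exp 1 ((1 - x \<bullet> i / \<epsilon>) + y \<bullet> ((1 / \<epsilon>) *\<^sub>R i)) * flat_exp 1 ((1 + x \<bullet> i / \<epsilon>) + y \<bullet> ((- 1 / \<epsilon>) *\<^sub>R i)))"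
    by (intro smooth_class.intros)
  then show "smooth_class (\<lambda>y. flat_exp 1 (1 - (x - y) \<bullet> i / \<epsilon>) * flat_exp 1 (1 + (x - y) \<bullet> i / \<epsilon>))"
    by (simp add: inner_diff_left diff_divide_distrib algebra_simps)
qed

lemma bump_nonneg: "bump \<epsilon> z \<ge> 0"
  unfolding bump_def by (intro prod_nonneg) (auto simp: flat_exp_1_nonneg)

lemma bump_even: "bump \<epsilon> (- z) = bump \<epsilon> z"
  unfolding bump_def by (intro prod.cong) (auto simp: mult.commute)

lemma bump_pos:
  assumes "0 < \<epsilon>" "norm z < \<epsilon>"
  shows "bump \<epsilon> z > 0"
  unfolding bump_def
proof (intro prod_pos mult_pos_pos)
  fix i :: 'a assume "i \<in> Basis"
  then have "\<bar>z \<bullet> i\<bar> < \<epsilon>" using Basis_le_norm[of i z] assms by simp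
  then show "0 < flat_exp 1 (1 - z \<bullet> i / \<epsilon>)" "0 < flat_exp 1 (1 + z \<bullet> i / \<epsilon>)"
    unfolding flat_exp_1_pos_iff using assms by (auto simp: field_simps abs_less_iff)
qed

lemma bump_support:
  fixes z :: "'a::euclidean_space"
  assumes "0 < \<epsilon>" "real DIM('a) * \<epsilon> \<le> norm z"
  shows "bump \<epsilon> z = 0"
proof (rule ccontr)
  assume nz: "bump \<epsilon> z \<noteq> 0"
  have lt: "\<bar>z \<bullet> i\<bar> < \<epsilon>" if i: "i \<in> Basis" for i
  proof -
    have "flat_exp 1 (1 - z \<bullet> i / \<epsilon>) * flat_exp 1 (1 + z \<bullet> i / \<epsilon>) \<noteq> 0"
      using nz i unfolding bump_def by (meson finite_Basis prod_zero)
    then have "0 < 1 - z \<bullet> i / \<epsilon>" "0 < 1 + z \<bullet> i / \<epsilon>" by (auto simp: flat_exp_def split: if_splits)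
    then show ?thesis using assms by (auto simp: field_simps abs_less_iff)
  qed
  have "norm z \<le> (\<Sum>i\<in>Basis. \<bar>z \<bullet> i\<bar>)" by (rule norm_le_l1)
  also have "\<dots> < (\<Sum>i\<in>(Basis::'a set). \<epsilon>)" by (rule sum_strict_mono) (auto simp: lt)
  finally show False using assms by simp
qed

text \<open>The reflected translates are included because they are the test functions for the weak
  gradient of f; evenness gives the signs when a convolution is moved from one factor to the
  other.\<close>

definition mollifier :: "real \<Rightarrow> ('a::euclidean_space \<Rightarrow> real) \<Rightarrow> bool" where
  "mollifier \<epsilon> \<eta> \<longleftrightarrow> smooth_class \<eta> \<and> (\<forall>x. smooth_class (\<lambda>y. \<eta> (x - y))) \<and> (\<forall>z. 0 \<le> \<eta> z) \<and> (\<forall>z. \<eta> (- z) = \<eta> z) \<and>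
     (\<forall>z. \<epsilon> \<le> norm z \<longrightarrow> \<eta> z = 0) \<and> (\<integral>\<^sup>+z. ennreal (\<eta> z) \<partial>lborel) = 1"

lemma mollifier_exists:
  assumes "0 < \<epsilon>"
  shows "\<exists>\<eta> :: 'a::euclidean_space \<Rightarrow> real. mollifier \<epsilon> \<eta>"
proof -
  \<comment> \<open>The cube with half side \<delta> lies in the ball of radius d \<delta> =
    \<epsilon>.\<close>
  define \<delta> where "\<delta> = \<epsilon> / real DIM('a)"
  have \<delta>: "\<delta> > 0" "real DIM('a) * \<delta> = \<epsilon>" using assms by (auto simp: \<delta>_def)
  define b :: "'a \<Rightarrow> real" where "b = bump \<delta>"
  have bc: "continuous_on UNIV b" unfolding b_def by (rule smooth_class_continuous[OF bump_smooth_class])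
  have [measurable]: "b \<in> borel_measurable borel" by (rule borel_measurable_continuous_onI[OF bc])
  have b0: "b z \<ge> 0" for z by (simp add: b_def bump_nonneg)
  have bs: "b z = 0" if "\<epsilon> \<le> norm z" for z using bump_support[of \<delta> z] \<delta> that by (simp add: b_def)
  have int: "integrable lborel b" by (rule integrable_continuous_bounded_support[OF bc bs])
  define I where "I = (\<integral>z. b z \<partial>lborel)"
  have I: "(\<integral>\<^sup>+z. ennreal (b z) \<partial>lborel) = ennreal I" unfolding I_def by (rule nn_integral_eq_integral[OF int]) (simp add: b0)
  have I0: "I \<ge> 0" unfolding I_def by (rule integral_nonneg_AE) (simp add: b0)
  have "(\<integral>\<^sup>+z. ennreal (b z) \<partial>lborel) \<noteq> 0"
  proof
    assume "(\<integral>\<^sup>+z. ennreal (b z) \<partial>lborel) = 0"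
    then have "AE z in lborel. ennreal (b z) = 0" by (subst (asm) nn_integral_0_iff_AE) auto
    then have "AE z in lborel. z \<notin> ball (0::'a) \<delta>"
      by eventually_elim (use bump_pos[OF \<delta>(1)] b0 in \<open>force simp: b_def ennreal_eq_0_iff\<close>)
    then have "emeasure lborel (ball (0::'a) \<delta>) = 0"
      by (subst (asm) AE_iff_measurable[of "ball (0::'a) \<delta>"]) auto
    moreover have "0 < unit_ball_vol (real DIM('a)) * \<delta> ^ DIM('a)" using \<delta>(1) by simp
    ultimately show False using \<delta>(1) by (simp add: emeasure_ball ennreal_eq_0_iff del: mult_pos_pos)
  qed
  then have Ip: "I > 0" using I I0 by (cases "I = 0") auto
  define \<eta> where "\<eta> z = (1 / I) * b z" for z
  have "mollifier \<epsilon> \<eta>"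
    unfolding mollifier_def
  proof (intro conjI allI impI)
    show "smooth_class \<eta>" unfolding \<eta>_def b_def by (intro smooth_class.mult smooth_class.const bump_smooth_class)
    show "smooth_class (\<lambda>y. \<eta> (x - y))" for x
      unfolding \<eta>_def b_def by (intro smooth_class.mult smooth_class.const bump_reflect_smooth_class)
    show "0 \<le> \<eta> z" for z using Ip b0 by (simp add: \<eta>_def)
    show "\<eta> (- z) = \<eta> z" for z by (simp add: \<eta>_def b_def bump_even)
    show "\<eta> z = 0" if "\<epsilon> \<le> norm z" for z using bs[OF that] by (simp add: \<eta>_def)
    have "(\<integral>\<^sup>+z. ennreal (\<eta> z) \<partial>lborel) = (\<integral>\<^sup>+z. ennreal (1 / I) * ennreal (b z) \<partial>lborel)"
      by (intro nn_integral_cong) (simp only: \<eta>_def, rule ennreal_mult, use Ip b0 in auto)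
    also have "\<dots> = ennreal (1 / I) * ennreal I" by (subst nn_integral_cmult) (auto simp: I)
    also have "\<dots> = 1" using Ip by (simp add: ennreal_mult[symmetric])
    finally show "(\<integral>\<^sup>+z. ennreal (\<eta> z) \<partial>lborel) = 1" .
  qed
  then show ?thesis by blast
qed

section \<open>Convolution with smooth compactly supported functions\<close>

definition cutoff :: "('a::euclidean_space \<Rightarrow> real) \<Rightarrow> bool" where
  "cutoff \<eta> \<longleftrightarrow> smooth_class \<eta> \<and> (\<exists>R. \<forall>z. R \<le> norm z \<longrightarrow> \<eta> z = 0)"

lemma cutoff_test_function: "cutoff \<eta> \<Longrightarrow> test_function \<eta>"
  unfolding cutoff_def using test_functionI smooth_class_smooth by blast

text \<open>Differentiation destroys the sign and the normalisation of a mollifier but preserves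
  this class, which allows induction on the order of the derivative.\<close>

lemma cutoff_partial:
  assumes "cutoff \<eta>"
  shows "cutoff (partial_deriv \<eta> i)"
proof -
  obtain R where "\<And>x v. R \<le> norm x \<Longrightarrow> partial_deriv \<eta> v x = 0"
    using test_function_bounded_support[OF cutoff_test_function[OF assms]] by metis
  then show ?thesis using assms smooth_class_partial unfolding cutoff_def by blast
qed

lemma partial_deriv_sum_Basis:
  fixes \<phi> :: "'a::euclidean_space \<Rightarrow> real"
  assumes "\<phi> differentiable (at z)"
  shows "partial_deriv \<phi> v z = (\<Sum>i\<in>Basis. (v \<bullet> i) * partial_deriv \<phi> i z)"
proof -
  have lin: "linear (frechet_derivative \<phi> (at z))"
    using assms frechet_derivative_works has_derivative_linear by blast
  have "partial_deriv \<phi> v z = frechet_derivative \<phi> (at z) (\<Sum>i\<in>Basis. (v \<bullet> i) *\<^sub>R i)"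
    by (simp add: partial_deriv_def euclidean_representation)
  also have "\<dots> = (\<Sum>i\<in>Basis. (v \<bullet> i) * partial_deriv \<phi> i z)"
    by (simp add: linear_sum[OF lin] linear_cmul[OF lin] partial_deriv_def)
  finally show ?thesis .
qed

lemma test_function_partial_bound:
  fixes \<phi> :: "'a::euclidean_space \<Rightarrow> real"
  assumes \<phi>: "test_function \<phi>"
  obtains B where "0 \<le> B" "\<And>i x. i \<in> Basis \<Longrightarrow> \<bar>partial_deriv \<phi> i x\<bar> \<le> B"
proof -
  obtain R where R: "\<And>x v. R \<le> norm x \<Longrightarrow> partial_deriv \<phi> v x = 0"
    using test_function_bounded_support[OF \<phi>] by metis
  have "\<exists>B. 0 \<le> B \<and> (\<forall>x. \<bar>partial_deriv \<phi> i x\<bar> \<le> B)" if "i \<in> Basis" for i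
    using bounded_of_continuous_support[OF test_function_partial_continuous[OF \<phi> that] R] by metis
  then obtain b where b: "\<And>i. i \<in> Basis \<Longrightarrow> 0 \<le> b i" "\<And>i x. i \<in> Basis \<Longrightarrow> \<bar>partial_deriv \<phi> i x\<bar> \<le> b i" by metis
  show ?thesis
  proof (rule that)
    show "0 \<le> (\<Sum>i\<in>Basis. b i)" using b by (simp add: sum_nonneg)
    show "\<bar>partial_deriv \<phi> i x\<bar> \<le> (\<Sum>i\<in>Basis. b i)" if "i \<in> Basis" for i x
      using b that member_le_sum[of i Basis b] by (meson finite_Basis order_trans DiffD1)
  qed
qed

lemma test_function_lipschitz:
  fixes \<phi> :: "'a::euclidean_space \<Rightarrow> real"
  assumes \<phi>: "test_function \<phi>"
  obtains B where "0 \<le> B" "\<And>x v. \<bar>\<phi> (x + v) - \<phi> x\<bar> \<le> B * norm v"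
proof -
  obtain b where b: "0 \<le> b" "\<And>i x. i \<in> Basis \<Longrightarrow> \<bar>partial_deriv \<phi> i x\<bar> \<le> b"
    using test_function_partial_bound[OF \<phi>] by metis
  have pd: "\<bar>partial_deriv \<phi> v x\<bar> \<le> real DIM('a) * b * norm v" for v x
  proof -
    have "\<bar>partial_deriv \<phi> v x\<bar> \<le> (\<Sum>i\<in>Basis. \<bar>(v \<bullet> i) * partial_deriv \<phi> i x\<bar>)"
      unfolding partial_deriv_sum_Basis[OF test_function_differentiable[OF \<phi>], of v] by (rule sum_abs)
    also have "\<dots> \<le> (\<Sum>i\<in>(Basis::'a set). norm v * b)"
      unfolding abs_mult by (intro sum_mono mult_mono) (auto simp: Basis_le_norm b)
    finally show ?thesis by (simp add: ac_simps)
  qed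
  have "\<bar>\<phi> (x + v) - \<phi> x\<bar> \<le> real DIM('a) * b * norm v" for x v
  proof -
    have "norm (\<phi> (x + 1 *\<^sub>R v) - \<phi> (x + 0 *\<^sub>R v)) \<le> (real DIM('a) * b * norm v) * norm (1 - 0 :: real)"
      by (rule field_differentiable_bound[of UNIV "\<lambda>t. \<phi> (x + t *\<^sub>R v)" "\<lambda>t. partial_deriv \<phi> v (x + t *\<^sub>R v)"])
         (use has_real_derivative_along_line[OF test_function_differentiable[OF \<phi>]] pd in auto)
    then show ?thesis by simp
  qed
  then show ?thesis using that[of "real DIM('a) * b"] b by simp
qed

text \<open>Mean value inequality for \<eta> (z + t h) minus its linear part, using that the partial
  derivatives are Lipschitz. The bound is uniform in z, which permits integrating it against
  f.\<close>

lemma cutoff_taylor: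
  fixes \<eta> :: "'a::euclidean_space \<Rightarrow> real"
  assumes \<eta>: "cutoff \<eta>"
  obtains B where "0 \<le> B" "\<And>z h. \<bar>\<eta> (z + h) - \<eta> z - (\<Sum>i\<in>Basis. (h \<bullet> i) * partial_deriv \<eta> i z)\<bar> \<le> B * (norm h)\<^sup>2"
proof -
  have "\<exists>B. 0 \<le> B \<and> (\<forall>x v. \<bar>partial_deriv \<eta> i (x + v) - partial_deriv \<eta> i x\<bar> \<le> B * norm v)" for i
    using test_function_lipschitz[OF cutoff_test_function[OF cutoff_partial[OF \<eta>]]] by metis
  then obtain b where b: "\<And>i. 0 \<le> b i" "\<And>i x v. \<bar>partial_deriv \<eta> i (x + v) - partial_deriv \<eta> i x\<bar> \<le> b i * norm v" by metis
  define B where "B = (\<Sum>i\<in>(Basis::'a set). b i)"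
  have B: "B \<ge> 0" by (simp add: B_def sum_nonneg b)
  have dif: "\<eta> differentiable (at x)" for x by (rule test_function_differentiable[OF cutoff_test_function[OF \<eta>]])
  have "\<bar>\<eta> (z + h) - \<eta> z - (\<Sum>i\<in>Basis. (h \<bullet> i) * partial_deriv \<eta> i z)\<bar> \<le> B * (norm h)\<^sup>2" for z h
  proof -
    define P where "P x = (\<Sum>i\<in>Basis. (h \<bullet> i) * partial_deriv \<eta> i x)" for x
    have der: "((\<lambda>t. \<eta> (z + t *\<^sub>R h) - t * P z) has_real_derivative (P (z + t *\<^sub>R h) - P z)) (at t)" for t
      using has_real_derivative_along_line[where \<phi>=\<eta> and x=z and t=t and v=h, OF dif] unfolding partial_deriv_sum_Basis[OF dif, of h] P_def[symmetric]
      by (auto intro!: derivative_eq_intros)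
    have bd: "\<bar>P (z + t *\<^sub>R h) - P z\<bar> \<le> B * (norm h)\<^sup>2" if "t \<in> {0..1}" for t
    proof -
      have "\<bar>P (z + t *\<^sub>R h) - P z\<bar> \<le> (\<Sum>i\<in>Basis. \<bar>(h \<bullet> i) * (partial_deriv \<eta> i (z + t *\<^sub>R h) - partial_deriv \<eta> i z)\<bar>)"
        unfolding P_def sum_subtractf[symmetric] right_diff_distrib[symmetric] by (rule sum_abs)
      also have "\<dots> \<le> (\<Sum>i\<in>Basis. norm h * (b i * norm h))"
      proof (rule sum_mono)
        fix i :: 'a assume i: "i \<in> Basis"
        have "norm (t *\<^sub>R h) \<le> norm h" using that by (simp add: mult_left_le_one_le)
        then have "b i * norm (t *\<^sub>R h) \<le> b i * norm h" using b(1) by (intro mult_left_mono)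
        then have "\<bar>partial_deriv \<eta> i (z + t *\<^sub>R h) - partial_deriv \<eta> i z\<bar> \<le> b i * norm h" using b(2)[of i z "t *\<^sub>R h"] by linarith
        then show "\<bar>(h \<bullet> i) * (partial_deriv \<eta> i (z + t *\<^sub>R h) - partial_deriv \<eta> i z)\<bar> \<le> norm h * (b i * norm h)"
          unfolding abs_mult by (intro mult_mono) (auto simp: Basis_le_norm i)
      qed
      also have "\<dots> = B * (norm h)\<^sup>2" by (simp add: B_def sum_distrib_left sum_distrib_right power2_eq_square ac_simps)
      finally show ?thesis .
    qed
    have "norm ((\<eta> (z + 1 *\<^sub>R h) - 1 * P z) - (\<eta> (z + 0 *\<^sub>R h) - 0 * P z)) \<le> (B * (norm h)\<^sup>2) * norm (1 - 0 :: real)"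
      by (rule field_differentiable_bound[of "{0..1}" "\<lambda>t. \<eta> (z + t *\<^sub>R h) - t * P z" "\<lambda>t. P (z + t *\<^sub>R h) - P z"])
         (use der bd in \<open>auto intro: has_field_derivative_at_within\<close>)
    then show ?thesis by (simp add: P_def)
  qed
  then show ?thesis using that B by blast
qed

definition conv :: "('a::euclidean_space \<Rightarrow> real) \<Rightarrow> ('a \<Rightarrow> real) \<Rightarrow> 'a \<Rightarrow> real" where
  "conv f \<eta> x = (\<integral>y. f y * \<eta> (x - y) \<partial>lborel)"

lemma cutoff_reflect_continuous:
  assumes "cutoff \<eta>"
  shows "continuous_on UNIV (\<lambda>y. \<eta> (x - y))"
  by (rule continuous_on_compose2[OF test_function_continuous[OF cutoff_test_function[OF assms]]])
     (auto intro!: continuous_intros)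

lemma conv_integrable:
  fixes f :: "'a::euclidean_space \<Rightarrow> real" and x :: 'a
  assumes f: "locally_finite_integral f" and \<eta>: "cutoff \<eta>"
  shows "integrable lborel (\<lambda>y. f y * \<eta> (x - y))"
proof -
  obtain R where R: "\<And>z. R \<le> norm z \<Longrightarrow> \<eta> z = 0" using \<eta> unfolding cutoff_def by blast
  show ?thesis
  proof (rule locally_finite_integral_times_integrable[OF f cutoff_reflect_continuous[OF \<eta>]])
    fix y :: 'a assume "norm x + R \<le> norm y"
    then have "R \<le> norm (x - y)" using norm_triangle_sub[of y x] by (simp add: norm_minus_commute)
    then show "\<eta> (x - y) = 0" by (rule R)
  qed
qed

text \<open>Integrates the uniform Taylor remainder against f, which is only locally integrable: for
  |h| \<le> 1 the remainder vanishes off a fixed ball, so the error is at most a constant times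
  |h|^2.\<close>

lemma conv_has_derivative:
  fixes f :: "'a::euclidean_space \<Rightarrow> real"
  assumes f: "locally_finite_integral f" and \<eta>: "cutoff \<eta>"
  shows "(conv f \<eta> has_derivative (\<lambda>h. \<Sum>i\<in>Basis. (h \<bullet> i) * conv f (partial_deriv \<eta> i) x)) (at x)"
proof -
  have [measurable]: "f \<in> borel_measurable borel" using f by (simp add: locally_finite_integral_def)
  obtain R where R: "0 < R" "\<And>z. R \<le> norm z \<Longrightarrow> \<eta> z = 0" "\<And>z v. R \<le> norm z \<Longrightarrow> partial_deriv \<eta> v z = 0"
    using test_function_bounded_support[OF cutoff_test_function[OF \<eta>]] by metis
  obtain B where B: "0 \<le> B" "\<And>z h. \<bar>\<eta> (z + h) - \<eta> z - (\<Sum>i\<in>Basis. (h \<bullet> i) * partial_deriv \<eta> i z)\<bar> \<le> B * (norm h)\<^sup>2"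
    using cutoff_taylor[OF \<eta>] by metis
  \<comment> \<open>Outside this ball both x - y and x + h - y have norm at least R, as |h| \<le>
    1.\<close>
  define \<rho> where "\<rho> = norm x + R + 1"
  have Kint: "integrable lborel (\<lambda>y. \<bar>f y\<bar> * indicator (ball 0 \<rho>) y)"
  proof (rule integrableI_bounded)
    have "(\<integral>\<^sup>+y. ennreal (norm (\<bar>f y\<bar> * indicator (ball 0 \<rho>) y)) \<partial>lborel) = (\<integral>\<^sup>+y\<in>ball 0 \<rho>. ennreal \<bar>f y\<bar> \<partial>lborel)"
      by (intro nn_integral_cong) (simp split: split_indicator)
    then show "(\<integral>\<^sup>+y. ennreal (norm (\<bar>f y\<bar> * indicator (ball 0 \<rho>) y)) \<partial>lborel) < \<infinity>"
      using f by (simp add: locally_finite_integral_def)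
  qed measurable
  define K where "K = (\<integral>y. \<bar>f y\<bar> * indicator (ball 0 \<rho>) y \<partial>lborel)"
  define F' where "F' h = (\<Sum>i\<in>Basis. (h \<bullet> i) * conv f (partial_deriv \<eta> i) x)" for h
  have bl: "bounded_linear F'"
    unfolding F'_def by (intro bounded_linear_sum bounded_linear_mult_left bounded_linear_compose[OF bounded_linear_mult_left bounded_linear_inner_left, unfolded o_def])
  have est: "\<bar>conv f \<eta> (x + h) - conv f \<eta> x - F' h\<bar> \<le> B * (norm h)\<^sup>2 * K" if h: "norm h \<le> 1" for h
  proof -
    define br where "br y = \<eta> (x + h - y) - \<eta> (x - y) - (\<Sum>i\<in>Basis. (h \<bullet> i) * partial_deriv \<eta> i (x - y))" for y
    have ints: "integrable lborel (\<lambda>y. f y * \<eta> (x + h - y))" "integrable lborel (\<lambda>y. f y * \<eta> (x - y))"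
      "integrable lborel (\<lambda>y. f y * partial_deriv \<eta> i (x - y))" for i
      by (intro conv_integrable[OF f] \<eta> cutoff_partial)+
    have "conv f \<eta> (x + h) - conv f \<eta> x - F' h = (\<integral>y. f y * \<eta> (x + h - y) - f y * \<eta> (x - y) - (\<Sum>i\<in>Basis. (h \<bullet> i) * (f y * partial_deriv \<eta> i (x - y))) \<partial>lborel)"
      unfolding F'_def conv_def using ints by simp
    also have "(\<lambda>y. f y * \<eta> (x + h - y) - f y * \<eta> (x - y) - (\<Sum>i\<in>Basis. (h \<bullet> i) * (f y * partial_deriv \<eta> i (x - y)))) = (\<lambda>y. f y * br y)"
      by (intro ext) (simp add: br_def right_diff_distrib sum_distrib_left ac_simps)
    finally have eq: "conv f \<eta> (x + h) - conv f \<eta> x - F' h = (\<integral>y. f y * br y \<partial>lborel)" .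
    have le: "norm (f y * br y) \<le> B * (norm h)\<^sup>2 * (\<bar>f y\<bar> * indicator (ball 0 \<rho>) y)" for y
    proof (cases "norm y < \<rho>")
      case True
      have "\<bar>br y\<bar> \<le> B * (norm h)\<^sup>2" using B(2)[of "x - y" h] by (simp add: br_def algebra_simps)
      from mult_left_mono[OF this, of "\<bar>f y\<bar>"] show ?thesis using True by (simp add: abs_mult ac_simps)
    next
      case False
      then have "norm x + R + 1 \<le> norm y" by (simp add: \<rho>_def)
      moreover have "norm y \<le> norm (x - y) + norm x" using norm_triangle_sub[of y x] by (simp add: norm_minus_commute)
      moreover have "norm (x - y) \<le> norm (x + h - y) + norm h"
        using norm_triangle_ineq[of "x + h - y" "- h"] by (simp add: algebra_simps)
      ultimately have "R \<le> norm (x - y)" "R \<le> norm (x + h - y)" using h by linarith+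
      then have "br y = 0" by (simp add: br_def R)
      then show ?thesis using False by simp
    qed
    have "\<bar>\<integral>y. f y * br y \<partial>lborel\<bar> \<le> (\<integral>y. norm (f y * br y) \<partial>lborel)"
      using integral_norm_bound[of lborel "\<lambda>y. f y * br y"] by simp
    also have "\<dots> \<le> (\<integral>y. B * (norm h)\<^sup>2 * (\<bar>f y\<bar> * indicator (ball 0 \<rho>) y) \<partial>lborel)"
    proof (rule integral_mono)
      have "integrable lborel (\<lambda>y. f y * \<eta> (x + h - y) - f y * \<eta> (x - y) - (\<Sum>i\<in>Basis. (h \<bullet> i) * (f y * partial_deriv \<eta> i (x - y))))"
        using ints by simp
      moreover have "(\<lambda>y. f y * \<eta> (x + h - y) - f y * \<eta> (x - y) - (\<Sum>i\<in>Basis. (h \<bullet> i) * (f y * partial_deriv \<eta> i (x - y)))) = (\<lambda>y. f y * br y)"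
        by (intro ext) (simp add: br_def right_diff_distrib sum_distrib_left ac_simps)
      ultimately show "integrable lborel (\<lambda>y. norm (f y * br y))" by simp
      show "integrable lborel (\<lambda>y. B * (norm h)\<^sup>2 * (\<bar>f y\<bar> * indicator (ball 0 \<rho>) y))" using Kint by simp
    qed (rule le)
    also have "\<dots> = B * (norm h)\<^sup>2 * K" using Kint by (simp add: K_def)
    finally show ?thesis unfolding eq .
  qed
  have "((\<lambda>y. norm ((conv f \<eta> y - conv f \<eta> x) - F' (y - x)) / norm (y - x)) \<longlongrightarrow> 0) (at x)"
  proof (rule Lim_null_comparison)
    show "\<forall>\<^sub>F y in at x. norm (norm ((conv f \<eta> y - conv f \<eta> x) - F' (y - x)) / norm (y - x)) \<le> B * K * norm (y - x)"
      unfolding eventually_at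
    proof (intro exI[of _ 1] conjI ballI impI)
      fix y assume y: "y \<noteq> x \<and> dist y x < 1"
      then have "norm (y - x) > 0" "norm (y - x) \<le> 1" by (auto simp: dist_norm)
      moreover have "\<bar>conv f \<eta> y - conv f \<eta> x - F' (y - x)\<bar> \<le> B * (norm (y - x))\<^sup>2 * K"
        using est[of "y - x"] y by (simp add: dist_norm)
      ultimately show "norm (norm ((conv f \<eta> y - conv f \<eta> x) - F' (y - x)) / norm (y - x)) \<le> B * K * norm (y - x)"
        by (simp add: pos_divide_le_eq power2_eq_square ac_simps)
    qed simp
    show "((\<lambda>y. B * K * norm (y - x)) \<longlongrightarrow> 0) (at x)"
      by (auto intro!: tendsto_eq_intros)
  qed
  then show ?thesis using bl unfolding has_derivative_iff_norm F'_def by blast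
qed

lemma conv_continuous:
  assumes "locally_finite_integral f" "cutoff \<eta>"
  shows "continuous_on UNIV (conv f \<eta>)"
  using conv_has_derivative[OF assms] has_derivative_continuous continuous_at_imp_continuous_on by blast

lemma conv_partial:
  assumes "locally_finite_integral f" "cutoff \<eta>" "i \<in> Basis"
  shows "partial_deriv (conv f \<eta>) i = conv f (partial_deriv \<eta> i)"
proof
  fix x
  have "partial_deriv (conv f \<eta>) i x = (\<Sum>j\<in>Basis. (i \<bullet> j) * conv f (partial_deriv \<eta> j) x)"
    by (rule partial_deriv_eqI[OF conv_has_derivative[OF assms(1,2)]])
  also have "\<dots> = (\<Sum>j\<in>Basis. if j = i then conv f (partial_deriv \<eta> j) x else 0)"
    using assms(3) by (intro sum.cong) (auto simp: inner_Basis)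
  also have "\<dots> = conv f (partial_deriv \<eta> i) x" using assms(3) by simp
  finally show "partial_deriv (conv f \<eta>) i x = conv f (partial_deriv \<eta> i) x" .
qed

lemma conv_Ck:
  assumes "locally_finite_integral f" "cutoff \<eta>"
  shows "Ck k (conv f \<eta>)"
  using assms(2)
proof (induction k arbitrary: \<eta>)
  case 0
  then show ?case using conv_continuous[OF assms(1)] by simp
next
  case (Suc k)
  have "conv f \<eta> differentiable (at x)" for x
    using conv_has_derivative[OF assms(1) Suc.prems] differentiableI by blast
  then show ?case
    using conv_continuous[OF assms(1) Suc.prems] conv_partial[OF assms(1) Suc.prems] Suc.IH[OF cutoff_partial[OF Suc.prems]] by simp
qed

lemma conv_test_function:
  fixes f :: "'a::euclidean_space \<Rightarrow> real"
  assumes f: "locally_finite_integral f" and \<eta>: "cutoff \<eta>" and S: "\<And>x. S \<le> norm x \<Longrightarrow> f x = 0"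
  shows "test_function (conv f \<eta>)"
proof -
  obtain R where R: "\<And>z. R \<le> norm z \<Longrightarrow> \<eta> z = 0" using \<eta> unfolding cutoff_def by blast
  show ?thesis
  proof (rule test_functionI)
    show "smooth_fun (conv f \<eta>)" using conv_Ck[OF f \<eta>] by (simp add: smooth_fun_def)
    fix x :: 'a assume x: "S + R \<le> norm x"
    have "f y * \<eta> (x - y) = 0" for y
    proof (cases "S \<le> norm y")
      case False
      then have "R \<le> norm (x - y)" using x norm_triangle_sub[of x y] by linarith
      then show ?thesis by (simp add: R)
    qed (simp add: S)
    then have "(\<lambda>y. f y * \<eta> (x - y)) = (\<lambda>_. 0)" by (rule ext)
    then show "conv f \<eta> x = 0" unfolding conv_def by (simp only:) simp
  qed
qed

lemma conv_C1_gradient: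
  assumes f: "locally_finite_integral f" and \<eta>: "cutoff \<eta>"
  shows "C1_gradient (conv f \<eta>) (\<lambda>x. \<Sum>i\<in>Basis. conv f (partial_deriv \<eta> i) x *\<^sub>R i)"
  unfolding C1_gradient_def
proof (intro conjI allI)
  show "continuous_on UNIV (\<lambda>x. \<Sum>i\<in>Basis. conv f (partial_deriv \<eta> i) x *\<^sub>R i)"
    by (intro continuous_intros conv_continuous[OF f] cutoff_partial \<eta>)
  fix x
  have "(\<lambda>h. (\<Sum>i\<in>Basis. conv f (partial_deriv \<eta> i) x *\<^sub>R i) \<bullet> h) = (\<lambda>h. \<Sum>i\<in>Basis. (h \<bullet> i) * conv f (partial_deriv \<eta> i) x)"
    by (intro ext) (simp add: inner_sum_right mult.commute inner_commute[of "sum _ _"])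
  then show "(conv f \<eta> has_derivative (\<lambda>h. (\<Sum>i\<in>Basis. conv f (partial_deriv \<eta> i) x *\<^sub>R i) \<bullet> h)) (at x)"
    using conv_has_derivative[OF f \<eta>, of x] by simp
qed

text \<open>First f is clamped to [-m, m], then continuous functions converging to f almost
  everywhere are clamped as well; the constant 2 m is integrable on the ball, so dominated
  convergence applies.\<close>

lemma continuous_approx_L1:
  fixes f :: "'a::euclidean_space \<Rightarrow> real"
  assumes f: "locally_finite_integral f" and e: "0 < e"
  shows "\<exists>h. continuous_on UNIV h \<and> (\<integral>\<^sup>+x\<in>ball 0 R. ennreal \<bar>h x - f x\<bar> \<partial>lborel) < ennreal e"
proof -
  have [measurable]: "f \<in> borel_measurable borel" using f by (simp add: locally_finite_integral_def)
  define cl where "cl m t = max (- m) (min m t)" for m t :: real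
  have clm[measurable]: "cl m \<in> borel_measurable borel" for m unfolding cl_def by measurable
  have "(\<lambda>m::nat. \<integral>\<^sup>+x. ennreal \<bar>cl (real m) (f x) - f x\<bar> * indicator (ball 0 R) x \<partial>lborel) \<longlonglongrightarrow> (\<integral>\<^sup>+x. 0 \<partial>(lborel :: 'a measure))"
  proof (rule nn_integral_dominated_convergence[where w="\<lambda>x. ennreal \<bar>f x\<bar> * indicator (ball 0 R) x"])
    show "AE x in lborel. ennreal \<bar>cl (real m) (f x) - f x\<bar> * indicator (ball 0 R) x \<le> ennreal \<bar>f x\<bar> * indicator (ball 0 R) x" for m
      by (intro AE_I2 mult_right_mono ennreal_leI) (auto simp: cl_def max_def min_def)
    show "(\<integral>\<^sup>+x. ennreal \<bar>f x\<bar> * indicator (ball 0 R) x \<partial>lborel) < \<infinity>"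
      using f by (simp add: locally_finite_integral_def)
    show "AE x in lborel. (\<lambda>m. ennreal \<bar>cl (real m) (f x) - f x\<bar> * indicator (ball 0 R) x) \<longlonglongrightarrow> 0"
    proof (rule AE_I2)
      fix x
      obtain m0 :: nat where m0: "\<bar>f x\<bar> \<le> real m0" using real_arch_simple by blast
      have "ennreal \<bar>cl (real m) (f x) - f x\<bar> * indicator (ball 0 R) x = 0" if "m0 \<le> m" for m
      proof -
        have "\<bar>f x\<bar> \<le> real m" using m0 that by linarith
        then have "cl (real m) (f x) = f x" by (auto simp: cl_def max_def min_def)
        then show ?thesis by simp
      qed
      then show "(\<lambda>m. ennreal \<bar>cl (real m) (f x) - f x\<bar> * indicator (ball 0 R) x) \<longlonglongrightarrow> 0"
        by (intro tendsto_eventually eventually_mono[OF eventually_ge_at_top[of m0]])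
    qed
  qed measurable
  then have "\<forall>\<^sub>F m in sequentially. (\<integral>\<^sup>+x. ennreal \<bar>cl (real m) (f x) - f x\<bar> * indicator (ball 0 R) x \<partial>lborel) < ennreal (e / 2)"
    using e by (intro order_tendstoD(2)[where y=0]) auto
  then obtain m where m: "(\<integral>\<^sup>+x\<in>ball 0 R. ennreal \<bar>cl (real m) (f x) - f x\<bar> \<partial>lborel) < ennreal (e / 2)"
    by (auto simp: eventually_sequentially)
  have "f \<in> borel_measurable lebesgue" by (rule measurable_completion) simp
  then have "f measurable_on UNIV" by (rule lebesgue_measurable_imp_measurable_on_real) simp
  then obtain N g where N: "negligible N" and g: "\<And>n. continuous_on UNIV (g n)" "\<And>x. x \<notin> N \<Longrightarrow> (\<lambda>n. g n x) \<longlonglongrightarrow> f x"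
    unfolding measurable_on_def by auto
  have [measurable]: "g n \<in> borel_measurable borel" for n by (rule borel_measurable_continuous_onI[OF g(1)])
  have NAE: "AE x in lborel. x \<notin> N"
    using N AE_not_in[of N lebesgue] by (simp add: negligible_iff_null_sets AE_completion_iff)
  have "(\<lambda>n::nat. \<integral>\<^sup>+x. ennreal \<bar>cl (real m) (g n x) - cl (real m) (f x)\<bar> * indicator (ball 0 R) x \<partial>lborel) \<longlonglongrightarrow> (\<integral>\<^sup>+x. 0 \<partial>(lborel :: 'a measure))"
  proof (rule nn_integral_dominated_convergence[where w="\<lambda>x. ennreal (2 * real m) * indicator (ball 0 R) x"])
    show "AE x in lborel. ennreal \<bar>cl (real m) (g n x) - cl (real m) (f x)\<bar> * indicator (ball 0 R) x \<le> ennreal (2 * real m) * indicator (ball 0 R) x" for n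
      by (intro AE_I2 mult_right_mono ennreal_leI) (auto simp: cl_def max_def min_def)
    show "(\<integral>\<^sup>+x. ennreal (2 * real m) * indicator (ball (0::'a) R) x \<partial>lborel) < \<infinity>"
      using emeasure_lborel_ball_finite[of "0::'a" R] by (subst nn_integral_cmult_indicator) (auto simp: ennreal_mult_less_top)
    show "AE x in lborel. (\<lambda>n. ennreal \<bar>cl (real m) (g n x) - cl (real m) (f x)\<bar> * indicator (ball 0 R) x) \<longlonglongrightarrow> 0"
      using NAE
    proof eventually_elim
      case (elim x)
      have "(\<lambda>n. cl (real m) (g n x)) \<longlonglongrightarrow> cl (real m) (f x)"
        unfolding cl_def by (intro tendsto_max tendsto_min tendsto_const g(2) elim)
      then have "(\<lambda>n. \<bar>cl (real m) (g n x) - cl (real m) (f x)\<bar>) \<longlonglongrightarrow> 0"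
        by (intro tendsto_rabs_zero) (simp add: LIM_zero)
      then have "(\<lambda>n. ennreal \<bar>cl (real m) (g n x) - cl (real m) (f x)\<bar>) \<longlonglongrightarrow> ennreal 0" by (rule tendsto_ennrealI)
      then show ?case by (simp split: split_indicator)
    qed
  qed measurable
  then have "\<forall>\<^sub>F n in sequentially. (\<integral>\<^sup>+x. ennreal \<bar>cl (real m) (g n x) - cl (real m) (f x)\<bar> * indicator (ball 0 R) x \<partial>lborel) < ennreal (e / 2)"
    using e by (intro order_tendstoD(2)[where y=0]) auto
  then obtain n where n: "(\<integral>\<^sup>+x\<in>ball 0 R. ennreal \<bar>cl (real m) (g n x) - cl (real m) (f x)\<bar> \<partial>lborel) < ennreal (e / 2)"
    by (auto simp: eventually_sequentially)
  define h where "h x = cl (real m) (g n x)" for x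
  have hc: "continuous_on UNIV h" unfolding h_def cl_def by (intro continuous_intros g(1))
  have "(\<integral>\<^sup>+x\<in>ball 0 R. ennreal \<bar>h x - f x\<bar> \<partial>lborel) \<le> (\<integral>\<^sup>+x. ennreal \<bar>cl (real m) (g n x) - cl (real m) (f x)\<bar> * indicator (ball 0 R) x
      + ennreal \<bar>cl (real m) (f x) - f x\<bar> * indicator (ball 0 R) x \<partial>lborel)"
  proof (rule nn_integral_mono)
    fix x
    have "ennreal \<bar>h x - f x\<bar> \<le> ennreal (\<bar>cl (real m) (g n x) - cl (real m) (f x)\<bar> + \<bar>cl (real m) (f x) - f x\<bar>)"
      unfolding h_def by (rule ennreal_leI) linarith
    then show "ennreal \<bar>h x - f x\<bar> * indicator (ball 0 R) x \<le> ennreal \<bar>cl (real m) (g n x) - cl (real m) (f x)\<bar> * indicator (ball 0 R) x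
      + ennreal \<bar>cl (real m) (f x) - f x\<bar> * indicator (ball 0 R) x" by (simp split: split_indicator)
  qed
  also have "\<dots> = (\<integral>\<^sup>+x\<in>ball 0 R. ennreal \<bar>cl (real m) (g n x) - cl (real m) (f x)\<bar> \<partial>lborel) + (\<integral>\<^sup>+x\<in>ball 0 R. ennreal \<bar>cl (real m) (f x) - f x\<bar> \<partial>lborel)"
    by (rule nn_integral_add) measurable
  also have "\<dots> < ennreal (e / 2) + ennreal (e / 2)" by (rule add_strict_mono[OF n m])
  also have "\<dots> = ennreal e" using e by (simp add: ennreal_plus[symmetric] del: ennreal_plus)
  finally show ?thesis using hc by blast
qed

text \<open>On the ball enlarged by 1 a continuous h replaces f and is uniformly continuous; the two
  approximation errors and the oscillation of h take a third of e each.\<close>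

lemma translation_continuous_L1:
  fixes f :: "'a::euclidean_space \<Rightarrow> real"
  assumes f: "locally_finite_integral f" and e: "0 < e" and R: "0 \<le> R"
  shows "\<exists>\<delta>>0. \<forall>z. norm z < \<delta> \<longrightarrow> (\<integral>\<^sup>+x\<in>ball 0 R. ennreal \<bar>f (z + x) - f x\<bar> \<partial>lborel) \<le> ennreal e"
proof -
  have [measurable]: "f \<in> borel_measurable borel" using f by (simp add: locally_finite_integral_def)
  have "e / 3 > 0" using e by simp
  from continuous_approx_L1[OF f this, of "R + 1"]
  obtain h where hc: "continuous_on UNIV h" and h: "(\<integral>\<^sup>+x\<in>ball 0 (R + 1). ennreal \<bar>h x - f x\<bar> \<partial>lborel) < ennreal (e / 3)" by blast
  have [measurable]: "h \<in> borel_measurable borel" by (rule borel_measurable_continuous_onI[OF hc])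
  define V where "V = unit_ball_vol (real DIM('a)) * R ^ DIM('a)"
  have V: "V \<ge> 0" using R by (simp add: V_def)
  define \<kappa> where "\<kappa> = e / (3 * (V + 1))"
  have \<kappa>: "\<kappa> > 0" using e V by (simp add: \<kappa>_def)
  have "uniformly_continuous_on (cball 0 (R + 1)) h"
    by (intro compact_uniformly_continuous continuous_on_subset[OF hc]) auto
  then obtain \<delta> where \<delta>: "\<delta> > 0" "\<And>x y. x \<in> cball 0 (R + 1) \<Longrightarrow> y \<in> cball 0 (R + 1) \<Longrightarrow> dist y x < \<delta> \<Longrightarrow> dist (h y) (h x) < \<kappa>"
    unfolding uniformly_continuous_on_def using \<kappa> by metis
  have "(\<integral>\<^sup>+x\<in>ball 0 R. ennreal \<bar>f (z + x) - f x\<bar> \<partial>lborel) \<le> ennreal e" if z: "norm z < min \<delta> 1" for z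
  proof -
    have "(\<integral>\<^sup>+x\<in>ball 0 R. ennreal \<bar>f (z + x) - f x\<bar> \<partial>lborel) \<le>
      (\<integral>\<^sup>+x. (ennreal \<bar>h (x + z) - f (x + z)\<bar> * indicator (ball 0 (R + 1)) (x + z) + ennreal \<kappa> * indicator (ball 0 R) x)
         + ennreal \<bar>h x - f x\<bar> * indicator (ball 0 (R + 1)) x \<partial>lborel)"
    proof (rule nn_integral_mono)
      fix x
      show "ennreal \<bar>f (z + x) - f x\<bar> * indicator (ball 0 R) x \<le>
        (ennreal \<bar>h (x + z) - f (x + z)\<bar> * indicator (ball 0 (R + 1)) (x + z) + ennreal \<kappa> * indicator (ball 0 R) x)
         + ennreal \<bar>h x - f x\<bar> * indicator (ball 0 (R + 1)) x"
      proof (cases "norm x < R")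
        case True
        then have xz: "norm (x + z) < R + 1" "norm x < R + 1" using z norm_triangle_ineq[of x z] by linarith+
        have "dist (x + z) x < \<delta>" using z by (simp add: dist_norm)
        then have "dist (h (x + z)) (h x) < \<kappa>" by (intro \<delta>(2)) (use xz in auto)
        then have "\<bar>f (x + z) - f x\<bar> \<le> \<bar>h (x + z) - f (x + z)\<bar> + \<kappa> + \<bar>h x - f x\<bar>" by (simp add: dist_real_def)
        then have "ennreal \<bar>f (x + z) - f x\<bar> \<le> ennreal (\<bar>h (x + z) - f (x + z)\<bar> + \<kappa> + \<bar>h x - f x\<bar>)" by (rule ennreal_leI)
        then show ?thesis using True xz \<kappa> by (simp add: add.commute)
      qed simp
    qed
    also have "\<dots> = (\<integral>\<^sup>+x. ennreal \<bar>h (x + z) - f (x + z)\<bar> * indicator (ball 0 (R + 1)) (x + z) \<partial>lborel) +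
        (\<integral>\<^sup>+x. ennreal \<kappa> * indicator (ball (0::'a) R) x \<partial>lborel) + (\<integral>\<^sup>+x\<in>ball 0 (R + 1). ennreal \<bar>h x - f x\<bar> \<partial>lborel)"
      by (subst nn_integral_add, measurable, subst nn_integral_add, measurable)
    also have "(\<integral>\<^sup>+x. ennreal \<bar>h (x + z) - f (x + z)\<bar> * indicator (ball 0 (R + 1)) (x + z) \<partial>lborel) = (\<integral>\<^sup>+x\<in>ball 0 (R + 1). ennreal \<bar>h x - f x\<bar> \<partial>lborel)"
      by (rule nn_integral_lborel_translate[where h="\<lambda>x. ennreal \<bar>h x - f x\<bar> * indicator (ball 0 (R + 1)) x"]) measurable
    also have "(\<integral>\<^sup>+x. ennreal \<kappa> * indicator (ball (0::'a) R) x \<partial>lborel) = ennreal (\<kappa> * V)"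
      using R \<kappa> V by (subst nn_integral_cmult_indicator) (auto simp: emeasure_ball V_def ennreal_mult)
    also have "(\<integral>\<^sup>+x\<in>ball 0 (R + 1). ennreal \<bar>h x - f x\<bar> \<partial>lborel) + ennreal (\<kappa> * V) + (\<integral>\<^sup>+x\<in>ball 0 (R + 1). ennreal \<bar>h x - f x\<bar> \<partial>lborel)
       \<le> ennreal (e / 3) + ennreal (e / 3) + ennreal (e / 3)"
    proof (intro add_mono ennreal_leI)
      show "\<kappa> * V \<le> e / 3" using V e by (simp add: \<kappa>_def field_simps)
    qed (use h in auto)
    also have "\<dots> = ennreal e" using e by (simp add: ennreal_plus[symmetric] del: ennreal_plus)
    finally show ?thesis .
  qed
  then show ?thesis using \<delta>(1) by (intro exI[of _ "min \<delta> 1"]) auto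
qed

lemma mollifier_cutoff: "mollifier \<epsilon> \<eta> \<Longrightarrow> cutoff \<eta>"
  unfolding mollifier_def cutoff_def by blast

lemma mollifier_continuous: "mollifier \<epsilon> \<eta> \<Longrightarrow> continuous_on UNIV \<eta>"
  by (rule test_function_continuous[OF cutoff_test_function[OF mollifier_cutoff]])

lemma mollifier_nn_integral:
  fixes \<eta> :: "'a::euclidean_space \<Rightarrow> real"
  assumes \<eta>: "mollifier \<epsilon> \<eta>"
  shows "(\<integral>\<^sup>+y. ennreal (\<eta> (x - y)) \<partial>lborel) = 1" "(\<integral>\<^sup>+y. ennreal (\<eta> (y - x)) \<partial>lborel) = 1"
proof -
  have [measurable]: "\<eta> \<in> borel_measurable borel" by (rule borel_measurable_continuous_onI[OF mollifier_continuous[OF \<eta>]])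
  show 1: "(\<integral>\<^sup>+y. ennreal (\<eta> (y - x)) \<partial>lborel) = 1"
    using nn_integral_lborel_translate[of "\<lambda>y. ennreal (\<eta> y)" "- x"] \<eta> by (simp add: mollifier_def)
  have "\<eta> (x - y) = \<eta> (y - x)" for y using \<eta> unfolding mollifier_def by (metis minus_diff_eq)
  then show "(\<integral>\<^sup>+y. ennreal (\<eta> (x - y)) \<partial>lborel) = 1" using 1 by simp
qed

lemma mollifier_integral:
  fixes \<eta> :: "'a::euclidean_space \<Rightarrow> real"
  assumes \<eta>: "mollifier \<epsilon> \<eta>"
  shows "integrable lborel (\<lambda>y. \<eta> (x - y))" "(\<integral>y. \<eta> (x - y) \<partial>lborel) = 1"
proof -
  have [measurable]: "\<eta> \<in> borel_measurable borel" by (rule borel_measurable_continuous_onI[OF mollifier_continuous[OF \<eta>]])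
  have "has_bochner_integral lborel (\<lambda>y. \<eta> (x - y)) 1"
    by (rule has_bochner_integral_nn_integral) (use \<eta> mollifier_nn_integral[OF \<eta>] in \<open>auto simp: mollifier_def\<close>)
  then show "integrable lborel (\<lambda>y. \<eta> (x - y))" "(\<integral>y. \<eta> (x - y) \<partial>lborel) = 1"
    by (auto simp: has_bochner_integral_iff)
qed

text \<open>The mollification error is bounded by an average of translation errors over |z| <
  \<epsilon>, with weights \<eta> z of total mass 1.\<close>

lemma mollify_L1_le:
  fixes f :: "'a::euclidean_space \<Rightarrow> real"
  assumes f: "locally_finite_integral f" and \<eta>: "mollifier \<epsilon> \<eta>"
    and small: "\<And>z. norm z < \<epsilon> \<Longrightarrow> (\<integral>\<^sup>+x\<in>ball 0 R. ennreal \<bar>f (z + x) - f x\<bar> \<partial>lborel) \<le> ennreal e"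
  shows "(\<integral>\<^sup>+x\<in>ball 0 R. ennreal \<bar>conv f \<eta> x - f x\<bar> \<partial>lborel) \<le> ennreal e"
proof -
  have [measurable]: "f \<in> borel_measurable borel" using f by (simp add: locally_finite_integral_def)
  have [measurable]: "\<eta> \<in> borel_measurable borel" by (rule borel_measurable_continuous_onI[OF mollifier_continuous[OF \<eta>]])
  have \<eta>0: "0 \<le> \<eta> z" and \<eta>e: "\<eta> (- z) = \<eta> z" and \<eta>s: "\<epsilon> \<le> norm z \<Longrightarrow> \<eta> z = 0" for z using \<eta> by (auto simp: mollifier_def)
  have pt: "ennreal \<bar>conv f \<eta> x - f x\<bar> \<le> (\<integral>\<^sup>+z. ennreal \<bar>f (z + x) - f x\<bar> * ennreal (\<eta> z) \<partial>lborel)" for x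
  proof -
    note i1 = conv_integrable[OF f mollifier_cutoff[OF \<eta>], of x] and i2 = mollifier_integral[OF \<eta>, of x]
    have i3: "integrable lborel (\<lambda>y. f y * \<eta> (x - y) - f x * \<eta> (x - y))" using i1 i2(1) by simp
    have "conv f \<eta> x - f x = (\<integral>y. f y * \<eta> (x - y) - f x * \<eta> (x - y) \<partial>lborel)"
      unfolding conv_def using i1 i2 by simp
    then have "ennreal \<bar>conv f \<eta> x - f x\<bar> \<le> (\<integral>\<^sup>+y. ennreal (norm (f y * \<eta> (x - y) - f x * \<eta> (x - y))) \<partial>lborel)"
      using integral_norm_bound_ennreal[OF i3] by simp
    also have "\<dots> = (\<integral>\<^sup>+y. ennreal \<bar>f y - f x\<bar> * ennreal (\<eta> (x - y)) \<partial>lborel)"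
      by (intro nn_integral_cong) (simp add: left_diff_distrib[symmetric] abs_mult \<eta>0 ennreal_mult)
    also have "\<dots> = (\<integral>\<^sup>+z. ennreal \<bar>f (z + x) - f x\<bar> * ennreal (\<eta> (x - (z + x))) \<partial>lborel)"
      by (rule nn_integral_lborel_translate[symmetric, where h="\<lambda>y. ennreal \<bar>f y - f x\<bar> * ennreal (\<eta> (x - y))"]) measurable
    finally show ?thesis by (simp add: \<eta>e)
  qed
  have "(\<integral>\<^sup>+x\<in>ball 0 R. ennreal \<bar>conv f \<eta> x - f x\<bar> \<partial>lborel) \<le> (\<integral>\<^sup>+x. (\<integral>\<^sup>+z. ennreal \<bar>f (z + x) - f x\<bar> * ennreal (\<eta> z) * indicator (ball 0 R) x \<partial>lborel) \<partial>lborel)"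
  proof (rule nn_integral_mono)
    fix x
    have "(\<integral>\<^sup>+z. ennreal \<bar>f (z + x) - f x\<bar> * ennreal (\<eta> z) * indicator (ball 0 R) x \<partial>lborel) =
       (\<integral>\<^sup>+z. ennreal \<bar>f (z + x) - f x\<bar> * ennreal (\<eta> z) \<partial>lborel) * indicator (ball 0 R) x"
      by (rule nn_integral_multc) measurable
    then show "ennreal \<bar>conv f \<eta> x - f x\<bar> * indicator (ball 0 R) x \<le> (\<integral>\<^sup>+z. ennreal \<bar>f (z + x) - f x\<bar> * ennreal (\<eta> z) * indicator (ball 0 R) x \<partial>lborel)"
      using mult_right_mono[OF pt[of x], of "indicator (ball 0 R) x"] by simp
  qed
  also have "\<dots> = (\<integral>\<^sup>+z. (\<integral>\<^sup>+x. ennreal \<bar>f (z + x) - f x\<bar> * ennreal (\<eta> z) * indicator (ball 0 R) x \<partial>lborel) \<partial>lborel)"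
    by (rule lborel_pair.Fubini') measurable
  also have "\<dots> \<le> (\<integral>\<^sup>+z. ennreal e * ennreal (\<eta> z) \<partial>lborel)"
  proof (rule nn_integral_mono)
    fix z :: 'a
    have "(\<integral>\<^sup>+x. ennreal \<bar>f (z + x) - f x\<bar> * ennreal (\<eta> z) * indicator (ball 0 R) x \<partial>lborel) =
      (\<integral>\<^sup>+x. ennreal (\<eta> z) * (ennreal \<bar>f (z + x) - f x\<bar> * indicator (ball 0 R) x) \<partial>lborel)"
      by (intro nn_integral_cong) (simp only: ac_simps)
    also have "\<dots> = ennreal (\<eta> z) * (\<integral>\<^sup>+x\<in>ball 0 R. ennreal \<bar>f (z + x) - f x\<bar> \<partial>lborel)"
      by (rule nn_integral_cmult) measurable
    also have "\<dots> \<le> ennreal (\<eta> z) * ennreal e"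
    proof (cases "norm z < \<epsilon>")
      case True
      then show ?thesis by (intro mult_left_mono small) auto
    next
      case False
      then show ?thesis using \<eta>s[of z] by simp
    qed
    finally show "(\<integral>\<^sup>+x. ennreal \<bar>f (z + x) - f x\<bar> * ennreal (\<eta> z) * indicator (ball 0 R) x \<partial>lborel) \<le> ennreal e * ennreal (\<eta> z)"
      by (simp add: mult.commute)
  qed
  also have "\<dots> = ennreal e * (\<integral>\<^sup>+z. ennreal (\<eta> z) \<partial>lborel)" by (rule nn_integral_cmult) measurable
  also have "\<dots> = ennreal e" using \<eta> by (simp add: mollifier_def)
  finally show ?thesis .
qed

lemma mollify_converges:
  fixes f :: "'a::euclidean_space \<Rightarrow> real"
  assumes f: "locally_finite_integral f" and \<eta>: "\<And>k. mollifier (1 / real (Suc k)) (\<eta> k)"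
  shows "(\<lambda>k. \<integral>\<^sup>+x\<in>ball 0 R. ennreal \<bar>conv f (\<eta> k) x - f x\<bar> \<partial>lborel) \<longlonglongrightarrow> 0"
proof (cases "0 \<le> R")
  case False
  then have e: "ball (0::'a) R = {}" by auto
  show ?thesis unfolding e by simp
next
  case True
  show ?thesis
  proof (rule order_tendstoI)
    fix a :: ennreal assume "0 < a"
    then obtain e where e: "0 < e" "ennreal e < a"
    proof (cases a)
      case (real r)
      then show ?thesis using that[of "r / 2"] \<open>0 < a\<close> by (auto simp: ennreal_less_iff)
    next
      case top
      then show ?thesis using that[of 1] by simp
    qed
    obtain \<delta> where \<delta>: "\<delta> > 0" "\<And>z. norm z < \<delta> \<Longrightarrow> (\<integral>\<^sup>+x\<in>ball 0 R. ennreal \<bar>f (z + x) - f x\<bar> \<partial>lborel) \<le> ennreal e"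
      using translation_continuous_L1[OF f e(1) True] by auto
    obtain n0 where n0: "inverse (real (Suc n0)) < \<delta>" using reals_Archimedean[OF \<delta>(1)] by blast
    have "(\<integral>\<^sup>+x\<in>ball 0 R. ennreal \<bar>conv f (\<eta> k) x - f x\<bar> \<partial>lborel) < a" if "n0 \<le> k" for k
    proof -
      have "1 / real (Suc k) \<le> inverse (real (Suc n0))" using that by (simp add: field_simps)
      then have "(\<integral>\<^sup>+x\<in>ball 0 R. ennreal \<bar>conv f (\<eta> k) x - f x\<bar> \<partial>lborel) \<le> ennreal e"
        using n0 by (intro mollify_L1_le[OF f \<eta>] \<delta>(2)) linarith
      then show ?thesis using e(2) by (rule le_less_trans)
    qed
    then show "\<forall>\<^sub>F k in sequentially. (\<integral>\<^sup>+x\<in>ball 0 R. ennreal \<bar>conv f (\<eta> k) x - f x\<bar> \<partial>lborel) < a"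
      by (auto simp: eventually_sequentially)
  qed simp
qed

section \<open>Approximation of Sobolev and BV functions\<close>

lemma Lp_bounded_locally_finite:
  fixes f :: "'a::euclidean_space \<Rightarrow> real"
  assumes f: "Lp_bounded p F f" and p: "1 \<le> p"
  shows "locally_finite_integral f"
  unfolding locally_finite_integral_def
proof (intro conjI allI)
  show "f \<in> borel_measurable borel" using f by (simp add: Lp_bounded_def)
  show "(\<integral>\<^sup>+x\<in>ball 0 R. ennreal \<bar>f x\<bar> \<partial>lborel) < \<infinity>" for R
    unfolding ennreal_mass[OF f p, symmetric] by simp
qed

text \<open>Jensen's inequality up to the factor 2 powr p, from \<open>le_young\<close> with t equal
  to half of the convolution, so that t can be absorbed on the left; Tonelli then integrates out the
  mollifier.\<close>

lemma mollified_powr_le: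
  fixes g :: "'a::euclidean_space \<Rightarrow> real"
  assumes g: "Lp_bounded p \<Gamma> g" and g0: "\<And>y. 0 \<le> g y" and p: "1 \<le> p" and \<eta>: "mollifier \<epsilon> \<eta>"
  shows "(\<integral>\<^sup>+x. ennreal (conv g \<eta> x powr p) \<partial>lborel) \<le> ennreal (2 powr p * \<Gamma>)"
proof -
  have [measurable]: "g \<in> borel_measurable borel" and \<Gamma>: "0 \<le> \<Gamma>" "(\<integral>\<^sup>+x. ennreal (\<bar>g x\<bar> powr p) \<partial>lborel) \<le> ennreal \<Gamma>"
    using g by (auto simp: Lp_bounded_def)
  have [measurable]: "\<eta> \<in> borel_measurable borel" by (rule borel_measurable_continuous_onI[OF mollifier_continuous[OF \<eta>]])
  have \<eta>0: "0 \<le> \<eta> z" for z using \<eta> by (auto simp: mollifier_def)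
  have gl: "locally_finite_integral g" by (rule Lp_bounded_locally_finite[OF g p])
  have pt: "ennreal (conv g \<eta> x powr p) \<le> (\<integral>\<^sup>+y. ennreal (2 powr p) * (ennreal (g y powr p) * ennreal (\<eta> (x - y))) \<partial>lborel)" for x
  proof -
    define s where "s = conv g \<eta> x"
    define Y where "Y = (\<integral>\<^sup>+y. ennreal (g y powr p) * ennreal (\<eta> (x - y)) \<partial>lborel)"
    have s0: "0 \<le> s" unfolding s_def conv_def by (rule integral_nonneg_AE) (simp add: g0 \<eta>0)
    have se: "ennreal s = (\<integral>\<^sup>+y. ennreal (g y * \<eta> (x - y)) \<partial>lborel)"
      unfolding s_def conv_def
      by (rule nn_integral_eq_integral[symmetric, OF conv_integrable[OF gl mollifier_cutoff[OF \<eta>]]]) (simp add: g0 \<eta>0)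
    have "ennreal (s powr p) \<le> ennreal (2 powr p) * Y"
    proof (cases "s = 0 \<or> Y = \<infinity>")
      case True
      then show ?thesis using p by (auto simp: ennreal_mult_top)
    next
      case False
      then obtain Y' where Y': "Y = ennreal Y'" "0 \<le> Y'" by (metis ennreal_cases infinity_ennreal_def)
      define t where "t = s / 2"
      have t: "t > 0" using False s0 by (simp add: t_def)
      have "ennreal s \<le> (\<integral>\<^sup>+y. ennreal t * ennreal (\<eta> (x - y)) + ennreal (t powr (1 - p)) * (ennreal (g y powr p) * ennreal (\<eta> (x - y))) \<partial>lborel)"
        unfolding se
      proof (rule nn_integral_mono)
        fix y
        have "g y * \<eta> (x - y) \<le> (t + t powr (1 - p) * g y powr p) * \<eta> (x - y)"
          by (intro mult_right_mono le_young t g0 p \<eta>0)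
        then have "ennreal (g y * \<eta> (x - y)) \<le> ennreal ((t + t powr (1 - p) * g y powr p) * \<eta> (x - y))" by (rule ennreal_leI)
        also have "\<dots> = ennreal t * ennreal (\<eta> (x - y)) + ennreal (t powr (1 - p)) * (ennreal (g y powr p) * ennreal (\<eta> (x - y)))"
          using t \<eta>0 by (simp add: distrib_right ennreal_mult mult.assoc)
        finally show "ennreal (g y * \<eta> (x - y)) \<le> ennreal t * ennreal (\<eta> (x - y)) + ennreal (t powr (1 - p)) * (ennreal (g y powr p) * ennreal (\<eta> (x - y)))" .
      qed
      also have "\<dots> = ennreal t * (\<integral>\<^sup>+y. ennreal (\<eta> (x - y)) \<partial>lborel) + ennreal (t powr (1 - p)) * Y"
        unfolding Y_def by (subst nn_integral_add, measurable, subst nn_integral_cmult, measurable, subst nn_integral_cmult, measurable)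
      also have "\<dots> = ennreal (t + t powr (1 - p) * Y')"
        using t Y' mollifier_nn_integral(1)[OF \<eta>, of x] by (simp add: ennreal_mult)
      finally have "s \<le> t + t powr (1 - p) * Y'" using t Y' by (subst (asm) ennreal_le_iff) auto
      then have "t \<le> t powr (1 - p) * Y'" by (simp add: t_def)
      then have "t powr (p - 1) * t \<le> t powr (p - 1) * (t powr (1 - p) * Y')" by (intro mult_left_mono) auto
      also have "\<dots> = Y'"
      proof -
        have "t powr (p - 1) * t powr (1 - p) = 1" using t by (simp flip: powr_add)
        then show ?thesis by (metis mult.assoc mult_1)
      qed
      also have "t powr (p - 1) * t = t powr p" using t by (simp add: powr_diff)
      finally have "t powr p \<le> Y'" .
      moreover have "s powr p = 2 powr p * t powr p" using t by (simp add: t_def powr_mult[symmetric])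
      ultimately have "s powr p \<le> 2 powr p * Y'" by simp
      then have "ennreal (s powr p) \<le> ennreal (2 powr p * Y')" by (rule ennreal_leI)
      then show ?thesis using Y' by (simp add: ennreal_mult)
    qed
    also have "\<dots> = (\<integral>\<^sup>+y. ennreal (2 powr p) * (ennreal (g y powr p) * ennreal (\<eta> (x - y))) \<partial>lborel)"
      unfolding Y_def by (rule nn_integral_cmult[symmetric]) measurable
    finally show ?thesis by (simp add: s_def)
  qed
  have "(\<integral>\<^sup>+x. ennreal (conv g \<eta> x powr p) \<partial>lborel) \<le> (\<integral>\<^sup>+x. (\<integral>\<^sup>+y. ennreal (2 powr p) * (ennreal (g y powr p) * ennreal (\<eta> (x - y))) \<partial>lborel) \<partial>lborel)"
    by (intro nn_integral_mono pt)
  also have "\<dots> = (\<integral>\<^sup>+y. (\<integral>\<^sup>+x. ennreal (2 powr p) * (ennreal (g y powr p) * ennreal (\<eta> (x - y))) \<partial>lborel) \<partial>lborel)"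
    by (rule lborel_pair.Fubini') measurable
  also have "\<dots> = (\<integral>\<^sup>+y. ennreal (2 powr p) * ennreal (\<bar>g y\<bar> powr p) \<partial>lborel)"
  proof (rule nn_integral_cong)
    fix y
    have "(\<integral>\<^sup>+x. ennreal (2 powr p) * (ennreal (g y powr p) * ennreal (\<eta> (x - y))) \<partial>lborel) =
       (\<integral>\<^sup>+x. (ennreal (2 powr p) * ennreal (g y powr p)) * ennreal (\<eta> (x - y)) \<partial>lborel)"
      by (simp add: mult.assoc)
    also have "\<dots> = (ennreal (2 powr p) * ennreal (g y powr p)) * (\<integral>\<^sup>+x. ennreal (\<eta> (x - y)) \<partial>lborel)"
      by (rule nn_integral_cmult) measurable
    finally show "(\<integral>\<^sup>+x. ennreal (2 powr p) * (ennreal (g y powr p) * ennreal (\<eta> (x - y))) \<partial>lborel) = ennreal (2 powr p) * ennreal (\<bar>g y\<bar> powr p)"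
      using mollifier_nn_integral(2)[OF \<eta>, of y] g0[of y] by simp
  qed
  also have "\<dots> = ennreal (2 powr p) * (\<integral>\<^sup>+y. ennreal (\<bar>g y\<bar> powr p) \<partial>lborel)" by (rule nn_integral_cmult) measurable
  also have "\<dots> \<le> ennreal (2 powr p) * ennreal \<Gamma>" by (intro mult_left_mono \<Gamma>) auto
  also have "\<dots> = ennreal (2 powr p * \<Gamma>)" using \<Gamma> by (simp add: ennreal_mult)
  finally show ?thesis .
qed

lemma partial_deriv_reflect:
  fixes \<eta> :: "'a::euclidean_space \<Rightarrow> real"
  assumes "\<eta> differentiable (at (x - y))"
  shows "partial_deriv (\<lambda>y. \<eta> (x - y)) i y = - partial_deriv \<eta> i (x - y)"
proof -
  have 1: "((\<lambda>y. x - y) has_derivative (\<lambda>h. - h)) (at y)" by (auto intro!: derivative_eq_intros)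
  have 2: "(\<eta> has_derivative frechet_derivative \<eta> (at (x - y))) (at (x - y))"
    using assms frechet_derivative_works by blast
  have "partial_deriv (\<lambda>y. \<eta> (x - y)) i y = frechet_derivative \<eta> (at (x - y)) (- i)"
    by (rule partial_deriv_eqI[OF has_derivative_compose[OF 1 2]])
  then show ?thesis using has_derivative_linear[OF 2] by (simp add: linear_neg partial_deriv_def)
qed

lemma mollifier_reflect_test_function:
  fixes \<eta> :: "'a::euclidean_space \<Rightarrow> real"
  assumes \<eta>: "mollifier \<epsilon> \<eta>"
  shows "test_function (\<lambda>y. \<eta> (x - y))"
proof (rule test_functionI)
  show "smooth_fun (\<lambda>y. \<eta> (x - y))" using \<eta> smooth_class_smooth unfolding mollifier_def by blast
  fix y :: 'a assume "\<epsilon> + norm x \<le> norm y"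
  then have "\<epsilon> \<le> norm (x - y)" using norm_triangle_sub[of y x] by (simp add: norm_minus_commute)
  then show "\<eta> (x - y) = 0" using \<eta> by (simp add: mollifier_def)
qed

lemma mollifier_sequence: "\<exists>\<eta> :: nat \<Rightarrow> 'a::euclidean_space \<Rightarrow> real. \<forall>k. mollifier (1 / real (Suc k)) (\<eta> k)"
proof (rule choice, rule allI)
  fix k :: nat
  show "\<exists>\<eta> :: 'a \<Rightarrow> real. mollifier (1 / real (Suc k)) \<eta>" by (rule mollifier_exists) simp
qed

text \<open>Testing the weak gradient with the reflected translates of \<eta> shows that the
  gradient of the mollification is the mollification of G. Written as a vector integral, its norm is
  at most the mollified norm of G.\<close>

lemma sobolev_gradient_approximable:
  fixes f :: "'a::euclidean_space \<Rightarrow> real"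
  assumes f: "locally_finite_integral f" and p: "1 \<le> p"
    and Gm[measurable]: "G \<in> borel_measurable borel" and G: "Lp_bounded p \<Gamma> (\<lambda>x. norm (G x))"
    and weak: "\<And>\<phi> i. test_function \<phi> \<Longrightarrow> i \<in> Basis \<Longrightarrow>
        (\<integral>x. f x * partial_deriv \<phi> i x \<partial>lborel) = - (\<integral>x. (G x \<bullet> i) * \<phi> x \<partial>lborel)"
  shows "gradient_approximable p (2 powr p * \<Gamma>) f"
proof -
  obtain \<eta> :: "nat \<Rightarrow> 'a \<Rightarrow> real" where \<eta>: "\<And>k. mollifier (1 / real (Suc k)) (\<eta> k)"
    using mollifier_sequence by blast
  note cut = mollifier_cutoff[OF \<eta>]
  define D where "D k x = (\<Sum>i\<in>Basis. conv f (partial_deriv (\<eta> k) i) x *\<^sub>R i)" for k x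
  have nG: "locally_finite_integral (\<lambda>x. norm (G x))" by (rule Lp_bounded_locally_finite[OF G p])
  have Dle: "norm (D k x) \<le> conv (\<lambda>y. norm (G y)) (\<eta> k) x" for k x
  proof -
    have [measurable]: "\<eta> k \<in> borel_measurable borel" by (rule borel_measurable_continuous_onI[OF mollifier_continuous[OF \<eta>]])
    have \<eta>0: "0 \<le> \<eta> k z" for z using \<eta>[of k] by (auto simp: mollifier_def)
    have int: "integrable lborel (\<lambda>y. \<eta> k (x - y) *\<^sub>R G y)"
    proof (rule integrable_norm_cancel)
      have "(\<lambda>y. norm (\<eta> k (x - y) *\<^sub>R G y)) = (\<lambda>y. norm (G y) * \<eta> k (x - y))" by (auto simp: \<eta>0 mult.commute)
      then show "integrable lborel (\<lambda>y. norm (\<eta> k (x - y) *\<^sub>R G y))" using conv_integrable[OF nG cut] by simp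
    qed measurable
    have "D k x = (\<integral>y. \<eta> k (x - y) *\<^sub>R G y \<partial>lborel)"
    proof (rule euclidean_eqI)
      fix i :: 'a assume i: "i \<in> Basis"
      have "D k x \<bullet> i = conv f (partial_deriv (\<eta> k) i) x"
        unfolding D_def using i by (simp add: inner_sum_left inner_Basis if_distrib cong: if_cong)
      also have "\<dots> = - (\<integral>y. f y * partial_deriv (\<lambda>y. \<eta> k (x - y)) i y \<partial>lborel)"
        unfolding conv_def
        using partial_deriv_reflect[where \<eta>="\<eta> k" and x=x and i=i, OF test_function_differentiable[OF cutoff_test_function[OF cut[of k]]]] by simp
      also have "\<dots> = (\<integral>y. (G y \<bullet> i) * \<eta> k (x - y) \<partial>lborel)"
        using weak[OF mollifier_reflect_test_function[OF \<eta>, of k x] i] by simp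
      also have "\<dots> = (\<integral>y. (\<eta> k (x - y) *\<^sub>R G y) \<bullet> i \<partial>lborel)" by (simp add: mult.commute)
      also have "\<dots> = (\<integral>y. \<eta> k (x - y) *\<^sub>R G y \<partial>lborel) \<bullet> i" by (rule integral_inner_left) (use int in simp)
      finally show "D k x \<bullet> i = (\<integral>y. \<eta> k (x - y) *\<^sub>R G y \<partial>lborel) \<bullet> i" .
    qed
    also have "norm \<dots> \<le> (\<integral>y. norm (\<eta> k (x - y) *\<^sub>R G y) \<partial>lborel)" by (rule integral_norm_bound)
    also have "\<dots> = conv (\<lambda>y. norm (G y)) (\<eta> k) x" unfolding conv_def by (simp add: \<eta>0 mult.commute)
    finally show ?thesis .
  qed
  have "(\<integral>\<^sup>+x. ennreal (norm (D k x) powr p) \<partial>lborel) \<le> ennreal (2 powr p * \<Gamma>)" for k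
  proof -
    have "(\<integral>\<^sup>+x. ennreal (norm (D k x) powr p) \<partial>lborel) \<le> (\<integral>\<^sup>+x. ennreal (conv (\<lambda>y. norm (G y)) (\<eta> k) x powr p) \<partial>lborel)"
      using p by (intro nn_integral_mono ennreal_leI powr_mono2 Dle) auto
    also have "\<dots> \<le> ennreal (2 powr p * \<Gamma>)" by (rule mollified_powr_le[OF G _ p \<eta>]) simp
    finally show ?thesis .
  qed
  moreover have "C1_gradient (conv f (\<eta> k)) (D k)" for k unfolding D_def by (rule conv_C1_gradient[OF f cut])
  moreover have "(\<lambda>k. \<integral>\<^sup>+x\<in>ball 0 R. ennreal \<bar>conv f (\<eta> k) x - f x\<bar> \<partial>lborel) \<longlonglongrightarrow> 0" for R
    by (rule mollify_converges[OF f \<eta>])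
  ultimately show ?thesis unfolding gradient_approximable_def by (intro exI[of _ "\<lambda>k. conv f (\<eta> k)"] exI[of _ D]) auto
qed

text \<open>Exchanging the integrals moves the convolution from f to \<psi> at the price of
  reflecting \<eta>; boundedness of \<eta> makes the double integral absolutely convergent.\<close>

lemma conv_duality:
  fixes f \<psi> \<eta> :: "'a::euclidean_space \<Rightarrow> real"
  assumes f: "integrable lborel f" and fm[measurable]: "f \<in> borel_measurable borel" and \<psi>: "integrable lborel \<psi>" and \<psi>m[measurable]: "\<psi> \<in> borel_measurable borel"
    and \<eta>c: "continuous_on UNIV \<eta>" and B: "\<And>z. \<bar>\<eta> z\<bar> \<le> B"
  shows "(\<integral>x. \<psi> x * conv f \<eta> x \<partial>lborel) = (\<integral>y. f y * conv \<psi> (\<lambda>z. \<eta> (- z)) y \<partial>lborel)"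
proof -
  have [measurable]: "\<eta> \<in> borel_measurable borel" by (rule borel_measurable_continuous_onI[OF \<eta>c])
  have B0: "0 \<le> B" using B[of 0] by linarith
  have int: "integrable (lborel \<Otimes>\<^sub>M lborel) (\<lambda>(x, y). \<psi> x * (f y * \<eta> (x - y)))"
  proof (rule Bochner_Integration.integrable_bound)
    show "integrable (lborel \<Otimes>\<^sub>M lborel) (\<lambda>(x, y). B * (\<psi> x * f y))"
      using lborel_pair.integrable_product_swap[of "\<lambda>(x, y). B * (\<psi> x * f y)"]
      by (intro lborel_pair.Fubini_integrable) (auto simp: f \<psi> abs_mult)
    have "\<bar>a * (b * \<eta> z)\<bar> \<le> \<bar>B * (a * b)\<bar>" for a b z
    proof -
      have "\<bar>a * b\<bar> * \<bar>\<eta> z\<bar> \<le> \<bar>a * b\<bar> * B" by (intro mult_left_mono B) auto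
      then show ?thesis using B0 by (simp add: abs_mult ac_simps)
    qed
    then show "AE z in lborel \<Otimes>\<^sub>M lborel. norm ((\<lambda>(x, y). \<psi> x * (f y * \<eta> (x - y))) z) \<le> norm ((\<lambda>(x, y). B * (\<psi> x * f y)) z)"
      by (intro AE_I2) (auto split: prod.split)
  qed measurable
  have "(\<integral>x. \<psi> x * conv f \<eta> x \<partial>lborel) = (\<integral>x. (\<integral>y. \<psi> x * (f y * \<eta> (x - y)) \<partial>lborel) \<partial>lborel)"
    unfolding conv_def by simp
  also have "\<dots> = (\<integral>y. (\<integral>x. \<psi> x * (f y * \<eta> (x - y)) \<partial>lborel) \<partial>lborel)"
    by (rule lborel_pair.Fubini_integral[symmetric, OF int])
  also have "\<dots> = (\<integral>y. f y * conv \<psi> (\<lambda>z. \<eta> (- z)) y \<partial>lborel)"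
    unfolding conv_def integral_mult_right_zero[symmetric] by (intro Bochner_Integration.integral_cong refl) (simp add: ac_simps)
  finally show ?thesis .
qed

text \<open>The mollification of the sign of the mollified gradient is a test field, and testing with it recovers
  the integral of the norm of that gradient.\<close>

lemma bv_gradient_approximable:
  fixes f :: "'a::euclidean_space \<Rightarrow> real"
  assumes f: "integrable lborel f" and fm[measurable]: "f \<in> borel_measurable borel"
    and V: "\<And>\<Psi>. test_field \<Psi> \<Longrightarrow> (\<And>x. norm (\<Psi> x) \<le> 1) \<Longrightarrow> (\<integral>x. f x * divergence \<Psi> x \<partial>lborel) \<le> V"
  shows "gradient_approximable 1 V f"
proof -
  have fl: "locally_finite_integral f"
    unfolding locally_finite_integral_def
  proof (intro conjI allI fm)
    fix R
    have "(\<integral>\<^sup>+x\<in>ball 0 R. ennreal \<bar>f x\<bar> \<partial>lborel) \<le> (\<integral>\<^sup>+x. ennreal (norm (f x)) \<partial>lborel)"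
      by (intro nn_integral_mono) (auto split: split_indicator)
    also have "\<dots> < \<infinity>" using f by (simp add: integrable_iff_bounded)
    finally show "(\<integral>\<^sup>+x\<in>ball 0 R. ennreal \<bar>f x\<bar> \<partial>lborel) < \<infinity>" .
  qed
  obtain \<eta> :: "nat \<Rightarrow> 'a \<Rightarrow> real" where \<eta>: "\<And>k. mollifier (1 / real (Suc k)) (\<eta> k)"
    using mollifier_sequence by blast
  note cut = mollifier_cutoff[OF \<eta>]
  define D where "D k x = (\<Sum>i\<in>Basis. conv f (partial_deriv (\<eta> k) i) x *\<^sub>R i)" for k x
  have C1: "C1_gradient (conv f (\<eta> k)) (D k)" for k unfolding D_def by (rule conv_C1_gradient[OF fl cut])
  have Dball: "(\<integral>\<^sup>+x. ennreal (norm (D k x)) * indicator (ball 0 (real R)) x \<partial>lborel) \<le> ennreal V" for k R :: nat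
  proof -
    note [measurable] = C1_gradient_measurable[OF C1[of k]]
    have [measurable]: "\<eta> k \<in> borel_measurable borel" by (rule borel_measurable_continuous_onI[OF mollifier_continuous[OF \<eta>]])
    have \<eta>0: "0 \<le> \<eta> k z" and even: "\<eta> k (- z) = \<eta> k z" for z using \<eta>[of k] by (auto simp: mollifier_def)
    \<comment> \<open>The minus sign matches that of integration by parts, so that the norm of the
      gradient appears with a plus. Cutting at radius R gives the test field compact
      support.\<close>
    define \<psi> where "\<psi> x = (if norm x < real R then - sgn (D k x) else 0)" for x
    have [measurable]: "\<psi> \<in> borel_measurable borel" unfolding \<psi>_def sgn_div_norm by measurable
    have \<psi>1: "norm (\<psi> x) \<le> 1" for x by (simp add: \<psi>_def norm_sgn)
    have \<psi>s: "\<psi> x = 0" if "real R \<le> norm x" for x using that by (simp add: \<psi>_def)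
    have \<psi>i: "integrable lborel (\<lambda>x. \<psi> x \<bullet> i)" if "i \<in> Basis" for i
    proof (rule integrableI_bounded)
      have "(\<integral>\<^sup>+x. ennreal (norm (\<psi> x \<bullet> i)) \<partial>lborel) \<le> (\<integral>\<^sup>+x. indicator (ball (0::'a) (real R)) x \<partial>lborel)"
      proof (rule nn_integral_mono)
        fix x
        have "\<bar>\<psi> x \<bullet> i\<bar> \<le> 1" using Basis_le_norm[OF that, of "\<psi> x"] \<psi>1[of x] by linarith
        then show "ennreal (norm (\<psi> x \<bullet> i)) \<le> indicator (ball 0 (real R)) x"
          using \<psi>s[of x] by (auto split: split_indicator simp: ennreal_le_1)
      qed
      also have "\<dots> < \<infinity>" using emeasure_lborel_ball_finite[of "0::'a" "real R"] by simp
      finally show "(\<integral>\<^sup>+x. ennreal (norm (\<psi> x \<bullet> i)) \<partial>lborel) < \<infinity>" .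
    qed measurable
    have \<psi>l: "locally_finite_integral (\<lambda>x. \<psi> x \<bullet> i)" if "i \<in> Basis" for i
      unfolding locally_finite_integral_def
    proof (intro conjI allI)
      fix r
      have "(\<integral>\<^sup>+x\<in>ball 0 r. ennreal \<bar>\<psi> x \<bullet> i\<bar> \<partial>lborel) \<le> (\<integral>\<^sup>+x. ennreal (norm (\<psi> x \<bullet> i)) \<partial>lborel)"
        by (intro nn_integral_mono) (auto split: split_indicator)
      also have "\<dots> < \<infinity>" using \<psi>i[OF that] by (simp add: integrable_iff_bounded)
      finally show "(\<integral>\<^sup>+x\<in>ball 0 r. ennreal \<bar>\<psi> x \<bullet> i\<bar> \<partial>lborel) < \<infinity>" .
    qed measurable
    define \<Psi> where "\<Psi> y = (\<Sum>i\<in>Basis. conv (\<lambda>x. \<psi> x \<bullet> i) (\<eta> k) y *\<^sub>R i)" for y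
    have \<Psi>i: "\<Psi> y \<bullet> i = conv (\<lambda>x. \<psi> x \<bullet> i) (\<eta> k) y" if "i \<in> Basis" for y i
      unfolding \<Psi>_def using that by (simp add: inner_sum_left inner_Basis if_distrib cong: if_cong)
    have tf: "test_field \<Psi>"
      unfolding test_field_def
    proof
      fix i :: 'a assume i: "i \<in> Basis"
      show "test_function (\<lambda>x. \<Psi> x \<bullet> i)"
        unfolding \<Psi>i[OF i] by (rule conv_test_function[OF \<psi>l[OF i] cut, of "real R"]) (simp add: \<psi>s)
    qed
    \<comment> \<open>An average of vectors of norm at most 1, with weights of total mass 1.\<close>
    have \<Psi>1: "norm (\<Psi> y) \<le> 1" for y
    proof -
      note mi = mollifier_integral[OF \<eta>[of k], of y]
      have le: "norm (\<eta> k (y - x) *\<^sub>R \<psi> x) \<le> \<eta> k (y - x)" for x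
        using mult_left_mono[OF \<psi>1[of x] \<eta>0[of "y - x"]] by (simp add: \<eta>0)
      have int: "integrable lborel (\<lambda>x. \<eta> k (y - x) *\<^sub>R \<psi> x)"
        by (rule Bochner_Integration.integrable_bound[OF mi(1)]) (use le in \<open>auto simp: \<eta>0\<close>)
      have "\<Psi> y = (\<integral>x. \<eta> k (y - x) *\<^sub>R \<psi> x \<partial>lborel)"
      proof (rule euclidean_eqI)
        fix i :: 'a assume i: "i \<in> Basis"
        have "\<Psi> y \<bullet> i = (\<integral>x. (\<eta> k (y - x) *\<^sub>R \<psi> x) \<bullet> i \<partial>lborel)" unfolding \<Psi>i[OF i] conv_def by (simp add: mult.commute)
        also have "\<dots> = (\<integral>x. \<eta> k (y - x) *\<^sub>R \<psi> x \<partial>lborel) \<bullet> i" by (rule integral_inner_left) (use int in simp)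
        finally show "\<Psi> y \<bullet> i = (\<integral>x. \<eta> k (y - x) *\<^sub>R \<psi> x \<partial>lborel) \<bullet> i" .
      qed
      also have "norm \<dots> \<le> (\<integral>x. norm (\<eta> k (y - x) *\<^sub>R \<psi> x) \<partial>lborel)" by (rule integral_norm_bound)
      also have "\<dots> \<le> (\<integral>x. \<eta> k (y - x) \<partial>lborel)" by (rule integral_mono[OF integrable_norm[OF int] mi(1) le])
      finally show ?thesis using mi by simp
    qed
    have pb: "\<exists>B. \<forall>z. \<bar>partial_deriv (\<eta> k) i z\<bar> \<le> B" if "i \<in> Basis" for i
      using test_function_partial_bound[OF cutoff_test_function[OF cut[of k]]] that by metis
    have pc: "continuous_on UNIV (partial_deriv (\<eta> k) i)" if "i \<in> Basis" for i
      by (rule test_function_partial_continuous[OF cutoff_test_function[OF cut] that])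
    \<comment> \<open>The partial derivatives of an even function are odd, which supplies the sign
      when the derivative passes to the test field.\<close>
    have odd: "partial_deriv (\<eta> k) i (- z) = - partial_deriv (\<eta> k) i z" for i z
      using partial_deriv_reflect[where \<eta>="\<eta> k" and x=0 and y=z and i=i, OF test_function_differentiable[OF cutoff_test_function[OF cut[of k]]]] even by simp
    have dual: "(\<integral>x. (\<psi> x \<bullet> i) * conv f (partial_deriv (\<eta> k) i) x \<partial>lborel) = - (\<integral>y. f y * partial_deriv (\<lambda>y. \<Psi> y \<bullet> i) i y \<partial>lborel)"
      if i: "i \<in> Basis" for i
    proof -
      obtain B where B: "\<And>z. \<bar>partial_deriv (\<eta> k) i z\<bar> \<le> B" using pb[OF i] by blast
      have "(\<integral>x. (\<psi> x \<bullet> i) * conv f (partial_deriv (\<eta> k) i) x \<partial>lborel) = (\<integral>y. f y * conv (\<lambda>x. \<psi> x \<bullet> i) (\<lambda>z. partial_deriv (\<eta> k) i (- z)) y \<partial>lborel)"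
        by (rule conv_duality[OF f fm \<psi>i[OF i] _ pc[OF i] B]) measurable
      also have "\<dots> = - (\<integral>y. f y * conv (\<lambda>x. \<psi> x \<bullet> i) (partial_deriv (\<eta> k) i) y \<partial>lborel)"
        unfolding odd conv_def by simp
      also have "conv (\<lambda>x. \<psi> x \<bullet> i) (partial_deriv (\<eta> k) i) = partial_deriv (\<lambda>y. \<Psi> y \<bullet> i) i"
        unfolding \<Psi>i[OF i] by (rule conv_partial[OF \<psi>l[OF i] cut i, symmetric])
      finally show ?thesis .
    qed
    have intd: "integrable lborel (\<lambda>y. f y * partial_deriv (\<lambda>y. \<Psi> y \<bullet> i) i y)" if i: "i \<in> Basis" for i
    proof -
      have t: "test_function (\<lambda>y. \<Psi> y \<bullet> i)" using tf i by (simp add: test_field_def)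
      obtain r where r: "\<And>x v. r \<le> norm x \<Longrightarrow> partial_deriv (\<lambda>y. \<Psi> y \<bullet> i) v x = 0"
        using test_function_bounded_support[OF t] by metis
      show ?thesis by (rule locally_finite_integral_times_integrable[OF fl test_function_partial_continuous[OF t i] r])
    qed
    have intp: "integrable lborel (\<lambda>x. (\<psi> x \<bullet> i) * conv f (partial_deriv (\<eta> k) i) x)" if i: "i \<in> Basis" for i
    proof -
      have cm: "continuous_on UNIV (conv f (partial_deriv (\<eta> k) i))" by (rule conv_continuous[OF fl cutoff_partial[OF cut]])
      then have [measurable]: "conv f (partial_deriv (\<eta> k) i) \<in> borel_measurable borel" by (rule borel_measurable_continuous_onI)
      have "integrable lborel (\<lambda>x. indicator (cball 0 (real R)) x *\<^sub>R \<bar>conv f (partial_deriv (\<eta> k) i) x\<bar>)"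
        by (rule borel_integrable_compact) (auto intro!: continuous_intros continuous_on_subset[OF cm])
      then show ?thesis
      proof (rule Bochner_Integration.integrable_bound)
        show "AE x in lborel. norm ((\<psi> x \<bullet> i) * conv f (partial_deriv (\<eta> k) i) x) \<le> norm (indicator (cball 0 (real R)) x *\<^sub>R \<bar>conv f (partial_deriv (\<eta> k) i) x\<bar>)"
        proof (rule AE_I2)
          fix x
          have "\<bar>\<psi> x \<bullet> i\<bar> \<le> 1" using Basis_le_norm[OF i, of "\<psi> x"] \<psi>1[of x] by linarith
          then have "\<bar>\<psi> x \<bullet> i\<bar> * \<bar>conv f (partial_deriv (\<eta> k) i) x\<bar> \<le> 1 * \<bar>conv f (partial_deriv (\<eta> k) i) x\<bar>" by (intro mult_right_mono) auto
          then show "norm ((\<psi> x \<bullet> i) * conv f (partial_deriv (\<eta> k) i) x) \<le> norm (indicator (cball 0 (real R)) x *\<^sub>R \<bar>conv f (partial_deriv (\<eta> k) i) x\<bar>)"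
            using \<psi>s[of x] by (cases "norm x \<le> real R") (auto simp: abs_mult)
        qed
      qed measurable
    qed
    have Deq: "(\<Sum>i\<in>Basis. (\<psi> x \<bullet> i) * conv f (partial_deriv (\<eta> k) i) x) = - (norm (D k x) * indicator (ball 0 (real R)) x)" for x
    proof -
      have Dx: "(\<Sum>i\<in>Basis. (\<psi> x \<bullet> i) * conv f (partial_deriv (\<eta> k) i) x) = \<psi> x \<bullet> D k x"
        unfolding D_def by (simp add: inner_sum_right mult.commute)
      have "sgn (D k x) \<bullet> D k x = norm (D k x)"
        by (cases "D k x = 0") (auto simp: sgn_div_norm dot_square_norm power2_eq_square)
      then show ?thesis unfolding Dx by (simp add: \<psi>_def)
    qed
    have iN: "integrable lborel (\<lambda>x. norm (D k x) * indicator (ball 0 (real R)) x)"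
    proof -
      have "integrable lborel (\<lambda>x. - (\<Sum>i\<in>Basis. (\<psi> x \<bullet> i) * conv f (partial_deriv (\<eta> k) i) x))" using intp by simp
      then show ?thesis unfolding Deq by simp
    qed
    have "(\<integral>x. norm (D k x) * indicator (ball 0 (real R)) x \<partial>lborel) = - (\<integral>x. (\<Sum>i\<in>Basis. (\<psi> x \<bullet> i) * conv f (partial_deriv (\<eta> k) i) x) \<partial>lborel)"
      unfolding Deq by simp
    also have "\<dots> = - (\<Sum>i\<in>Basis. \<integral>x. (\<psi> x \<bullet> i) * conv f (partial_deriv (\<eta> k) i) x \<partial>lborel)" using intp by simp
    also have "\<dots> = (\<Sum>i\<in>Basis. \<integral>y. f y * partial_deriv (\<lambda>y. \<Psi> y \<bullet> i) i y \<partial>lborel)" by (simp add: dual sum_negf)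
    also have "\<dots> = (\<integral>y. f y * divergence \<Psi> y \<partial>lborel)" unfolding divergence_def sum_distrib_left using intd by simp
    also have "\<dots> \<le> V" by (rule V[OF tf \<Psi>1])
    finally have le: "(\<integral>x. norm (D k x) * indicator (ball 0 (real R)) x \<partial>lborel) \<le> V" .
    have "(\<integral>\<^sup>+x. ennreal (norm (D k x)) * indicator (ball 0 (real R)) x \<partial>lborel) = (\<integral>\<^sup>+x. ennreal (norm (D k x) * indicator (ball 0 (real R)) x) \<partial>lborel)"
      by (intro nn_integral_cong) (simp split: split_indicator)
    also have "\<dots> = ennreal (\<integral>x. norm (D k x) * indicator (ball 0 (real R)) x \<partial>lborel)" by (rule nn_integral_eq_integral[OF iN]) simp
    also have "\<dots> \<le> ennreal V" by (rule ennreal_leI[OF le])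
    finally show ?thesis .
  qed
  have Dle: "(\<integral>\<^sup>+x. ennreal (norm (D k x) powr 1) \<partial>lborel) \<le> ennreal V" for k
  proof -
    note [measurable] = C1_gradient_measurable[OF C1[of k]]
    \<comment> \<open>The bound does not depend on R, so monotone convergence removes the
      cut.\<close>
    have "(\<lambda>R::nat. \<integral>\<^sup>+x. ennreal (norm (D k x)) * indicator (ball 0 (real R)) x \<partial>lborel) \<longlonglongrightarrow> (\<integral>\<^sup>+x. ennreal (norm (D k x)) \<partial>lborel)"
    proof (rule nn_integral_LIMSEQ)
      show "incseq (\<lambda>R::nat. \<lambda>x. ennreal (norm (D k x)) * indicator (ball 0 (real R)) x)"
        by (auto simp: incseq_def le_fun_def split: split_indicator)
      show "(\<lambda>R. ennreal (norm (D k x)) * indicator (ball 0 (real R)) x) \<longlonglongrightarrow> ennreal (norm (D k x))" for x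
      proof -
        obtain R0 :: nat where R0: "norm x < real R0" using reals_Archimedean2 by blast
        have "ennreal (norm (D k x)) * indicator (ball 0 (real R)) x = ennreal (norm (D k x))" if "R0 \<le> R" for R
          using R0 that by (simp add: less_le_trans)
        then show ?thesis by (intro tendsto_eventually eventually_mono[OF eventually_ge_at_top[of R0]])
      qed
    qed measurable
    then have "(\<integral>\<^sup>+x. ennreal (norm (D k x)) \<partial>lborel) \<le> ennreal V"
      by (rule LIMSEQ_le_const2) (use Dball in auto)
    then show ?thesis by simp
  qed
  have conv: "(\<lambda>k. \<integral>\<^sup>+x\<in>ball 0 R. ennreal \<bar>conv f (\<eta> k) x - f x\<bar> \<partial>lborel) \<longlonglongrightarrow> 0" for R
    by (rule mollify_converges[OF fl \<eta>])
  show ?thesis unfolding gradient_approximable_def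
    by (intro exI[of _ "\<lambda>k. conv f (\<eta> k)"] exI[of _ D]) (use C1 Dle conv in auto)
qed

section \<open>Fractional maximal functions\<close>

text \<open>The estimates so far are for Borel functions; this supplies representatives, one
  coordinate at a time.\<close>

lemma lebesgue_measurable_borel_version:
  fixes f :: "'a::euclidean_space \<Rightarrow> 'b::euclidean_space"
  assumes "f \<in> borel_measurable lebesgue"
  obtains f' where "f' \<in> borel_measurable borel" "AE x in lborel. f x = f' x"
proof -
  have "\<exists>h. h \<in> borel_measurable borel \<and> (AE x in lborel. f x \<bullet> i = h x)" for i
    using completion_ex_borel_measurable_real[of "\<lambda>x. f x \<bullet> i" lborel] assms by auto
  then obtain h where h: "\<And>i. h i \<in> borel_measurable borel" "\<And>i. AE x in lborel. f x \<bullet> i = h i x" by metis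
  define f' where "f' x = (\<Sum>i\<in>Basis. h i x *\<^sub>R i)" for x
  have "f' \<in> borel_measurable borel" unfolding f'_def using h(1) by measurable
  moreover have "AE x in lborel. \<forall>i\<in>Basis. f x \<bullet> i = h i x" by (subst AE_finite_all) (use h in auto)
  then have "AE x in lborel. f x = f' x"
  proof eventually_elim
    case (elim x)
    then have "(\<Sum>i\<in>Basis. h i x *\<^sub>R i) = (\<Sum>i\<in>Basis. (f x \<bullet> i) *\<^sub>R i)" by (intro sum.cong) auto
    then show ?case unfolding f'_def by (simp add: euclidean_representation)
  qed
  ultimately show ?thesis using that by blast
qed

lemma nn_integral_lebesgue_eq_lborel:
  fixes u :: "'a::euclidean_space \<Rightarrow> ennreal"
  assumes "u' \<in> borel_measurable borel" "AE x in lborel. u x = u' x"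
  shows "(\<integral>\<^sup>+x. u x \<partial>lebesgue) = (\<integral>\<^sup>+x. u' x \<partial>lborel)"
proof -
  have "(\<integral>\<^sup>+x. u x \<partial>lebesgue) = (\<integral>\<^sup>+x. u' x \<partial>lebesgue)"
    by (rule nn_integral_cong_AE) (rule AE_completion[OF assms(2)])
  then show ?thesis using assms(1) by (simp add: nn_integral_completion)
qed

lemma integral_lebesgue_eq_lborel:
  fixes u :: "'a::euclidean_space \<Rightarrow> real"
  assumes "u \<in> borel_measurable lebesgue" "u' \<in> borel_measurable borel" "AE x in lborel. u x = u' x"
  shows "(\<integral>x. u x \<partial>lebesgue) = (\<integral>x. u' x \<partial>lborel)"
proof -
  have u': "u' \<in> borel_measurable lebesgue" using assms(2) by (intro measurable_completion) simp
  have "(\<integral>x. u x \<partial>lebesgue) = (\<integral>x. u' x \<partial>lebesgue)"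
    by (rule integral_cong_AE[OF assms(1) u' AE_completion[OF assms(3)]])
  then show ?thesis using assms(2) by (simp add: integral_completion)
qed

lemma in_Lp_imp_Lp_bounded:
  fixes g :: "'a::euclidean_space \<Rightarrow> 'b::euclidean_space"
  assumes g: "in_Lp p g" and g'[measurable]: "g' \<in> borel_measurable borel" and ae: "AE x in lborel. g x = g' x"
  shows "Lp_bounded p (\<integral>x. norm (g x) powr p \<partial>lebesgue) (\<lambda>x. norm (g' x))"
  unfolding Lp_bounded_def
proof (intro conjI)
  have "(\<integral>\<^sup>+x. ennreal (\<bar>norm (g' x)\<bar> powr p) \<partial>lborel) = (\<integral>\<^sup>+x. ennreal (norm (g x) powr p) \<partial>lebesgue)"
    by (rule nn_integral_lebesgue_eq_lborel[symmetric]) (use ae in auto)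
  also have "\<dots> = ennreal (\<integral>x. norm (g x) powr p \<partial>lebesgue)"
    using g by (intro nn_integral_eq_integral) (auto simp: in_Lp_def)
  finally show "(\<integral>\<^sup>+x. ennreal (\<bar>norm (g' x)\<bar> powr p) \<partial>lborel) \<le> ennreal (\<integral>x. norm (g x) powr p \<partial>lebesgue)" by simp
qed (auto intro: integral_nonneg_AE)

lemma Lp_bounded_norm_real:
  fixes f :: "'a::euclidean_space \<Rightarrow> real"
  assumes "Lp_bounded p F (\<lambda>x. norm (f x))" "f \<in> borel_measurable borel"
  shows "Lp_bounded p F f"
  using assms by (simp add: Lp_bounded_def)

lemma sobolev_borel_version:
  fixes f :: "'a::euclidean_space \<Rightarrow> real"
  assumes p: "1 \<le> p" and f: "in_Lp p f" and G: "has_weak_gradient f G" "in_Lp p G"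
  obtains f' F where "AE x in lborel. f x = f' x" "Lp_bounded p F f'"
    "gradient_approximable p (2 powr p * (\<integral>x. norm (G x) powr p \<partial>lebesgue)) f'"
proof -
  have fm: "f \<in> borel_measurable lebesgue" and Gm: "G \<in> borel_measurable lebesgue"
    using f G by (auto simp: in_Lp_def)
  obtain f' where f'[measurable]: "f' \<in> borel_measurable borel" and fae: "AE x in lborel. f x = f' x"
    using lebesgue_measurable_borel_version[OF fm] by metis
  obtain G' where G'[measurable]: "G' \<in> borel_measurable borel" and Gae: "AE x in lborel. G x = G' x"
    using lebesgue_measurable_borel_version[OF Gm] by metis
  have Lf: "Lp_bounded p (\<integral>x. norm (f x) powr p \<partial>lebesgue) f'"
    by (rule Lp_bounded_norm_real[OF in_Lp_imp_Lp_bounded[OF f f' fae] f'])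
  have LG: "Lp_bounded p (\<integral>x. norm (G x) powr p \<partial>lebesgue) (\<lambda>x. norm (G' x))"
    by (rule in_Lp_imp_Lp_bounded[OF G(2) G' Gae])
  have "gradient_approximable p (2 powr p * (\<integral>x. norm (G x) powr p \<partial>lebesgue)) f'"
  proof (rule sobolev_gradient_approximable[OF Lp_bounded_locally_finite[OF Lf p] p G' LG])
    fix \<phi> :: "'a \<Rightarrow> real" and i :: 'a assume \<phi>: "test_function \<phi>" and i: "i \<in> Basis"
    have [measurable]: "\<phi> \<in> borel_measurable borel" "partial_deriv \<phi> i \<in> borel_measurable borel"
      using test_function_continuous[OF \<phi>] test_function_partial_continuous[OF \<phi> i] borel_measurable_continuous_onI by auto
    have l: "\<phi> \<in> borel_measurable lebesgue" "partial_deriv \<phi> i \<in> borel_measurable lebesgue"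
      by (intro measurable_completion; simp)+
    have "(\<integral>x. f x * partial_deriv \<phi> i x \<partial>lebesgue) = (\<integral>x. f' x * partial_deriv \<phi> i x \<partial>lborel)"
      by (rule integral_lebesgue_eq_lborel) (use fm l fae in auto)
    moreover have "(\<integral>x. (G x \<bullet> i) * \<phi> x \<partial>lebesgue) = (\<integral>x. (G' x \<bullet> i) * \<phi> x \<partial>lborel)"
      by (rule integral_lebesgue_eq_lborel) (use Gm l Gae in auto)
    ultimately show "(\<integral>x. f' x * partial_deriv \<phi> i x \<partial>lborel) = - (\<integral>x. (G' x \<bullet> i) * \<phi> x \<partial>lborel)"
      using G(1) \<phi> i unfolding has_weak_gradient_def by auto
  qed
  then show ?thesis using that fae Lf by blast
qed

lemma bv_borel_version:
  fixes f :: "'a::euclidean_space \<Rightarrow> real"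
  assumes f: "BV f"
  obtains f' F where "AE x in lborel. f x = f' x" "Lp_bounded 1 F f'"
    "gradient_approximable 1 (real_of_ereal (variation f)) f'" "0 \<le> real_of_ereal (variation f)"
proof -
  have fi: "integrable lebesgue f" and vf: "variation f < \<infinity>" using f by (auto simp: BV_def)
  then have fm: "f \<in> borel_measurable lebesgue" by auto
  obtain f' where f'[measurable]: "f' \<in> borel_measurable borel" and fae: "AE x in lborel. f x = f' x"
    using lebesgue_measurable_borel_version[OF fm] by metis
  have "in_Lp 1 f" using fi fm by (auto simp: in_Lp_def)
  from Lp_bounded_norm_real[OF in_Lp_imp_Lp_bounded[OF this f' fae] f']
  have Lf: "Lp_bounded 1 (\<integral>x. norm (f x) powr 1 \<partial>lebesgue) f'" .
  have f'i: "integrable lborel f'"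
    using Lf unfolding Lp_bounded_def by (intro integrableI_bounded) (auto simp: le_less_trans[OF _ ennreal_less_top])
  have div_le: "ereal (\<integral>x. f x * divergence \<Psi> x \<partial>lebesgue) \<le> variation f" if "test_field \<Psi>" "\<And>x. norm (\<Psi> x) \<le> 1" for \<Psi>
    unfolding variation_def by (rule SUP_upper) (use that in auto)
  \<comment> \<open>Testing with the zero field bounds the supremum below by 0; together with
    finiteness this makes \<open>real_of_ereal\<close> faithful.\<close>
  have "0 \<le> variation f"
  proof -
    have z: "test_field (\<lambda>_::'a. 0 :: 'a)"
    proof -
      have "test_function (\<lambda>_::'a. 0 :: real)"
        by (rule test_functionI[OF smooth_class_smooth[OF smooth_class.const], of 0]) simp
      then show ?thesis unfolding test_field_def by simp
    qed
    have "partial_deriv (\<lambda>_. (0 :: 'a) \<bullet> i) i x = 0" for i x :: 'a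
      by (rule partial_deriv_eq_0[of UNIV]) auto
    then have "divergence (\<lambda>_. 0 :: 'a) x = 0" for x :: 'a
      unfolding divergence_def by (intro sum.neutral) blast
    then show ?thesis using div_le[OF z] by (simp add: zero_ereal_def)
  qed
  moreover have "\<exists>v. y = ereal v \<and> 0 \<le> v" if "0 \<le> y" "y < \<infinity>" for y :: ereal
    using that by (cases y) auto
  ultimately obtain v where v: "variation f = ereal v" "0 \<le> v" using vf by blast
  have "gradient_approximable 1 v f'"
  proof (rule bv_gradient_approximable[OF f'i f'])
    fix \<Psi> :: "'a \<Rightarrow> 'a" assume \<Psi>: "test_field \<Psi>" "\<And>x. norm (\<Psi> x) \<le> 1"
    have [measurable]: "divergence \<Psi> \<in> borel_measurable borel"
    proof -
      have "partial_deriv (\<lambda>y. \<Psi> y \<bullet> i) i \<in> borel_measurable borel" if "i \<in> Basis" for i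
        using \<Psi>(1) that by (intro borel_measurable_continuous_onI test_function_partial_continuous) (auto simp: test_field_def)
      then show ?thesis unfolding divergence_def[abs_def] by (intro borel_measurable_sum) auto
    qed
    have l: "divergence \<Psi> \<in> borel_measurable lebesgue" by (rule measurable_completion) simp
    have "(\<integral>x. f x * divergence \<Psi> x \<partial>lebesgue) = (\<integral>x. f' x * divergence \<Psi> x \<partial>lborel)"
      by (rule integral_lebesgue_eq_lborel) (use fm l fae in auto)
    then show "(\<integral>x. f' x * divergence \<Psi> x \<partial>lborel) \<le> v" using div_le[OF \<Psi>] v by simp
  qed
  then show ?thesis using that[OF fae Lf] v by simp
qed

lemma has_weak_gradient_scale:
  assumes "has_weak_gradient u H"
  shows "has_weak_gradient (\<lambda>x. a * u x) (\<lambda>x. a *\<^sub>R H x)"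
proof -
  have loc: "locally_integrable (\<lambda>x. a * w x)" if "locally_integrable w" for w :: "'a \<Rightarrow> real"
    using that unfolding locally_integrable_def by auto
  show ?thesis
    using assms unfolding has_weak_gradient_def by (auto simp: mult.assoc intro: loc)
qed

context admissible_balls
begin

definition frac_max :: "real \<Rightarrow> ('a \<Rightarrow> real) \<Rightarrow> 'a \<Rightarrow> ennreal" where
  "frac_max \<alpha> f x = (SUP (c, r)\<in>{(c, r). A x c r}. ennreal (r powr \<alpha>) * avg f (ball c r))"

text \<open>Means do not see null sets, so equality holds at every x although f and f' agree only
  almost everywhere. The factor is the volume normalisation left out of
  \<open>frac_val\<close>.\<close>

lemma frac_max_eq:
  assumes ae: "AE x in lborel. f x = f' x" and f': "Lp_bounded p F f'" and p: "1 \<le> p"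
  shows "frac_max \<alpha> f x = ennreal (1 / unit_ball_vol (real DIM('a))) * max_val \<alpha> f' x"
proof -
  define \<omega> where "\<omega> = unit_ball_vol (real DIM('a))"
  have \<omega>: "\<omega> > 0" by (simp add: \<omega>_def)
  have [measurable]: "f' \<in> borel_measurable borel" using f' by (simp add: Lp_bounded_def)
  have eq: "ennreal (r powr \<alpha>) * avg f (ball c r) = ennreal (1 / \<omega>) * ennreal (frac_val \<alpha> f' c r)" if "A x c r" for c r
  proof -
    have r: "r > 0" using A_mem that by blast
    have "(\<integral>\<^sup>+y\<in>ball c r. ennreal \<bar>f y\<bar> \<partial>lebesgue) = (\<integral>\<^sup>+y\<in>ball c r. ennreal \<bar>f' y\<bar> \<partial>lborel)"
      by (rule nn_integral_lebesgue_eq_lborel) (use ae in auto)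
    then have "(\<integral>\<^sup>+y\<in>ball c r. ennreal \<bar>f y\<bar> \<partial>lebesgue) = ennreal (mass f' c r)" by (simp add: ennreal_mass[OF f' p])
    moreover have "emeasure lebesgue (ball c r) = ennreal (\<omega> * r ^ DIM('a))"
      using r by (simp add: emeasure_ball \<omega>_def)
    ultimately have "avg f (ball c r) = ennreal (mass f' c r / (\<omega> * r ^ DIM('a)))"
      unfolding avg_def using r \<omega> by (simp add: divide_ennreal mass_nonneg)
    then have "ennreal (r powr \<alpha>) * avg f (ball c r) = ennreal (r powr \<alpha> * (mass f' c r / (\<omega> * r ^ DIM('a))))"
      using r \<omega> ennreal_mult[of "r powr \<alpha>" "mass f' c r / (\<omega> * r ^ DIM('a))"] by (simp add: mass_nonneg)
    also have "r powr \<alpha> * (mass f' c r / (\<omega> * r ^ DIM('a))) = 1 / \<omega> * frac_val \<alpha> f' c r"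
      using r \<omega> by (simp add: frac_val_def powr_diff powr_realpow)
    also have "ennreal (1 / \<omega> * frac_val \<alpha> f' c r) = ennreal (1 / \<omega>) * ennreal (frac_val \<alpha> f' c r)"
      using \<omega> by (intro ennreal_mult frac_val_nonneg) simp
    finally show ?thesis .
  qed
  have "frac_max \<alpha> f x = (SUP (c, r)\<in>{(c, r). A x c r}. ennreal (1 / \<omega>) * ennreal (frac_val \<alpha> f' c r))"
    unfolding frac_max_def by (rule SUP_cong) (auto simp: eq)
  also have "\<dots> = ennreal (1 / \<omega>) * max_val \<alpha> f' x"
    unfolding max_val_def case_prod_beta by (rule SUP_mult_left_ennreal[symmetric])
  finally show ?thesis by (simp add: \<omega>_def)
qed

text \<open>Turns the bound on the integral of |H|^q into one on the norm: the q-th root changes W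
  powr (q / p) into W powr (1 / p).\<close>

lemma frac_max_weak_gradient:
  assumes p: "1 \<le> p" and \<alpha>: "0 < \<alpha>" "\<alpha> < real DIM('a) / p" and q: "q = 1 / (1 / p - \<alpha> / real DIM('a))"
  shows "\<exists>C\<ge>0. \<forall>f f' F W. (AE x in lborel. f x = f' x) \<and> Lp_bounded p F f' \<and> 0 \<le> W \<and> gradient_approximable p W f' \<longrightarrow>
     (AE x in lebesgue. frac_max \<alpha> f x < \<infinity>) \<and>
     (\<exists>H. has_weak_gradient (\<lambda>x. enn2real (frac_max \<alpha> f x)) H \<and> in_Lp q H \<and> Lp_norm q H \<le> C * W powr (1 / p))"
proof -
  define \<omega> where "\<omega> = unit_ball_vol (real DIM('a))"
  have \<omega>: "\<omega> > 0" by (simp add: \<omega>_def)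
  have "\<alpha> / real DIM('a) < 1 / p" using \<alpha> p by (simp add: field_simps)
  then have q0: "q > 0" by (simp add: q)
  obtain C where C: "C \<ge> 0" and bound: "\<And>f F W. Lp_bounded p F f \<Longrightarrow> 0 \<le> W \<Longrightarrow> gradient_approximable p W f \<Longrightarrow>
     (AE x in lborel. max_val \<alpha> f x < \<infinity>) \<and>
     (\<exists>H\<in>borel_measurable borel. has_weak_gradient (\<lambda>x. enn2real (max_val \<alpha> f x)) H \<and>
        (\<integral>\<^sup>+x. ennreal (norm (H x) powr q) \<partial>lborel) \<le> ennreal (C * W powr (q / p)))"
    using max_val_weak_gradient[OF p \<alpha> q] by metis
  show ?thesis
  proof (intro exI[of _ "1 / \<omega> * C powr (1 / q)"] conjI[of "0 \<le> _"] allI impI)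
    show "0 \<le> 1 / \<omega> * C powr (1 / q)" using \<omega> by simp
    fix f f' :: "'a \<Rightarrow> real" and F W :: real
    assume asm: "(AE x in lborel. f x = f' x) \<and> Lp_bounded p F f' \<and> 0 \<le> W \<and> gradient_approximable p W f'"
    then have W: "0 \<le> W" by blast
    have eq: "frac_max \<alpha> f x = ennreal (1 / \<omega>) * max_val \<alpha> f' x" for x
      unfolding \<omega>_def using asm p by (intro frac_max_eq) auto
    have eqr: "enn2real (frac_max \<alpha> f x) = 1 / \<omega> * enn2real (max_val \<alpha> f' x)" for x
      unfolding eq enn2real_mult using \<omega> by simp
    from bound[of F f' W] asm obtain H where fin: "AE x in lborel. max_val \<alpha> f' x < \<infinity>"
      and Hm[measurable]: "H \<in> borel_measurable borel" and Hw: "has_weak_gradient (\<lambda>x. enn2real (max_val \<alpha> f' x)) H"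
      and HI: "(\<integral>\<^sup>+x. ennreal (norm (H x) powr q) \<partial>lborel) \<le> ennreal (C * W powr (q / p))" by blast
    define H' where "H' x = (1 / \<omega>) *\<^sub>R H x" for x
    have H'm[measurable]: "H' \<in> borel_measurable borel" unfolding H'_def by measurable
    have nH': "norm (H' x) powr q = (1 / \<omega>) powr q * norm (H x) powr q" for x
      unfolding H'_def norm_scaleR using \<omega> by (simp add: powr_mult powr_divide)
    have iH: "integrable lborel (\<lambda>x. norm (H x) powr q)"
      using HI by (intro integrableI_bounded) (auto simp: le_less_trans[OF _ ennreal_less_top])
    have iH': "integrable lborel (\<lambda>x. norm (H' x) powr q)" unfolding nH' using iH by simp
    have "in_Lp q H'" unfolding in_Lp_def
    proof
      show "H' \<in> borel_measurable lebesgue" by (rule measurable_completion) simp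
      show "integrable lebesgue (\<lambda>x. norm (H' x) powr q)" using iH' by (subst integrable_completion) auto
    qed
    moreover have "has_weak_gradient (\<lambda>x. enn2real (frac_max \<alpha> f x)) H'"
      unfolding eqr H'_def by (rule has_weak_gradient_scale[OF Hw])
    moreover have "Lp_norm q H' \<le> 1 / \<omega> * C powr (1 / q) * W powr (1 / p)"
    proof -
      define I where "I = (\<integral>x. norm (H x) powr q \<partial>lborel)"
      have I0: "0 \<le> I" unfolding I_def by (rule integral_nonneg_AE) simp
      have "ennreal I \<le> ennreal (C * W powr (q / p))"
        using HI nn_integral_eq_integral[OF iH] by (simp add: I_def)
      then have I: "I \<le> C * W powr (q / p)" using C by (subst (asm) ennreal_le_iff) auto
      have "Lp_norm q H' = (\<integral>x. norm (H' x) powr q \<partial>lborel) powr (1 / q)"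
        unfolding Lp_norm_def by (subst integral_completion) auto
      also have "\<dots> = ((1 / \<omega>) powr q * I) powr (1 / q)" unfolding nH' I_def using iH by simp
      also have "\<dots> = 1 / \<omega> * I powr (1 / q)" using \<omega> I0 q0 by (simp add: powr_mult powr_powr)
      also have "\<dots> \<le> 1 / \<omega> * (C * W powr (q / p)) powr (1 / q)"
        using I I0 q0 \<omega> by (intro mult_left_mono powr_mono2) auto
      also have "\<dots> = 1 / \<omega> * C powr (1 / q) * W powr (1 / p)"
        using C q0 by (simp add: powr_mult powr_powr)
      finally show ?thesis .
    qed
    moreover have "AE x in lebesgue. frac_max \<alpha> f x < \<infinity>"
    proof (rule AE_completion)
      show "AE x in lborel. frac_max \<alpha> f x < \<infinity>"
        using fin by eventually_elim (simp add: eq ennreal_mult_less_top)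
    qed
    ultimately show "(AE x in lebesgue. frac_max \<alpha> f x < \<infinity>) \<and>
      (\<exists>H. has_weak_gradient (\<lambda>x. enn2real (frac_max \<alpha> f x)) H \<and> in_Lp q H \<and> Lp_norm q H \<le> 1 / \<omega> * C powr (1 / q) * W powr (1 / p))"
      by blast
  qed
qed

lemma frac_max_endpoint:
  assumes p: "1 \<le> p" and \<alpha>: "\<alpha> = real DIM('a) / p"
  shows "\<exists>C\<ge>0. \<forall>f f' F W. (AE x in lborel. f x = f' x) \<and> Lp_bounded p F f' \<and> 0 \<le> W \<and> gradient_approximable p W f' \<longrightarrow>
     (AE x in lebesgue. frac_max \<alpha> f x < \<infinity>) \<and>
     (\<exists>H. has_weak_gradient (\<lambda>x. enn2real (frac_max \<alpha> f x)) H \<and> (AE x in lebesgue. norm (H x) \<le> C * W powr (1 / p)))"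
proof -
  define \<omega> where "\<omega> = unit_ball_vol (real DIM('a))"
  have \<omega>: "\<omega> > 0" by (simp add: \<omega>_def)
  obtain C where C: "C \<ge> 0" and bound: "\<And>f F W. Lp_bounded p F f \<Longrightarrow> 0 \<le> W \<Longrightarrow> gradient_approximable p W f \<Longrightarrow>
     (\<forall>x. max_val \<alpha> f x < \<infinity>) \<and>
     (\<exists>H\<in>borel_measurable borel. has_weak_gradient (\<lambda>x. enn2real (max_val \<alpha> f x)) H \<and>
        (AE x in lborel. norm (H x) \<le> C * W powr (1 / p)))"
    using max_val_endpoint[OF p \<alpha>] by metis
  show ?thesis
  proof (intro exI[of _ "1 / \<omega> * C"] conjI[of "0 \<le> _"] allI impI)
    show "0 \<le> 1 / \<omega> * C" using \<omega> C by simp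
    fix f f' :: "'a \<Rightarrow> real" and F W :: real
    assume asm: "(AE x in lborel. f x = f' x) \<and> Lp_bounded p F f' \<and> 0 \<le> W \<and> gradient_approximable p W f'"
    have eq: "frac_max \<alpha> f x = ennreal (1 / \<omega>) * max_val \<alpha> f' x" for x
      unfolding \<omega>_def using asm p by (intro frac_max_eq) auto
    have eqr: "enn2real (frac_max \<alpha> f x) = 1 / \<omega> * enn2real (max_val \<alpha> f' x)" for x
      unfolding eq enn2real_mult using \<omega> by simp
    from bound[of F f' W] asm obtain H where fin: "\<And>x. max_val \<alpha> f' x < \<infinity>"
      and Hw: "has_weak_gradient (\<lambda>x. enn2real (max_val \<alpha> f' x)) H"
      and HI: "AE x in lborel. norm (H x) \<le> C * W powr (1 / p)" by blast
    have "has_weak_gradient (\<lambda>x. enn2real (frac_max \<alpha> f x)) (\<lambda>x. (1 / \<omega>) *\<^sub>R H x)"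
      unfolding eqr by (rule has_weak_gradient_scale[OF Hw])
    moreover have "AE x in lebesgue. norm ((1 / \<omega>) *\<^sub>R H x) \<le> 1 / \<omega> * C * W powr (1 / p)"
      using AE_completion[OF HI]
    proof eventually_elim
      case (elim x)
      from mult_left_mono[OF this, of "1 / \<omega>"] show ?case using \<omega> by simp
    qed
    moreover have "frac_max \<alpha> f x < \<infinity>" for x using fin[of x] by (simp add: eq ennreal_mult_less_top)
    ultimately show "(AE x in lebesgue. frac_max \<alpha> f x < \<infinity>) \<and>
      (\<exists>H. has_weak_gradient (\<lambda>x. enn2real (frac_max \<alpha> f x)) H \<and> (AE x in lebesgue. norm (H x) \<le> 1 / \<omega> * C * W powr (1 / p)))"
      by blast
  qed
qed

lemma two_powr_powr_Lp_norm:
  assumes "1 \<le> p"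
  shows "(2 powr p * (\<integral>x. norm (G x) powr p \<partial>lebesgue)) powr (1 / p) = 2 * Lp_norm p G"
  using assms by (subst powr_mult) (auto simp: powr_powr Lp_norm_def integral_nonneg_AE)

lemma frac_max_theorem:
  assumes p: "1 \<le> p" and \<alpha>: "0 < \<alpha>" "\<alpha> \<le> real DIM('a) / p"
  shows
    "(\<alpha> < real DIM('a) / p \<longrightarrow>
       (\<exists>C. (\<forall>f G. in_Lp p f \<and> has_weak_gradient f G \<and> in_Lp p G \<longrightarrow>
               (AE x in lebesgue. frac_max \<alpha> f x < \<infinity>) \<and>
               (\<exists>H. has_weak_gradient (\<lambda>x. enn2real (frac_max \<alpha> f x)) H \<and>
                    in_Lp (1 / (1 / p - \<alpha> / real DIM('a))) H \<and>
                    Lp_norm (1 / (1 / p - \<alpha> / real DIM('a))) H \<le> C * Lp_norm p G)) \<and>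
            (p = 1 \<longrightarrow> (\<forall>f. BV f \<longrightarrow>
               (AE x in lebesgue. frac_max \<alpha> f x < \<infinity>) \<and>
               (\<exists>H. has_weak_gradient (\<lambda>x. enn2real (frac_max \<alpha> f x)) H \<and>
                    in_Lp (1 / (1 - \<alpha> / real DIM('a))) H \<and>
                    Lp_norm (1 / (1 - \<alpha> / real DIM('a))) H \<le> C * real_of_ereal (variation f))))))
     \<and> (\<alpha> = real DIM('a) / p \<longrightarrow>
       (\<exists>C. \<forall>f G. in_Lp p f \<and> has_weak_gradient f G \<and> in_Lp p G \<longrightarrow>
               (AE x in lebesgue. frac_max \<alpha> f x < \<infinity>) \<and>
               (\<exists>H. has_weak_gradient (\<lambda>x. enn2real (frac_max \<alpha> f x)) H \<and>
                    (AE x in lebesgue. norm (H x) \<le> C * Lp_norm p G))))"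
proof (intro conjI[where P="_ \<longrightarrow> _"] impI)
  assume \<alpha>p: "\<alpha> < real DIM('a) / p"
  define q where "q = 1 / (1 / p - \<alpha> / real DIM('a))"
  obtain C where C: "C \<ge> 0" and all: "\<forall>f f' F W. (AE x in lborel. f x = f' x) \<and> Lp_bounded p F f' \<and> 0 \<le> W \<and> gradient_approximable p W f' \<longrightarrow>
     (AE x in lebesgue. frac_max \<alpha> f x < \<infinity>) \<and>
     (\<exists>H. has_weak_gradient (\<lambda>x. enn2real (frac_max \<alpha> f x)) H \<and> in_Lp q H \<and> Lp_norm q H \<le> C * W powr (1 / p))"
    using frac_max_weak_gradient[OF p \<alpha>(1) \<alpha>p q_def] by blast
  have bound: "(AE x in lebesgue. frac_max \<alpha> f x < \<infinity>) \<and>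
     (\<exists>H. has_weak_gradient (\<lambda>x. enn2real (frac_max \<alpha> f x)) H \<and> in_Lp q H \<and> Lp_norm q H \<le> C * W powr (1 / p))"
    if "AE x in lborel. f x = f' x" "Lp_bounded p F f'" "0 \<le> W" "gradient_approximable p W f'" for f f' F W
    using all that by blast
  have sob: "(AE x in lebesgue. frac_max \<alpha> f x < \<infinity>) \<and>
     (\<exists>H. has_weak_gradient (\<lambda>x. enn2real (frac_max \<alpha> f x)) H \<and> in_Lp q H \<and> Lp_norm q H \<le> 2 * C * Lp_norm p G)"
    if fG: "in_Lp p f \<and> has_weak_gradient f G \<and> in_Lp p G" for f G
  proof -
    define W where "W = 2 powr p * (\<integral>x. norm (G x) powr p \<partial>lebesgue)"
    have W0: "0 \<le> W" unfolding W_def by (simp add: integral_nonneg_AE)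
    obtain f' F where "AE x in lborel. f x = f' x" "Lp_bounded p F f'" "gradient_approximable p W f'"
      using sobolev_borel_version[OF p, of f G] fG unfolding W_def by blast
    then show ?thesis using bound[of f f' F W] W0 two_powr_powr_Lp_norm[OF p, of G]
      unfolding W_def by (simp add: ac_simps)
  qed
  have bv: "(AE x in lebesgue. frac_max \<alpha> f x < \<infinity>) \<and>
     (\<exists>H. has_weak_gradient (\<lambda>x. enn2real (frac_max \<alpha> f x)) H \<and> in_Lp q H \<and> Lp_norm q H \<le> 2 * C * real_of_ereal (variation f))"
    if "BV f" and p1: "p = 1" for f
  proof -
    obtain f' F where f': "AE x in lborel. f x = f' x" "Lp_bounded 1 F f'"
        "gradient_approximable 1 (real_of_ereal (variation f)) f'" and v: "0 \<le> real_of_ereal (variation f)"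
      using bv_borel_version[OF \<open>BV f\<close>] by blast
    from bound[of f f' F "real_of_ereal (variation f)"] f' v p1 obtain H where
      fin: "AE x in lebesgue. frac_max \<alpha> f x < \<infinity>" and H: "has_weak_gradient (\<lambda>x. enn2real (frac_max \<alpha> f x)) H" "in_Lp q H"
      and le: "Lp_norm q H \<le> C * real_of_ereal (variation f) powr 1" by auto
    \<comment> \<open>The Sobolev case has constant 2 C, the 2 being the p-th root of the
      mollification factor 2 powr p; the BV bound is weakened to share it.\<close>
    have "C * real_of_ereal (variation f) \<le> 2 * C * real_of_ereal (variation f)" using C v by (simp add: mult_nonneg_nonneg)
    then have "Lp_norm q H \<le> 2 * C * real_of_ereal (variation f)"
      using le unfolding powr_one[OF v] by linarith
    then show ?thesis using fin H by blast
  qed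
  show "\<exists>C. (\<forall>f G. in_Lp p f \<and> has_weak_gradient f G \<and> in_Lp p G \<longrightarrow>
               (AE x in lebesgue. frac_max \<alpha> f x < \<infinity>) \<and>
               (\<exists>H. has_weak_gradient (\<lambda>x. enn2real (frac_max \<alpha> f x)) H \<and>
                    in_Lp (1 / (1 / p - \<alpha> / real DIM('a))) H \<and>
                    Lp_norm (1 / (1 / p - \<alpha> / real DIM('a))) H \<le> C * Lp_norm p G)) \<and>
            (p = 1 \<longrightarrow> (\<forall>f. BV f \<longrightarrow>
               (AE x in lebesgue. frac_max \<alpha> f x < \<infinity>) \<and>
               (\<exists>H. has_weak_gradient (\<lambda>x. enn2real (frac_max \<alpha> f x)) H \<and>
                    in_Lp (1 / (1 - \<alpha> / real DIM('a))) H \<and>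
                    Lp_norm (1 / (1 - \<alpha> / real DIM('a))) H \<le> C * real_of_ereal (variation f))))"
  proof (rule exI[of _ "2 * C"], rule conjI, rule_tac [2] impI)
    show "\<forall>f G. in_Lp p f \<and> has_weak_gradient f G \<and> in_Lp p G \<longrightarrow>
               (AE x in lebesgue. frac_max \<alpha> f x < \<infinity>) \<and>
               (\<exists>H. has_weak_gradient (\<lambda>x. enn2real (frac_max \<alpha> f x)) H \<and>
                    in_Lp (1 / (1 / p - \<alpha> / real DIM('a))) H \<and>
                    Lp_norm (1 / (1 / p - \<alpha> / real DIM('a))) H \<le> 2 * C * Lp_norm p G)"
      unfolding q_def[symmetric] using sob by blast
    assume p1: "p = 1"
    have q1: "1 / (1 - \<alpha> / real DIM('a)) = q" by (simp add: q_def p1)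
    show "\<forall>f. BV f \<longrightarrow> (AE x in lebesgue. frac_max \<alpha> f x < \<infinity>) \<and>
               (\<exists>H. has_weak_gradient (\<lambda>x. enn2real (frac_max \<alpha> f x)) H \<and>
                    in_Lp (1 / (1 - \<alpha> / real DIM('a))) H \<and>
                    Lp_norm (1 / (1 - \<alpha> / real DIM('a))) H \<le> 2 * C * real_of_ereal (variation f))"
      unfolding q1 using bv p1 by blast
  qed
next
  assume \<alpha>p: "\<alpha> = real DIM('a) / p"
  obtain C where C: "C \<ge> 0" and all: "\<forall>f f' F W. (AE x in lborel. f x = f' x) \<and> Lp_bounded p F f' \<and> 0 \<le> W \<and> gradient_approximable p W f' \<longrightarrow>
     (AE x in lebesgue. frac_max \<alpha> f x < \<infinity>) \<and>
     (\<exists>H. has_weak_gradient (\<lambda>x. enn2real (frac_max \<alpha> f x)) H \<and> (AE x in lebesgue. norm (H x) \<le> C * W powr (1 / p)))"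
    using frac_max_endpoint[OF p \<alpha>p] by blast
  have bound: "(AE x in lebesgue. frac_max \<alpha> f x < \<infinity>) \<and>
     (\<exists>H. has_weak_gradient (\<lambda>x. enn2real (frac_max \<alpha> f x)) H \<and> (AE x in lebesgue. norm (H x) \<le> C * W powr (1 / p)))"
    if "AE x in lborel. f x = f' x" "Lp_bounded p F f'" "0 \<le> W" "gradient_approximable p W f'" for f f' F W
    using all that by blast
  have "(AE x in lebesgue. frac_max \<alpha> f x < \<infinity>) \<and>
     (\<exists>H. has_weak_gradient (\<lambda>x. enn2real (frac_max \<alpha> f x)) H \<and> (AE x in lebesgue. norm (H x) \<le> (2 * C) * Lp_norm p G))"
    if fG: "in_Lp p f \<and> has_weak_gradient f G \<and> in_Lp p G" for f G
  proof -
    define W where "W = 2 powr p * (\<integral>x. norm (G x) powr p \<partial>lebesgue)"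
    have W0: "0 \<le> W" unfolding W_def by (simp add: integral_nonneg_AE)
    obtain f' F where "AE x in lborel. f x = f' x" "Lp_bounded p F f'" "gradient_approximable p W f'"
      using sobolev_borel_version[OF p, of f G] fG unfolding W_def by blast
    then show ?thesis using bound[of f f' F W] W0 two_powr_powr_Lp_norm[OF p, of G]
      unfolding W_def by (simp add: ac_simps)
  qed
  then show "\<exists>C. \<forall>f G. in_Lp p f \<and> has_weak_gradient f G \<and> in_Lp p G \<longrightarrow>
               (AE x in lebesgue. frac_max \<alpha> f x < \<infinity>) \<and>
               (\<exists>H. has_weak_gradient (\<lambda>x. enn2real (frac_max \<alpha> f x)) H \<and>
                    (AE x in lebesgue. norm (H x) \<le> C * Lp_norm p G))"
    by blast
qed

end

lemma admissible_balls_centered: "admissible_balls (\<lambda>x c r :: real. 0 < r \<and> c = (x :: 'a::euclidean_space))"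
  by unfold_locales auto

lemma admissible_balls_uncentered: "admissible_balls (\<lambda>x c r :: real. 0 < r \<and> (x :: 'a::euclidean_space) \<in> ball c r)"
  by unfold_locales (auto simp: dist_commute)

lemma frac_max_centered_eq:
  "admissible_balls.frac_max (\<lambda>x c r. 0 < r \<and> c = (x :: 'a::euclidean_space)) = frac_max_centered"
proof (intro ext)
  fix \<alpha> f and x :: 'a
  have e: "{(c, r). (0::real) < r \<and> c = x} = (\<lambda>r. (x, r)) ` {0<..}" for x :: 'a by auto
  show "admissible_balls.frac_max (\<lambda>x c r. 0 < r \<and> c = (x :: 'a)) \<alpha> f x = frac_max_centered \<alpha> f x"
    unfolding admissible_balls.frac_max_def[OF admissible_balls_centered] frac_max_centered_def e image_image by simp
qed

lemma frac_max_uncentered_eq: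
  "admissible_balls.frac_max (\<lambda>x c r. 0 < r \<and> (x :: 'a::euclidean_space) \<in> ball c r) = frac_max_uncentered"
  unfolding admissible_balls.frac_max_def[OF admissible_balls_uncentered] frac_max_uncentered_def fun_eq_iff by blast

text \<open>Weak gradients are defined for real functions, hence \<open>enn2real\<close>, which
  sends the value infinity to 0; the clause on finiteness almost everywhere guarantees that this
  changes the maximal function only on a null set. The constants are chosen before f and its
  gradient.\<close>

theorem theorem1p1:
  fixes p \<alpha> :: real
    and M :: "real \<Rightarrow> ('a::euclidean_space \<Rightarrow> real) \<Rightarrow> 'a \<Rightarrow> ennreal"
  assumes p: "1 \<le> p"
    and \<alpha>: "0 < \<alpha>" "\<alpha> \<le> real DIM('a) / p"
    and M: "M = frac_max_centered \<or> M = frac_max_uncentered"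
  shows
    "(\<alpha> < real DIM('a) / p \<longrightarrow>
       (\<exists>C. (\<forall>f G. in_Lp p f \<and> has_weak_gradient f G \<and> in_Lp p G \<longrightarrow>
               (AE x in lebesgue. M \<alpha> f x < \<infinity>) \<and>
               (\<exists>H. has_weak_gradient (\<lambda>x. enn2real (M \<alpha> f x)) H \<and>
                    in_Lp (1 / (1 / p - \<alpha> / real DIM('a))) H \<and>
                    Lp_norm (1 / (1 / p - \<alpha> / real DIM('a))) H \<le> C * Lp_norm p G)) \<and>
            (p = 1 \<longrightarrow> (\<forall>f. BV f \<longrightarrow>
               (AE x in lebesgue. M \<alpha> f x < \<infinity>) \<and>
               (\<exists>H. has_weak_gradient (\<lambda>x. enn2real (M \<alpha> f x)) H \<and>
                    in_Lp (1 / (1 - \<alpha> / real DIM('a))) H \<and>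
                    Lp_norm (1 / (1 - \<alpha> / real DIM('a))) H \<le> C * real_of_ereal (variation f))))))
     \<and> (\<alpha> = real DIM('a) / p \<longrightarrow>
       (\<exists>C. \<forall>f G. in_Lp p f \<and> has_weak_gradient f G \<and> in_Lp p G \<longrightarrow>
               (AE x in lebesgue. M \<alpha> f x < \<infinity>) \<and>
               (\<exists>H. has_weak_gradient (\<lambda>x. enn2real (M \<alpha> f x)) H \<and>
                    (AE x in lebesgue. norm (H x) \<le> C * Lp_norm p G))))"
proof -
  from M consider "M = frac_max_centered" | "M = frac_max_uncentered" by blast
  then show ?thesis
  proof cases
    case 1
    show ?thesis
      using admissible_balls.frac_max_theorem[OF admissible_balls_centered p \<alpha>] unfolding frac_max_centered_eq 1 .
  next
    case 2
    show ?thesis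
      using admissible_balls.frac_max_theorem[OF admissible_balls_uncentered p \<alpha>] unfolding frac_max_uncentered_eq 2 .
  qed
qed

end
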